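(* Let $N\ge 2$ be an integer, $R_0>0$, $E_{R_0}=\{x\in\mathbf{R}^N: |x|>R_0\}$, and let $q$ be a complex-valued, measurable, locally bounded function on $E_{R_0}$ with $$\lim_{r\to\infty}\Big(r^2\inf_{|x|=r}\mathrm{Re}\,(-q(x))\Big)=\infty .$$ Let $u\in H^2(E_{R_0})_{\mathrm{loc}}$ be a solution of $-\Delta u(x)+q(x)u(x)=0$ in $E_{R_0}$. Put $Q(x)=q(x)+\frac{(N-1)(N-3)}{4r^2}$, $r=|x|$, and assume: (a) $Q=Q_0+Q_1$, where $Q_0$ is a non-positive, measurable, locally bounded function on $E_{R_0}$, $Q_1$ is a complex-valued, measurable, locally bounded function on $E_{R_0}$, and there is a constant $\beta\in(0,1)$ with $0\ge \beta Q_0(x)\ge \mathrm{Re}\,(Q(x))$ for $x\in E_{R_0}$. (b) For every $\phi\in X=L_2(S^{N-1})$, the function $r\mapsto (Q_0(r\cdot)\phi,\phi)$ has a right limit at every $r>R_0$. (c) There exist $h_0>0$ and, for $0<h<h_0$, a real-valued measurable function $Q_{0r}(x;h)$ on $E_{R_0}$ such that $\sup\{|Q_{0r}(x;h)| : x\in G,\ 0<h<h_0\}<\infty$ for every compact $G\subset E_{R_0}$; $$\tfrac1h\big(\{Q_0((r+h)\cdot)-Q_0(r\cdot)\}\phi,\phi\big)\le (Q_{0r}(r\cdot;h)\phi,\phi)\qquad(\phi\in X,\ r>R_0,\ 0<h<h_0);$$ and $\lim_{h\downarrow 0}(Q_{0r}(r\cdot;h)\phi,\phi)=(Q_{0r}(r\cdot)\phi,\phi)$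 for all $\phi\in X$, $r>R_0$, with a real-valued, measurable, locally bounded function $Q_{0r}(x)$ on $E_{R_0}$. (d) There exists $h\in L_1((R_0,\infty))$ with $0<h(r)\le \frac2r$ for $r>R_0$ such that, with $$a(r)=\frac{1}{h(r)}\sup_{|x|=r}|Q_1(x)|,\qquad b(r)=\inf_{|x|=r}\Big[-\Big(Q_0(x)+\frac{1}{h(r)}Q_{0r}(x)\Big)\Big],$$ one has $a(r)^2\le b(r)$ for all $r>R_0$. (e) There exist a positive $C^1$ function $F$ on $(R_0,\infty)$ and positive constants $c_0,c_1$ such that $F(r)^2\le c_0r^4h(r)^2b(r)$ for $r>R_0$, $F(r)\to\infty$ as $r\to\infty$, and $F'(r)\le c_1r^{-1}$ for $r>R_0$. Suppose that $$\varliminf_{r\to\infty}\int_{|x|=r}\Big\{\Big|\frac{\partial u}{\partial r}\Big|^2-\mathrm{Re}\,(q(x))|u|^2\Big\}\,dS=0 .$$ Then $u$ has compact support.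
   Context: $S^{N-1}$ is the unit sphere of $\mathbf{R}^N$; $X=L_2(S^{N-1})$ has inner product $(\ ,\ )$. For a function $f$ on $E_{R_0}$ and $r>R_0$, $f(r\cdot)$ denotes the function $\omega\mapsto f(r\omega)$ on $S^{N-1}$; inside inner products $Q_0(r\cdot)\phi$ etc. denotes pointwise multiplication. "Locally bounded on $E_{R_0}$" means bounded on every compact subset of $E_{R_0}$. "$u$ has compact support" is meant as the alternative to "the support of $u$ is unbounded", i.e. $u(x)=0$ for all sufficiently large $|x|$. *)

theory Defs
  imports "HOL-Analysis.Analysis"
begin

definition exterior :: "real \<Rightarrow> 'a::euclidean_space set"
  where "exterior R = {x. norm x > R}"

definition locally_bounded_on :: "'a::euclidean_space set \<Rightarrow> ('a \<Rightarrow> 'b::real_normed_vector) \<Rightarrow> bool"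
  where "locally_bounded_on S f \<longleftrightarrow> (\<forall>K. compact K \<and> K \<subseteq> S \<longrightarrow> bounded (f ` K))"


subsection \<open>The unit sphere\<close>

text \<open>Lebesgue surface measure on the unit sphere of a Euclidean space of dimension \<open>N\<close>:
  the measure of \<open>A\<close> is \<open>N\<close> times the volume of the cone \<open>{t \<omega> | 0 < t < 1, \<omega> \<in> A}\<close>,
  completed so that all Lebesgue measurable functions on the sphere are measurable.\<close>

definition sphere_measure :: "'a::euclidean_space measure"
  where "sphere_measure = completion
    (distr (scale_measure (of_nat DIM('a)) (restrict_space lborel (ball 0 1 - {0})))
       (restrict_space borel (sphere 0 1)) sgn)"

text \<open>Elements of \<open>X = L\<^sub>2(S\<^sup>N\<^sup>-\<^sup>1)\<close> are represented by square integrable functions.\<close>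

definition L2_sphere :: "('a::euclidean_space \<Rightarrow> complex) \<Rightarrow> bool"
  where "L2_sphere \<phi> \<longleftrightarrow> \<phi> \<in> borel_measurable sphere_measure \<and>
    integrable sphere_measure (\<lambda>\<omega>. (cmod (\<phi> \<omega>))\<^sup>2)"

definition X_inner :: "('a::euclidean_space \<Rightarrow> complex) \<Rightarrow> ('a \<Rightarrow> complex) \<Rightarrow> complex"
  where "X_inner f g = (LINT \<omega>|sphere_measure. f \<omega> * cnj (g \<omega>))"

text \<open>The quadratic form \<open>(V \<phi>, \<phi>)\<close> of the operator of multiplication by a real-valued
  function \<open>V\<close> on the sphere.  The inner product is then a real number, so taking the real
  part is only a change of type.\<close>

definition mult_form :: "('a::euclidean_space \<Rightarrow> real) \<Rightarrow> ('a \<Rightarrow> complex) \<Rightarrow> real"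
  where "mult_form V \<phi> = Re (X_inner (\<lambda>\<omega>. of_real (V \<omega>) * \<phi> \<omega>) \<phi>)"

text \<open>Measurability of a pointwise given coefficient: Lebesgue measurability on the exterior
  domain, and Lebesgue measurability of every restriction \<open>\<omega> \<mapsto> f (r \<omega>)\<close>, without which the
  expressions \<open>(f(r\<cdot>)\<phi>, \<phi>)\<close> and the integrals over \<open>|x| = r\<close> are not defined for
  every \<open>r\<close>.  Every Borel measurable function has both properties.\<close>

definition measurable_coeff ::
    "real \<Rightarrow> ('a::euclidean_space \<Rightarrow> 'b::{second_countable_topology, real_normed_vector}) \<Rightarrow> bool"
  where "measurable_coeff R f \<longleftrightarrow> f \<in> borel_measurable (lebesgue_on (exterior R)) \<and>
    (\<forall>r>R. (\<lambda>\<omega>. f (r *\<^sub>R \<omega>)) \<in> borel_measurable sphere_measure)"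


subsection \<open>Local Sobolev spaces\<close>

primrec C_on :: "nat \<Rightarrow> 'a::euclidean_space set \<Rightarrow> ('a \<Rightarrow> 'b::real_normed_vector) \<Rightarrow> bool"
  where
    "C_on 0 S f \<longleftrightarrow> continuous_on S f"
  | "C_on (Suc k) S f \<longleftrightarrow> (\<forall>x\<in>S. f differentiable (at x)) \<and>
       (\<forall>v. C_on k S (\<lambda>x. frechet_derivative f (at x) v))"

definition smooth_on :: "'a::euclidean_space set \<Rightarrow> ('a \<Rightarrow> 'b::real_normed_vector) \<Rightarrow> bool"
  where "smooth_on S f \<longleftrightarrow> (\<forall>k. C_on k S f)"

definition test_fun :: "'a::euclidean_space set \<Rightarrow> ('a \<Rightarrow> real) \<Rightarrow> bool"
  where "test_fun \<Omega> \<psi> \<longleftrightarrow> smooth_on UNIV \<psi> \<and>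
    (\<exists>K. compact K \<and> K \<subseteq> \<Omega> \<and> (\<forall>x. x \<notin> K \<longrightarrow> \<psi> x = 0))"

definition L2_loc :: "'a::euclidean_space set \<Rightarrow> ('a \<Rightarrow> complex) \<Rightarrow> bool"
  where "L2_loc \<Omega> f \<longleftrightarrow> f \<in> borel_measurable (lebesgue_on \<Omega>) \<and>
    (\<forall>K. compact K \<and> K \<subseteq> \<Omega> \<longrightarrow> integrable (lebesgue_on K) (\<lambda>x. (cmod (f x))\<^sup>2))"

definition is_weak_partial ::
    "'a::euclidean_space set \<Rightarrow> 'a \<Rightarrow> ('a \<Rightarrow> complex) \<Rightarrow> ('a \<Rightarrow> complex) \<Rightarrow> bool"
  where "is_weak_partial \<Omega> v f g \<longleftrightarrow> L2_loc \<Omega> g \<and>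
    (\<forall>\<psi>. test_fun \<Omega> \<psi> \<longrightarrow>
      (LINT x|lebesgue_on \<Omega>. frechet_derivative \<psi> (at x) v *\<^sub>R f x) =
      - (LINT x|lebesgue_on \<Omega>. \<psi> x *\<^sub>R g x))"

text \<open>Weak derivatives are unique up to null sets; \<open>weak_partial\<close> selects a representative
  when there is one in \<open>L\<^sub>2\<^sub>,\<^sub>l\<^sub>o\<^sub>c\<close>.\<close>

definition weak_partial ::
    "'a::euclidean_space set \<Rightarrow> 'a \<Rightarrow> ('a \<Rightarrow> complex) \<Rightarrow> 'a \<Rightarrow> complex"
  where "weak_partial \<Omega> v f = (SOME g. is_weak_partial \<Omega> v f g)"

definition H1_loc :: "'a::euclidean_space set \<Rightarrow> ('a \<Rightarrow> complex) \<Rightarrow> bool"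
  where "H1_loc \<Omega> f \<longleftrightarrow> L2_loc \<Omega> f \<and> (\<forall>b\<in>Basis. \<exists>g. is_weak_partial \<Omega> b f g)"

definition H2_loc :: "'a::euclidean_space set \<Rightarrow> ('a \<Rightarrow> complex) \<Rightarrow> bool"
  where "H2_loc \<Omega> f \<longleftrightarrow> H1_loc \<Omega> f \<and> (\<forall>b\<in>Basis. H1_loc \<Omega> (weak_partial \<Omega> b f))"

definition weak_laplacian :: "'a::euclidean_space set \<Rightarrow> ('a \<Rightarrow> complex) \<Rightarrow> 'a \<Rightarrow> complex"
  where "weak_laplacian \<Omega> f x = (\<Sum>b\<in>Basis. weak_partial \<Omega> b (weak_partial \<Omega> b f) x)"


subsection \<open>Traces and integrals on spheres\<close>

text \<open>The trace of \<open>f \<in> H\<^sup>1\<^sub>l\<^sub>o\<^sub>c(\<Omega>)\<close> on the sphere \<open>|x| = r\<close>, as a function on the unit sphere,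
  is the \<open>L\<^sub>2\<close> limit of the restrictions of smooth functions converging to \<open>f\<close> in
  \<open>H\<^sup>1\<close> of an annulus around that sphere.  It is unique up to null sets of the sphere.\<close>

definition is_sphere_trace ::
    "'a::euclidean_space set \<Rightarrow> real \<Rightarrow> ('a \<Rightarrow> complex) \<Rightarrow> ('a \<Rightarrow> complex) \<Rightarrow> bool"
  where "is_sphere_trace \<Omega> r f g \<longleftrightarrow> L2_sphere g \<and>
    (\<exists>r1 r2 A \<phi>. 0 < r1 \<and> r1 < r \<and> r < r2 \<and> A = {x. r1 \<le> norm x \<and> norm x \<le> r2} \<and> A \<subseteq> \<Omega> \<and>
      (\<forall>n::nat. smooth_on UNIV (\<phi> n)) \<and>
      (\<lambda>n. LINT x|lebesgue_on A. (cmod (\<phi> n x - f x))\<^sup>2) \<longlonglongrightarrow> 0 \<and>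
      (\<forall>b\<in>Basis. (\<lambda>n. LINT x|lebesgue_on A.
         (cmod (frechet_derivative (\<phi> n) (at x) b - weak_partial \<Omega> b f x))\<^sup>2) \<longlonglongrightarrow> 0) \<and>
      (\<lambda>n. LINT \<omega>|sphere_measure. (cmod (\<phi> n (r *\<^sub>R \<omega>) - g \<omega>))\<^sup>2) \<longlonglongrightarrow> 0)"

definition sphere_trace ::
    "'a::euclidean_space set \<Rightarrow> real \<Rightarrow> ('a \<Rightarrow> complex) \<Rightarrow> 'a \<Rightarrow> complex"
  where "sphere_trace \<Omega> r f = (SOME g. is_sphere_trace \<Omega> r f g)"

text \<open>The radial derivative \<open>\<partial>f/\<partial>r\<close> on \<open>|x| = r\<close>, namely the inner product of the trace of the
  weak gradient with the unit normal \<open>\<omega> = x/r\<close>.\<close>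

definition radial_deriv_trace ::
    "'a::euclidean_space set \<Rightarrow> real \<Rightarrow> ('a \<Rightarrow> complex) \<Rightarrow> 'a \<Rightarrow> complex"
  where "radial_deriv_trace \<Omega> r f \<omega> =
    (\<Sum>b\<in>Basis. (\<omega> \<bullet> b) *\<^sub>R sphere_trace \<Omega> r (weak_partial \<Omega> b f) \<omega>)"

text \<open>The integral over \<open>|x| = r\<close> with respect to surface measure of the function
  \<open>x \<mapsto> f (x/r)\<close>.\<close>

definition sphere_integral :: "real \<Rightarrow> ('a::euclidean_space \<Rightarrow> real) \<Rightarrow> real"
  where "sphere_integral r f = r ^ (DIM('a) - 1) * (LINT \<omega>|sphere_measure. f \<omega>)"

end

theory Submission
  imports Defs
begin

text \<open>With $v(r) = r^{(N-1)/2} u(r\,\cdot)$ the equation becomes an ordinary differential equation in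
  $L_2$ of the unit sphere. Put $A = |v|^2$, $C = (v,v')$, $D = |v'|^2$, $K = -(Q_0 v,v)$, and let $B$ be
  the tangential part of the gradient. The hypotheses on $Q_{0r}$ and $Q_1$ make $E = D - B + K$ times
  an integrating factor of $h$ nondecreasing, so the energy condition forces $E \<le> 0$. If $A(r_0) \<noteq> 0$ for
  some large $r_0$, then for large $m$ the functional $E + 2mC/r + (2m^2+m-F)A/r^2$, the energy of
  $r^m v$ corrected by $F$, stays positive once multiplied by $r^{2m+2}$. With $E \<le> 0$ and $F \<rightarrow> \<infinity>$ this
  makes $A$ increase, contradicting that $A$ is small along a sequence of radii. The derivatives of $C$
  and $D - B$ are Rellich identities, proved for mollifications of $u$ and passed to the limit. Since
  $(Q_0 v,v)$ is not differentiable, $E$ is handled through lower right derivatives.\<close>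

text \<open>Hypothesis (c) bounds the difference quotients of (Q_0 phi, phi) only from above. Hence
  K may jump upwards, and all one knows is that its difference quotients are bounded below and that
  its lower right derivative has a lower bound; the proof rests on the fact that such a function is
  nondecreasing once this lower bound is nonnegative almost everywhere. The energy integral alone
  does not control A. For each fixed phi, (d) and (e) give a linear differential inequality for
  -(Q_0 phi, phi), and integrating it yields -(Q_0 phi, phi) >= c |phi|^2 at all large radii with c
  independent of phi. The coefficient 2m^2 + m is forced: w = r^m v satisfies w'' - (2m/r) w' +
  m(m+1)/r^2 w = r^m v'', and adding m(m+1)/r^2 |w|^2 to |w'|^2 produces m^2 + m(m+1). Second
  derivatives of u have no trace on spheres, so the limit in the Rellich identities is taken after
  integrating in r; this is why the derivatives of C and D - B are obtained for almost every
  r.\<close>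

notation (input) scaleR (infixr "*R" 75)
notation (input) tendsto (infixr "--->" 55)
abbreviation (input) LIMSEQ_ascii (infix "---->" 60) where "X ----> L == (X ---> L) sequentially"

subsection \<open>Lower right derivatives\<close>

text \<open>The lower right Dini derivative of \<open>f\<close> at \<open>t\<close> is at least \<open>k\<close>.\<close>

definition rd_ge :: "(real => real) => real => real => bool"
 where "rd_ge f t k \<longleftrightarrow> (ALL e>0. \<forall>\<^sub>F s in at_right 0. f (t + s) - f t >= (k - e) * s)"

text \<open>Only downward slopes are bounded, so upward jumps are allowed. This is the regularity
  that hypothesis (c) leaves to the form of \<open>Q0\<close> along a path.\<close>

definition lower_lip :: "real => real => (real => real) => bool"
 where "lower_lip x y f \<longleftrightarrow> (EX L. ALL s t. x <= s --> s <= t --> t <= y --> f t - f s >= - L * (t - s))"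

lemma rd_ge_mono: "rd_ge f t k ==> k' <= k ==> rd_ge f t k'"
 unfolding rd_ge_def
proof (intro allI impI)
 fix e :: real assume *: "ALL e>0. \<forall>\<^sub>F s in at_right 0. (k - e) * s <= f (t + s) - f t" "k' <= k" "e > 0"
 then have "\<forall>\<^sub>F s in at_right 0. (k - e) * s <= f (t + s) - f t" by blast
 moreover have "\<forall>\<^sub>F s::real in at_right 0. s > 0" by (simp add: eventually_at_right_less)
 ultimately show "\<forall>\<^sub>F s in at_right 0. (k' - e) * s <= f (t + s) - f t"
 proof eventually_elim
  case (elim s)
  have "(k' - e) * s <= (k - e) * s" using elim(2) *(2) by (intro mult_right_mono) auto
  then show ?case using elim(1) by linarith
 qed
qed

lemma rd_ge_add:
 assumes "rd_ge f t k" "rd_ge g t l" shows "rd_ge (%x. f x + g x) t (k + l)"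
 unfolding rd_ge_def
proof (intro allI impI)
 fix e :: real assume "e > 0"
 then have "\<forall>\<^sub>F s in at_right 0. f (t + s) - f t >= (k - e/2) * s"
  "\<forall>\<^sub>F s in at_right 0. g (t + s) - g t >= (l - e/2) * s"
  using assms half_gt_zero unfolding rd_ge_def by blast+
 then show "\<forall>\<^sub>F s in at_right 0. f (t + s) + g (t + s) - (f t + g t) >= (k + l - e) * s"
  by eventually_elim (simp add: algebra_simps)
qed

lemma rd_ge_of_tendsto:
 assumes "((%s. (f (t + s) - f t) / s) ---> d) (at_right 0)"
 shows "rd_ge f t d"
 unfolding rd_ge_def
proof (intro allI impI)
 fix e :: real assume "e > 0"
 then have "\<forall>\<^sub>F s in at_right 0. (f (t + s) - f t) / s > d - e"
  using assms by (intro order_tendstoD(1)[OF assms]) auto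
 moreover have "\<forall>\<^sub>F s::real in at_right 0. s > 0" by (simp add: eventually_at_right_less)
 ultimately show "\<forall>\<^sub>F s in at_right 0. (d - e) * s <= f (t + s) - f t"
  by eventually_elim (simp add: field_simps)
qed

lemma tendsto_right_quotient:
 assumes "(f has_real_derivative d) (at t)"
 shows "((%s. (f (t + s) - f t) / s) ---> d) (at_right 0)"
 using assms unfolding DERIV_def by (rule filterlim_mono) (auto intro: at_le)

lemma rd_ge_deriv: "(f has_real_derivative d) (at t) ==> rd_ge f t d"
 by (intro rd_ge_of_tendsto tendsto_right_quotient)

text \<open>The increment is split as W(t+s) (f(t+s) - f(t)) + (W(t+s) - W(t)) f(t). In this order f
  appears away from t only inside its own increment, where the Dini bound applies even if f jumps;
  positivity of W near t preserves the inequality.\<close>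

lemma rd_ge_mult:
 assumes f: "rd_ge f t k" and W: "((%s. (W (t + s) - W t) / s) ---> d) (at_right 0)" and pos: "W t > 0"
 shows "rd_ge (%x. W x * f x) t (W t * k + d * f t)"
 unfolding rd_ge_def
proof (intro allI impI)
 fix e :: real assume e: "e > 0"
 have sp: "\<forall>\<^sub>F s::real in at_right 0. s > 0" by (simp add: eventually_at_right_less)
 have s0: "((%s::real. s) ---> 0) (at_right 0)" by (rule tendsto_ident_at)
 have "((%s. W t + (W (t + s) - W t) / s * s) ---> W t + d * 0) (at_right 0)"
  by (intro tendsto_intros W s0)
 then have Wc: "((%s. W (t + s)) ---> W t) (at_right 0)"
  using tendsto_cong[OF eventually_mono[OF sp, of "%s. W t + (W (t + s) - W t) / s * s = W (t + s)"]] by simp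
 \<comment> \<open>A quarter of e is spent on the slope of f; the rest absorbs the convergence of
   W(t+s) to W(t).\<close>
 define e' where "e' = e / (4 * W t)"
 have e': "e' > 0" using e pos by (simp add: e'_def)
 have L: "((%s. W (t + s) * (k - e') + (W (t + s) - W t) / s * f t) ---> W t * (k - e') + d * f t) (at_right 0)"
  by (intro tendsto_intros W Wc)
 have "W t * (k - e') + d * f t > W t * k + d * f t - e"
  using e pos by (simp add: e'_def field_simps)
 then have 1: "\<forall>\<^sub>F s in at_right 0. W (t + s) * (k - e') + (W (t + s) - W t) / s * f t > W t * k + d * f t - e"
  using order_tendstoD(1)[OF L] by blast
 have 2: "\<forall>\<^sub>F s in at_right 0. f (t + s) - f t >= (k - e') * s"
  using f e' unfolding rd_ge_def by blast
 have 3: "\<forall>\<^sub>F s in at_right 0. W (t + s) > 0" using order_tendstoD(1)[OF Wc pos] .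
 show "\<forall>\<^sub>F s in at_right 0. (W t * k + d * f t - e) * s <= W (t + s) * f (t + s) - W t * f t"
  using 1 2 3 sp
 proof eventually_elim
  case (elim s)
  have "(W t * k + d * f t - e) * s <= (W (t + s) * (k - e') + (W (t + s) - W t) / s * f t) * s"
   using elim by (intro mult_right_mono) auto
  also have "... = W (t + s) * ((k - e') * s) + (W (t + s) - W t) * f t" using elim by (simp add: field_simps)
  also have "... <= W (t + s) * (f (t + s) - f t) + (W (t + s) - W t) * f t"
   using elim by (intro add_right_mono mult_left_mono) auto
  finally show ?case by (simp add: algebra_simps)
 qed
qed

lemma lower_lip_add:
 assumes "lower_lip x y f" "lower_lip x y g" shows "lower_lip x y (%t. f t + g t)"
proof -
 obtain L M where L: "!!s t. x <= s ==> s <= t ==> t <= y ==> f t - f s >= - L * (t - s)"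
  and M: "!!s t. x <= s ==> s <= t ==> t <= y ==> g t - g s >= - M * (t - s)"
  using assms unfolding lower_lip_def by metis
 show ?thesis unfolding lower_lip_def
 proof (intro exI[of _ "L + M"] allI impI)
  fix s t assume *: "x <= s" "s <= t" "t <= y"
  show "- (L + M) * (t - s) <= f t + g t - (f s + g s)"
   using L[OF *] M[OF *] by (simp add: algebra_simps)
 qed
qed

lemma lower_lip_lipschitz:
 assumes "!!s t. x <= s ==> s <= t ==> t <= y ==> \<bar>f t - f s\<bar> <= L * (t - s)"
 shows "lower_lip x y f"
 unfolding lower_lip_def
proof (intro exI[of _ L] allI impI)
 fix s t assume "x <= s" "s <= t" "t <= y"
 from assms[OF this] show "- L * (t - s) <= f t - f s" by linarith
qed

text \<open>The value at x bounds f from below and the value at y bounds it from above, each up to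
  the slope bound times the length.\<close>

lemma lower_lip_bounded:
 assumes "lower_lip x y f"
 obtains M where "!!t. x <= t ==> t <= y ==> \<bar>f t\<bar> <= M"
proof -
 obtain L where L: "!!s t. x <= s ==> s <= t ==> t <= y ==> f t - f s >= - L * (t - s)"
  using assms unfolding lower_lip_def by metis
 show ?thesis
 proof (rule that[of "\<bar>f x\<bar> + \<bar>f y\<bar> + \<bar>L\<bar> * (y - x)"])
  fix t assume t: "x <= t" "t <= y"
  have "L * (t - x) <= \<bar>L\<bar> * (y - x)" "L * (y - t) <= \<bar>L\<bar> * (y - x)"
   using t by (auto intro!: mult_mono)
  then show "\<bar>f t\<bar> <= \<bar>f x\<bar> + \<bar>f y\<bar> + \<bar>L\<bar> * (y - x)"
   using L[of x t] L[of t y] t by (auto simp: abs_if algebra_simps split: if_splits)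
 qed
qed

lemma lower_lip_mult:
 assumes f: "lower_lip x y f" and W: "!!s t. x <= s ==> s <= t ==> t <= y ==> \<bar>W t - W s\<bar> <= N * (t - s)"
  and pos: "!!t. x <= t ==> t <= y ==> W t >= 0"
 shows "lower_lip x y (%t. W t * f t)"
proof -
 obtain M where M: "!!t. x <= t ==> t <= y ==> \<bar>f t\<bar> <= M" using lower_lip_bounded[OF f] by blast
 obtain L where L: "!!s t. x <= s ==> s <= t ==> t <= y ==> f t - f s >= - L * (t - s)"
  using f unfolding lower_lip_def by metis
 obtain V where V: "!!t. x <= t ==> t <= y ==> \<bar>W t\<bar> <= V"
  using lower_lip_bounded[OF lower_lip_lipschitz[OF W]] by blast
 show ?thesis unfolding lower_lip_def
 proof (intro exI[of _ "V * \<bar>L\<bar> + N * M"] allI impI)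
  fix s t assume *: "x <= s" "s <= t" "t <= y"
  have a: "W t * (f t - f s) >= W t * (- \<bar>L\<bar> * (t - s))"
  proof (intro mult_left_mono)
   have "- \<bar>L\<bar> * (t - s) <= - L * (t - s)" using * by (intro mult_right_mono) auto
   then show "- \<bar>L\<bar> * (t - s) <= f t - f s" using L[OF *] by linarith
   show "0 <= W t" using pos * by auto
  qed
  have b: "W t * (- \<bar>L\<bar> * (t - s)) >= - (V * \<bar>L\<bar> * (t - s))"
  proof -
   have "W t * (\<bar>L\<bar> * (t - s)) <= V * (\<bar>L\<bar> * (t - s))"
    using V[of t] * by (intro mult_right_mono) auto
   then show ?thesis by (simp add: algebra_simps)
  qed
  have "\<bar>(W t - W s) * f s\<bar> <= (N * (t - s)) * M" unfolding abs_mult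
   using W[OF *] M[of s] * by (intro mult_mono) auto
  then show "- (V * \<bar>L\<bar> + N * M) * (t - s) <= W t * f t - W s * f s"
   using a b by (simp add: algebra_simps abs_le_iff)
 qed
qed

lemma lower_lip_subinterval:
 assumes "lower_lip x y f" "x <= x'" "y' <= y" shows "lower_lip x' y' f"
proof -
 obtain L where L: "ALL s t. x <= s --> s <= t --> t <= y --> f t - f s >= - L * (t - s)"
  using assms unfolding lower_lip_def by metis
 then have "ALL s t. x' <= s --> s <= t --> t <= y' --> f t - f s >= - L * (t - s)"
  using assms(2,3) order_trans by blast
 then show ?thesis unfolding lower_lip_def by blast
qed

lemma C1_lipschitz:
 fixes f :: "real => real"
 assumes "!!t. x <= t ==> t <= y ==> (f has_real_derivative f' t) (at t)" "continuous_on {x..y} f'"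
 obtains L where "!!s t. x <= s ==> s <= t ==> t <= y ==> \<bar>f t - f s\<bar> <= L * (t - s)"
proof -
 have "bounded (f' ` {x..y})" using assms(2) compact_continuous_image compact_imp_bounded by blast
 then obtain L where "ALL v:f' ` {x..y}. norm v <= L" unfolding bounded_iff by blast
 then have L: "\<bar>f' t\<bar> <= L" if "t : {x..y}" for t using that by simp
 show ?thesis
 proof (rule that[of L])
  fix s t assume *: "x <= s" "s <= t" "t <= y"
  have "norm (f t - f s) <= L * norm (t - s)"
  proof (rule field_differentiable_bound[of "{s..t}" f f' L])
   show "!!z. z : {s..t} ==> (f has_field_derivative f' z) (at z within {s..t})"
    using assms(1) * by (auto intro: has_field_derivative_at_within)
  qed (use * L in auto)
  then show "\<bar>f t - f s\<bar> <= L * (t - s)" using * by simp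
 qed
qed

text \<open>A monotonicity theorem for functions that may jump upwards. With L a bound on the
  downward slopes, g(t) = f(t) + L t is nondecreasing, so its difference quotients are nonnegative
  and their integrals over [x, y] are at most g(y) - g(x). Almost everywhere their lower limit is at
  least L, and Fatou's lemma yields L (y - x) <= g(y) - g(x), which is the claim.\<close>

lemma le_of_rd_ge_zero:
 assumes xy: "x <= y" and ll: "lower_lip x y f"
  and rd: "AE t in lborel. x < t --> t < y --> rd_ge f t 0"
 shows "f x <= f y"
proof (cases "x = y")
 case False
 with xy have xy: "x < y" by simp
 obtain L0 where L0: "!!s t. x <= s ==> s <= t ==> t <= y ==> f t - f s >= - L0 * (t - s)"
  using ll unfolding lower_lip_def by metis
 define L where "L = \<bar>L0\<bar>"
 have L: "f t - f s >= - L * (t - s)" if "x <= s" "s <= t" "t <= y" for s t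
 proof -
  have "- L * (t - s) <= - L0 * (t - s)" using that by (intro mult_right_mono) (auto simp: L_def)
  then show ?thesis using L0[OF that] by linarith
 qed
 \<comment> \<open>Clamping the argument to [x, y] makes g monotone and bounded on the whole line,
   so that shifted integrals make sense.\<close>
 define c where "c t = max x (min y t)" for t
 define g where "g t = f (c t) + L * c t" for t
 have c: "x <= c t" "c t <= y" "s <= t ==> c s <= c t" for s t using xy by (auto simp: c_def)
 have g: "mono g"
 proof (rule monoI)
  fix s t :: real assume "s <= t"
  then show "g s <= g t" using L[of "c s" "c t"] c by (auto simp: g_def algebra_simps)
 qed
 have gm[measurable]: "g : borel_measurable borel" using g by (rule borel_measurable_mono)
 have gx: "g t >= g x" for t using monoD[OF g, of x "c t"] c xy by (simp add: g_def c_def)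
 have gy: "g t <= g y" for t using monoD[OF g, of "c t" y] c xy by (simp add: g_def c_def)
 have gint: "set_integrable lborel {p..q} g" for p q
 proof -
  have "integrable lborel (%t. indicator {p..q} t *R g t)"
  proof (rule integrableI_bounded_set_indicator[where B="\<bar>g x\<bar> + \<bar>g y\<bar>"])
   show "AE t in lborel. t : {p..q} --> norm (g t) <= \<bar>g x\<bar> + \<bar>g y\<bar>"
    using gx gy by (intro AE_I2) (smt (verit) real_norm_def)
  qed (auto simp: emeasure_lborel_Icc_eq)
  then show ?thesis by (simp add: set_integrable_def)
 qed
 define I where "I p q = (LINT t:{p..q}|lborel. g t)" for p q
 have I_split: "I p r = I p q + I q r" if "p <= q" "q <= r" for p q r
  unfolding I_def using that gint
  by (subst (1 2 3) set_borel_integral_eq_integral(2)) (auto intro!: Henstock_Kurzweil_Integration.integral_combine[symmetric] set_borel_integral_eq_integral(1))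
 have I_shift: "(LINT t:{p..q}|lborel. g (t + s)) = I (p + s) (q + s)" for p q s
  unfolding I_def set_lebesgue_integral_def
  by (subst lborel_integral_real_affine[where c=1 and t=s, of "%t. indicator {p + s..q + s} t *R g t"])
    (auto simp: add.commute intro!: Bochner_Integration.integral_cong split: split_indicator)
 have ci: "integrable lborel (indicat_real {p..q})" for p q :: real
  by (intro integrable_real_indicator) (auto simp: emeasure_lborel_Icc_eq)
 have I_up: "I p q <= g y * (q - p)" and I_lo: "I p q >= g x * (q - p)" if "p <= q" for p q
 proof -
  have "I p q <= (LINT t:{p..q}|lborel. g y)" unfolding I_def
   using gint gy by (intro set_integral_mono) (auto simp: set_integrable_def ci)
  then show "I p q <= g y * (q - p)" using that by (simp add: set_integral_const emeasure_lborel_Icc_eq mult.commute)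
  have "I p q >= (LINT t:{p..q}|lborel. g x)" unfolding I_def
   using gint gx by (intro set_integral_mono) (auto simp: set_integrable_def ci)
  then show "I p q >= g x * (q - p)" using that by (simp add: set_integral_const emeasure_lborel_Icc_eq mult.commute)
 qed
 define d where "d n t = real (Suc n) * (g (t + 1 / Suc n) - g t)" for n t
 have d0: "d n t >= 0" for n t using monoD[OF g, of t "t + 1 / Suc n"] by (simp add: d_def)
 have dm[measurable]: "d n : borel_measurable borel" for n unfolding d_def by measurable
 have gsi: "set_integrable lborel {x..y} (%t. g (t + s))" for s
 proof -
  have "integrable lborel (%t. indicator {x..y} t *R g (t + s))"
  proof (rule integrableI_bounded_set_indicator[where B="\<bar>g x\<bar> + \<bar>g y\<bar>"])
   show "AE t in lborel. t : {x..y} --> norm (g (t+s)) <= \<bar>g x\<bar> + \<bar>g y\<bar>"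
    using gx gy by (intro AE_I2) (smt (verit) real_norm_def)
  qed (auto simp: emeasure_lborel_Icc_eq)
  then show ?thesis by (simp add: set_integrable_def)
 qed
 have dint: "set_integrable lborel {x..y} (d n)" for n
  unfolding d_def using gsi[of "1 / Suc n"] gint by (intro set_integrable_mult_right set_integral_diff(1)) auto
 have dI: "(LINT t:{x..y}|lborel. d n t) <= g y - g x" for n
 proof -
  let ?s = "1 / real (Suc n)"
  have "(LINT t:{x..y}|lborel. d n t) = real (Suc n) * (I (x + ?s) (y + ?s) - I x y)"
   unfolding d_def using gsi[of ?s] gint
   by (simp add: set_integral_diff I_shift I_def[symmetric] del: of_nat_Suc) 
  \<comment> \<open>The shifted interval differs from the original one by a piece of length 1/(n+1)
    at each end; on these g is at most g(y) and at least g(x).\<close>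
  also have "I (x + ?s) (y + ?s) - I x y = I y (y + ?s) - I x (x + ?s)"
   using I_split[of x y "y + ?s"] I_split[of x "x + ?s" "y + ?s"] xy by simp
  also have "real (Suc n) * ... <= real (Suc n) * (g y * ?s - g x * ?s)"
   using I_up[of y "y + ?s"] I_lo[of x "x + ?s"] by (intro mult_left_mono) auto
  also have "... = (g y - g x) * (real (Suc n) * ?s)" by (simp only: algebra_simps)
  also have "real (Suc n) * ?s = 1" by simp
  finally show ?thesis by simp
 qed
 have liminf: "AE t in lborel. ennreal L * indicator {x..y} t <= liminf (%n. ennreal (indicator {x..y} t *R d n t))"
  using rd AE_lborel_singleton[of x] AE_lborel_singleton[of y]
 proof eventually_elim
  case (elim t)
  show ?case
  proof (cases "t : {x..y}")
   case True
   with elim have t: "x < t" "t < y" "rd_ge f t 0" by auto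
   show ?thesis
   proof (rule ennreal_le_epsilon)
    fix e :: real assume e: "e > 0"
    have lim: "filterlim (%n. 1 / real (Suc n)) (at_right 0) sequentially"
     unfolding filterlim_at using lim_inverse_n' LIMSEQ_inverse_real_of_nat
     by (auto simp: inverse_eq_divide)
    have "\<forall>\<^sub>F s in at_right 0. f (t + s) - f t >= (0 - e) * s & s < y - t"
    proof (rule eventually_conj)
     show "\<forall>\<^sub>F s in at_right 0. f (t + s) - f t >= (0 - e) * s" using t e unfolding rd_ge_def by blast
     show "\<forall>\<^sub>F s in at_right 0. s < y - t" using eventually_at_right_real[of 0 "y - t"] t
      by (auto elim: eventually_mono)
    qed
    from this[THEN filterlim_iff[THEN iffD1, OF lim, rule_format]]
    have "\<forall>\<^sub>F n in sequentially. ennreal L - ennreal e <= ennreal (indicator {x..y} t *R d n t)"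
    proof eventually_elim
     case (elim n)
     let ?s = "1 / real (Suc n)"
     have sp: "?s > 0" by simp
     \<comment> \<open>The step has been restricted to t + s < y, so the clamp is the identity at
       both points.\<close>
     have "c t = t" "c (t + ?s) = t + ?s" unfolding c_def using elim t sp by linarith+
     then have "g (t + ?s) - g t = f (t + ?s) - f t + L * ?s" by (simp only: g_def) (simp add: algebra_simps)
     then have "g (t + ?s) - g t >= (L - e) * ?s" using elim by (simp only: algebra_simps) simp
     then have "d n t >= real (Suc n) * ((L - e) * ?s)" unfolding d_def by (intro mult_left_mono) auto
     also have "real (Suc n) * ((L - e) * ?s) = L - e" by simp
     finally show ?case using True e by (simp add: ennreal_minus L_def ennreal_leI)
    qed
    then have "ennreal L - ennreal e <= liminf (%n. ennreal (indicator {x..y} t *R d n t))"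
     by (rule Liminf_bounded)
    then show "ennreal L * indicator {x..y} t <= liminf (%n. ennreal (indicator {x..y} t *R d n t)) + ennreal e"
     using True by (simp add: ennreal_minus_le_iff add.commute)
   qed
  qed simp
 qed
 have "ennreal (L * (y - x)) = (\<integral>\<^sup>+t. ennreal L * indicator {x..y} t \<partial>lborel)"
  using xy by (simp add: nn_integral_cmult emeasure_lborel_Icc_eq ennreal_mult L_def)
 also have "... <= (\<integral>\<^sup>+t. liminf (%n. ennreal (indicator {x..y} t *R d n t)) \<partial>lborel)"
  by (rule nn_integral_mono_AE[OF liminf])
 also have "... <= liminf (%n. \<integral>\<^sup>+t. ennreal (indicator {x..y} t *R d n t) \<partial>lborel)"
  by (rule nn_integral_liminf) measurable
 also have "... <= liminf (%n::nat. ennreal (g y - g x))"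
 proof (rule Liminf_mono, rule always_eventually, rule allI)
  fix n
  have "(\<integral>\<^sup>+t. ennreal (indicator {x..y} t *R d n t) \<partial>lborel) = ennreal (LINT t:{x..y}|lborel. d n t)"
   using dint[of n] d0 unfolding set_integrable_def set_lebesgue_integral_def
   by (intro nn_integral_eq_integral) auto
  then show "(\<integral>\<^sup>+t. ennreal (indicator {x..y} t *R d n t) \<partial>lborel) <= ennreal (g y - g x)"
   using dI[of n] by (simp add: ennreal_leI)
 qed
 also have "... = ennreal (g y - g x)" by (simp add: Liminf_const)
 finally have "L * (y - x) <= g y - g x"
  using gx[of y] by (subst (asm) ennreal_le_iff) auto
 then show ?thesis using xy by (simp add: g_def c_def algebra_simps)
qed simp

lemma tendsto_right_quotient_iff:
 "((%s. (f (t + s) - f t) / s) ---> d) (at_right 0) \<longleftrightarrow> (f has_real_derivative d) (at t within {t<..})"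
 unfolding has_field_derivative_iff
 by (subst filterlim_at_right_to_0[of _ _ t]) (simp add: add.commute)

text \<open>W is the exponential of the integral of h from R0. As h is positive and integrable, W
  stays between 1 and a constant; as h <= 2/x on [x, y], it is Lipschitz there. Multiplication by W
  removes a term -h f from a differential inequality for f.\<close>

lemma integrating_weight:
 fixes h :: "real => real"
 assumes R0: "R0 > 0" and h: "integrable (lebesgue_on {R0<..}) h" and hb: "!!r. r > R0 ==> 0 < h r & h r <= 2 / r"
 obtains W M where "!!r. r >= R0 ==> 1 <= W r" "!!r. r >= R0 ==> W r <= M"
  "!!x y. R0 < x ==> EX N. ALL s t. x <= s --> s <= t --> t <= y --> \<bar>W t - W s\<bar> <= N * (t - s)"
  "AE t in lborel. R0 < t --> ((%s. (W (t + s) - W t) / s) ---> W t * h t) (at_right 0)"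
proof -
 define g where "g r = (if r > R0 then h r else 0)" for r
 have "integrable lebesgue (%x. indicator {R0<..} x *R h x)"
  using h by (simp add: integrable_restrict_space)
 also have "(%x. indicator {R0<..} x *R h x) = g" by (auto simp: g_def)
 finally have gi: "integrable lebesgue g" .
 have g0: "g r >= 0" for r using hb[of r] by (auto simp: g_def)
 have gU: "g absolutely_integrable_on UNIV" using gi by (simp add: set_integrable_def)
 have gS: "g integrable_on {x..y}" for x y
  using set_integrable_subset[OF gU, of "{x..y}"] by (intro set_lebesgue_integral_eq_integral(1)) auto
 define H where "H t = integral {R0..t} g" for t
 have Hd: "H t - H s = integral {s..t} g" if "R0 <= s" "s <= t" for s t
  using Henstock_Kurzweil_Integration.integral_combine[OF that gS] by (simp add: H_def)
 have H0: "H t >= 0" for t unfolding H_def by (intro integral_nonneg gS) (auto simp: g0)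
 have HU: "H t <= integral UNIV g" for t unfolding H_def
  by (intro integral_subset_le gS) (use gU in \<open>auto simp: g0 absolutely_integrable_on_def\<close>)
 have Hlip: "H t - H s <= 2 / x * (t - s)" "H t - H s >= 0" if "R0 < x" "x <= s" "s <= t" for x s t
 proof -
  have "integral {s..t} g <= integral {s..t} (%_. 2 / x)"
  proof (rule integral_le)
   fix r assume "r : {s..t}"
   then have "R0 < r" "x <= r" using that by auto
   then have "g r <= 2 / r" using hb by (simp add: g_def)
   also have "2 / r <= 2 / x" using \<open>x <= r\<close> that R0 by (intro divide_left_mono) auto
   finally show "g r <= 2 / x" .
  qed (use gS in auto)
  then show "H t - H s <= 2 / x * (t - s)" using that by (simp add: Hd mult.commute)
  show "H t - H s >= 0" using that by (subst Hd) (auto intro!: integral_nonneg gS g0)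
 qed
 \<comment> \<open>Lebesgue differentiation for averages over [x, x + h], which are exactly the
   right difference quotients of H. Since h is merely integrable, the derivative of W exists off a
   negligible set.\<close>
 obtain N where N: "negligible N" and N': "!!x e. x \<notin> N ==> 0 < e ==>
   EX d>0. ALL h. 0 < h & h < d --> norm (integral (cbox x (x + h *R One)) g /\<^sub>R h ^ DIM(real) - g x) < e"
  using integrable_ccontinuous_explicit[of g] gS by (metis box_real(2))
 have lim: "((%s. (H (t + s) - H t) / s) ---> h t) (at_right 0)" if t: "R0 < t" "t \<notin> N" for t
  unfolding tendsto_iff
 proof (intro allI impI)
  fix e :: real assume "e > 0"
  then obtain d where d: "d > 0" "!!h. 0 < h ==> h < d ==> norm (integral {t..t+h} g / h - g t) < e"
   using N'[OF t(2), of e] by (auto simp: divide_inverse mult.commute)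
  have "\<forall>\<^sub>F s in at_right 0. s : {0<..<d}" using eventually_at_right_real[OF d(1)] .
  then show "\<forall>\<^sub>F s in at_right 0. dist ((H (t + s) - H t) / s) (h t) < e"
  proof eventually_elim
   case (elim s)
   then show ?case using d(2)[of s] t by (simp add: Hd dist_real_def g_def)
  qed
 qed
 have NAE: "AE t in lborel. t \<notin> N" 
  using AE_not_in[of N lebesgue] N by (simp add: negligible_iff_null_sets AE_completion_iff)
 show ?thesis
 proof (rule that[of "%t. exp (H t)" "exp (integral UNIV g)"])
  show "1 <= exp (H r)" for r using H0 by simp
  show "exp (H r) <= exp (integral UNIV g)" for r using HU by simp
  show "EX L. ALL s t. x <= s --> s <= t --> t <= y --> \<bar>exp (H t) - exp (H s)\<bar> <= L * (t - s)" if x: "R0 < x" for x y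
  proof (intro exI[of _ "exp (integral UNIV g) * (2 / x)"] allI impI)
   fix s t assume *: "x <= s" "s <= t" "t <= y"
   have "exp (H s) <= exp (H t)" using Hlip(2)[OF x *(1,2)] by simp
   moreover have "exp (H t) - exp (H s) = exp (H t) * (1 - exp (- (H t - H s)))"
    by (simp add: exp_diff right_diff_distrib)
   moreover have "1 - exp (- (H t - H s)) <= H t - H s" using exp_ge_add_one_self[of "- (H t - H s)"] by linarith
   moreover have "exp (H t) * (H t - H s) <= exp (integral UNIV g) * (2 / x * (t - s))"
    using HU Hlip[OF x *(1,2)] by (intro mult_mono) auto
   ultimately show "\<bar>exp (H t) - exp (H s)\<bar> <= exp (integral UNIV g) * (2 / x) * (t - s)"
    by (smt (verit) exp_ge_zero mult_left_mono mult.assoc)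
  qed
  show "AE t in lborel. R0 < t --> ((%s. (exp (H (t + s)) - exp (H t)) / s) ---> exp (H t) * h t) (at_right 0)"
   using NAE
  proof eventually_elim
   case (elim t)
   show ?case
   proof
    assume "R0 < t"
    from lim[OF this elim] have "(H has_real_derivative h t) (at t within {t<..})"
     by (simp add: tendsto_right_quotient_iff)
    then have "((%x. exp (H x)) has_real_derivative exp (H t) * h t) (at t within {t<..})"
     by (intro derivative_eq_intros) auto
    then show "((%s. (exp (H (t + s)) - exp (H t)) / s) ---> exp (H t) * h t) (at_right 0)"
     by (subst tendsto_right_quotient_iff)
   qed
  qed
 qed
qed

text \<open>Here g stands for -(Q_0 phi, phi) at a fixed phi and n for |phi|^2. The weighted
  function W g grows at rate at least W h b n, and F >= 1 together with h <= 2/t makes h b at least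
  1/(2 c0 t^3). Integrating from r1 to r >= 2 r1 gives a bound proportional to n whose constant does
  not depend on g.\<close>

lemma form_lower_bound:
 fixes g h b :: "real => real"
 assumes R0: "R0 > 0" and W1: "!!r. r >= R0 ==> 1 <= W r" and WM: "!!r. r >= R0 ==> W r <= M"
  and Wlip: "!!x y. R0 < x ==> EX N. ALL s t. x <= s --> s <= t --> t <= y --> \<bar>W t - W s\<bar> <= N * (t - s)"
  and Wd: "AE t in lborel. R0 < t --> ((%s. (W (t + s) - W t) / s) ---> W t * h t) (at_right 0)"
  and hb: "!!r. r > R0 ==> 0 < h r & h r <= 2 / r"
  and F: "!!r. r > R0 ==> (F r)\<^sup>2 <= c0 * r ^ 4 * (h r)^2 * b r" and c0: "c0 > 0"
  and r1: "r1 > R0" "!!r. r >= r1 ==> F r >= 1"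
  and n: "n >= 0" and g0: "!!r. r > R0 ==> g r >= 0"
  and gl: "!!x y. R0 < x ==> lower_lip x y g"
  and gr: "!!r. r > R0 ==> rd_ge g r (- h r * g r + h r * b r * n)"
  and r: "r >= 2 * r1"
 shows "g r >= 3 / (16 * c0 * r1^2 * M) * n"
proof -
 \<comment> \<open>The second summand has derivative -n/(2 c0 t^3), the negative of the guaranteed
   growth of W g, so f is nondecreasing.\<close>
 define f where "f t = W t * g t + n / (4 * c0) * (1 / t^2)" for t
 have r10: "r1 > 0" using R0 r1 by simp
 have "f r1 <= f r"
 proof (rule le_of_rd_ge_zero[where f=f and x=r1 and y=r])
  show "r1 <= r" using r r10 by simp
  obtain N where N: "!!s t. r1 <= s ==> s <= t ==> t <= r ==> \<bar>W t - W s\<bar> <= N * (t - s)"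
   using Wlip[OF r1(1)] by metis
  have 1: "lower_lip r1 r (%t. W t * g t)"
   using gl[OF r1(1)] N W1 r1 by (intro lower_lip_mult) (auto intro: order_trans[of 0 1])
  obtain L where L: "!!s t. r1 <= s ==> s <= t ==> t <= r ==> \<bar>n / (4 * c0) * (1 / t^2) - n / (4 * c0) * (1 / s^2)\<bar> <= L * (t - s)"
  proof (rule C1_lipschitz[of r1 r "%t. n / (4 * c0) * (1 / t^2)" "%t. - (n / (2 * c0)) / t ^ 3"])
   show "((%t. n / (4 * c0) * (1 / t^2)) has_real_derivative - (n / (2 * c0)) / t ^ 3) (at t)" if "r1 <= t" for t
    using that r10 c0 by (auto intro!: derivative_eq_intros simp: field_simps power_numeral_reduce)
   show "continuous_on {r1..r} (%t. - (n / (2 * c0)) / t ^ 3)"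
    using r10 by (intro continuous_intros) auto
  qed blast
  show "lower_lip r1 r f" unfolding f_def by (intro lower_lip_add 1 lower_lip_lipschitz[OF L])
  show "AE t in lborel. r1 < t --> t < r --> rd_ge f t 0"
   using Wd
  proof eventually_elim
   case (elim t)
   show ?case
   proof (intro impI)
    assume t: "r1 < t"
    then have tR: "R0 < t" "t > 0" using r1 r10 by auto
    have h: "0 < h t" "h t <= 2 / t" using hb[OF tR(1)] by auto
    have d: "((%t. n / (4 * c0) * (1 / t^2)) has_real_derivative - (n / (2 * c0)) / t ^ 3) (at t)"
     using tR c0 by (auto intro!: derivative_eq_intros simp: field_simps power_numeral_reduce)
    have "rd_ge f t (W t * (- h t * g t + h t * b t * n) + W t * h t * g t + - (n / (2 * c0)) / t ^ 3)"
     unfolding f_def using elim tR W1[of t] by (intro rd_ge_add rd_ge_mult gr rd_ge_deriv d) auto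
    moreover have "0 <= W t * (- h t * g t + h t * b t * n) + W t * h t * g t + - (n / (2 * c0)) / t ^ 3"
    proof -
     have "1 <= (F t)\<^sup>2" using r1(2)[of t] t by (simp add: power_le_one_iff one_le_power)
     also have "... <= (c0 * t ^ 4 * (h t * b t)) * h t" using F[OF tR(1)] by (simp add: power2_eq_square mult_ac)
     finally have k: "1 <= (c0 * t ^ 4 * (h t * b t)) * h t" .
     \<comment> \<open>The sign of b is recovered from 1 <= F^2 <= c0 t^4 h^2 b.\<close>
     have k0: "c0 * t ^ 4 * (h t * b t) >= 0"
     proof (rule ccontr)
      assume "\<not> ?thesis"
      then have "(c0 * t ^ 4 * (h t * b t)) * h t < 0" using h by (simp add: mult_neg_pos)
      then show False using k by simp
     qed
     have "(c0 * t ^ 4 * (h t * b t)) * h t <= (c0 * t ^ 4 * (h t * b t)) * (2 / t)"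
      by (rule mult_left_mono[OF h(2) k0])
     with k have "1 <= (2 * c0 * t ^ 3) * (h t * b t)" using tR by (simp add: field_simps power_numeral_reduce)
     then have hbl: "1 / (2 * c0 * t ^ 3) <= h t * b t" using tR c0 by (simp add: field_simps)
     then have "h t * b t >= 0" using tR c0 by (smt (verit) divide_nonneg_pos mult_pos_pos zero_less_power)
     then have "h t * b t <= W t * (h t * b t)" using W1[of t] tR by (simp add: mult_le_cancel_right1)
     with hbl have "1 / (2 * c0 * t ^ 3) <= W t * (h t * b t)" by linarith
     from mult_right_mono[OF this n] show ?thesis by (simp add: algebra_simps)
    qed
    ultimately show "rd_ge f t 0" by (rule rd_ge_mono)
   qed
  qed
 qed
 moreover have "W r1 * g r1 >= 0" using W1[of r1] g0[of r1] r1 by simp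
 ultimately have "n / (4 * c0) * (1 / r1^2 - 1 / r^2) <= W r * g r" by (simp add: f_def algebra_simps)
 \<comment> \<open>Since r >= 2 r1, 1/r^2 is at most a quarter of 1/r1^2; this factor 3/4 is the
   origin of the constant 3/16.\<close>
 moreover have "n / (4 * c0) * (3 / 4 * (1 / r1^2)) <= n / (4 * c0) * (1 / r1^2 - 1 / r^2)"
 proof (rule mult_left_mono)
  have "(2 * r1)\<^sup>2 <= r\<^sup>2" using r r10 by (intro power_mono) auto
  then have "1 / r^2 <= 1 / (2 * r1)^2" using r10 r
   by (intro divide_left_mono mult_pos_pos) auto
  then show "3 / 4 * (1 / r1^2) <= 1 / r1^2 - 1 / r^2" by (simp add: power_mult_distrib)
  show "0 <= n / (4 * c0)" using n c0 by simp
 qed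
 moreover have "W r * g r <= M * g r" using WM[of r] g0[of r] r r1 r10 by (intro mult_right_mono) auto
 ultimately have k: "n * 3 / (16 * c0 * r1^2) <= M * g r" by (simp add: field_simps)
 have M: "M > 0" using W1[of R0] WM[of R0] by simp
 have "n * 3 / (16 * c0 * r1^2) <= g r * M" using k by (simp only: mult.commute)
 then have "n * 3 / (16 * c0 * r1^2) / M <= g r" by (subst pos_divide_le_eq[OF M])
 then show ?thesis by (simp add: mult.commute)
qed

subsection \<open>The scalar growth argument\<close>

text \<open>The left side is the derivative of t^(2m+2) Y divided by t^(2m+2), for the functional Y
  of the growth argument, with the derivatives of E, C and A inserted. The exponent 2m+2 cancels B
  and leaves (2/t - h) K, and the coefficient 2m^2+m completes the D, C and A terms to a multiple of
  |v' + (m/t) v|^2.\<close>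

lemma weighted_derivative_identity:
 fixes t :: real
 assumes "t > 0"
 shows "(S + 2/t * B - h * K + h * b * A) + ((2*m/t) * (D + B - K + R) + - (2*m)/t\<^sup>2 * C)
   + ((- F'/t\<^sup>2 - 2 * ((2*m\<^sup>2+m) - F)/t^3) * A + ((2*m\<^sup>2+m) - F)/t\<^sup>2 * (2 * C))
   + (2*m+2)/t * (D - B + K + (2*m/t) * C + ((2*m\<^sup>2+m) - F)/t\<^sup>2 * A)
  = (4*m+2)/t * (D + 2*(m/t)*C + (m/t)^2*A) + (S + 2*(m/t)* R) - 2*(F/t\<^sup>2) * (C + (m/t)*A)
   + h*b*A - F'/t\<^sup>2*A + (2/t - h)*K"
proof -
 define w where "w = 1 / t"
 have w: "x / t = x * w" "x / t^2 = x * w^2" "x / t ^ 3 = x * w ^ 3" for x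
  by (simp_all add: w_def power_one_over)
 show ?thesis unfolding w by algebra
qed

text \<open>Cauchy-Schwarz for v and v' + c v, extracted from C^2 <= A D alone: the difference A |v'
  + c v|^2 - (C + c A)^2 equals A D - C^2.\<close>

lemma cross_term_bound:
 fixes A C D c :: real
 assumes "A >= 0" "D >= 0" "C\<^sup>2 <= A * D"
 shows "D + 2 * c * C + c^2 * A >= 0" "\<bar>C + c * A\<bar> <= sqrt (A * (D + 2 * c * C + c^2 * A))"
proof -
 have *: "A * (D + 2 * c * C + c^2 * A) = A * D - C\<^sup>2 + (C + c * A)^2"
  by (simp add: power2_eq_square algebra_simps)
 show "D + 2 * c * C + c^2 * A >= 0"
 proof (cases "A = 0")
  case False
  then have "A > 0" using assms by simp
  moreover have "A * (D + 2 * c * C + c^2 * A) >= 0" unfolding * using assms by simp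
  ultimately show ?thesis by (simp add: zero_le_mult_iff)
 qed (use assms in auto)
 show "\<bar>C + c * A\<bar> <= sqrt (A * (D + 2 * c * C + c^2 * A))"
  using assms(3) unfolding * by (intro real_le_rsqrt) simp
qed

text \<open>With X^2 = A, Y^2 = |v' + (m/t) v|^2 and s^2 = b, the Q_1 term and the cross term with F
  are at most constants times h s X Y, and the term with F' costs at most half of h b A because F^2
  >= 4 c0 c1. The other half of h b A and the large multiple of Y^2 absorb the products once m >= (1
  + sqrt c0)^2.\<close>

lemma quadratic_form_nonneg:
 fixes t m F F' a b h A C D K S R c0 c1 :: real
 assumes t: "t > 0" and A: "A >= 0" "D >= 0" "C\<^sup>2 <= A * D" "K >= 0"
  and h: "0 < h" "h <= 2 / t" and a: "a >= 0" "a\<^sup>2 <= b"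
  and SR: "\<bar>S + 2 * (m/t) * R\<bar> <= 2 * h * a * sqrt (A * (D + 2 * (m/t) * C + (m/t)^2 * A))"
  and F: "F > 0" "F\<^sup>2 <= c0 * t ^ 4 * h^2 * b" "F' <= c1 * inverse t" "F\<^sup>2 >= 4 * c0 * c1"
  and c: "c0 > 0" "c1 > 0" and m: "m >= (1 + sqrt c0)\<^sup>2"
 shows "0 <= (4*m+2)/t * (D + 2*(m/t)*C + (m/t)^2*A) + (S + 2*(m/t)* R) - 2*(F/t\<^sup>2) * (C + (m/t)*A)
   + h*b*A - F'/t\<^sup>2*A + (2/t - h)*K"
proof -
 define G where "G = D + 2*(m/t)*C + (m/t)^2*A"
 define X Y s where "X = sqrt A" "Y = sqrt G" "s = sqrt b"
 have G: "G >= 0" "\<bar>C + (m/t) * A\<bar> <= sqrt (A * G)" unfolding G_def using cross_term_bound[OF A(1-3)] by blast+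
 have b0: "b >= 0" using a(2) by (meson order_trans zero_le_power2)
 have XY: "X >= 0" "Y >= 0" "s >= 0" "X\<^sup>2 = A" "Y\<^sup>2 = G" "s\<^sup>2 = b" "sqrt (A * G) = X * Y"
  using A G b0 by (auto simp: X_Y_s_def real_sqrt_mult)
 have "a <= s" unfolding X_Y_s_def using a by (intro real_le_rsqrt) auto
 have "sqrt (F^2) <= sqrt (c0 * (t^2)^2 * h^2 * b)" using F(2) by (intro real_sqrt_le_mono) simp
 moreover have "sqrt (t ^ 4) = t^2" using real_sqrt_abs[of "t\<^sup>2"] by simp
 ultimately have Fs: "F <= sqrt c0 * t^2 * h * s" using F(1) h by (simp add: real_sqrt_mult X_Y_s_def)
 \<comment> \<open>By h <= 2/t the lower bound on m leaves room for the term 2 h (1 + sqrt c0)^2 Y^2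
   that Young's inequality produces below.\<close>
 have m1: "0 <= (4*m+2)/t - 2 * h * (1 + sqrt c0)^2"
 proof -
  have "2 * h * (1 + sqrt c0)^2 <= 2 * (2/t) * m" using h m t by (intro mult_mono) auto
  moreover have "2 * (2/t) * m <= (4*m+2)/t" using t by (simp add: field_simps)
  ultimately show ?thesis by linarith
 qed
 have S: "\<bar>S + 2 * (m/t) * R\<bar> <= 2 * h * s * (X * Y)"
 proof -
  have "2 * h * a * (X * Y) <= 2 * h * s * (X * Y)"
   using \<open>a <= s\<close> h XY by (intro mult_right_mono mult_left_mono) auto
  then show ?thesis using SR XY(7) by (simp add: G_def)
 qed
 have Fc: "2*(F/t\<^sup>2) * (C + (m/t)*A) <= 2 * (sqrt c0 * h * s) * (X * Y)"
 proof -
  have "F / t^2 <= sqrt c0 * h * s" using Fs t by (simp add: field_simps)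
  then have "(F / t^2) * (X * Y) <= (sqrt c0 * h * s) * (X * Y)"
   using XY by (intro mult_right_mono) auto
  moreover have "(F / t^2) * (C + (m/t)*A) <= (F / t^2) * (X * Y)"
   using G(2) XY(7) F(1) by (intro mult_left_mono) auto
  ultimately show ?thesis by simp
 qed
 have F'b: "F' / t^2 <= h * b / 2"
 proof -
  have "F' <= c1 / t" using F(3) by (simp add: divide_inverse)
  then have "F' / t^2 <= c1 / t / t^2" using t by (intro divide_right_mono) auto
  also have "... = c1 / t ^ 3" by (simp add: power2_eq_square power3_eq_cube)
  also have "... <= h * b / 2"
  proof -
   have "4 * c0 * c1 <= (c0 * t ^ 4 * (h * b)) * h" using F(2,4) by (simp add: power2_eq_square mult_ac)
   also have "... <= (c0 * t ^ 4 * (h * b)) * (2/t)" using h b0 c by (intro mult_left_mono) auto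
   also have "... = 2 * c0 * (t ^ 3 * (h * b))" using t by (simp add: field_simps power_numeral_reduce)
   finally have "2 * c1 <= t ^ 3 * (h * b)" using c by (simp add: field_simps)
   then show ?thesis using t by (simp add: field_simps)
  qed
  finally show ?thesis .
 qed
 \<comment> \<open>Young's inequality. It is applied with v = 1 + sqrt c0, which adds the constant 1
   of the S and R terms to the constant sqrt c0 of the F term.\<close>
 have sq: "2 * h * s * v * (X * Y) <= h * b / 2 * X^2 + 2 * h * v^2 * Y^2" for v
 proof -
  have "0 <= h * (s * X - 2 * v * Y)^2" using h by simp
  then have "0 <= h * (s^2 * X^2 - 4 * v * s * X * Y + 4 * v^2 * Y^2)"
   by (simp add: power2_eq_square algebra_simps)
  then show ?thesis unfolding XY(6)[symmetric] by (simp add: algebra_simps)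
 qed
 have "F' / t^2 * A <= h * b / 2 * A" using F'b A by (intro mult_right_mono) auto
 moreover have "(2/t - h) * K >= 0" using h A by simp
 moreover have "((4*m+2)/t - 2 * h * (1 + sqrt c0)^2) * G >= 0" using m1 G by simp
 moreover have "2 * h * s * (1 + sqrt c0) * (X * Y) = 2 * h * s * (X * Y) + 2 * (sqrt c0 * h * s) * (X * Y)"
  by (simp add: algebra_simps)
 ultimately show ?thesis
  using S Fc sq[of "1 + sqrt c0"] unfolding G_def[symmetric] XY by (simp add: left_diff_distrib abs_le_iff)
qed

text \<open>Only scalar functions of r remain here: S and R are the contributions of Q_1 to the
  derivatives of E = D - B + K and of C. The bound \<open>SR\<close> is used twice, with c = 0 to
  see that W E is nondecreasing and with c = m/r in the growth estimate, where the root contains |v'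
  + c v|^2.\<close>

theorem growth_alternative:
 fixes A B C D K S R h a b F F' :: "real => real"
 assumes R0: "R0 > 0"
  and nonneg: "!!r. r > R0 ==> A r >= 0" "!!r. r > R0 ==> B r >= 0" "!!r. r > R0 ==> D r >= 0" "!!r. r > R0 ==> K r >= 0"
  and CS: "!!r. r > R0 ==> (C r)\<^sup>2 <= A r * D r"
  and A_deriv: "!!r. r > R0 ==> (A has_real_derivative 2 * C r) (at r)"
  and C_lip: "!!x y. R0 < x ==> EX L. ALL s t. x <= s --> s <= t --> t <= y --> \<bar>C t - C s\<bar> <= L * (t - s)"
  and E_ll: "!!x y. R0 < x ==> lower_lip x y (%r. D r - B r + K r)"
  and C_rd: "AE r in lborel. r > R0 --> rd_ge C r (D r + B r - K r + R r)"
  and E_rd: "AE r in lborel. r > R0 -->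
    rd_ge (%r. D r - B r + K r) r (S r + 2 / r * B r - h r * K r + h r * b r * A r)"
  and SR: "!!r c. r > R0 ==> \<bar>S r + 2 * c * R r\<bar> <= 2 * h r * a r * sqrt (A r * (D r + 2 * c * C r + c^2 * A r))"
  and h_L1: "integrable (lebesgue_on {R0<..}) h"
  and h_bounds: "!!r. r > R0 ==> 0 < h r & h r <= 2 / r"
  and a0: "!!r. r > R0 ==> a r >= 0"
  and a_b: "!!r. r > R0 ==> (a r)\<^sup>2 <= b r"
  and F_pos: "!!r. r > R0 ==> F r > 0"
  and F_deriv: "!!r. r > R0 ==> (F has_real_derivative F' r) (at r)"
  and F_C1: "continuous_on {R0<..} F'"
  and c_pos: "c0 > 0" "c1 > 0"
  and F_bound: "!!r. r > R0 ==> (F r)\<^sup>2 <= c0 * r ^ 4 * (h r)^2 * b r"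
  and F_lim: "filterlim F at_top at_top"
  and F'_bound: "!!r. r > R0 ==> F' r <= c1 * inverse r"
  and small: "!!e T. e > 0 ==> EX r>T. r > R0 & D r + K r + A r < e"
 shows "EX T>R0. ALL r>T. A r = 0"
proof (rule ccontr)
 assume neg: "\<not> ?thesis"
 define E where "E r = D r - B r + K r" for r
 obtain W M where W: "!!r. r >= R0 ==> 1 <= W r" "!!r. r >= R0 ==> W r <= M"
  and Wl: "!!x y. R0 < x ==> EX N. ALL s t. x <= s --> s <= t --> t <= y --> \<bar>W t - W s\<bar> <= N * (t - s)"
  and Wd: "AE t in lborel. R0 < t --> ((%s. (W (t + s) - W t) / s) ---> W t * h t) (at_right 0)"
  by (rule integrating_weight[OF R0 h_L1 h_bounds]) auto
 have WE: "W x * E x <= W y * E y" if xy: "R0 < x" "x <= y" for x y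
 proof (rule le_of_rd_ge_zero[where f="%t. W t * E t"])
  obtain N where N: "!!s t. x <= s ==> s <= t ==> t <= y ==> \<bar>W t - W s\<bar> <= N * (t - s)"
   using Wl[OF xy(1)] by metis
  show "lower_lip x y (%t. W t * E t)"
   unfolding E_def using E_ll[OF xy(1)] N W xy by (intro lower_lip_mult) (auto intro: order_trans[of 0 1])
  show "AE t in lborel. x < t --> t < y --> rd_ge (%t. W t * E t) t 0"
   using E_rd Wd
  proof eventually_elim
   case (elim t)
   show ?case
   proof (intro impI)
    assume "x < t"
    then have t: "R0 < t" "t > 0" using xy R0 by auto
    have Wt: "W t >= 1" using W t by simp
    have "rd_ge (%t. W t * E t) t (W t * (S t + 2 / t * B t - h t * K t + h t * b t * A t) + W t * h t * E t)"
     unfolding E_def using elim t Wt by (intro rd_ge_mult) auto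
    moreover have "0 <= W t * (S t + 2 / t * B t - h t * K t + h t * b t * A t) + W t * h t * E t"
    proof -
     have h: "0 < h t" "h t <= 2 / t" using h_bounds[OF t(1)] by auto
     \<comment> \<open>The choice c = 0 leaves |S| <= 2 h a sqrt(A D). By a^2 <= b this is at most h
       (b A + D), which the terms h b A and h D of the weighted derivative compensate.\<close>
     have "\<bar>S t\<bar> <= h t * (2 * a t * sqrt (A t) * sqrt (D t))"
      using SR[OF t(1), of 0] by (simp add: real_sqrt_mult mult_ac)
     also have "... <= h t * (b t * A t + D t)"
     proof (rule mult_left_mono)
      have "0 <= (a t * sqrt (A t) - sqrt (D t))\<^sup>2" by simp
      then have "2 * a t * sqrt (A t) * sqrt (D t) <= (a t)\<^sup>2 * A t + D t"
       using nonneg[OF t(1)] by (simp add: power2_diff power_mult_distrib)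
      also have "... <= b t * A t + D t" using a_b[OF t(1)] nonneg[OF t(1)] by (intro add_right_mono mult_right_mono) auto
      finally show "2 * a t * sqrt (A t) * sqrt (D t) <= b t * A t + D t" .
     qed (use h in auto)
     finally have 1: "S t + h t * (b t * A t + D t) >= 0" by linarith
     have 2: "(2 / t - h t) * B t >= 0" using h nonneg[OF t(1)] by simp
     have "0 <= W t * ((S t + h t * (b t * A t + D t)) + (2 / t - h t) * B t)"
      using 1 2 Wt by (intro mult_nonneg_nonneg) auto
     then show ?thesis by (simp add: E_def algebra_simps)
    qed
    ultimately show "rd_ge (%t. W t * E t) t 0" by (rule rd_ge_mono)
   qed
  qed
 qed (use that in auto)
 have M: "M > 0" using W[of R0] by simp
 \<comment> \<open>If E were positive at r, then W E could not fall below its value there, so E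
   would stay above W(r) E(r) / M at all later radii, although E <= D + K is arbitrarily small along
   a sequence.\<close>
 have E_le: "E r <= 0" if r: "r > R0" for r
 proof (rule ccontr)
  assume "\<not> ?thesis"
  then have "W r * E r > 0" using W(1)[of r] r by simp
  then obtain x where x: "x > r" "D x + K x + A x < W r * E r / M"
   using small[of "W r * E r / M" r] M by auto
  have "E x <= D x + K x + A x" using nonneg[of x] x r by (simp add: E_def)
  then have Ex: "E x < W r * E r / M" using x by linarith
  have "W r * E r <= W x * E x" using WE[of r x] x r by simp
  also have "W x * E x <= M * E x"
  proof (rule mult_right_mono)
   have "0 < W x * E x" using \<open>W r * E r <= W x * E x\<close> \<open>W r * E r > 0\<close> by linarith
   then show "0 <= E x" using W(1)[of x] x r by (simp add: zero_less_mult_iff)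
  qed (use W x r in auto)
  finally show False using Ex M by (simp add: field_simps)
 qed
 obtain r1 where r1: "r1 > R0" "!!r. r >= r1 ==> F r >= 1 + 4 * c0 * c1"
 proof -
  from F_lim have "\<forall>\<^sub>F r in at_top. 1 + 4 * c0 * c1 <= F r" by (simp add: filterlim_at_top)
  then obtain T where "!!r. r >= T ==> 1 + 4 * c0 * c1 <= F r" unfolding eventually_at_top_linorder by blast
  then show ?thesis using that[of "max T (R0 + 1)"] by auto
 qed
 have F2: "(F r)\<^sup>2 >= 4 * c0 * c1" if "r >= r1" for r
 proof -
  have "0 < 4 * c0 * c1" using c_pos by simp
  then have "1 * (1 + 4 * c0 * c1) <= F r * F r" using r1(2)[OF that] by (intro mult_mono) auto
  then show ?thesis by (simp add: power2_eq_square)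
 qed
 from neg r1(1) obtain r0 where r0: "r0 > r1" "A r0 \<noteq> 0" by blast
 then have r0R: "r0 > R0" "r0 > 0" using r1 R0 by auto
 have A0: "A r0 > 0" using nonneg(1)[OF r0R(1)] r0 by simp
 define Y where "Y m t = E t + (2*m/t) * C t + ((2*m\<^sup>2+m) - F t)/t\<^sup>2 * A t" for m t :: real
 define k where "k = \<bar>E r0 - F r0 / r0^2 * A r0\<bar>"
 \<comment> \<open>The first bound is the one asked by \<open>quadratic_form_nonneg\<close>; the
   third uses A(r0) > 0 to make the quadratic term 2 m^2 A(r0)/r0^2 outweigh everything else in Y at
   r0.\<close>
 obtain m :: nat where m: "real m >= (1 + sqrt c0)\<^sup>2" "real m >= 1" "real m >= (k + 1 + 2 * \<bar>C r0\<bar> / r0) * (r0^2 / (2 * A r0))"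
 proof -
  obtain m :: nat where "max ((1 + sqrt c0)^2) (max 1 ((k + 1 + 2 * \<bar>C r0\<bar> / r0) * (r0^2 / (2 * A r0)))) <= real m"
   using real_arch_simple by blast
  then show ?thesis using that by auto
 qed
 have Y0: "Y m r0 > 0"
 proof -
  have "(k + 1 + 2 * \<bar>C r0\<bar> / r0) <= m * (2 * A r0 / r0^2)"
   using m(3) A0 r0R by (simp add: field_simps)
  then have "k + 1 <= m * (2 * A r0 / r0^2) - 2 * \<bar>C r0\<bar> / r0" by simp
  also have "... <= m * (2 * A r0 / r0^2) + 2 * C r0 / r0 + A r0 / r0^2"
  proof -
   have "- (2 * \<bar>C r0\<bar> / r0) <= 2 * C r0 / r0" using r0R by (simp add: field_simps)
   moreover have "A r0 / r0^2 >= 0" using A0 by simp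
   ultimately show ?thesis by linarith
  qed
  finally have "m * (k + 1) <= m * (m * (2 * A r0 / r0^2) + 2 * C r0 / r0 + A r0 / r0^2)"
   by (intro mult_left_mono) auto
  moreover have "1 * (k + 1) <= m * (k + 1)" using m(2) by (intro mult_right_mono) (auto simp: k_def)
  moreover have "Y m r0 = m * (m * (2 * A r0 / r0^2) + 2 * C r0 / r0 + A r0 / r0^2) + (E r0 - F r0 / r0^2 * A r0)"
   by (simp add: Y_def diff_divide_distrib add_divide_distrib power2_eq_square algebra_simps)
  ultimately show ?thesis by (simp add: k_def)
 qed
 define Z where "Z t = t ^ (2*m+2) * Y m t" for t
 define G where "G t = ((2*(real m)\<^sup>2+m) - F t)/t\<^sup>2 * A t" for t
 define G' where "G' t = (- F' t/t\<^sup>2 - 2 * ((2*(real m)\<^sup>2+m) - F t)/t^3) * A t + ((2*(real m)\<^sup>2+m) - F t)/t\<^sup>2 * (2 * C t)" for t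
 have Cc: "continuous_on {x..y} C" if x: "R0 < x" for x y
 proof -
  obtain L where L: "!!s t. x <= s ==> s <= t ==> t <= y ==> \<bar>C t - C s\<bar> <= L * (t - s)" using C_lip[OF x] by metis
  have "\<bar>L\<bar>-lipschitz_on {x..y} C"
  proof (rule lipschitz_onI)
   fix s t assume st: "s : {x..y}" "t : {x..y}"
   have *: "\<bar>C q - C p\<bar> <= \<bar>L\<bar> * (q - p)" if "p : {x..y}" "q : {x..y}" "p <= q" for p q
   proof -
    have "L * (q - p) <= \<bar>L\<bar> * (q - p)" using that by (intro mult_right_mono) auto
    then show ?thesis using L[of p q] that by simp
   qed
   show "dist (C s) (C t) <= \<bar>L\<bar> * dist s t"
   proof (cases "s <= t")
    case True
    then show ?thesis using *[OF st True] by (simp add: dist_real_def abs_minus_commute)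
   next
    case False
    then show ?thesis using *[OF st(2,1)] by (simp add: dist_real_def)
   qed
  qed simp
  then show ?thesis by (rule lipschitz_on_continuous_on)
 qed
 have Gd: "(G has_real_derivative G' t) (at t)" if "t > R0" for t
 proof -
  have "t > 0" using that R0 by simp
  have "((%t. ((2*(real m)\<^sup>2+m) - F t)/t\<^sup>2) has_real_derivative
    ((0 - F' t) * t^2 - ((2*(real m)\<^sup>2+m) - F t) * (2 * t)) / (t^2 * t^2)) (at t)"
   using \<open>t > 0\<close> by (intro DERIV_divide DERIV_diff DERIV_const F_deriv that) (auto intro!: derivative_eq_intros)
  also have "((0 - F' t) * t^2 - ((2*(real m)\<^sup>2+m) - F t) * (2 * t)) / (t^2 * t^2)
    = - F' t/t\<^sup>2 - 2 * ((2*(real m)\<^sup>2+m) - F t)/t^3"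
   using \<open>t > 0\<close> by (simp add: field_simps power2_eq_square power3_eq_cube)
  finally have d: "((%t. ((2*(real m)\<^sup>2+m) - F t)/t\<^sup>2) has_real_derivative
    - F' t/t\<^sup>2 - 2 * ((2*(real m)\<^sup>2+m) - F t)/t^3) (at t)" .
  show ?thesis unfolding G_def G'_def
   by (rule DERIV_cong[OF DERIV_mult[OF d A_deriv[OF that]]]) simp
 qed
 have pd: "((%t. t ^ (2*m+2)) has_real_derivative real (2*m+2) * t ^ (2*m+1)) (at t)" for t
  by (rule DERIV_cong[OF DERIV_pow]) simp
 have Zmono: "Z r0 <= Z y" if y: "r0 <= y" for y
 proof (rule le_of_rd_ge_zero[where f=Z])
  obtain LG where LG: "!!s t. r0 <= s ==> s <= t ==> t <= y ==> \<bar>G t - G s\<bar> <= LG * (t - s)"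
  proof (rule C1_lipschitz[of r0 y G G'])
   show "continuous_on {r0..y} G'" unfolding G'_def using r0R
    by (intro continuous_intros Cc continuous_on_subset[OF F_C1] 
     continuous_at_imp_continuous_on[of _ F] continuous_at_imp_continuous_on[of _ A])
      (auto intro: DERIV_isCont[OF F_deriv] DERIV_isCont[OF A_deriv])
  qed (use Gd r0R in auto)
  obtain LC where LC: "!!s t. r0 <= s ==> s <= t ==> t <= y ==> \<bar>C t - C s\<bar> <= LC * (t - s)"
   using C_lip[OF r0R(1), of y] by metis
  obtain L1 where L1: "!!s t. r0 <= s ==> s <= t ==> t <= y ==> \<bar>2 * real m / t - 2 * real m / s\<bar> <= L1 * (t - s)"
  proof (rule C1_lipschitz[of r0 y "%t. 2 * real m / t" "%t. - (2 * real m) / t^2"])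
   show "((%t. 2 * real m / t) has_real_derivative - (2 * real m) / t^2) (at t)" if "r0 <= t" for t
    using that r0R by (auto intro!: derivative_eq_intros simp: power2_eq_square)
   show "continuous_on {r0..y} (%t. - (2 * real m) / t^2)" using r0R by (intro continuous_intros) auto
  qed blast
  obtain L2 where L2: "!!s t. r0 <= s ==> s <= t ==> t <= y ==> \<bar>t ^ (2*m+2) - s ^ (2*m+2)\<bar> <= L2 * (t - s)"
  proof (rule C1_lipschitz[of r0 y "%t. t ^ (2*m+2)" "%t. real (2*m+2) * t ^ (2*m+1)"])
  qed (intro pd, auto intro!: continuous_intros)
  have "lower_lip r0 y (%t. E t + (2*real m/t) * C t + G t)"
   unfolding E_def using r0R L1
   by (intro lower_lip_add E_ll lower_lip_lipschitz[OF LG] lower_lip_mult lower_lip_lipschitz[OF LC]) auto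
  then have "lower_lip r0 y (Y m)" by (simp add: Y_def[abs_def] G_def)
  then show "lower_lip r0 y Z" unfolding Z_def using r0R L2 by (intro lower_lip_mult) auto
  show "AE t in lborel. r0 < t --> t < y --> rd_ge Z t 0"
   using E_rd C_rd
  proof eventually_elim
   case (elim t)
   show ?case
   proof (intro impI)
    assume "r0 < t"
    then have t: "R0 < t" "t > 0" "t >= r1" using r0R r0 by auto
    let ?E' = "S t + 2 / t * B t - h t * K t + h t * b t * A t"
    let ?C' = "(2*real m/t) * (D t + B t - K t + R t) + - (2*real m)/t\<^sup>2 * C t"
    have m0: "m > 0" using m(2) by simp
    have "rd_ge (%t. E t + (2*real m/t) * C t + G t) t (?E' + ?C' + G' t)"
    proof (intro rd_ge_add)
     show "rd_ge E t ?E'" unfolding E_def using elim t by auto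
     show "rd_ge (%t. (2*real m/t) * C t) t ?C'"
      using elim t m0
      by (intro rd_ge_mult tendsto_right_quotient) (auto intro!: derivative_eq_intros simp: power2_eq_square)
    qed (use elim t Gd in \<open>auto intro: rd_ge_deriv\<close>)
    then have "rd_ge (Y m) t (?E' + ?C' + G' t)" by (simp add: Y_def[abs_def] G_def)
    then have "rd_ge Z t (t ^ (2*m+2) * (?E' + ?C' + G' t) + (real (2*m+2) * t ^ (2*m+1)) * Y m t)"
     unfolding Z_def using t by (intro rd_ge_mult tendsto_right_quotient pd) auto
    moreover have "t ^ (2*m+2) * (?E' + ?C' + G' t) + (real (2*m+2) * t ^ (2*m+1)) * Y m t
      = t ^ (2*m+2) * (?E' + ?C' + G' t + (2*m+2)/t * Y m t)"
    proof -
     have "t ^ (2*m+2) = t ^ (2*m+1) * t" by simp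
     then have "real (2*m+2) * t ^ (2*m+1) = t ^ (2*m+2) * ((2*m+2)/t)" using t by simp
     then show ?thesis by (simp only: distrib_left mult.assoc)
    qed
    moreover have "0 <= ?E' + ?C' + G' t + (2*m+2)/t * Y m t"
     unfolding G'_def Y_def E_def
     using weighted_derivative_identity[OF t(2), of "S t" "B t" "h t" "K t" "b t" "A t" "real m" "D t" "R t" "C t" "F' t" "F t"]
      quadratic_form_nonneg[OF t(2) nonneg(1,3)[OF t(1)] CS[OF t(1)] nonneg(4)[OF t(1)]
       h_bounds[OF t(1), THEN conjunct1] h_bounds[OF t(1), THEN conjunct2] a0[OF t(1)] a_b[OF t(1)]
       SR[OF t(1)] F_pos[OF t(1)] F_bound[OF t(1)] F'_bound[OF t(1)] F2[OF t(3)] c_pos m(1)]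
     by (simp add: add.commute)
    ultimately show "rd_ge Z t 0" using t by (auto elim!: rd_ge_mono)
   qed
  qed
 qed (use y in auto)
 from F_lim have "\<forall>\<^sub>F r in at_top. 2*(real m)\<^sup>2+m <= F r" by (simp add: filterlim_at_top)
 then obtain r2' where r2': "!!r. r >= r2' ==> 2*(real m)\<^sup>2+m <= F r" unfolding eventually_at_top_linorder by blast
 define r2 where "r2 = max r2' r0"
 \<comment> \<open>Beyond r2 the coefficient 2m^2 + m - F is nonpositive, and so is E; a positive Y
   can then only come from 2mC/r.\<close>
 have Cpos: "C r > 0" if r: "r >= r2" for r
 proof -
  have rr: "r >= r0" "r > R0" "r > 0" "2*(real m)\<^sup>2+m <= F r" using r r2' r0R by (auto simp: r2_def)
  have "Z r > 0" using Zmono[OF rr(1)] Y0 r0R by (smt (verit) Z_def mult_pos_pos zero_less_power)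
  then have "Y m r > 0" unfolding Z_def by (rule zero_less_mult_pos) (use rr in simp)
  moreover have "((2*(real m)\<^sup>2+m) - F r)/r\<^sup>2 * A r <= 0"
   using rr nonneg(1)[of r] by (intro mult_nonpos_nonneg divide_nonpos_nonneg) auto
  ultimately have "(2*m/r) * C r > 0" using E_le[of r] rr by (simp add: Y_def)
  then show ?thesis using rr m(2) by (simp add: zero_less_mult_iff zero_less_divide_iff)
 qed
 have Ainc: "A x < A y" if xy: "r2 <= x" "x < y" for x y
 proof (rule DERIV_pos_imp_increasing[OF xy(2)])
  fix z assume "x <= z" "z <= y"
  then show "EX d. (A has_real_derivative d) (at z) & 0 < d"
   using A_deriv[of z] Cpos[of z] xy r0R by (intro exI[of _ "2 * C z"]) (auto simp: r2_def)
 qed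
 have r2: "r2 > R0" using r0R by (auto simp: r2_def)
 have "A (r2 + 1) > 0" using Ainc[of r2 "r2 + 1"] nonneg(1)[OF r2] by simp
 then obtain x where x: "x > r2 + 1" "D x + K x + A x < A (r2 + 1)" using small by blast
 have "A (r2 + 1) < A x" using Ainc[of "r2 + 1" x] x by simp
 then show False using x nonneg[of x] r2 by auto
qed

subsection \<open>Polar coordinates and the divergence theorem on spheres\<close>

text \<open>The measure inside \<open>sphere_measure\<close> before completion. Its sets are Borel,
  so products, Tonelli and measurability in the radius are available here; integrals are carried
  over to the completion afterwards.\<close>

definition sphere0 :: "'a::euclidean_space measure"
 where "sphere0 = distr (scale_measure (of_nat DIM('a)) (restrict_space lborel (ball 0 1 - {0})))
    (restrict_space borel (sphere 0 1)) sgn"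

lemma sphere_measure_eq: "sphere_measure = completion sphere0"
 by (simp add: sphere_measure_def sphere0_def)

lemma space_sphere0 [simp]: "space (sphere0 :: 'a::euclidean_space measure) = sphere 0 1"
 and sets_sphere0 [measurable_cong, simp]: "sets (sphere0 :: 'a measure) = sets (restrict_space borel (sphere 0 1))"
 by (simp_all add: sphere0_def space_restrict_space)

lemma space_sphere_measure [simp]: "space (sphere_measure :: 'a::euclidean_space measure) = sphere 0 1"
 by (simp add: sphere_measure_eq)

lemma measurable_sgn_ball: "sgn : restrict_space lborel (ball 0 1 - {0}) \<rightarrow>\<^sub>M restrict_space (borel :: 'a::euclidean_space measure) (sphere 0 1)"
 by (intro measurable_restrict_space3) (auto simp: norm_sgn)

lemma borel_measurable_sgn [measurable]: "sgn : borel_measurable (borel :: 'a::euclidean_space measure)"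
proof -
 have "sgn = (%x::'a. inverse (norm x) *R x)" by (auto simp: sgn_div_norm)
 then show ?thesis by simp
qed

lemma borel_measurable_sphere0:
 "f : borel_measurable borel ==> f : borel_measurable sphere0"
 using measurable_restrict_space1 by (subst measurable_cong_sets[OF sets_sphere0 refl]) blast

lemma nn_integral_sphere0:
 assumes [measurable]: "f : borel_measurable borel"
 shows "(\<integral>\<^sup>+om. f om \<partial>sphere0) = of_nat DIM('a) * (\<integral>\<^sup>+x. f (sgn x) * indicator (ball 0 1 - {0}) x \<partial>(lborel :: 'a::euclidean_space measure))"
proof -
 have s: "sgn : scale_measure (of_nat DIM('a)) (restrict_space lborel (ball 0 1 - {0})) \<rightarrow>\<^sub>M restrict_space (borel :: 'a measure) (sphere 0 1)"
  using measurable_sgn_ball by (subst measurable_cong_sets[OF sets_scale_measure refl])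
 have f: "f : borel_measurable (restrict_space borel (sphere 0 1))" by (rule measurable_restrict_space1) measurable
 show ?thesis unfolding sphere0_def
  using measurable_compose[OF measurable_sgn_ball f]
  by (subst nn_integral_distr[OF s]) (use f in \<open>simp_all add: nn_integral_scale_measure nn_integral_restrict_space\<close>)
qed

lemma finite_measure_sphere0: "finite_measure (sphere0 :: 'a::euclidean_space measure)"
proof
 have "emeasure (sphere0 :: 'a measure) (space sphere0) = (\<integral>\<^sup>+om. 1 \<partial>(sphere0 :: 'a measure))" by simp
 also have "... < top"
 proof (subst nn_integral_sphere0)
  have "emeasure lborel (ball (0::'a) 1 - {0}) < \<infinity>"
   by (intro le_less_trans[OF emeasure_mono emeasure_bounded_finite[of "ball (0::'a) 1"]]) auto
  then show "of_nat DIM('a) * (\<integral>\<^sup>+x. 1 * indicator (ball 0 1 - {0}) x \<partial>(lborel :: 'a measure)) < top"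
   by (simp add: ennreal_mult_less_top ennreal_of_nat_eq_real_of_nat)
 qed simp
 finally show "emeasure (sphere0 :: 'a measure) (space sphere0) \<noteq> \<infinity>" by simp
qed

lemma nn_integral_lborel_scale:
 fixes f :: "'a::euclidean_space => ennreal"
 assumes [measurable]: "f : borel_measurable borel" and c: "c > 0"
 shows "(\<integral>\<^sup>+x. f x \<partial>lborel) = ennreal (c ^ DIM('a)) * (\<integral>\<^sup>+x. f (c *R x) \<partial>lborel)"
 using c by (subst lborel_affine[of c 0]) (simp_all add: nn_integral_density nn_integral_distr nn_integral_cmult)

text \<open>After the substitutions in \<open>polar_nn_integral\<close> this tail integral is what
  cancels the factor N |y|^N.\<close>

lemma nn_integral_power_tail:
 assumes "N > 0" "\<rho> > 0"
 shows "(\<integral>\<^sup>+s. ennreal (1 / s ^ (N + 1)) * indicator {\<rho>..} s \<partial>lborel) = ennreal (1 / (real N * \<rho> ^ N))"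
proof -
 have "(\<integral>\<^sup>+s. ennreal (1 / s ^ (N + 1)) * indicator {\<rho>..} s \<partial>lborel) = ennreal (0 - (- 1 / (real N * \<rho> ^ N)))"
 proof (rule nn_integral_FTC_atLeast)
  fix s assume s: "\<rho> <= s"
  then have "s > 0" using assms by simp
  then show "((%s. - 1 / (real N * s ^ N)) has_real_derivative 1 / s ^ (N + 1)) (at s)"
   using assms by (auto intro!: derivative_eq_intros simp: field_simps power_Suc[symmetric] power_add[symmetric] simp del: power_Suc)
  show "0 <= 1 / s ^ (N + 1)" using \<open>s > 0\<close> by simp
 next
  show "((%s. - 1 / (real N * s ^ N)) ---> 0) at_top"
   using assms by (intro tendsto_divide_0[OF tendsto_const] filterlim_at_top_imp_at_infinity
    filterlim_tendsto_pos_mult_at_top[OF tendsto_const] filterlim_pow_at_top filterlim_ident) auto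
 qed auto
 then show ?thesis by simp
qed

definition radial_measure :: "nat => real measure"
 where "radial_measure N = density lborel (%r. ennreal (r ^ (N - 1)) * indicator {0<..} r)"

text \<open>Surface measure is defined by cones, so the right side is a double integral of N r^(N-1)
  f(r x/|x|) over r > 0 and x in the punctured unit ball. Substituting r = |x| s, exchanging the
  integrals and then substituting y = s x leaves f(y) times N |y|^N times the integral of s^(-N-1)
  over s > |y|, and the last two factors multiply to 1.\<close>

lemma polar_nn_integral:
 fixes f :: "'a::euclidean_space => ennreal"
 assumes [measurable]: "f : borel_measurable borel"
 shows "(\<integral>\<^sup>+x. f x \<partial>lborel) = (\<integral>\<^sup>+r. (\<integral>\<^sup>+om. f (r *R om) \<partial>sphere0) \<partial>radial_measure DIM('a))"
proof -
 let ?N = "DIM('a)"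
 define B z where "B = (indicator (ball (0::'a) 1 - {0}) :: 'a => ennreal)" and "z = (indicator (- {0::'a}) :: 'a => ennreal)"
 have [measurable]: "B : borel_measurable borel" "z : borel_measurable borel" unfolding B_def z_def by (intro borel_measurable_indicator; simp)+
 have N: "?N > 0" by simp
 then obtain n where Nn: "DIM('a) = Suc n" using gr0_conv_Suc by blast
 have "(\<integral>\<^sup>+r. (\<integral>\<^sup>+om. f (r *R om) \<partial>sphere0) \<partial>radial_measure ?N)
   = (\<integral>\<^sup>+r. ennreal (r ^ (?N - 1)) * indicator {0<..} r * (of_nat ?N * (\<integral>\<^sup>+x. f (r *R sgn x) * B x \<partial>lborel)) \<partial>lborel)"
  unfolding radial_measure_def by (subst nn_integral_density) (auto simp: nn_integral_sphere0 B_def[symmetric])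
 also have "... = (\<integral>\<^sup>+r. (\<integral>\<^sup>+x. ennreal (r ^ (?N - 1)) * indicator {0<..} r * of_nat ?N * (f (r *R sgn x) * B x) \<partial>lborel) \<partial>lborel)"
  by (subst nn_integral_cmult[symmetric]) (auto simp: nn_integral_cmult mult.assoc)
 also have "... = (\<integral>\<^sup>+x. (\<integral>\<^sup>+r. ennreal (r ^ (?N - 1)) * indicator {0<..} r * of_nat ?N * (f (r *R sgn x) * B x) \<partial>lborel) \<partial>lborel)"
  by (rule lborel_pair.Fubini') measurable
 \<comment> \<open>Substitution r = |x| s: now f is evaluated at s x and the normalisation of x has
   disappeared.\<close>
 also have "... = (\<integral>\<^sup>+x. (\<integral>\<^sup>+s. ennreal (s ^ (?N - 1)) * indicator {0<..} s * of_nat ?N * (ennreal (norm x ^ ?N) * f (s *R x) * B x) \<partial>lborel) \<partial>lborel)"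
 proof (rule nn_integral_cong)
  fix x :: 'a
  show "(\<integral>\<^sup>+r. ennreal (r ^ (?N - 1)) * indicator {0<..} r * of_nat ?N * (f (r *R sgn x) * B x) \<partial>lborel)
   = (\<integral>\<^sup>+s. ennreal (s ^ (?N - 1)) * indicator {0<..} s * of_nat ?N * (ennreal (norm x ^ ?N) * f (s *R x) * B x) \<partial>lborel)"
  proof (cases "x = 0")
   case False
   then have nx: "norm x > 0" by simp
   have "(\<integral>\<^sup>+r. ennreal (r ^ (?N - 1)) * indicator {0<..} r * of_nat ?N * (f (r *R sgn x) * B x) \<partial>lborel)
    = ennreal (norm x) * (\<integral>\<^sup>+s. ennreal ((norm x * s) ^ (?N - 1)) * indicator {0<..} (norm x * s) * of_nat ?N * (f ((norm x * s) *R sgn x) * B x) \<partial>lborel)"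
    using nx by (subst nn_integral_real_affine[where c="norm x" and t=0]) auto
   also have "... = (\<integral>\<^sup>+s. ennreal (norm x) * (ennreal ((norm x * s) ^ (?N - 1)) * indicator {0<..} (norm x * s) * of_nat ?N * (f ((norm x * s) *R sgn x) * B x)) \<partial>lborel)"
    by (subst nn_integral_cmult) auto
   also have "... = (\<integral>\<^sup>+s. ennreal (s ^ (?N - 1)) * indicator {0<..} s * of_nat ?N * (ennreal (norm x ^ ?N) * f (s *R x) * B x) \<partial>lborel)"
   proof (rule nn_integral_cong)
    fix s :: real
    have "(norm x * s) *R sgn x = s *R x" using nx by (simp add: sgn_div_norm)
    moreover have "indicator {0<..} (norm x * s) = (indicator {0<..} s :: ennreal)"
     using nx by (auto simp: indicator_def zero_less_mult_iff)
    moreover have "ennreal (norm x) * ennreal ((norm x * s) ^ (?N - 1)) = ennreal (s ^ (?N - 1)) * ennreal (norm x ^ ?N)" if "s > 0"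
    proof -
     have "norm x ^ ?N = norm x * norm x ^ (?N - 1)" by (simp add: Nn)
     then show ?thesis using that by (simp add: ennreal_mult[symmetric] power_mult_distrib mult_ac)
    qed
    ultimately have e: "(norm x * s) *R sgn x = s *R x" "indicator {0<..} (norm x * s) = (indicator {0<..} s :: ennreal)"
     "s > 0 ==> ennreal (norm x) * ennreal ((norm x * s) ^ (?N - 1)) = ennreal (s ^ (?N - 1)) * ennreal (norm x ^ ?N)"
     by blast+
    show "ennreal (norm x) * (ennreal ((norm x * s) ^ (?N - 1)) * indicator {0<..} (norm x * s) * of_nat ?N * (f ((norm x * s) *R sgn x) * B x))
     = ennreal (s ^ (?N - 1)) * indicator {0<..} s * of_nat ?N * (ennreal (norm x ^ ?N) * f (s *R x) * B x)"
    proof (cases "s > 0")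
     case True
     have "ennreal (norm x) * ennreal ((norm x * s) ^ (?N - 1)) * (indicator {0<..} s * of_nat ?N * (f (s *R x) * B x))
      = ennreal (s ^ (?N - 1)) * ennreal (norm x ^ ?N) * (indicator {0<..} s * of_nat ?N * (f (s *R x) * B x))"
      unfolding e(3)[OF True] ..
     then show ?thesis unfolding e(1,2) by (simp only: mult_ac)
    qed (simp add: e(2))
   qed
   finally show ?thesis .
  qed (simp add: B_def z_def)
 qed
 also have "... = (\<integral>\<^sup>+s. (\<integral>\<^sup>+x. ennreal (s ^ (?N - 1)) * indicator {0<..} s * of_nat ?N * (ennreal (norm x ^ ?N) * f (s *R x) * B x) \<partial>lborel) \<partial>lborel)"
  by (rule lborel_pair.Fubini') measurable
 \<comment> \<open>Substitution y = s x; the condition |x| < 1 of the ball becomes |y| < s.\<close>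
 also have "... = (\<integral>\<^sup>+s. (\<integral>\<^sup>+y. of_nat ?N * ennreal (1 / s ^ (?N + 1)) * indicator {0<..} s * ennreal (norm y ^ ?N) * f y * (if norm y < s then 1 else 0) * z y \<partial>lborel) \<partial>lborel)"
 proof (rule nn_integral_cong)
  fix s :: real
  show "(\<integral>\<^sup>+x. ennreal (s ^ (?N - 1)) * indicator {0<..} s * of_nat ?N * (ennreal (norm x ^ ?N) * f (s *R x) * B x) \<partial>lborel)
   = (\<integral>\<^sup>+y. of_nat ?N * ennreal (1 / s ^ (?N + 1)) * indicator {0<..} s * ennreal (norm y ^ ?N) * f y * (if norm y < s then 1 else 0) * z y \<partial>lborel)"
  proof (cases "s > 0")
   case True
   have "(\<integral>\<^sup>+y. of_nat ?N * ennreal (1 / s ^ (?N + 1)) * indicator {0<..} s * ennreal (norm y ^ ?N) * f y * (if norm y < s then 1 else 0) * z y \<partial>lborel)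
    = ennreal (s ^ ?N) * (\<integral>\<^sup>+x. of_nat ?N * ennreal (1 / s ^ (?N + 1)) * indicator {0<..} s * ennreal (norm (s *R x) ^ ?N) * f (s *R x) * (if norm (s *R x) < s then 1 else 0) * z (s *R x) \<partial>lborel)"
    using True by (subst nn_integral_lborel_scale[of _ s]) auto
   also have "... = (\<integral>\<^sup>+x. ennreal (s ^ ?N) * (of_nat ?N * ennreal (1 / s ^ (?N + 1)) * indicator {0<..} s * ennreal (norm (s *R x) ^ ?N) * f (s *R x) * (if norm (s *R x) < s then 1 else 0) * z (s *R x)) \<partial>lborel)"
    by (subst nn_integral_cmult) auto
   also have "... = (\<integral>\<^sup>+x. ennreal (s ^ (?N - 1)) * indicator {0<..} s * of_nat ?N * (ennreal (norm x ^ ?N) * f (s *R x) * B x) \<partial>lborel)"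
   proof (rule nn_integral_cong)
    fix x :: 'a
    have i: "(if norm (s *R x) < s then 1 else 0) * z (s *R x) = B x"
     using True by (auto simp: indicator_def B_def z_def)
    have "s ^ ?N = s * s ^ (?N - 1)" by (simp add: Nn)
    then have "s ^ ?N * (1 / s ^ (?N + 1)) * norm (s *R x) ^ ?N = s ^ (?N - 1) * norm x ^ ?N"
     using True by (simp add: power_mult_distrib)
    then have "ennreal (s ^ ?N) * (ennreal (1 / s ^ (?N + 1)) * ennreal (norm (s *R x) ^ ?N)) = ennreal (s ^ (?N - 1)) * ennreal (norm x ^ ?N)"
     using True by (simp add: ennreal_mult[symmetric] mult.assoc)
    then have "ennreal (s ^ ?N) * (ennreal (1 / s ^ (?N + 1)) * ennreal (norm (s *R x) ^ ?N)) * (of_nat ?N * indicator {0<..} s * f (s *R x) * ((if norm (s *R x) < s then 1 else 0) * z (s *R x)))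
     = ennreal (s ^ (?N - 1)) * ennreal (norm x ^ ?N) * (of_nat ?N * indicator {0<..} s * f (s *R x) * B x)"
     unfolding i by simp
    then show "ennreal (s ^ ?N) * (of_nat ?N * ennreal (1 / s ^ (?N + 1)) * indicator {0<..} s * ennreal (norm (s *R x) ^ ?N) * f (s *R x) * (if norm (s *R x) < s then 1 else 0) * z (s *R x))
     = ennreal (s ^ (?N - 1)) * indicator {0<..} s * of_nat ?N * (ennreal (norm x ^ ?N) * f (s *R x) * B x)"
     by (simp only: mult_ac)
     
   qed
   finally show ?thesis by simp
  qed simp
 qed
 also have "... = (\<integral>\<^sup>+y. (\<integral>\<^sup>+s. of_nat ?N * ennreal (1 / s ^ (?N + 1)) * indicator {0<..} s * ennreal (norm y ^ ?N) * f y * (if norm y < s then 1 else 0) * z y \<partial>lborel) \<partial>lborel)"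
  by (rule lborel_pair.Fubini'[symmetric]) measurable
 also have "... = (\<integral>\<^sup>+y. f y * z y \<partial>lborel)"
 proof (rule nn_integral_cong)
  fix y :: 'a
  show "(\<integral>\<^sup>+s. of_nat ?N * ennreal (1 / s ^ (?N + 1)) * indicator {0<..} s * ennreal (norm y ^ ?N) * f y * (if norm y < s then 1 else 0) * z y \<partial>lborel) = f y * z y"
  proof (cases "y = 0")
   case False
   then have ny: "norm y > 0" by simp
   have "(\<integral>\<^sup>+s. of_nat ?N * ennreal (1 / s ^ (?N + 1)) * indicator {0<..} s * ennreal (norm y ^ ?N) * f y * (if norm y < s then 1 else 0) * z y \<partial>lborel)
    = (\<integral>\<^sup>+s. (of_nat ?N * ennreal (norm y ^ ?N) * f y) * (ennreal (1 / s ^ (?N + 1)) * indicator {norm y..} s) \<partial>lborel)"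
   \<comment> \<open>The open ball gives s > |y| while the tail integral runs over s >= |y|; the two
     differ in a single point.\<close>
   proof (intro nn_integral_cong_AE eventually_mono[OF AE_lborel_singleton[of "norm y"]])
    fix s :: real assume "s \<noteq> norm y"
    then show "of_nat ?N * ennreal (1 / s ^ (?N + 1)) * indicator {0<..} s * ennreal (norm y ^ ?N) * f y * (if norm y < s then 1 else 0) * z y
     = (of_nat ?N * ennreal (norm y ^ ?N) * f y) * (ennreal (1 / s ^ (?N + 1)) * indicator {norm y..} s)"
     using False less_trans[OF ny, of s] by (cases "norm y < s") (auto simp: indicator_def z_def mult_ac)
   qed
   also have "... = (of_nat ?N * ennreal (norm y ^ ?N) * f y) * ennreal (1 / (real ?N * norm y ^ ?N))"
    using nn_integral_power_tail[OF N ny] by (subst nn_integral_cmult) auto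
   also have "of_nat ?N * ennreal (norm y ^ ?N) = ennreal (real ?N * norm y ^ ?N)"
    using ny by (simp add: ennreal_mult ennreal_of_nat_eq_real_of_nat)
   also have "ennreal (real ?N * norm y ^ ?N) * f y * ennreal (1 / (real ?N * norm y ^ ?N))
     = f y * (ennreal (real ?N * norm y ^ ?N) * ennreal (1 / (real ?N * norm y ^ ?N)))" by (simp only: mult_ac)
   also have "ennreal (real ?N * norm y ^ ?N) * ennreal (1 / (real ?N * norm y ^ ?N))
     = ennreal (real ?N * norm y ^ ?N * (1 / (real ?N * norm y ^ ?N)))" using ny by (intro ennreal_mult[symmetric]) auto
   also have "real ?N * norm y ^ ?N * (1 / (real ?N * norm y ^ ?N)) = 1" using ny by simp
   finally show ?thesis using False by (simp add: B_def z_def)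
  qed (simp add: B_def z_def)
 qed
 also have "... = (\<integral>\<^sup>+y. f y \<partial>lborel)"
  using AE_lborel_singleton[of "0::'a"] by (intro nn_integral_cong_AE) (auto elim!: eventually_mono simp: B_def z_def)
 finally show ?thesis by simp
qed

interpretation sphere0: finite_measure "sphere0 :: 'a::euclidean_space measure" by (rule finite_measure_sphere0)

lemma sets_radial_measure [measurable_cong, simp]: "sets (radial_measure N) = sets borel"
 and space_radial_measure [simp]: "space (radial_measure N) = UNIV"
 by (simp_all add: radial_measure_def)

interpretation radial: sigma_finite_measure "radial_measure N"
 unfolding radial_measure_def
 by (subst sigma_finite_measure.sigma_finite_iff_density_finite[OF sigma_finite_lborel]) (auto simp: ennreal_mult_eq_top_iff indicator_def)

interpretation polar: pair_sigma_finite "radial_measure N" "sphere0 :: 'a::euclidean_space measure" ..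

lemma AE_radial_pos: "AE r in radial_measure N. r > 0"
 unfolding radial_measure_def by (subst AE_density) (auto intro!: AE_I2 simp: indicator_def)

lemma measurable_scale_sphere [measurable]:
 "(%(r, om). r *R om) : radial_measure N \<Otimes>\<^sub>M (sphere0 :: 'a::euclidean_space measure) \<rightarrow>\<^sub>M borel"
proof -
 have "(%om. om) : sphere0 \<rightarrow>\<^sub>M (borel :: 'a measure)" by (rule borel_measurable_sphere0) simp
 then have [measurable]: "(%x. snd x) : radial_measure N \<Otimes>\<^sub>M sphere0 \<rightarrow>\<^sub>M (borel :: 'a measure)"
  using measurable_compose[OF measurable_snd] by blast
 have [measurable]: "(%x. fst x) : radial_measure N \<Otimes>\<^sub>M (sphere0 :: 'a measure) \<rightarrow>\<^sub>M borel" by measurable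
 show ?thesis unfolding split_beta by measurable
qed

lemma lborel_polar:
 "(lborel :: 'a::euclidean_space measure) = distr (radial_measure DIM('a) \<Otimes>\<^sub>M sphere0) borel (%(r, om). r *R om)"
proof (rule measure_eqI)
 fix A :: "'a set" assume "A : sets lborel"
 then have [measurable]: "A : sets borel" by simp
 have "emeasure lborel A = (\<integral>\<^sup>+x. indicator A x \<partial>lborel)" by simp
 also have "... = (\<integral>\<^sup>+r. (\<integral>\<^sup>+om. indicator A (r *R om) \<partial>sphere0) \<partial>radial_measure DIM('a))"
  by (rule polar_nn_integral) measurable
 also have "... = (\<integral>\<^sup>+p. indicator A (case p of (r, om) => r *R om) \<partial>(radial_measure DIM('a) \<Otimes>\<^sub>M sphere0))"
  by (subst sphere0.nn_integral_fst[symmetric]) (auto simp: split_beta)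
 also have "... = (\<integral>\<^sup>+x. indicator A x \<partial>distr (radial_measure DIM('a) \<Otimes>\<^sub>M sphere0) borel (%(r, om). r *R om))"
  by (subst nn_integral_distr) auto
 also have "... = emeasure (distr (radial_measure DIM('a) \<Otimes>\<^sub>M sphere0) borel (%(r, om). r *R om)) A" by simp
 finally show "emeasure lborel A = emeasure (distr (radial_measure DIM('a) \<Otimes>\<^sub>M sphere0) borel (%(r, om). r *R om)) A" .
qed simp

text \<open>Fubini for null sets. It lets a coefficient be replaced by a Borel version on almost
  every sphere.\<close>

lemma AE_polar:
 assumes "AE x in (lborel :: 'a::euclidean_space measure). P x"
 shows "AE r in lborel. r > 0 --> (AE om in (sphere0 :: 'a measure). P (r *R om))"
proof -
 have "AE p in radial_measure DIM('a) \<Otimes>\<^sub>M (sphere0 :: 'a measure). P (case p of (r, om) => r *R om)"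
 proof (rule AE_distrD[where M'=borel and P=P and f="%(r, om). r *R om"])
  show "AE x in distr (radial_measure DIM('a) \<Otimes>\<^sub>M sphere0) borel (%(r, om). r *R om :: 'a). P x"
   using assms by (simp only: lborel_polar[symmetric])
 qed measurable
 from polar.AE_pair[OF this]
 have "AE r in radial_measure DIM('a). AE om in sphere0. P (r *R om)" by simp
 then have "AE r in lborel. 0 < ennreal (r ^ (DIM('a) - 1)) * indicator {0<..} r --> (AE om in sphere0. P (r *R om))"
  unfolding radial_measure_def by (subst (asm) AE_density) auto
 then show ?thesis by eventually_elim (auto simp: indicator_def)
qed

text \<open>Serves for a radial cutoff times a function of the direction, the integrands that occur
  in the divergence theorem below.\<close>

lemma polar_integral_product:
 fixes f :: "'a::euclidean_space => real" and g :: "real => real"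
 assumes [measurable]: "f : borel_measurable borel" "g : borel_measurable borel"
  and f: "integrable sphere0 f" and g: "integrable lborel (%r. indicator {0<..} r * r ^ (DIM('a) - 1) * g r)"
 shows "integrable lborel (%x::'a. g (norm x) * f (sgn x))"
  and "(LINT x|(lborel::'a measure). g (norm x) * f (sgn x)) =
   (LINT r|lborel. indicator {0<..} r * r ^ (DIM('a) - 1) * g r) * (LINT om|sphere0. f om)"
proof -
 let ?R = "radial_measure DIM('a)" and ?S = "sphere0 :: 'a measure"
 let ?c = "%r::real. indicator {0<..} r * r ^ (DIM('a) - 1)"
 have R: "?R = density lborel (%r. ennreal (?c r))"
  unfolding radial_measure_def by (intro arg_cong[where f="density lborel"]) (auto simp: indicator_def)
 have gR: "integrable ?R g" unfolding R using g by (subst integrable_density) (auto simp: indicator_def mult.assoc)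
 have gI: "(LINT r|?R. g r) = (LINT r|lborel. ?c r * g r)"
  unfolding R by (subst integral_density) (auto simp: indicator_def)
 have fm[measurable]: "f : borel_measurable ?S" using f by simp
 have ip: "integrable (?R \<Otimes>\<^sub>M ?S) (%(r, om). g r * f om)"
 proof (rule polar.Fubini_integrable)
  show "integrable ?R (%r. LINT om|?S. norm (case (r, om) of (r, om) => g r * f om))"
   using gR by (simp add: abs_mult)
  show "AE r in ?R. integrable ?S (%om. case (r, om) of (r, om) => g r * f om)" using f by simp
 qed measurable
 have ae: "AE p in ?R \<Otimes>\<^sub>M ?S. (case p of (r, om) => g r * f om) = g (norm (fst p *R snd p)) * f (sgn (fst p *R snd p))"
 proof (rule polar.AE_pair_measure)
  show "{p : space (?R \<Otimes>\<^sub>M ?S). (case p of (r, om) => g r * f om) = g (norm (fst p *R snd p)) * f (sgn (fst p *R snd p))} : sets (?R \<Otimes>\<^sub>M ?S)"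
   using measurable_scale_sphere[of "DIM('a)", where 'a='a] unfolding split_beta by measurable
  show "AE r in ?R. AE om in ?S. (case (r, om) of (r, om) => g r * f om) = g (norm (fst (r, om) *R snd (r, om))) * f (sgn (fst (r, om) *R snd (r, om)))"
   using AE_radial_pos
  proof eventually_elim
   case (elim r)
   show ?case by (rule AE_I2) (use elim in \<open>auto simp: sgn_div_norm\<close>)
  qed
 qed
 let ?h = "%x::'a. g (norm x) * f (sgn x)"
 have mh: "(%p. ?h (fst p *R snd p)) : borel_measurable (?R \<Otimes>\<^sub>M ?S)"
  using measurable_scale_sphere[of "DIM('a)", where 'a='a] unfolding split_beta by measurable
 have i2: "integrable (?R \<Otimes>\<^sub>M ?S) (%p. ?h (fst p *R snd p))"
  by (rule integrable_cong_AE_imp[OF ip mh]) (rule eventually_mono[OF ae], simp)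
 show "integrable lborel ?h"
  by (subst lborel_polar, subst integrable_distr_eq) (use i2 in \<open>auto simp: split_beta\<close>)
 have "(LINT x|lborel. ?h x) = (LINT p|(?R \<Otimes>\<^sub>M ?S). ?h (fst p *R snd p))"
  by (subst lborel_polar, subst integral_distr) (auto simp: split_beta)
 also have "... = (LINT p|(?R \<Otimes>\<^sub>M ?S). (case p of (r, om) => g r * f om))"
  by (rule integral_cong_AE[OF mh]) (use ip in simp, rule eventually_mono[OF ae], simp)
 also have "... = (LINT r|?R. LINT om|?S. g r * f om)"
  using polar.integral_fst'[OF ip] by simp
 also have "... = (LINT r|?R. g r) * (LINT om|?S. f om)" by simp
 finally show "(LINT x|lborel. ?h x) = (LINT r|lborel. ?c r * g r) * (LINT om|?S. f om)" by (simp add: gI)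
qed

section \<open>Integration by parts and differentiation under the sphere integral\<close>

lemma integrable_bounded_support:
 fixes f :: "'a::euclidean_space => 'b::{banach,second_countable_topology}"
 assumes "continuous_on UNIV f" "!!x. norm x > R ==> f x = 0"
 shows "integrable lborel f"
proof -
 have "integrable lborel (%x. indicator (cball 0 R) x *R f x)"
  using borel_integrable_compact[of "cball 0 R" f] continuous_on_subset[OF assms(1)] by auto
 moreover have "(%x. indicator (cball 0 R) x *R f x) = f"
  using assms by (intro ext) (auto simp: indicator_def not_le)
 ultimately show ?thesis by simp
qed

text \<open>Translation invariance makes the integral of each difference quotient in the direction b
  vanish. The mean value theorem dominates the quotients on a fixed ball, and they converge to the
  derivative.\<close>

lemma integral_partial_derivative_zero:
 fixes f :: "'a::euclidean_space => real"
 assumes d: "!!x. (f has_derivative f' x) (at x)" and c: "continuous_on UNIV (%x. f' x b)"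
  and s: "!!x. norm x > R ==> f x = 0"
 shows "(LINT x|lborel. f' x b) = 0"
proof -
 have fc: "continuous_on UNIV f" using d by (meson continuous_at_imp_continuous_on has_derivative_continuous)
 have fi: "integrable lborel f" using integrable_bounded_support[OF fc s] .
 have fti: "integrable lborel (%x. f (x + t *R b))" for t
  using integrable_distr_eq[of "%x. x + t *R b" lborel borel f] fi lborel_distr_plus[of "t *R b"]
   borel_measurable_continuous_onI[OF fc] by (simp add: add.commute[of _ "t *R b"])
 have ftI: "(LINT x|lborel. f (x + t *R b)) = (LINT x|lborel. f x)" for t
  using integral_distr[of "%x. x + t *R b" lborel borel f] lborel_distr_plus[of "t *R b"]
   borel_measurable_continuous_onI[OF fc] by (simp add: add.commute[of _ "t *R b"])
 define q where "q n x = real (Suc n) * (f (x + (1 / real (Suc n)) *R b) - f x)" for n x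
 have q0: "(LINT x|lborel. q n x) = 0" for n unfolding q_def using fti fi ftI by simp
 \<comment> \<open>Outside the ball of radius R' both x and its translates by at most b lie beyond
   the support radius R.\<close>
 define R' where "R' = \<bar>R\<bar> + norm b"
 obtain M where M: "!!x. x : cball 0 (R' + norm b) ==> \<bar>f' x b\<bar> <= M"
 proof -
  have "bounded ((%x. f' x b) ` cball 0 (R' + norm b))"
   using c by (intro compact_imp_bounded compact_continuous_image) (auto intro: continuous_on_subset)
  then obtain M where "ALL y:(%x. f' x b) ` cball 0 (R' + norm b). norm y <= M" unfolding bounded_iff by blast
  then show ?thesis using that[of M] by simp
 qed
 have dl: "((%t. f (x + t *R b)) has_real_derivative f' (x + t *R b) b) (at t)" for x t
 proof -
  have "((%t. f (x + t *R b)) has_derivative (%h. f' (x + t *R b) (h *R b))) (at t)"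
   by (rule has_derivative_compose[of "%t. x + t *R b" "%h. h *R b", OF _ d]) (auto intro!: derivative_eq_intros)
  moreover have "f' (x + t *R b) (h *R b) = f' (x + t *R b) b * h" for h
   using linear_scale[OF has_derivative_linear[OF d]] by (simp add: mult.commute)
  ultimately show ?thesis by (simp add: has_field_derivative_def)
 qed
 have qlim: "(%n. q n x) ----> f' x b" for x
 proof -
  have "((%h. (f (x + h *R b) - f x) / h) ---> f' x b) (at 0)"
   using dl[of x 0] by (simp add: DERIV_def)
  moreover have "filterlim (%n. 1 / real (Suc n)) (at 0) sequentially"
   unfolding filterlim_at using LIMSEQ_inverse_real_of_nat by (auto simp: inverse_eq_divide)
  ultimately have "(%n. (f (x + (1 / real (Suc n)) *R b) - f x) / (1 / real (Suc n))) ----> f' x b"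
   by (rule filterlim_compose)
  then show ?thesis unfolding q_def by (simp add: mult.commute del: of_nat_Suc)
 qed
 have qb: "norm (q n x) <= M * indicator (cball 0 R') x" for n x
 proof (cases "x : cball 0 R'")
  case True
  let ?s = "1 / real (Suc n)"
  have "EX z>0. z < ?s & f (x + ?s *R b) - f (x + 0 *R b) = (?s - 0) * f' (x + z *R b) b"
   by (rule MVT2) (use dl in auto)
  then obtain z where z: "0 < z" "z < ?s" "f (x + ?s *R b) - f x = ?s * f' (x + z *R b) b" by auto
  have "z < 1" using z(2) by (rule less_le_trans) (simp add: field_simps)
  then have "norm (x + z *R b) <= R' + norm b" 
   using True z norm_triangle_ineq[of x "z *R b"] mult_right_mono[of z 1 "norm b"] by simp
  then have "\<bar>f' (x + z *R b) b\<bar> <= M" using M by simp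
  then show ?thesis unfolding q_def z(3) using True by simp
 next
  case False
  have "norm ((1 / real (Suc n)) *R b) <= norm b" using mult_right_mono[of "1 / real (Suc n)" 1 "norm b"] by simp
  then have "norm (x + (1 / real (Suc n)) *R b) > R" "norm x > R"
   using False norm_diff_ineq[of x "(1 / real (Suc n)) *R b"] norm_ge_zero[of b] unfolding R'_def mem_cball_0 by linarith+
  then show ?thesis using s False by (simp add: q_def)
 qed
 have [measurable]: "(%x. f' x b) : borel_measurable borel" "q n : borel_measurable borel" for n
  using c fc by (auto intro!: borel_measurable_continuous_onI continuous_intros continuous_on_compose2[OF fc] simp: q_def[abs_def])
 have "(%n. LINT x|lborel. q n x) ----> (LINT x|lborel. f' x b)"
 proof (rule integral_dominated_convergence[where w="%x. M * indicator (cball 0 R') x"])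
  show "integrable lborel (%x::'a. M * indicator (cball 0 R') x)"
   using emeasure_bounded_finite[of "cball (0::'a) R'"] by (intro integrable_mult_right integrable_real_indicator) auto
 qed (use qlim qb in auto)
 then show ?thesis using q0 LIMSEQ_unique[OF _ tendsto_const] by simp
qed

lemma integrable_sphere0_continuous:
 fixes f :: "'a::euclidean_space => 'b::{banach,second_countable_topology}"
 assumes "continuous_on (sphere 0 1) f"
 shows "integrable sphere0 f"
proof -
 have "f : borel_measurable (restrict_space borel (sphere 0 1))"
  by (rule borel_measurable_continuous_on_restrict[OF assms])
 then have m: "f : borel_measurable sphere0" by (subst measurable_cong_sets[OF sets_sphere0 refl])
 have "bounded (f ` sphere 0 1)" using assms by (intro compact_imp_bounded compact_continuous_image) auto
 then obtain M where "ALL y:f ` sphere 0 1. norm y <= M" unfolding bounded_iff by blast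
 then show ?thesis using m by (intro sphere0.integrable_const_bound[where B=M] AE_I2) auto
qed

text \<open>By the mean value theorem each quotient is a value of the derivative at a nearby radius;
  uniform continuity on the compact product makes this uniform in the direction.\<close>

lemma sphere_integral_has_derivative:
 fixes g :: "real => 'a::euclidean_space => real"
 assumes r: "a < r" "r < b"
  and d: "!!t om. a <= t ==> t <= b ==> norm om = 1 ==> ((%t. g t om) has_real_derivative g' t om) (at t)"
  and g: "!!t. a <= t ==> t <= b ==> continuous_on (sphere 0 1) (g t)"
  and c: "continuous_on ({a..b} \<times> sphere 0 1) (%(t, om). g' t om)"
 shows "((%t. LINT om|sphere0. g t om) has_real_derivative (LINT om|sphere0. g' r om)) (at r)"
 unfolding DERIV_def LIM_eq
proof (intro allI impI)
 fix e :: real assume "e > 0"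
 define s where "s = measure (sphere0 :: 'a measure) (sphere 0 1) + 1"
 have s: "s > 0" by (simp add: s_def add_nonneg_pos)
 have cr: "continuous_on (sphere 0 1) (g' r)"
 proof -
  have "continuous_on (sphere 0 1) (%om. case (r, om) of (t, om) => g' t om)"
   by (rule continuous_on_compose2[OF c, of "sphere 0 1" "%om. (r, om)"]) (use r in \<open>auto intro!: continuous_intros\<close>)
  then show ?thesis by simp
 qed
 have "uniformly_continuous_on ({a..b} \<times> sphere 0 1) (%(t, om). g' t om)"
  using c by (intro compact_uniformly_continuous compact_Times) auto
 from this[unfolded uniformly_continuous_on_def, rule_format, of "e / (2 * s)"]
 obtain d' where d': "d' > 0" and D: "!!x y. x : {a..b} \<times> sphere 0 1 ==> y : {a..b} \<times> sphere 0 1 ==> dist y x < d' ==>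
   dist (case y of (t, om) => g' t om) (case x of (t, om) => g' t om) < e / (2 * s)"
  using \<open>e > 0\<close> s by (metis divide_pos_pos mult_pos_pos zero_less_numeral)
 define \<delta> where "\<delta> = Min {d', r - a, b - r}"
 have \<delta>: "\<delta> > 0" "\<delta> <= d'" "\<delta> <= r - a" "\<delta> <= b - r" using d' r by (auto simp: \<delta>_def)
 show "EX s>0. ALL h. h \<noteq> 0 & norm (h - 0) < s -->
   norm (((LINT om|sphere0. g (r + h) om) - (LINT om|sphere0. g r om)) / h - (LINT om|sphere0. g' r om)) < e"
 proof (intro exI[of _ \<delta>] conjI allI impI \<delta>(1))
  fix h :: real assume h: "h \<noteq> 0 & norm (h - 0) < \<delta>"
  then have h: "h \<noteq> 0" "\<bar>h\<bar> < \<delta>" by auto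
  have gi: "integrable sphere0 (g (r + h))" "integrable sphere0 (g r)" "integrable sphere0 (g' r)"
   using h \<delta> r by (auto intro!: integrable_sphere0_continuous g cr)
  have pw: "\<bar>(g (r + h) om - g r om) / h - g' r om\<bar> <= e / (2 * s)" if w: "norm om = 1" for om
  proof -
   have "EX t. \<bar>t - r\<bar> < \<delta> & g (r + h) om - g r om = h * g' t om"
   proof (cases "h > 0")
    case True
    then have "EX z>r. z < r + h & g (r + h) om - g r om = (r + h - r) * g' z om"
     using h \<delta> by (intro MVT2 d w) auto
    then obtain z where "r < z" "z < r + h" "g (r + h) om - g r om = h * g' z om" by auto
    then show ?thesis using h by (intro exI[of _ z]) auto
   next
    case False
    then have "EX z>r + h. z < r & g r om - g (r + h) om = (r - (r + h)) * g' z om"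
     using h \<delta> by (intro MVT2 d w) auto
    then obtain z where "r + h < z" "z < r" "g r om - g (r + h) om = - h * g' z om" by auto
    then show ?thesis using h by (intro exI[of _ z]) auto
   qed
   then obtain t where t: "\<bar>t - r\<bar> < \<delta>" "g (r + h) om - g r om = h * g' t om" by blast
   have "dist (g' t om) (g' r om) < e / (2 * s)"
   proof -
    have "a <= t" "t <= b" "\<bar>t - r\<bar> < d'" using t(1) \<delta> by linarith+
    then show ?thesis using D[of "(r, om)" "(t, om)"] r w by (auto simp: dist_Pair_Pair dist_real_def)
   qed
   then show ?thesis using t h by (simp add: dist_real_def)
  qed
  have "((LINT om|sphere0. g (r + h) om) - (LINT om|sphere0. g r om)) / h - (LINT om|sphere0. g' r om)
    = (LINT om|sphere0. (g (r + h) om - g r om) / h - g' r om)"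
   using gi by simp
  also have "norm ... <= (LINT om|(sphere0 :: 'a measure). e / (2 * s))"
  proof (rule order_trans[OF integral_norm_bound], rule Bochner_Integration.integral_mono)
   show "integrable sphere0 (%om. norm ((g (r + h) om - g r om) / h - g' r om))" using gi by simp
   show "norm ((g (r + h) om - g r om) / h - g' r om) <= e / (2 * s)" if "om : space sphere0" for om
    using pw[of om] that by simp
  qed simp
  also have "... = e / 2 * (measure (sphere0 :: 'a measure) (sphere 0 1) / s)" by simp
  also have "... <= e / 2 * 1" using \<open>e > 0\<close> s by (intro mult_left_mono) (auto simp: s_def)
  also have "... < e" using \<open>e > 0\<close> by simp
  finally show "norm (((LINT om|sphere0. g (r + h) om) - (LINT om|sphere0. g r om)) / h - (LINT om|sphere0. g' r om)) < e" .
 qed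
qed

text \<open>A radial cutoff supported in [1, 2]. Squaring the positive part makes it C^1, and
  vanishing below 1 keeps fields built from x/|x| differentiable at the origin.\<close>

definition bump12 :: "real => real" where "bump12 t = (max 0 ((t - 1) * (2 - t)))^2"
definition bump12' :: "real => real" where "bump12' t = 2 * max 0 ((t - 1) * (2 - t)) * (3 - 2 * t)"

lemma bump12_zero: "t <= 1 \<or> t >= 2 ==> bump12 t = 0 & bump12' t = 0"
proof -
 assume "t <= 1 \<or> t >= 2"
 then have "(t - 1) * (2 - t) <= 0" by (auto simp: mult_le_0_iff)
 then show ?thesis by (simp add: bump12_def bump12'_def max_def)
qed

lemma square_max_zero_deriv: "((%t::real. (max 0 t)^2) has_real_derivative 2 * max 0 t) (at t)"
proof -
 consider "t > 0" | "t < 0" | "t = 0" by linarith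
 then show ?thesis
 proof cases
  case 1
  have "((%t::real. t^2) has_real_derivative 2 * max 0 t) (at t)" using 1 by (auto intro!: derivative_eq_intros)
  then show ?thesis
   by (rule has_field_derivative_transform_within_open[where S="{0<..}"]) (use 1 in auto)
 next
  case 2
  have "((%t::real. 0) has_real_derivative 2 * max 0 t) (at t)" using 2 by (auto intro!: derivative_eq_intros)
  then show ?thesis
   by (rule has_field_derivative_transform_within_open[where S="{..<0}"]) (use 2 in auto)
 next
  case 3
  have "((%h::real. ((max 0 h)^2) / h) ---> 0) (at 0)"
  proof (rule Lim_null_comparison)
   show "\<forall>\<^sub>F h in at 0. norm ((max 0 h)^2 / h) <= \<bar>h::real\<bar>"
    by (rule always_eventually) (auto simp: max_def power2_eq_square)
   show "((%h::real. \<bar>h\<bar>) ---> 0) (at 0)" by (auto intro: tendsto_eq_intros)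
  qed
  then show ?thesis using 3 by (simp add: DERIV_def)
 qed
qed

lemma bump12_deriv: "(bump12 has_real_derivative bump12' t) (at t)"
proof -
 have "((%t. (t - 1) * (2 - t)) has_real_derivative (3 - 2 * t)) (at t)" by (auto intro!: derivative_eq_intros)
 from DERIV_chain2[OF square_max_zero_deriv this] show ?thesis by (simp add: bump12_def[abs_def] bump12'_def)
qed

lemma continuous_bump12: "continuous_on UNIV bump12" "continuous_on UNIV bump12'"
 unfolding bump12_def[abs_def] bump12'_def[abs_def] by (intro continuous_intros)+

text \<open>The field V(r x/|x|) is constant along rays. It is multiplied by a radial cutoff and its
  divergence integrated over the whole space, which gives zero. In polar coordinates the derivative
  of the cutoff meets the normal component of V and the cutoff itself meets the tangential
  divergence; the two radial integrals have ratio -(N-1).\<close>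

lemma sphere_divergence_tangential:
 fixes V :: "'a::euclidean_space => 'a => real"
 assumes dim: "DIM('a) >= 2" and r: "r > 0"
  and d: "!!b x. b : Basis ==> (V b has_derivative V' b x) (at x)"
  and c: "!!b v. b : Basis ==> continuous_on UNIV (%x. V' b x v)"
 shows "(real DIM('a) - 1) * (LINT om|sphere0. (SUM b:Basis. (b \<bullet> om) * V b (r *R om)))
  = r * (LINT om|sphere0. (SUM b:Basis. V' b (r *R om) (b - (b \<bullet> om) *R om)))"
proof -
 let ?N = "DIM('a)"
 define P where "P om = (SUM b:Basis. (b \<bullet> om) * V b (r *R om))" for om
 define Q where "Q om = (SUM b:Basis. V' b (r *R om) (b - (b \<bullet> om) *R om))" for om
 \<comment> \<open>This is r times the derivative of x/|x| in the direction b: up to the factor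
   r/|x|, the projection of b onto the tangent space.\<close>
 define U where "U b x = r *R inverse (norm x) *R (b - (b \<bullet> sgn x) *R sgn x)" for b x :: 'a
 define w where "w b x = bump12 (norm x) * V b (r *R sgn x)" for b x
 define w' where "w' b x h = bump12' (norm x) * (h \<bullet> sgn x) * V b (r *R sgn x) + bump12 (norm x) * V' b (r *R sgn x) (U h x)" for b x h
 have Vc: "continuous_on UNIV (V b)" if "b : Basis" for b
  using d[OF that] by (meson continuous_at_imp_continuous_on has_derivative_continuous)
 have lin: "V' b x v = (SUM i:Basis. (v \<bullet> i) * V' b x i)" if "b : Basis" for b x v
 proof -
  have "linear (V' b x)" using d[OF that] by (rule has_derivative_linear)
  then have "V' b x (SUM i:Basis. (v \<bullet> i) *R i) = (SUM i:Basis. (v \<bullet> i) * V' b x i)"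
   by (simp add: linear_sum linear_scale)
  then show ?thesis by (simp add: euclidean_representation)
 qed
 have V'c: "continuous_on S (%x. V' b (f x) (g x))" if "b : Basis" "continuous_on S f" "continuous_on S g" for b S f and g :: "_ => 'a"
 proof -
  have "continuous_on S (%x. SUM i:Basis. (g x \<bullet> i) * V' b (f x) i)"
   by (intro continuous_intros that continuous_on_compose2[OF c[OF that(1)]]) auto
  moreover have "(%x. V' b (f x) (g x)) = (%x. SUM i:Basis. (g x \<bullet> i) * V' b (f x) i)"
   by (intro ext lin that)
  ultimately show ?thesis by (simp only:)
 qed
 have der: "(w b has_derivative w' b x) (at x)" if b: "b : Basis" for b x
 \<comment> \<open>Inside the unit ball the cutoff vanishes, which covers the origin, where x/|x| is
   not differentiable.\<close>
 proof (cases "norm x < 1")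
  case True
  have e: "w' b x = (%h. 0)" using bump12_zero[of "norm x"] True by (auto simp: w'_def)
  show ?thesis unfolding e
  proof (rule has_derivative_transform_within_open[where f="%x. 0" and s="ball 0 1"])
   show "0 = w b y" if "y : ball 0 1" for y using bump12_zero[of "norm y"] that by (simp add: w_def)
  qed (use True in auto)
 next
  case False
  then have x: "x \<noteq> 0" by auto
  have n: "(norm has_derivative (%h. h \<bullet> sgn x)) (at x)" using has_derivative_norm[OF x] by (simp add: inner_commute)
  have "((%x. inverse (norm x) *R x) has_derivative (%h. inverse (norm x) *R h + (- (inverse (norm x) * (h \<bullet> sgn x) * inverse (norm x))) *R x)) (at x)"
   using x by (auto intro!: derivative_eq_intros n)
  moreover have "inverse (norm x) *R h + (- (inverse (norm x) * (h \<bullet> sgn x) * inverse (norm x))) *R x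
    = inverse (norm x) *R (h - (h \<bullet> sgn x) *R sgn x)" for h
   by (simp add: sgn_div_norm algebra_simps)
  moreover have "(%x::'a. inverse (norm x) *R x) = sgn" by (auto simp: sgn_div_norm)
  ultimately have s: "(sgn has_derivative (%h. inverse (norm x) *R (h - (h \<bullet> sgn x) *R sgn x))) (at x)" by simp
  have "((%x. V b (r *R sgn x)) has_derivative (%h. V' b (r *R sgn x) (U h x))) (at x)"
   unfolding U_def
   by (rule has_derivative_compose[OF _ d[OF b]]) (intro has_derivative_scaleR_right s)
  moreover have "((%x. bump12 (norm x)) has_derivative (%h. bump12' (norm x) * (h \<bullet> sgn x))) (at x)"
   by (rule has_derivative_compose[OF n, of bump12 "%h. bump12' (norm x) * h"]) 
    (use bump12_deriv in \<open>simp add: has_field_derivative_def\<close>)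
  ultimately have "((%x. bump12 (norm x) * V b (r *R sgn x)) has_derivative
    (%h. bump12 (norm x) * V' b (r *R sgn x) (U h x) + bump12' (norm x) * (h \<bullet> sgn x) * V b (r *R sgn x))) (at x)"
   using has_derivative_mult by blast
  then show ?thesis by (simp add: w_def[abs_def] w'_def[abs_def] add.commute)
 qed
 have sgnc: "continuous_on (- {0::'a}) sgn" by (intro continuous_on_sgn continuous_intros) auto
 have bc: "continuous_on S (%x::'a. bump12 (norm x))" "continuous_on S (%x::'a. bump12' (norm x))" for S
  by (intro continuous_on_compose2[OF continuous_bump12(1)] continuous_on_compose2[OF continuous_bump12(2)] continuous_intros; simp)+
 have w'c: "continuous_on UNIV (%x. w' b x h)" if b: "b : Basis" for b h
 proof -
  have "continuous_on (- {0}) (%x. w' b x h)" unfolding w'_def U_def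
   by (intro continuous_intros bc V'c b sgnc continuous_on_compose2[OF Vc[OF b]]) auto
  moreover have "continuous_on (ball 0 1) (%x. w' b x h)"
   using bump12_zero by (subst continuous_on_cong[OF refl, where g="%x. 0"]) (auto simp: w'_def)
  ultimately have "continuous_on (- {0} \<union> ball 0 1) (%x. w' b x h)" by (intro continuous_on_open_Un) auto
  moreover have "- {0} \<union> ball 0 1 = (UNIV :: 'a set)" by auto
  ultimately show ?thesis by simp
 qed
 have wz: "w b x = 0" if "norm x > 2" for b x using bump12_zero that by (simp add: w_def)
 have w'z: "w' b x h = 0" if "norm x > 2" for b x h using bump12_zero that by (simp add: w'_def)
 have int0: "(LINT x|lborel. w' b x b) = 0" if "b : Basis" for b
  by (rule integral_partial_derivative_zero[OF der[OF that] w'c[OF that] wz])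
 have Pc: "continuous_on UNIV P" unfolding P_def[abs_def]
  by (intro continuous_intros continuous_on_compose2[OF Vc]) auto
 have Qc: "continuous_on UNIV Q" unfolding Q_def[abs_def]
  by (intro continuous_intros V'c) auto
 have m[measurable]: "P : borel_measurable borel" "Q : borel_measurable borel" "bump12 : borel_measurable borel" "bump12' : borel_measurable borel"
  using Pc Qc continuous_bump12 by (auto intro: borel_measurable_continuous_onI)
 have PQi: "integrable sphere0 P" "integrable sphere0 Q"
  using Pc Qc by (auto intro!: integrable_sphere0_continuous intro: continuous_on_subset)
 let ?g2 = "%t. bump12 t / t"
 have e1: "indicator {0<..} t * t ^ (?N - 1) * bump12' t = t ^ (?N - 1) * bump12' t"
  and e2: "indicator {0<..} t * t ^ (?N - 1) * ?g2 t = t ^ (?N - 2) * bump12 t" for t :: real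
 proof -
  have "t ^ (?N - 1) = t * t ^ (?N - 2)" using dim by (metis One_nat_def Suc_1 Suc_diff_le diff_Suc_Suc power_Suc)
  then show "indicator {0<..} t * t ^ (?N - 1) * bump12' t = t ^ (?N - 1) * bump12' t"
   "indicator {0<..} t * t ^ (?N - 1) * ?g2 t = t ^ (?N - 2) * bump12 t"
   using bump12_zero[of t] by (cases "t > 0"; simp)+
 qed
 have bz: "bump12 t = 0 & bump12' t = 0" if "norm t > 2" for t :: real
  using that by (intro bump12_zero) (auto simp: abs_if split: if_splits)
 have ip1: "integrable lborel (%t. t ^ (?N - 1) * bump12' t)" and ip2: "integrable lborel (%t. t ^ (?N - 2) * bump12 t)"
  by (intro integrable_bounded_support[where R=2] continuous_intros continuous_bump12; simp add: bz)+
 define J1 J2 where "J1 = (LINT t|lborel. t ^ (?N - 1) * bump12' t)" and "J2 = (LINT t|lborel. t ^ (?N - 2) * bump12 t)"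
 note pol1 = polar_integral_product[of P bump12', unfolded e1, OF m(1,4) PQi(1) ip1]
 note pol2 = polar_integral_product[of Q ?g2, unfolded e2, OF m(2) borel_measurable_divide[OF m(3) measurable_ident_sets[OF refl]] PQi(2) ip2]
 have "0 = (SUM b:Basis. LINT x|lborel. w' b x b)" using int0 by simp
 also have "... = (LINT x|lborel. (SUM b:Basis. w' b x b))"
  by (subst Bochner_Integration.integral_sum) (auto intro!: integrable_bounded_support[where R=2] w'c w'z)
 also have "(%x. SUM b:Basis. w' b x b) = (%x. bump12' (norm x) * P (sgn x) + r * (?g2 (norm x) * Q (sgn x)))"
 proof
  fix x :: 'a
  have "V' b y (U b x) = r * inverse (norm x) * V' b y (b - (b \<bullet> sgn x) *R sgn x)" if "b : Basis" for b y
   using linear_scale[OF has_derivative_linear[OF d[OF that]]] by (simp add: U_def)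
  then show "(SUM b:Basis. w' b x b) = bump12' (norm x) * P (sgn x) + r * (?g2 (norm x) * Q (sgn x))"
   by (simp add: w'_def P_def Q_def sum.distrib sum_distrib_left divide_inverse mult_ac)
 qed
 also have "(LINT x|lborel. bump12' (norm x) * P (sgn x) + r * (?g2 (norm x) * Q (sgn x)))
   = J1 * (LINT om|sphere0. P om) + r * (J2 * (LINT om|sphere0. Q om))"
  unfolding Bochner_Integration.integral_add[OF pol1(1) integrable_mult_right[OF pol2(1)]] integral_mult_right_zero
   pol1(2) pol2(2) J1_def J2_def ..
 finally have main: "J1 * (LINT om|sphere0. P om) + r * (J2 * (LINT om|sphere0. Q om)) = 0" by simp
 \<comment> \<open>One-dimensional integration by parts for t^(N-1) times the cutoff relates the two
   radial integrals.\<close>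
 have "(LINT t|lborel. (t ^ (?N - 1) * bump12' t + (real ?N - 1) * (t ^ (?N - 2) * bump12 t)) * 1) = 0"
 proof (rule integral_partial_derivative_zero[where f="%t::real. t ^ (?N - 1) * bump12 t" and R=2 and b=1
   and f'="%t h. (t ^ (?N - 1) * bump12' t + (real ?N - 1) * (t ^ (?N - 2) * bump12 t)) * h"])
  fix t :: real
  have "((%t. t ^ (?N - 1) * bump12 t) has_real_derivative
    (t ^ (?N - 1) * bump12' t + (real ?N - 1) * (t ^ (?N - 2) * bump12 t))) (at t)"
   using dim by (auto intro!: derivative_eq_intros bump12_deriv simp: of_nat_diff numeral_2_eq_2)
  then show "((%t. t ^ (?N - 1) * bump12 t) has_derivative
    (%h. (t ^ (?N - 1) * bump12' t + (real ?N - 1) * (t ^ (?N - 2) * bump12 t)) * h)) (at t)"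
   by (simp add: has_field_derivative_def)
  show "norm t > 2 ==> t ^ (?N - 1) * bump12 t = 0" using bz[of t] by simp
 qed (intro continuous_intros continuous_bump12)
 then have "J1 + (real ?N - 1) * J2 = 0" using ip1 ip2 by (simp add: J1_def J2_def)
 then have J: "J1 = - (real ?N - 1) * J2" by algebra
 \<comment> \<open>J2 is the common factor to be cancelled; its integrand is nonnegative and
   positive on the interval (1, 2).\<close>
 have "J2 \<noteq> 0"
 proof
  assume "J2 = 0"
  have nn: "t ^ (?N - 2) * bump12 t >= 0" for t
   using bump12_zero[of t] by (cases "t > 0") (auto simp: bump12_def)
  have "AE t in lborel. t ^ (?N - 2) * bump12 t = 0"
   using integral_nonneg_eq_0_iff_AE[OF ip2] nn \<open>J2 = 0\<close> by (simp add: J2_def)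
  then have "AE t in lborel. t \<notin> {1<..<2::real}"
  proof eventually_elim
   case (elim t)
   show ?case
   proof
    assume "t : {1<..<2}"
    then have "(t - 1) * (2 - t) > 0" "t > 0" "t \<noteq> 1" "t \<noteq> 2" by auto
    then show False using elim by (simp add: bump12_def)
   qed
  qed
  then have "{1<..<2::real} : null_sets lborel" by (subst AE_iff_null_sets) auto
  then have "emeasure lborel {1<..<2::real} = 0" by (rule null_setsD1)
  then show False unfolding emeasure_lborel_Ioo[of 1 2, simplified] by simp
 qed
 have "J2 * ((real ?N - 1) * (LINT om|sphere0. P om) - r * (LINT om|sphere0. Q om)) = 0"
  using main unfolding J by (simp add: algebra_simps)
 then have "(real ?N - 1) * (LINT om|sphere0. P om) = r * (LINT om|sphere0. Q om)"
  using \<open>J2 \<noteq> 0\<close> by simp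
 then show ?thesis by (simp add: P_def Q_def)
qed

subsection \<open>Rellich identities for smooth functions\<close>

lemma has_derivative_basis_expansion:
 fixes f' :: "'a::euclidean_space => 'b::real_normed_vector"
 assumes "linear f'"
 shows "f' v = (SUM i:Basis. (v \<bullet> i) *R f' i)"
proof -
 have "f' (SUM i:Basis. (v \<bullet> i) *R i) = (SUM i:Basis. (v \<bullet> i) *R f' i)"
  using assms by (simp add: linear_sum linear_scale)
 then show ?thesis by (simp add: euclidean_representation)
qed

lemma continuous_on_directional_derivative:
 fixes g' :: "'a::euclidean_space => 'a => 'b::real_normed_vector"
 assumes lin: "!!x. linear (%v. g' v x)" and c: "!!v. continuous_on UNIV (g' v)"
  and f: "continuous_on S f" and g: "continuous_on S g"
 shows "continuous_on S (%x. g' (f x) (g x))"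
proof -
 have "continuous_on S (%x. SUM i:Basis. (f x \<bullet> i) *R g' i (g x))"
  by (intro continuous_intros f g continuous_on_compose2[OF c g]) auto
 moreover have "(%x. g' (f x) (g x)) = (%x. SUM i:Basis. (f x \<bullet> i) *R g' i (g x))"
  by (intro ext has_derivative_basis_expansion[where f'="%v. g' v _"] lin)
 ultimately show ?thesis by (simp only:)
qed

text \<open>The derivative of V along rays contributes the normal part of the divergence. The
  derivative of r^(N-1) contributes (N-1)/r times the flux, which
  \<open>sphere_divergence_tangential\<close> turns into the tangential part.\<close>

lemma sphere_flux_has_derivative:
 fixes V :: "'a::euclidean_space => 'a => real"
 assumes dim: "DIM('a) >= 2" and r: "r > 0"
  and d: "!!b x. b : Basis ==> (V b has_derivative V' b x) (at x)"
  and c: "!!b v. b : Basis ==> continuous_on UNIV (%x. V' b x v)"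
 shows "((%r. r ^ (DIM('a) - 1) * (LINT om|sphere0. (SUM b:Basis. (b \<bullet> om) * V b (r *R om)))) has_real_derivative
   r ^ (DIM('a) - 1) * (LINT om|sphere0. (SUM b:Basis. V' b (r *R om) b))) (at r)"
proof -
 let ?N = "DIM('a)"
 let ?S = "sphere0 :: 'a measure"
 have lin: "linear (V' b x)" if "b : Basis" for b x using d[OF that] by (rule has_derivative_linear)
 have V'c: "continuous_on S (%x. V' b (g x) (f x))" if "b : Basis" "continuous_on S f" "continuous_on S g"
  for b and S :: "'c::real_normed_vector set" and f g
  by (rule continuous_on_directional_derivative[where g'="%v x. V' b x v", OF lin[OF that(1)] c[OF that(1)] that(2,3)])
 have Vc: "continuous_on UNIV (V b)" if "b : Basis" for b
  using d[OF that] by (meson continuous_at_imp_continuous_on has_derivative_continuous)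
 define P where "P t om = (SUM b:Basis. (b \<bullet> om) * V b (t *R om))" for t om
 define P' where "P' t om = (SUM b:Basis. (b \<bullet> om) * V' b (t *R om) om)" for t om
 have "((%t. LINT om|?S. P t om) has_real_derivative (LINT om|?S. P' r om)) (at r)"
 proof (rule sphere_integral_has_derivative[where a="r-1" and b="r+1"])
  show "((%t. P t om) has_real_derivative P' t om) (at t)" for t and om :: 'a
  proof -
   have "((%t. V b (t *R om)) has_real_derivative V' b (t *R om) om) (at t)" if b: "b : Basis" for b
   proof -
    have "((%t. V b (t *R om)) has_derivative (%h. V' b (t *R om) (h *R om))) (at t)"
     by (rule has_derivative_compose[OF _ d[OF b]]) (auto intro!: derivative_eq_intros)
    then show ?thesis using linear_scale[OF lin[OF b]] by (simp add: has_field_derivative_def mult_commute_abs)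
   qed
   then show ?thesis unfolding P_def P'_def by (intro DERIV_sum DERIV_cmult)
  qed
  show "continuous_on (sphere 0 1) (P t)" for t unfolding P_def
   by (intro continuous_intros continuous_on_compose2[OF Vc]) auto
  show "continuous_on ({r-1..r+1} \<times> sphere 0 1) (%(t, om). P' t om)"
   unfolding P'_def split_beta by (intro continuous_intros V'c) auto
 qed auto
 then have "((%r. r ^ (?N - 1) * (LINT om|?S. P r om)) has_real_derivative
   (real (?N - 1) * r ^ (?N - 1 - Suc 0)) * (LINT om|?S. P r om) + (LINT om|?S. P' r om) * r ^ (?N - 1)) (at r)"
  by (rule DERIV_mult[OF DERIV_pow])
 moreover have "(real (?N - 1) * r ^ (?N - 1 - Suc 0)) * (LINT om|?S. P r om) + (LINT om|?S. P' r om) * r ^ (?N - 1)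
   = r ^ (?N - 1) * (LINT om|?S. (SUM b:Basis. V' b (r *R om) b))"
 proof -
  define Q where "Q om = (SUM b:Basis. V' b (r *R om) (b - (b \<bullet> om) *R om))" for om
  have "continuous_on (sphere 0 1) (P' r)" "continuous_on (sphere 0 1) Q"
   unfolding P'_def Q_def by (intro continuous_intros V'c; simp)+
  then have i: "integrable ?S (P' r)" "integrable ?S Q" by (auto intro: integrable_sphere0_continuous)
  have "(real ?N - 1) * (LINT om|?S. P r om) = r * (LINT om|?S. Q om)"
   using sphere_divergence_tangential[OF dim r d c] by (simp add: P_def Q_def)
  moreover have "r ^ (?N - 1) = r * r ^ (?N - 1 - Suc 0)"
   using dim by (metis One_nat_def Suc_1 Suc_diff_le diff_Suc_Suc power_Suc diff_Suc_1 Suc_le_D)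
  ultimately have "(real (?N - 1) * r ^ (?N - 1 - Suc 0)) * (LINT om|?S. P r om) = r ^ (?N - 1) * (LINT om|?S. Q om)"
   using dim by (simp add: of_nat_diff mult_ac)
  moreover have "(%om. SUM b:Basis. V' b (r *R om) b) = (%om. Q om + P' r om)"
  proof
   fix om :: 'a
   show "(SUM b:Basis. V' b (r *R om) b) = Q om + P' r om"
    unfolding Q_def P'_def sum.distrib[symmetric]
    by (intro sum.cong refl) (simp add: linear_diff[OF lin] linear_scale[OF lin])
  qed
  ultimately show ?thesis using i by (simp add: algebra_simps)
 qed
 ultimately show ?thesis by (simp add: P_def)
qed

text \<open>\<open>g v\<close> is the derivative in the direction v, kept as one function for each v
  so that continuity is asked direction by direction. On complex values the inner product is the
  real one, Re (z cnj w), so the identities below are the real parts of the usual complex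
  ones.\<close>

locale C1_complex =
 fixes \<phi> :: "'a::euclidean_space => complex" and g :: "'a => 'a => complex"
 assumes d1: "(\<phi> has_derivative (%v. g v x)) (at x)"
  and c1: "continuous_on UNIV (g v)"
begin

definition grad2 where "grad2 x = (SUM b:Basis. (cmod (g b x))^2)"

lemma lin1: "linear (%v. g v x)" using d1 by (rule has_derivative_linear)

lemma c0: "continuous_on UNIV \<phi>" using d1 by (meson continuous_at_imp_continuous_on has_derivative_continuous)

lemma continuous_phi: "continuous_on S f ==> continuous_on S (%x. \<phi> (f x))"
 by (rule continuous_on_compose2[OF c0]) auto
lemma continuous_g: "continuous_on S f ==> continuous_on S k ==> continuous_on S (%x. g (f x) (k x))"
 by (rule continuous_on_directional_derivative[OF lin1 c1])
lemma continuous_grad2: "continuous_on S k ==> continuous_on S (%x. grad2 (k x))"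
 unfolding grad2_def by (intro continuous_intros continuous_g)

lemma sphere_norm_deriv:
 assumes r: "r > 0"
 shows "((%r. LINT om|sphere0. (cmod (\<phi> (r *R om)))^2) has_real_derivative
   (LINT om|sphere0. 2 * (\<phi> (r *R om) \<bullet> g om (r *R om)))) (at r)"
proof (rule sphere_integral_has_derivative[where a="r-1" and b="r+1"])
 show "((%t. (cmod (\<phi> (t *R om)))^2) has_real_derivative 2 * (\<phi> (t *R om) \<bullet> g om (t *R om))) (at t)" for t om
 proof -
  have "((%t. \<phi> (t *R om)) has_derivative (%h. g (h *R om) (t *R om))) (at t)"
   by (rule has_derivative_compose[OF _ d1]) (auto intro!: derivative_eq_intros)
  from has_derivative_inner[OF this this]
  show ?thesis using linear_scale[OF lin1]
   by (simp add: has_field_derivative_def dot_square_norm inner_commute mult_commute_abs mult.left_commute)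
 qed
 show "continuous_on (sphere 0 1) (%om. (cmod (\<phi> (t *R om)))^2)" for t
  by (intro continuous_intros continuous_phi)
 show "continuous_on ({r-1..r+1} \<times> sphere 0 1) (%(t, om). 2 * (\<phi> (t *R om) \<bullet> g om (t *R om)))"
  unfolding split_beta by (intro continuous_intros continuous_phi continuous_g)
qed auto

end

text \<open>Symmetry of the second derivatives is part of the interface; mollifications satisfy it
  through an explicit formula for the kernel.\<close>

locale C2_complex =
 fixes \<phi> :: "'a::euclidean_space => complex" and g :: "'a => 'a => complex" and hh :: "'a => 'a => 'a => complex"
 assumes d1: "(\<phi> has_derivative (%v. g v x)) (at x)"
  and d2: "(g v has_derivative (%w. hh v w x)) (at x)"
  and c2: "continuous_on UNIV (hh v w)"
  and sym: "hh v w x = hh w v x"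

sublocale C2_complex \<subseteq> C1_complex
proof
 show "(\<phi> has_derivative (%v. g v x)) (at x)" for x by (rule d1)
 show "continuous_on UNIV (g v)" for v using d2 by (meson continuous_at_imp_continuous_on has_derivative_continuous)
qed

context C2_complex
begin

definition lap where "lap x = (SUM b:Basis. hh b b x)"

lemma lin2: "linear (%w. hh v w x)" using d2 by (rule has_derivative_linear)
lemma lin2': "linear (%v. hh v w x)" using lin2[of w x] by (subst sym)

lemma continuous_hh: "continuous_on S k ==> continuous_on S (%x. hh v w (k x))"
 by (rule continuous_on_compose2[OF c2]) auto
lemma continuous_lap: "continuous_on S k ==> continuous_on S (%x. lap (k x))"
 unfolding lap_def by (intro continuous_intros continuous_hh)
text \<open>The field is \<phi> grad \<phi>; its divergence is the Laplacian paired with \<phi> plus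
  the squared gradient.\<close>

lemma flux_phi_grad:
 assumes dim: "DIM('a) >= 2" and r: "r > 0"
 shows "((%r. r ^ (DIM('a) - 1) * (LINT om|sphere0. \<phi> (r *R om) \<bullet> g om (r *R om))) has_real_derivative
   r ^ (DIM('a) - 1) * (LINT om|sphere0. \<phi> (r *R om) \<bullet> lap (r *R om) + grad2 (r *R om))) (at r)"
proof -
 define V where "V b x = \<phi> x \<bullet> g b x" for b x
 define V' where "V' b x v = \<phi> x \<bullet> hh b v x + g v x \<bullet> g b x" for b x v
 have "((%r. r ^ (DIM('a) - 1) * (LINT om|sphere0. (SUM b:Basis. (b \<bullet> om) * V b (r *R om)))) has_real_derivative
   r ^ (DIM('a) - 1) * (LINT om|sphere0. (SUM b:Basis. V' b (r *R om) b))) (at r)"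
 proof (rule sphere_flux_has_derivative[where V=V and V'=V', OF dim r])
  show "(V b has_derivative V' b x) (at x)" for b x
   unfolding V_def[abs_def] V'_def[abs_def] by (rule has_derivative_inner[OF d1 d2])
  show "continuous_on UNIV (%x. V' b x v)" for b v
   unfolding V'_def by (intro continuous_intros continuous_phi continuous_hh continuous_g)
 qed
 moreover have "(SUM b:Basis. (b \<bullet> om) * V b x) = \<phi> x \<bullet> g om x" for om x
  unfolding V_def by (subst (2) has_derivative_basis_expansion[OF lin1]) (simp add: inner_sum_right inner_commute)
 moreover have "(SUM b:Basis. V' b x b) = \<phi> x \<bullet> lap x + grad2 x" for x
  unfolding V'_def lap_def grad2_def by (simp add: inner_sum_right sum.distrib dot_square_norm)
 ultimately show ?thesis by simp
qed

text \<open>The Rellich-Pohozaev field 2 (x . grad \<phi>) grad \<phi> - |grad \<phi>|^2 x. Its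
  normal component on a sphere is r (2 |\<phi>_r|^2 - |grad \<phi>|^2). In its divergence all second
  derivatives other than the Laplacian cancel.\<close>

lemma flux_pohozaev:
 assumes dim: "DIM('a) >= 2" and r: "r > 0"
 shows "((%r. r ^ (DIM('a) - 1) * (LINT om|sphere0. r * (2 * (cmod (g om (r *R om)))^2 - grad2 (r *R om)))) has_real_derivative
   r ^ (DIM('a) - 1) * (LINT om|sphere0. (2 - real DIM('a)) * grad2 (r *R om) + 2 * r * (g om (r *R om) \<bullet> lap (r *R om)))) (at r)"
proof -
 define V where "V b x = 2 * ((SUM c:Basis. (x \<bullet> c) *R g c x) \<bullet> g b x) - (SUM c:Basis. g c x \<bullet> g c x) * (x \<bullet> b)" for b x
 define V' where "V' b x v = 2 * ((SUM c:Basis. (x \<bullet> c) *R g c x) \<bullet> hh b v x + (SUM c:Basis. (x \<bullet> c) *R hh c v x + (v \<bullet> c) *R g c x) \<bullet> g b x)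
   - ((SUM c:Basis. g c x \<bullet> g c x) * (v \<bullet> b) + (SUM c:Basis. g c x \<bullet> hh c v x + hh c v x \<bullet> g c x) * (x \<bullet> b))" for b x v
 have gx: "(SUM c:Basis. (y \<bullet> c) *R g c x) = g y x" for x y by (rule has_derivative_basis_expansion[OF lin1, symmetric])
 have hx: "(SUM c:Basis. (y \<bullet> c) *R hh c v x) = hh y v x" for x y v by (rule has_derivative_basis_expansion[OF lin2', symmetric])
 have G: "(SUM c:Basis. g c x \<bullet> g c x) = grad2 x" for x by (simp add: grad2_def dot_square_norm)
 have "((%r. r ^ (DIM('a) - 1) * (LINT om|sphere0. (SUM b:Basis. (b \<bullet> om) * V b (r *R om)))) has_real_derivative
   r ^ (DIM('a) - 1) * (LINT om|sphere0. (SUM b:Basis. V' b (r *R om) b))) (at r)"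
 proof (rule sphere_flux_has_derivative[where V=V and V'=V', OF dim r])
  show "(V b has_derivative V' b x) (at x)" for b x
   unfolding V_def[abs_def] V'_def[abs_def]
   by (intro has_derivative_diff has_derivative_mult has_derivative_mult_right has_derivative_inner has_derivative_sum
    has_derivative_scaleR has_derivative_inner_left has_derivative_ident d2)
  show "continuous_on UNIV (%x. V' b x v)" for b v
   unfolding V'_def by (intro continuous_intros continuous_hh continuous_g)
 qed
 moreover have "(LINT om|sphere0. (SUM b:Basis. (b \<bullet> om) * V b (r *R om))) = (LINT om|sphere0. r * (2 * (cmod (g om (r *R om)))^2 - grad2 (r *R om)))" for r
 proof (rule Bochner_Integration.integral_cong[OF refl])
  fix om :: 'a assume w0: "om : space sphere0"
  then have w: "om : sphere 0 1" by simp
  show "(SUM b:Basis. (b \<bullet> om) * V b (r *R om)) = r * (2 * (cmod (g om (r *R om)))^2 - grad2 (r *R om))"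
 proof -
  let ?x = "r *R om"
  have "(SUM b:Basis. (b \<bullet> om) * V b ?x) = 2 * (g ?x ?x \<bullet> (SUM b:Basis. (om \<bullet> b) *R g b ?x)) - grad2 ?x * (SUM b:Basis. (?x \<bullet> b) * (om \<bullet> b))"
  proof -
   have "(b \<bullet> om) * V b ?x = 2 * (g ?x ?x \<bullet> ((om \<bullet> b) *R g b ?x)) - grad2 ?x * ((?x \<bullet> b) * (om \<bullet> b))" for b
    unfolding V_def gx G by (simp add: inner_commute algebra_simps)
   then show ?thesis by (simp only: inner_sum_right sum_distrib_left sum_subtractf)
  qed
  also have "(SUM b:Basis. (?x \<bullet> b) * (om \<bullet> b)) = r * (om \<bullet> om)" by (subst euclidean_inner[of ?x om, symmetric]) simp
  also have "om \<bullet> om = 1" using w by (simp add: dot_square_norm)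
  also have "(SUM b:Basis. (om \<bullet> b) *R g b ?x) = g om ?x" by (rule gx)
  also have "g ?x ?x = r *R g om ?x" using linear_scale[OF lin1] by simp
  finally show ?thesis by (simp add: dot_square_norm algebra_simps)
 qed
 qed
 moreover have "(SUM b:Basis. V' b (r *R om) b) = (2 - real DIM('a)) * grad2 (r *R om) + 2 * r * (g om (r *R om) \<bullet> lap (r *R om))" for om
 proof -
  let ?x = "r *R om"
  have e: "V' b ?x b = 2 * (g ?x ?x \<bullet> hh b b ?x) + 2 * (hh b ?x ?x \<bullet> g b ?x) + 2 * (g b ?x \<bullet> g b ?x)
    - grad2 ?x - (?x \<bullet> b) * (SUM c:Basis. 2 * (g c ?x \<bullet> hh c b ?x))" if b: "b : Basis" for b
  proof -
   have "(SUM c:Basis. (?x \<bullet> c) *R hh c b ?x + (b \<bullet> c) *R g c ?x) = hh ?x b ?x + g b ?x"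
    by (simp only: sum.distrib gx hx)
   then show ?thesis unfolding V'_def gx G using b
    by (simp add: inner_left_distrib inner_commute sym[of _ ?x] algebra_simps)
  qed
  \<comment> \<open>By symmetry, differentiating |grad \<phi>|^2 along x gives the same sum of
    second derivatives as differentiating x . grad \<phi> does; the two cancel below.\<close>
  have "(SUM b:Basis. (?x \<bullet> b) * (SUM c:Basis. 2 * (g c ?x \<bullet> hh c b ?x))) = (SUM c:Basis. 2 * (g c ?x \<bullet> hh c ?x ?x))"
  proof -
   have "(SUM b:Basis. (?x \<bullet> b) * (SUM c:Basis. 2 * (g c ?x \<bullet> hh c b ?x))) = (SUM b:Basis. SUM c:Basis. 2 * (g c ?x \<bullet> ((?x \<bullet> b) *R hh c b ?x)))"
    by (simp add: sum_distrib_left mult_ac)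
   also have "... = (SUM c:Basis. SUM b:Basis. 2 * (g c ?x \<bullet> ((?x \<bullet> b) *R hh c b ?x)))" by (rule sum.swap)
   also have "... = (SUM c:Basis. 2 * (g c ?x \<bullet> (SUM b:Basis. (?x \<bullet> b) *R hh c b ?x)))"
    by (simp only: inner_sum_right sum_distrib_left)
   also have "... = (SUM c:Basis. 2 * (g c ?x \<bullet> hh c ?x ?x))"
    by (simp only: has_derivative_basis_expansion[OF lin2, symmetric])
   finally show ?thesis .
  qed
  moreover have "(SUM b:Basis. V' b ?x b) = 2 * (g ?x ?x \<bullet> lap ?x) + (SUM b:Basis. 2 * (g b ?x \<bullet> hh b ?x ?x)) + 2 * grad2 ?x
    - real DIM('a) * grad2 ?x - (SUM b:Basis. (?x \<bullet> b) * (SUM c:Basis. 2 * (g c ?x \<bullet> hh c b ?x)))"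
   using e by (simp add: sum.distrib sum_subtractf lap_def inner_sum_right sum_distrib_left G[symmetric] inner_commute)
  moreover have "g ?x ?x = r *R g om ?x" using linear_scale[OF lin1] by simp
  ultimately show ?thesis by (simp add: algebra_simps)
 qed
 ultimately show ?thesis by (simp only:)
qed

end

lemma C2_complex_imp_C1: "C2_complex \<phi> g hh ==> C1_complex \<phi> g"
proof -
 assume "C2_complex \<phi> g hh"
 then interpret C2_complex \<phi> g hh .
 show ?thesis by unfold_locales
qed

subsection \<open>Square integrable functions\<close>

definition L2fun :: "'b measure => ('b => complex) => bool"
 where "L2fun M f \<longleftrightarrow> f : borel_measurable M & integrable M (%x. (cmod (f x))^2)"

definition L2norm :: "'b measure => ('b => complex) => real"
 where "L2norm M f = sqrt (LINT x|M. (cmod (f x))^2)"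

lemma L2_sphere_L2fun: "L2_sphere = L2fun sphere_measure"
 by (intro ext) (simp add: L2_sphere_def L2fun_def)

lemma L2fun_measurable [measurable_dest]: "L2fun M f ==> f : borel_measurable M"
 and L2fun_integrable: "L2fun M f ==> integrable M (%x. (cmod (f x))^2)"
 by (simp_all add: L2fun_def)

lemma L2norm_nonneg [simp]: "L2norm M f >= 0"
 and L2norm_power2: "(L2norm M f)\<^sup>2 = (LINT x|M. (cmod (f x))^2)"
 by (simp_all add: L2norm_def)

lemma L2fun_mult_bounded:
 assumes f: "L2fun M f" and W[measurable]: "W : borel_measurable M" and b: "!!x. x : space M ==> cmod (W x) <= k"
 shows "L2fun M (%x. W x * f x)"
proof -
 have [measurable]: "f : borel_measurable M" using f by measurable
 have "integrable M (%x. k^2 * (cmod (f x))^2)" using f by (simp add: L2fun_def)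
 then have "integrable M (%x. (cmod (W x * f x))^2)"
  by (rule Bochner_Integration.integrable_bound) (auto intro!: AE_I2 mult_right_mono power_mono b simp: norm_mult power_mult_distrib)
 then show ?thesis by (simp add: L2fun_def)
qed

lemma L2fun_cmult: "L2fun M f ==> L2fun M (%x. c * f x)"
 by (rule L2fun_mult_bounded[where k="cmod c"]) auto

lemma L2fun_scaleR: "L2fun M f ==> L2fun M (%x. c *R f x)"
 unfolding scaleR_conv_of_real by (rule L2fun_cmult)

lemma L2fun_zero [simp]: "L2fun M (%x. 0)" by (simp add: L2fun_def)

lemma L2fun_add:
 assumes "L2fun M f" "L2fun M g" shows "L2fun M (%x. f x + g x)"
proof -
 have [measurable]: "f : borel_measurable M" "g : borel_measurable M" using assms by measurable
 have "integrable M (%x. 2 * (cmod (f x))^2 + 2 * (cmod (g x))^2)" using assms by (simp add: L2fun_def)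
 then have "integrable M (%x. (cmod (f x + g x))^2)"
 proof (rule Bochner_Integration.integrable_bound)
  show "AE x in M. norm ((cmod (f x + g x))^2) <= norm (2 * (cmod (f x))^2 + 2 * (cmod (g x))^2)"
  proof (rule AE_I2)
   fix x
   have "(cmod (f x + g x))\<^sup>2 <= (cmod (f x) + cmod (g x))\<^sup>2" by (intro power_mono norm_triangle_ineq) auto
   also have "... <= 2 * (cmod (f x))^2 + 2 * (cmod (g x))^2" using sum_squares_bound[of "cmod (f x)" "cmod (g x)"] by (simp add: power2_sum)
   finally show "norm ((cmod (f x + g x))^2) <= norm (2 * (cmod (f x))^2 + 2 * (cmod (g x))^2)" by simp
  qed
 qed measurable
 then show ?thesis by (simp add: L2fun_def)
qed

lemma L2fun_diff:
 "L2fun M f ==> L2fun M g ==> L2fun M (%x. f x - g x)"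
 using L2fun_add[OF _ L2fun_cmult[where c="-1"]] by fastforce

lemma L2fun_sum:
 "finite I ==> (!!i. i : I ==> L2fun M (f i)) ==> L2fun M (%x. SUM i:I. f i x)"
 by (induction I rule: finite_induct) (auto intro: L2fun_add)

lemma integrable_norm_mult:
 assumes f: "L2fun M f" and g: "L2fun M g"
 shows "integrable M (%x. cmod (f x) * cmod (g x))"
proof -
 have [measurable]: "f : borel_measurable M" "g : borel_measurable M" using assms by measurable
 have "integrable M (%x. (cmod (f x))^2 + (cmod (g x))^2)" using assms by (simp add: L2fun_def)
 then show ?thesis
 proof (rule Bochner_Integration.integrable_bound)
  show "AE x in M. norm (cmod (f x) * cmod (g x)) <= norm ((cmod (f x))^2 + (cmod (g x))^2)"
  proof (rule AE_I2)
   fix x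
   have "cmod (f x) * cmod (g x) >= 0" by simp
   then have "cmod (f x) * cmod (g x) <= (cmod (f x))\<^sup>2 + (cmod (g x))^2"
    using sum_squares_bound[of "cmod (f x)" "cmod (g x)"] by linarith
   then show "norm (cmod (f x) * cmod (g x)) <= norm ((cmod (f x))^2 + (cmod (g x))^2)" by simp
  qed
 qed measurable
qed

lemma integrable_weighted_inner:
 assumes f: "L2fun M f" and g: "L2fun M g"
  and W[measurable]: "W : borel_measurable M" and b: "!!x. x : space M ==> \<bar>W x\<bar> <= k"
 shows "integrable M (%x. W x * (f x \<bullet> g x))"
proof -
 have [measurable]: "f : borel_measurable M" "g : borel_measurable M" using assms by measurable
 have "integrable M (%x. k * (cmod (f x) * cmod (g x)))" using integrable_norm_mult[OF f g] by simp
 then show ?thesis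
 proof (rule Bochner_Integration.integrable_bound)
  show "AE x in M. norm (W x * (f x \<bullet> g x)) <= norm (k * (cmod (f x) * cmod (g x)))"
  proof (rule AE_I2)
   fix x assume x: "x : space M"
   have "\<bar>W x * (f x \<bullet> g x)\<bar> <= k * (cmod (f x) * cmod (g x))"
    unfolding abs_mult using b[OF x] Cauchy_Schwarz_ineq2[of "f x" "g x"] by (intro mult_mono) auto
   then show "norm (W x * (f x \<bullet> g x)) <= norm (k * (cmod (f x) * cmod (g x)))" by (simp add: order_trans[OF _ abs_ge_self])
  qed
 qed measurable
qed

lemma integrable_inner:
 "L2fun M f ==> L2fun M g ==> integrable M (%x. f x \<bullet> g x)"
 using integrable_weighted_inner[where W="%_. 1" and k=1] by simp

lemma integral_norm_mult_le:
 assumes f: "L2fun M f" and g: "L2fun M g"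
 shows "(LINT x|M. cmod (f x) * cmod (g x)) <= L2norm M f * L2norm M g"
proof -
 define a b c where "a = (LINT x|M. (cmod (f x))^2)" "b = (LINT x|M. cmod (f x) * cmod (g x))" "c = (LINT x|M. (cmod (g x))^2)"
 note d = this
 have p: "0 <= c * t^2 - 2 * b * t + a" for t
 proof -
  have i: "integrable M (%x. (cmod (f x))^2)" "integrable M (%x. cmod (f x) * cmod (g x))" "integrable M (%x. (cmod (g x))^2)"
   using f g integrable_norm_mult by (auto simp: L2fun_def)
  have "0 <= (LINT x|M. (cmod (f x) - t * cmod (g x))^2)" by simp
  also have "(%x. (cmod (f x) - t * cmod (g x))^2) = (%x. (cmod (f x))^2 - (2 * t) * (cmod (f x) * cmod (g x)) + t^2 * (cmod (g x))^2)"
   by (intro ext) (simp add: power2_eq_square algebra_simps)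
  also have "(LINT x|M. (cmod (f x))^2 - (2 * t) * (cmod (f x) * cmod (g x)) + t^2 * (cmod (g x))^2) = a - 2 * t * b + t^2 * c"
   using i by (simp add: d)
  finally show ?thesis by (simp add: algebra_simps)
 qed
 have a0: "a >= 0" "c >= 0" "b >= 0" by (auto simp: d)
 have "b\<^sup>2 <= a * c"
 proof (cases "c = 0")
  case True
  have "b = 0"
  proof (rule ccontr)
   assume "b \<noteq> 0"
   then have "b > 0" using a0 by simp
   then show False using p[of "(a + 1) / (2 * b)"] True by simp
  qed
  then show ?thesis using a0 by simp
 next
  case False
  then have c: "c > 0" using a0 by simp
  have "0 <= c * (c * (b / c)^2 - 2 * b * (b / c) + a)" using p[of "b / c"] c by simp
  also have "... = a * c - b\<^sup>2" using c by (simp add: field_simps power2_eq_square)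
  finally show ?thesis by simp
 qed
 then have "b <= sqrt (a * c)" by (rule real_le_rsqrt)
 then show ?thesis by (simp add: d L2norm_def real_sqrt_mult)
qed

lemma weighted_inner_bound:
 assumes f: "L2fun M f" and g: "L2fun M g"
  and W: "W : borel_measurable M" and b: "!!x. x : space M ==> \<bar>W x\<bar> <= k"
 shows "\<bar>LINT x|M. W x * (f x \<bullet> g x)\<bar> <= k * (L2norm M f * L2norm M g)"
proof (cases "space M = {}")
 case True
 then have "(LINT x|M. h x) = (0::real)" for h
  by (subst Bochner_Integration.integral_cong[where g="%_. 0"]) auto
 then show ?thesis by (simp add: L2norm_def)
next
 case False
 then have k: "k >= 0" using b by (meson abs_ge_zero all_not_in_conv order_trans)
 have "\<bar>LINT x|M. W x * (f x \<bullet> g x)\<bar> <= (LINT x|M. \<bar>W x * (f x \<bullet> g x)\<bar>)"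
  using integral_norm_bound[of M "%x. W x * (f x \<bullet> g x)"] by simp
 also have "... <= (LINT x|M. k * (cmod (f x) * cmod (g x)))"
 proof (rule Bochner_Integration.integral_mono)
  show "integrable M (%x. \<bar>W x * (f x \<bullet> g x)\<bar>)" using integrable_weighted_inner[OF assms] by simp
  show "integrable M (%x. k * (cmod (f x) * cmod (g x)))" using integrable_norm_mult[OF f g] by simp
  show "\<bar>W x * (f x \<bullet> g x)\<bar> <= k * (cmod (f x) * cmod (g x))" if "x : space M" for x
   unfolding abs_mult using b[OF that] Cauchy_Schwarz_ineq2[of "f x" "g x"] k by (intro mult_mono) auto
 qed
 also have "... = k * (LINT x|M. cmod (f x) * cmod (g x))" by simp
 also have "... <= k * (L2norm M f * L2norm M g)" using integral_norm_mult_le[OF f g] k by (intro mult_left_mono)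
 finally show ?thesis .
qed

lemma inner_bound:
 "L2fun M f ==> L2fun M g ==> \<bar>LINT x|M. f x \<bullet> g x\<bar> <= L2norm M f * L2norm M g"
 using weighted_inner_bound[where W="%_. 1" and k=1] by simp

lemma L2norm_add_square:
 assumes "L2fun M f" "L2fun M g"
 shows "(L2norm M (%x. f x + g x))\<^sup>2 = (L2norm M f)^2 + 2 * (LINT x|M. f x \<bullet> g x) + (L2norm M g)^2"
proof -
 have e: "(cmod (f x + g x))\<^sup>2 = (cmod (f x))^2 + 2 * (f x \<bullet> g x) + (cmod (g x))^2" for x
  by (simp add: dot_square_norm[symmetric] inner_add_left inner_add_right inner_commute)
 show ?thesis unfolding L2norm_power2 e
  using assms integrable_inner[OF assms] by (simp add: L2fun_def)
qed

lemma L2norm_triangle: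
 assumes "L2fun M f" "L2fun M g"
 shows "L2norm M (%x. f x + g x) <= L2norm M f + L2norm M g"
proof (rule power2_le_imp_le)
 have "(LINT x|M. f x \<bullet> g x) <= L2norm M f * L2norm M g" using inner_bound[OF assms] by simp
 then show "(L2norm M (%x. f x + g x))\<^sup>2 <= (L2norm M f + L2norm M g)\<^sup>2"
  unfolding L2norm_add_square[OF assms] by (simp add: power2_sum)
qed simp

lemma L2norm_scaleR: "L2norm M (%x. c *R f x) = \<bar>c\<bar> * L2norm M f"
 by (simp add: L2norm_def power_mult_distrib real_sqrt_mult)

lemma L2norm_mult_bounded:
 assumes f: "L2fun M f" and W: "W : borel_measurable M" and b: "!!x. x : space M ==> cmod (W x) <= k" and k: "k >= 0"
 shows "L2norm M (%x. W x * f x) <= k * L2norm M f"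
proof -
 have "(LINT x|M. (cmod (W x * f x))^2) <= (LINT x|M. k^2 * (cmod (f x))^2)"
  using f L2fun_mult_bounded[OF f W b]
  by (intro Bochner_Integration.integral_mono) (auto simp: L2fun_def norm_mult power_mult_distrib intro!: mult_right_mono power_mono b)
 then have "L2norm M (%x. W x * f x) <= sqrt (k^2 * (LINT x|M. (cmod (f x))^2))"
  unfolding L2norm_def by simp
 then show ?thesis using k by (simp add: L2norm_def real_sqrt_mult)
qed

lemma L2norm_minus_commute: "L2norm M (%x. f x - g x) = L2norm M (%x. g x - f x)"
 by (simp add: L2norm_def norm_minus_commute)

lemma L2norm_triangle_diff:
 assumes "L2fun M f" "L2fun M g" "L2fun M h"
 shows "L2norm M (%x. f x - h x) <= L2norm M (%x. f x - g x) + L2norm M (%x. g x - h x)"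
 using L2norm_triangle[of M "%x. f x - g x" "%x. g x - h x"] assms by (simp add: L2fun_diff)

lemma L2norm_sum_le:
 assumes "finite I" "!!i. i : I ==> L2fun M (f i)"
 shows "L2norm M (%x. SUM i:I. f i x) <= (SUM i:I. L2norm M (f i))"
 using assms
proof (induction I rule: finite_induct)
 case (insert i I)
 then have "L2norm M (%x. f i x + (SUM i:I. f i x)) <= L2norm M (f i) + L2norm M (%x. SUM i:I. f i x)"
  by (intro L2norm_triangle L2fun_sum) auto
 then show ?case using insert by simp
qed (simp add: L2norm_def)

lemma L2_tendsto_iff: "((%i. L2norm M (f i)) ---> 0) F \<longleftrightarrow> ((%i. LINT x|M. (cmod (f i x))^2) ---> 0) F"
proof
 assume "((%i. L2norm M (f i)) ---> 0) F"
 from tendsto_power[OF this, of 2] show "((%i. LINT x|M. (cmod (f i x))^2) ---> 0) F" by (simp add: L2norm_power2)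
next
 assume "((%i. LINT x|M. (cmod (f i x))^2) ---> 0) F"
 from tendsto_real_sqrt[OF this] show "((%i. L2norm M (f i)) ---> 0) F" by (simp add: L2norm_def)
qed

lemma weighted_inner_tendsto:
 assumes f: "!!i. L2fun M (f i)" "L2fun M f0" "((%i. L2norm M (%x. f i x - f0 x)) ---> 0) F"
  and g: "!!i. L2fun M (g i)" "L2fun M g0" "((%i. L2norm M (%x. g i x - g0 x)) ---> 0) F"
  and W: "W : borel_measurable M" "!!x. x : space M ==> \<bar>W x\<bar> <= k"
 shows "((%i. LINT x|M. W x * (f i x \<bullet> g i x)) ---> (LINT x|M. W x * (f0 x \<bullet> g0 x))) F"
proof -
 have k: "\<bar>W x\<bar> <= \<bar>k\<bar>" if "x : space M" for x using W(2)[OF that] by simp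
 have b: "\<bar>(LINT x|M. W x * (f i x \<bullet> g i x)) - (LINT x|M. W x * (f0 x \<bullet> g0 x))\<bar>
   <= \<bar>k\<bar> * (L2norm M (%x. f i x - f0 x) * (L2norm M (%x. g i x - g0 x) + L2norm M g0) + L2norm M f0 * L2norm M (%x. g i x - g0 x))" for i
 proof -
  have i: "integrable M (%x. W x * (f' x \<bullet> g' x))" if "L2fun M f'" "L2fun M g'" for f' g'
   by (rule integrable_weighted_inner[OF that W(1) k])
  have "(LINT x|M. W x * (f i x \<bullet> g i x)) - (LINT x|M. W x * (f0 x \<bullet> g0 x))
   = (LINT x|M. W x * ((f i x - f0 x) \<bullet> g i x)) + (LINT x|M. W x * (f0 x \<bullet> (g i x - g0 x)))"
  proof -
   have e: "W x * ((f i x - f0 x) \<bullet> g i x) = W x * (f i x \<bullet> g i x) - W x * (f0 x \<bullet> g i x)"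
    "W x * (f0 x \<bullet> (g i x - g0 x)) = W x * (f0 x \<bullet> g i x) - W x * (f0 x \<bullet> g0 x)" for x
    by (simp_all add: inner_diff_left inner_diff_right right_diff_distrib)
   show ?thesis unfolding e using i f g by simp
  qed
  moreover have "\<bar>LINT x|M. W x * ((f i x - f0 x) \<bullet> g i x)\<bar> <= \<bar>k\<bar> * (L2norm M (%x. f i x - f0 x) * L2norm M (g i))"
   using f g by (intro weighted_inner_bound L2fun_diff W(1) k) auto
  moreover have "L2norm M (g i) <= L2norm M (%x. g i x - g0 x) + L2norm M g0"
   using L2norm_triangle[of M "%x. g i x - g0 x" g0] g by (simp add: L2fun_diff)
  then have "\<bar>k\<bar> * (L2norm M (%x. f i x - f0 x) * L2norm M (g i)) <= \<bar>k\<bar> * (L2norm M (%x. f i x - f0 x) * (L2norm M (%x. g i x - g0 x) + L2norm M g0))"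
   by (intro mult_left_mono) auto
  moreover have "\<bar>LINT x|M. W x * (f0 x \<bullet> (g i x - g0 x))\<bar> <= \<bar>k\<bar> * (L2norm M f0 * L2norm M (%x. g i x - g0 x))"
   using f g by (intro weighted_inner_bound L2fun_diff W(1) k) auto
  ultimately show ?thesis by (simp add: distrib_left abs_le_iff)
 qed
 have "((%i. \<bar>k\<bar> * (L2norm M (%x. f i x - f0 x) * (L2norm M (%x. g i x - g0 x) + L2norm M g0) + L2norm M f0 * L2norm M (%x. g i x - g0 x))) --->
   \<bar>k\<bar> * (0 * (0 + L2norm M g0) + L2norm M f0 * 0)) F"
  by (intro tendsto_intros f g)
 then have lim: "((%i. \<bar>k\<bar> * (L2norm M (%x. f i x - f0 x) * (L2norm M (%x. g i x - g0 x) + L2norm M g0) + L2norm M f0 * L2norm M (%x. g i x - g0 x))) ---> 0) F"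
  by simp
 show ?thesis
  by (rule Lim_null[THEN iffD2], rule Lim_null_comparison[OF always_eventually lim]) (use b in simp)
qed

lemmas inner_tendsto = weighted_inner_tendsto[where W="%_. 1" and k=1, simplified]

text \<open>Riesz-Fischer. A sequence of indices with differences below 2^-k converges almost
  everywhere, and Fatou's lemma turns the Cauchy bound into convergence of the full sequence to that
  limit.\<close>

lemma L2_complete:
 fixes f :: "nat => 'b => complex"
 assumes f: "!!n. L2fun M (f n)"
  and cauchy: "!!e. e > 0 ==> EX N. ALL m>=N. ALL n>=N. L2norm M (%x. f m x - f n x) < e"
 obtains g where "L2fun M g" "(%n. L2norm M (%x. f n x - g x)) ----> 0"
proof -
 have [measurable]: "f n : borel_measurable M" for n using f by measurable
 have "ALL k. EX N. ALL m>=N. ALL n>=N. L2norm M (%x. f m x - f n x) < (1/2) ^ k" using cauchy by simp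
 then obtain N where N: "!!k m n. m >= N k ==> n >= N k ==> L2norm M (%x. f m x - f n x) < (1/2) ^ k" by metis
 \<comment> \<open>Partial sums dominate every earlier N j, which N k itself might not.\<close>
 define \<nu> where "\<nu> k = (\<Sum>i\<le>k. N i)" for k
 have \<nu>: "N j <= \<nu> k" if "j <= k" for j k unfolding \<nu>_def using that by (intro member_le_sum) auto
 define \<phi> where "\<phi> k = f (\<nu> k)" for k
 have nn: "(\<integral>\<^sup>+x. ennreal ((cmod (f m x - f n x))^2) \<partial>M) = ennreal ((L2norm M (%x. f m x - f n x))^2)" for m n
  unfolding L2norm_power2 using L2fun_diff[OF f f, of m n]
  by (intro nn_integral_eq_integral) (auto simp: L2fun_def)
 \<comment> \<open>The squared differences have integrals at most 4^-k, so the weight 2^k still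
   leaves a convergent series. Where its sum is finite, the differences are bounded by a geometric
   sequence.\<close>
 have conv: "AE x in M. convergent (%k. \<phi> k x)"
 proof -
  have "(\<integral>\<^sup>+x. (\<Sum>k. ennreal (2 ^ k * (cmod (\<phi> (Suc k) x - \<phi> k x))^2)) \<partial>M)
    = (\<Sum>k. \<integral>\<^sup>+x. ennreal (2 ^ k * (cmod (\<phi> (Suc k) x - \<phi> k x))^2) \<partial>M)"
   unfolding \<phi>_def by (rule nn_integral_suminf) measurable
  also have "... <= (\<Sum>k. ennreal ((1/2) ^ k))"
  proof (rule suminf_le)
   fix k
   have "(L2norm M (%x. f (\<nu> (Suc k)) x - f (\<nu> k) x))\<^sup>2 <= ((1/2) ^ k)\<^sup>2"
    using N[of k "\<nu> (Suc k)" "\<nu> k"] \<nu>[of k "Suc k"] \<nu>[of k k] by (intro power_mono) auto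
   then have "2 ^ k * (L2norm M (%x. f (\<nu> (Suc k)) x - f (\<nu> k) x))^2 <= 2 ^ k * ((1/2) ^ k)^2" by simp
   also have "... = (1/2) ^ k" by (simp add: power2_eq_square power_divide)
   finally have *: "2 ^ k * (L2norm M (%x. f (\<nu> (Suc k)) x - f (\<nu> k) x))^2 <= (1/2) ^ k" .
   show "(\<integral>\<^sup>+x. ennreal (2 ^ k * (cmod (\<phi> (Suc k) x - \<phi> k x))^2) \<partial>M) <= ennreal ((1/2) ^ k)"
   proof -
    have "(\<integral>\<^sup>+x. ennreal (2 ^ k * (cmod (\<phi> (Suc k) x - \<phi> k x))^2) \<partial>M) = (\<integral>\<^sup>+x. ennreal (2 ^ k) * ennreal ((cmod (\<phi> (Suc k) x - \<phi> k x))^2) \<partial>M)"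
     by (intro nn_integral_cong ennreal_mult) auto
    also have "... = ennreal (2 ^ k) * (\<integral>\<^sup>+x. ennreal ((cmod (\<phi> (Suc k) x - \<phi> k x))^2) \<partial>M)"
     unfolding \<phi>_def by (rule nn_integral_cmult) measurable
    also have "... = ennreal (2 ^ k * (L2norm M (%x. f (\<nu> (Suc k)) x - f (\<nu> k) x))^2)"
     unfolding \<phi>_def nn by (rule ennreal_mult[symmetric]) auto
    also have "... <= ennreal ((1/2) ^ k)" using * by (rule ennreal_leI)
    finally show ?thesis .
   qed
  qed auto
  also have "... = ennreal (\<Sum>k. (1/2) ^ k)" by (rule suminf_ennreal2) (auto intro: summable_geometric)
  also have "... < top" by simp
  finally have "(\<integral>\<^sup>+x. (\<Sum>k. ennreal (2 ^ k * (cmod (\<phi> (Suc k) x - \<phi> k x))^2)) \<partial>M) \<noteq> \<infinity>" by simp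
  then have "AE x in M. (\<Sum>k. ennreal (2 ^ k * (cmod (\<phi> (Suc k) x - \<phi> k x))^2)) \<noteq> \<infinity>"
   by (rule nn_integral_PInf_AE[rotated]) (unfold \<phi>_def, measurable)
  then show ?thesis
  proof eventually_elim
   case (elim x)
   define d where "d k = \<phi> (Suc k) x - \<phi> k x" for k
   define C where "C = enn2real (\<Sum>k. ennreal (2 ^ k * (cmod (d k))^2))"
   have "(\<Sum>k. ennreal (2 ^ k * (cmod (d k))^2)) \<noteq> top" using elim by (simp only: d_def infinity_ennreal_def simp_thms)
   then have C: "(\<Sum>k. ennreal (2 ^ k * (cmod (d k))^2)) = ennreal C" "C >= 0"
    unfolding C_def by (simp_all add: less_top)
   have "cmod (d k) <= sqrt C * sqrt (1/2) ^ k" for k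
   proof -
    have "ennreal (2 ^ k * (cmod (d k))^2) <= ennreal C"
    proof -
     have "(SUM k:{k}. ennreal (2 ^ k * (cmod (d k))^2)) <= (\<Sum>k. ennreal (2 ^ k * (cmod (d k))^2))"
      by (rule sum_le_suminf) (rule summableI, simp_all)
     then show ?thesis unfolding C(1) by simp
    qed
    then have "2 ^ k * (cmod (d k))^2 <= C" using C(2) by simp
    then have "(cmod (d k))\<^sup>2 <= C * (1/2) ^ k" by (simp add: field_simps power_divide)
    then have "cmod (d k) <= sqrt (C * (1/2) ^ k)" by (rule real_le_rsqrt)
    then show ?thesis by (simp only: real_sqrt_mult real_sqrt_power)
   qed
   moreover have "summable (%k. sqrt C * sqrt (1/2) ^ k)"
    by (intro summable_mult summable_geometric) (simp add: real_sqrt_lt_1_iff)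
   ultimately have "summable d" using summable_comparison_test[of d "%k. sqrt C * sqrt (1/2) ^ k"] by blast
   then have "convergent (%n. (\<Sum>k<n. d k) + \<phi> 0 x)"
    by (intro convergent_add convergent_const) (simp add: summable_iff_convergent)
   moreover have "(\<Sum>k<n. d k) + \<phi> 0 x = \<phi> n x" for n
    unfolding d_def by (subst sum_lessThan_telescope) simp
   ultimately show ?case by simp
  qed
 qed
 define g where "g x = lim (%k. \<phi> k x)" for x
 have [measurable]: "g : borel_measurable M" unfolding g_def[abs_def] \<phi>_def by (rule borel_measurable_lim_metric) measurable
 have bound: "(\<integral>\<^sup>+x. ennreal ((cmod (f n x - g x))^2) \<partial>M) <= ennreal (((1/2) ^ j)^2)" if n: "n >= N j" for n j
 proof -
  have "(\<integral>\<^sup>+x. ennreal ((cmod (f n x - g x))^2) \<partial>M) = (\<integral>\<^sup>+x. liminf (%k. ennreal ((cmod (f n x - \<phi> k x))^2)) \<partial>M)"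
  proof (rule nn_integral_cong_AE)
   show "AE x in M. ennreal ((cmod (f n x - g x))^2) = liminf (%k. ennreal ((cmod (f n x - \<phi> k x))^2))"
    using conv
   proof eventually_elim
    case (elim x)
    then have "(%k. \<phi> k x) ----> g x" unfolding g_def by (simp add: convergent_LIMSEQ_iff)
    then have "(%k. ennreal ((cmod (f n x - \<phi> k x))^2)) ----> ennreal ((cmod (f n x - g x))^2)"
     by (intro tendsto_intros)
    then show ?case by (rule lim_imp_Liminf[OF sequentially_bot, symmetric])
   qed
  qed
  also have "... <= liminf (%k. \<integral>\<^sup>+x. ennreal ((cmod (f n x - \<phi> k x))^2) \<partial>M)"
   unfolding \<phi>_def by (rule nn_integral_liminf) measurable
  also have "... <= liminf (%k::nat. ennreal (((1/2) ^ j)^2))"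
  proof (rule Liminf_mono)
   show "\<forall>\<^sub>F k in sequentially. (\<integral>\<^sup>+x. ennreal ((cmod (f n x - \<phi> k x))^2) \<partial>M) <= ennreal (((1/2) ^ j)^2)"
    using eventually_ge_at_top[of j]
   proof eventually_elim
    case (elim k)
    show ?case unfolding \<phi>_def nn using N[OF n, of "\<nu> k"] \<nu>[OF elim] by (intro ennreal_leI power_mono) auto
   qed
  qed
  finally show ?thesis by (simp add: Liminf_const)
 qed
 have sq: "L2fun M (%x. f n x - g x) & L2norm M (%x. f n x - g x) <= (1/2) ^ j" if n: "n >= N j" for n j
 proof -
  have i: "integrable M (%x. (cmod (f n x - g x))^2)"
  proof (rule integrableI_bounded)
   show "(\<integral>\<^sup>+x. ennreal (norm ((cmod (f n x - g x))^2)) \<partial>M) < \<infinity>"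
    using le_less_trans[OF bound[OF n] ennreal_less_top] by simp
  qed measurable
  then have "ennreal (LINT x|M. (cmod (f n x - g x))^2) <= ennreal (((1/2) ^ j)^2)"
   using bound[OF n] by (simp add: nn_integral_eq_integral)
  then have "(L2norm M (%x. f n x - g x))\<^sup>2 <= ((1/2) ^ j)\<^sup>2" by (simp add: L2norm_power2)
  then have "L2norm M (%x. f n x - g x) <= (1/2) ^ j" by (rule power2_le_imp_le) simp
  then show ?thesis using i by (simp add: L2fun_def)
 qed
 show ?thesis
 proof (rule that[of g])
  show "L2fun M g"
   using L2fun_diff[OF f[of "N 0"] conjunct1[OF sq[of 0 "N 0"]]] by simp
  show "(%n. L2norm M (%x. f n x - g x)) ----> 0"
  proof (rule LIMSEQ_I)
   fix e :: real assume "e > 0"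
   then obtain j where "(1/2) ^ j < e" using real_arch_pow_inv[of e "1/2"] by auto
   then show "EX no. ALL n>=no. norm (L2norm M (%x. f n x - g x) - 0) < e"
   proof (intro exI[of _ "N j"] allI impI)
    fix n assume "n >= N j"
    from conjunct2[OF sq[OF this]] \<open>(1/2) ^ j < e\<close> show "norm (L2norm M (%x. f n x - g x) - 0) < e" by simp
   qed
  qed
 qed
qed

subsection \<open>Mollification\<close>

text \<open>exp(-1/t) divided by powers of t: derivatives are linear combinations of members of the
  family, and each member tends to 0 at the origin.\<close>

definition flat :: "nat => real => real"
 where "flat k t = (if t > 0 then exp (- (1 / t)) / t ^ k else 0)"

lemma flat_tendsto_zero: "(flat k ---> 0) (at 0)"
proof -
 have "((%x. x ^ k / exp x) ---> 0) (at_top :: real filter)" by (rule tendsto_power_div_exp_0)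
 then have "((%t. (1 / t) ^ k / exp (1 / t)) ---> (0::real)) (at_right 0)"
  by (subst (asm) filterlim_at_top_to_right) (simp add: inverse_eq_divide)
 moreover have "\<forall>\<^sub>F t in at_right 0. (1 / t) ^ k / exp (1 / t) = flat k t"
  using eventually_at_right_less[of "0::real"]
  by eventually_elim (simp add: flat_def exp_minus power_one_over field_simps)
 ultimately have r: "(flat k ---> 0) (at_right 0)" by (rule Lim_transform_eventually)
 have "\<forall>\<^sub>F t in at_left 0. (0::real) = flat k t"
  using eventually_at_left_real[of "-1" "0::real"] by (auto elim!: eventually_mono simp: flat_def)
 then have l: "(flat k ---> 0) (at_left 0)" by (rule Lim_transform_eventually[OF tendsto_const])
 show ?thesis by (rule filterlim_split_at_real[OF l r])
qed

lemma flat_deriv: "(flat k has_real_derivative (flat (k + 2) t - real k * flat (k + 1) t)) (at t)"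
proof -
 consider "t > 0" | "t < 0" | "t = 0" by linarith
 then show ?thesis
 proof cases
  case 1
  have "((%t. exp (- (1 / t)) / t ^ k) has_real_derivative (flat (k + 2) t - real k * flat (k + 1) t)) (at t)"
  proof -
   have "((%t. exp (- (1 / t))) has_real_derivative exp (- (1 / t)) * (1 / t^2)) (at t)"
    using 1 by (auto intro!: derivative_eq_intros simp: power2_eq_square)
   moreover have "t ^ k \<noteq> 0" using 1 by simp
   ultimately have "((%t. exp (- (1 / t)) / t ^ k) has_real_derivative
     (exp (- (1 / t)) * (1 / t^2) * t ^ k - exp (- (1 / t)) * (real k * t ^ (k - Suc 0))) / (t ^ k * t ^ k)) (at t)"
    by (intro DERIV_divide DERIV_pow)
   moreover have "(exp (- (1 / t)) * (1 / t^2) * t ^ k - exp (- (1 / t)) * (real k * t ^ (k - Suc 0))) / (t ^ k * t ^ k)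
     = flat (k + 2) t - real k * flat (k + 1) t"
    using 1 by (cases k) (simp_all add: flat_def field_simps power2_eq_square)
   ultimately show ?thesis by simp
  qed
  then show ?thesis
   by (rule has_field_derivative_transform_within_open[where S="{0<..}"]) (use 1 in \<open>auto simp: flat_def\<close>)
 next
  case 2
  then have e: "flat (k + 2) t - real k * flat (k + 1) t = 0" by (simp add: flat_def)
  show ?thesis unfolding e
   by (rule has_field_derivative_transform_within_open[where S="{..<0}" and f="%_. 0"]) (use 2 in \<open>auto simp: flat_def\<close>)
 next
  case 3
  have e: "(%h. (flat k (t + h) - flat k t) / h) = flat (k + 1)" using 3 by (auto simp: flat_def)
  have z: "flat (k + 2) t - real k * flat (k + 1) t = 0" using 3 by (simp add: flat_def)
  show ?thesis unfolding DERIV_def e z by (rule flat_tendsto_zero)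
 qed
qed

text \<open>A class of functions supported in the closed ball of radius e which contains the
  mollifier and is closed under directional derivatives. Smoothness of every order then follows by
  induction, without formulas for higher derivatives.\<close>

inductive bump_fun :: "real => ('a::euclidean_space => real) => bool" for e where
 base: "bump_fun e (%w. flat k (e^2 - w \<bullet> w))"
| mult: "bump_fun e g ==> bump_fun e (%w. (w \<bullet> v) * g w)"
| add: "bump_fun e g ==> bump_fun e h ==> bump_fun e (%w. g w + h w)"
| scale: "bump_fun e g ==> bump_fun e (%w. c * g w)"

lemma bump_fun_derivative:
 assumes "bump_fun e g"
 obtains g' where "!!w. (g has_derivative g' w) (at w)" "!!v. bump_fun e (%w. g' w v)"
proof -
 have "EX g'. (ALL w. (g has_derivative g' w) (at w)) & (ALL v. bump_fun e (%w. g' w v))"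
  using assms
 proof induction
  case (base k)
  define g' where "g' w v = (flat (k + 2) (e^2 - w \<bullet> w) - real k * flat (k + 1) (e^2 - w \<bullet> w)) * (- (2 * (w \<bullet> v)))" for w v :: 'a
  have "((%w. flat k (e^2 - w \<bullet> w)) has_derivative g' w) (at w)" for w :: 'a
  proof -
   have "((%w. e^2 - w \<bullet> w) has_derivative (%v. - (2 * (w \<bullet> v)))) (at w)"
    by (auto intro!: derivative_eq_intros simp: inner_commute)
   from has_derivative_compose[OF this, of "flat k" "(*) (flat (k + 2) (e^2 - w \<bullet> w) - real k * flat (k + 1) (e^2 - w \<bullet> w))"]
   show ?thesis using flat_deriv by (simp add: has_field_derivative_def g'_def[abs_def])
  qed
  moreover have "bump_fun e (%w. g' w v)" for v
  proof -
   have "bump_fun e (%w. (- 2) * ((w \<bullet> v) * (flat (k + 2) (e^2 - w \<bullet> w) + (- real k) * flat (k + 1) (e^2 - w \<bullet> w))))"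
    by (intro bump_fun.intros)
   then show ?thesis by (rule back_subst) (auto simp: g'_def algebra_simps)
  qed
  ultimately show ?case by blast
 next
  case (mult g v)
  then obtain g' where g': "!!w. (g has_derivative g' w) (at w)" "!!v. bump_fun e (%w. g' w v)" by blast
  have "((%w. (w \<bullet> v) * g w) has_derivative (%x. (w \<bullet> v) * g' w x + (x \<bullet> v) * g w)) (at w)" for w
   by (auto intro!: derivative_eq_intros g' simp: algebra_simps)
  moreover have "bump_fun e (%w. (w \<bullet> v) * g' w x + (x \<bullet> v) * g w)" for x
   by (intro bump_fun.intros g' mult.hyps)
  ultimately show ?case by (intro exI[of _ "%w x. (w \<bullet> v) * g' w x + (x \<bullet> v) * g w"] conjI allI)
 next
  case (add g h)
  then obtain g' h' where g': "!!w. (g has_derivative g' w) (at w)" "!!v. bump_fun e (%w. g' w v)"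
   "!!w. (h has_derivative h' w) (at w)" "!!v. bump_fun e (%w. h' w v)" by blast
  have "((%w. g w + h w) has_derivative (%x. g' w x + h' w x)) (at w)" for w
   by (intro has_derivative_add g')
  moreover have "bump_fun e (%w. g' w x + h' w x)" for x by (intro bump_fun.intros g')
  ultimately show ?case by (intro exI[of _ "%w x. g' w x + h' w x"] conjI allI)
 next
  case (scale g c)
  then obtain g' where g': "!!w. (g has_derivative g' w) (at w)" "!!v. bump_fun e (%w. g' w v)" by blast
  have "((%w. c * g w) has_derivative (%x. c * g' w x)) (at w)" for w
   by (intro has_derivative_mult_right g')
  moreover have "bump_fun e (%w. c * g' w x)" for x by (intro bump_fun.intros g')
  ultimately show ?case by (intro exI[of _ "%w x. c * g' w x"] conjI allI)
 qed
 then show ?thesis using that by blast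
qed

lemma bump_fun_support:
 assumes "bump_fun e g" "e > 0" "norm w >= e" shows "g w = 0"
 using assms(1)
proof induction
 case (base k)
 have "e\<^sup>2 <= (norm w)\<^sup>2" using assms(2,3) by (intro power_mono) auto
 then show ?case by (simp add: flat_def dot_square_norm)
qed auto

lemma bump_fun_continuous: "bump_fun e g ==> continuous_on UNIV g"
 by (metis bump_fun_derivative continuous_at_imp_continuous_on has_derivative_continuous)

lemma bump_fun_measurable: "bump_fun e g ==> g : borel_measurable borel"
 by (intro borel_measurable_continuous_onI bump_fun_continuous)

lemma bump_fun_bounded:
 assumes "bump_fun e (g :: 'a::euclidean_space => real)" "e > 0"
 obtains B where "B >= 0" "!!w. \<bar>g w\<bar> <= B"
proof -
 have "bounded (g ` cball 0 e)"
  using continuous_on_subset[OF bump_fun_continuous[OF assms(1)]] by (intro compact_imp_bounded compact_continuous_image) auto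
 then obtain B where B: "ALL y:g ` cball 0 e. norm y <= B" unfolding bounded_iff by blast
 show ?thesis
 proof (rule that[of "\<bar>B\<bar>"])
  show "\<bar>g w\<bar> <= \<bar>B\<bar>" for w
  proof (cases "norm w <= e")
   case True
   then have "\<bar>g w\<bar> <= B" using B by auto
   then show ?thesis by simp
  qed (use bump_fun_support[OF assms, of w] in auto)
 qed simp
qed

lemma bump_fun_mvt:
 fixes g :: "'a::euclidean_space => real"
 assumes d: "!!w. (g has_derivative g' w) (at w)"
 obtains t where "0 < t" "t < 1" "g (w + k) - g w = g' (w + t *R k) k"
proof -
 have "EX t>0. t < 1 & g (w + 1 *R k) - g (w + 0 *R k) = (1 - 0) * g' (w + t *R k) k"
 proof (rule MVT2)
  show "((%t. g (w + t *R k)) has_real_derivative g' (w + t *R k) k) (at t)" for t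
  proof -
   have "((%t. g (w + t *R k)) has_derivative (%h. g' (w + t *R k) (h *R k))) (at t)"
    by (rule has_derivative_compose[OF _ d]) (auto intro!: derivative_eq_intros)
   then show ?thesis using linear_scale[OF has_derivative_linear[OF d]] by (simp add: has_field_derivative_def mult_commute_abs)
  qed
 qed simp
 then show ?thesis using that by auto
qed

lemma linear_euclidean_bound:
 fixes f :: "'a::euclidean_space => real"
 assumes "linear f" shows "\<bar>f k\<bar> <= norm k * (SUM i:Basis. \<bar>f i\<bar>)"
proof -
 have "f (SUM i:Basis. (k \<bullet> i) *R i) = (SUM i:Basis. (k \<bullet> i) * f i)"
  using assms by (simp add: linear_sum linear_scale)
 then have "\<bar>f k\<bar> = \<bar>SUM i:Basis. (k \<bullet> i) * f i\<bar>" by (simp add: euclidean_representation)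
 also have "... <= (SUM i:Basis. \<bar>(k \<bullet> i) * f i\<bar>)" by (rule sum_abs)
 also have "... <= (SUM i:Basis. norm k * \<bar>f i\<bar>)"
  by (intro sum_mono) (auto simp: abs_mult intro!: mult_right_mono Basis_le_norm)
 finally show ?thesis by (simp add: sum_distrib_left)
qed

lemma bump_fun_lipschitz:
 assumes g: "bump_fun e (g :: 'a::euclidean_space => real)" "e > 0"
 obtains L where "L >= 0" "!!w k. \<bar>g (w + k) - g w\<bar> <= L * norm k"
proof -
 obtain g' where g': "!!w. (g has_derivative g' w) (at w)" "!!v. bump_fun e (%w. g' w v)" using bump_fun_derivative[OF g(1)] by blast
 have "ALL i. EX B>=0. ALL w. \<bar>g' w i\<bar> <= B" using bump_fun_bounded[OF g'(2) g(2)] by metis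
 then obtain B where B: "!!i. B i >= 0" "!!i w. \<bar>g' w i\<bar> <= B i" by metis
 show ?thesis
 proof (rule that[of "SUM i:Basis. B i"])
  fix w k
  obtain t where t: "g (w + k) - g w = g' (w + t *R k) k" using bump_fun_mvt[OF g'(1)] by blast
  have "\<bar>g' (w + t *R k) k\<bar> <= norm k * (SUM i:Basis. \<bar>g' (w + t *R k) i\<bar>)"
   by (rule linear_euclidean_bound[OF has_derivative_linear[OF g'(1)]])
  also have "... <= norm k * (SUM i:Basis. B i)" by (intro mult_left_mono sum_mono B) auto
  finally show "\<bar>g (w + k) - g w\<bar> <= (SUM i:Basis. B i) * norm k" by (simp add: t mult.commute)
 qed (auto intro: sum_nonneg B)
qed

text \<open>The first-order Taylor remainder is quadratic uniformly in the base point. Integrated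
  against |F| it bounds the remainder of a convolution, which is how convolutions are
  differentiated.\<close>

lemma bump_fun_remainder:
 assumes g: "bump_fun e (g :: 'a::euclidean_space => real)" "e > 0"
  and g': "!!w. (g has_derivative g' w) (at w)" "!!v. bump_fun e (%w. g' w v)"
 obtains M where "M >= 0" "!!w k. \<bar>g (w + k) - g w - g' w k\<bar> <= M * (norm k)^2"
proof -
 have "ALL i. EX L>=0. ALL w k. \<bar>g' (w + k) i - g' w i\<bar> <= L * norm k" using bump_fun_lipschitz[OF g'(2) g(2)] by metis
 then obtain L where L: "!!i. L i >= 0" "!!i w k. \<bar>g' (w + k) i - g' w i\<bar> <= L i * norm k" by metis
 show ?thesis
 proof (rule that[of "SUM i:Basis. L i"])
  fix w k
  obtain t where t: "0 < t" "t < 1" "g (w + k) - g w = g' (w + t *R k) k" using bump_fun_mvt[OF g'(1)] by blast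
  have "linear (%v. g' (w + t *R k) v - g' w v)"
   by (intro linear_compose_sub has_derivative_linear[OF g'(1)])
  from linear_euclidean_bound[OF this, of k]
  have "\<bar>g' (w + t *R k) k - g' w k\<bar> <= norm k * (SUM i:Basis. \<bar>g' (w + t *R k) i - g' w i\<bar>)" .
  also have "... <= norm k * (SUM i:Basis. L i * norm k)"
  proof (intro mult_left_mono sum_mono)
   fix i
   have "\<bar>g' (w + t *R k) i - g' w i\<bar> <= L i * norm (t *R k)" by (rule L)
   also have "... <= L i * norm k" using t L(1)[of i] by (intro mult_left_mono) (auto intro: mult_left_le_one_le)
   finally show "\<bar>g' (w + t *R k) i - g' w i\<bar> <= L i * norm k" .
  qed simp
  finally show "\<bar>g (w + k) - g w - g' w k\<bar> <= (SUM i:Basis. L i) * (norm k)^2"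
   by (simp add: t(3) sum_distrib_right[symmetric] power2_eq_square mult_ac)
 qed (auto intro: sum_nonneg L)
qed

section \<open>Convolution with bump functions and convergence in the mean square\<close>

definition convol :: "('a::euclidean_space => real) => ('a => complex) => 'a => complex"
 where "convol g F x = (LINT y|lborel. g (x - y) *R F y)"

lemma convol_integrable:
 fixes F :: "'a::euclidean_space => complex"
 assumes g: "bump_fun e g" "e > 0" and F: "integrable lborel F"
 shows "integrable lborel (%y. g (x - y) *R F y)"
proof -
 have [measurable]: "F : borel_measurable borel" "g : borel_measurable borel" using F bump_fun_measurable[OF g(1)] by auto
 obtain B where B: "B >= 0" "!!w. \<bar>g w\<bar> <= B" using bump_fun_bounded[OF g] by blast
 have "integrable lborel (%y. B * norm (F y))" using integrable_norm[OF F] by simp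
 then show ?thesis
 proof (rule Bochner_Integration.integrable_bound)
  show "AE y in lborel. norm (g (x - y) *R F y) <= norm (B * norm (F y))"
   using B by (intro AE_I2) (simp add: abs_mult mult_right_mono)
 qed measurable
qed

lemma convol_has_derivative:
 assumes g: "bump_fun e (g :: 'a::euclidean_space => real)" "e > 0" and F: "integrable lborel F"
  and g': "!!w. (g has_derivative g' w) (at w)" "!!v. bump_fun e (%w. g' w v)"
 shows "(convol g F has_derivative (%v. convol (%w. g' w v) F x)) (at x)"
proof -
 obtain M where M: "M >= 0" "!!w k. \<bar>g (w + k) - g w - g' w k\<bar> <= M * (norm k)^2" using bump_fun_remainder[OF g g'] by blast
 have lin: "linear (g' w)" for w using g'(1) by (rule has_derivative_linear)
 have i: "integrable lborel (%y. g (x - y) *R F y)" "integrable lborel (%y. g' (x - y) v *R F y)" for x v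
  using convol_integrable[OF g F] convol_integrable[OF g'(2) g(2) F] by auto
 define C where "C = M * (LINT y|lborel. norm (F y))"
 have est: "norm (convol g F z - convol g F x - convol (%w. g' w (z - x)) F x) <= C * (norm (z - x))^2" for z
 proof -
  have "convol g F z - convol g F x - convol (%w. g' w (z - x)) F x
    = (LINT y|lborel. (g (z - y) - g (x - y) - g' (x - y) (z - x)) *R F y)"
   unfolding convol_def scaleR_diff_left using i by simp
  also have "norm ... <= (LINT y|lborel. M * (norm (z - x))^2 * norm (F y))"
  proof (rule order_trans[OF integral_norm_bound], rule Bochner_Integration.integral_mono)
   show "integrable lborel (%y. norm ((g (z - y) - g (x - y) - g' (x - y) (z - x)) *R F y))"
    unfolding scaleR_diff_left using i by simp
   show "integrable lborel (%y. M * (norm (z - x))^2 * norm (F y))" using integrable_norm[OF F] by simp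
   show "norm ((g (z - y) - g (x - y) - g' (x - y) (z - x)) *R F y) <= M * (norm (z - x))^2 * norm (F y)" for y
   proof -
    have "\<bar>g (z - y) - g (x - y) - g' (x - y) (z - x)\<bar> <= M * (norm (z - x))^2"
     using M(2)[of "x - y" "z - x"] by (simp add: algebra_simps)
    then show ?thesis unfolding norm_scaleR by (rule mult_right_mono) simp
   qed
  qed
  finally show ?thesis by (simp add: C_def mult_ac)
 qed
 show ?thesis
 proof (rule has_derivativeI_sandwich[where e=1 and H="%z. C * norm (z - x)"])
  have "linear (%v. convol (%w. g' w v) F x)"
   by (rule linearI) (simp_all add: convol_def linear_add[OF lin] linear_scale[OF lin] scaleR_add_left i flip: scaleR_scaleR)
  then show "bounded_linear (%v. convol (%w. g' w v) F x)" by (simp add: linear_conv_bounded_linear)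
  show "norm (convol g F z - convol g F x - convol (%w. g' w (z - x)) F x) / norm (z - x) <= C * norm (z - x)" if "z \<noteq> x" for z
   using est[of z] that by (simp add: pos_divide_le_eq power2_eq_square mult.assoc)
  show "((%z. C * norm (z - x)) ---> 0) (at x)"
   by (auto intro!: tendsto_eq_intros)
 qed auto
qed

lemma convol_C_on:
 assumes "bump_fun e (g :: 'a::euclidean_space => real)" "e > 0" "integrable lborel F"
 shows "C_on k UNIV (convol g F)"
 using assms(1)
proof (induction k arbitrary: g)
 case 0
 obtain g' where g': "!!w. (g has_derivative g' w) (at w)" "!!v. bump_fun e (%w. g' w v)" using bump_fun_derivative[OF 0] by blast
 show ?case using convol_has_derivative[OF 0 assms(2,3) g']
  by (auto intro!: continuous_at_imp_continuous_on has_derivative_continuous)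
next
 case (Suc k)
 obtain g' where g': "!!w. (g has_derivative g' w) (at w)" "!!v. bump_fun e (%w. g' w v)" using bump_fun_derivative[OF Suc.prems] by blast
 note d = convol_has_derivative[OF Suc.prems assms(2,3) g']
 have "frechet_derivative (convol g F) (at x) v = convol (%w. g' w v) F x" for x v
  using fun_cong[OF frechet_derivative_at[OF d[of x]], of v] by simp
 then have e: "(%x. frechet_derivative (convol g F) (at x) v) = convol (%w. g' w v) F" for v by (intro ext)
 show ?case unfolding C_on.simps e using Suc.IH[OF g'(2)] differentiableI[OF d] by blast
qed

text \<open>This makes y -> g(x - y) admissible as a test function in the definition of a weak
  derivative.\<close>

lemma bump_fun_reflect_C_on:
 assumes "bump_fun e (g :: 'a::euclidean_space => real)"
 shows "C_on k UNIV (%y. g (x - y))"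
 using assms
proof (induction k arbitrary: g)
 case 0
 have "continuous_on UNIV (%y. g (x - y))"
  by (rule continuous_on_compose2[OF bump_fun_continuous[OF 0]]) (auto intro!: continuous_intros)
 then show ?case by simp
next
 case (Suc k)
 obtain g' where g': "!!w. (g has_derivative g' w) (at w)" "!!v. bump_fun e (%w. g' w v)" using bump_fun_derivative[OF Suc.prems] by blast
 have d: "((%y. g (x - y)) has_derivative (%v. g' (x - y) (- v))) (at y)" for y
  by (rule has_derivative_compose[OF _ g'(1)]) (auto intro!: derivative_eq_intros)
 have "frechet_derivative (%y. g (x - y)) (at y) v = g' (x - y) (- v)" for y v
  using fun_cong[OF frechet_derivative_at[OF d[of y]], of v] by simp
 then have e: "(%y. frechet_derivative (%y. g (x - y)) (at y) v) = (%y. g' (x - y) (- v))" for v by (intro ext)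
 show ?case unfolding C_on.simps e using Suc.IH[OF g'(2)] differentiableI[OF d] by blast
qed

lemma nn_integral_translate:
 fixes f :: "'a::euclidean_space => ennreal"
 assumes [measurable]: "f : borel_measurable borel"
 shows "(\<integral>\<^sup>+x. f (x - c) \<partial>lborel) = (\<integral>\<^sup>+x. f x \<partial>lborel)"
proof -
 have "(\<integral>\<^sup>+x. f x \<partial>lborel) = (\<integral>\<^sup>+x. f x \<partial>distr lborel borel ((+) (- c)))" by (simp add: lborel_distr_plus)
 also have "... = (\<integral>\<^sup>+x. f (x - c) \<partial>lborel)" by (subst nn_integral_distr) auto
 finally show ?thesis by simp
qed

definition mollifier :: "real => 'a::euclidean_space => real"
 where "mollifier e w = flat 0 (e^2 - w \<bullet> w) / (LINT v|(lborel :: 'a measure). flat 0 (e^2 - v \<bullet> v))"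

lemma mollifier:
 assumes e: "e > 0"
 shows mollifier_bump: "bump_fun e (mollifier e :: 'a::euclidean_space => real)"
  and mollifier_nonneg: "mollifier e (w :: 'a) >= 0"
  and mollifier_sym: "mollifier e (- w :: 'a) = mollifier e w"
  and mollifier_nn_integral: "(\<integral>\<^sup>+x. ennreal (mollifier e (x - y)) \<partial>(lborel :: 'a measure)) = 1"
proof -
 let ?f = "%v::'a. flat 0 (e^2 - v \<bullet> v)"
 define I where "I = (LINT v|lborel. ?f v)"
 have bf: "bump_fun e ?f" by (rule bump_fun.base)
 have f0: "?f v >= 0" for v by (simp add: flat_def)
 have [measurable]: "?f : borel_measurable borel" using bump_fun_measurable[OF bf] .
 have fi: "integrable lborel ?f"
 proof -
  obtain B where B: "!!w. \<bar>?f w\<bar> <= B" using bump_fun_bounded[OF bf e] by blast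
  have "integrable lborel (%x. indicator (cball 0 e) x *R ?f x)"
   using B emeasure_bounded_finite[of "cball (0::'a) e"]
   by (intro integrableI_bounded_set_indicator[where B=B]) auto
  moreover have "(%x. indicator (cball 0 e) x *R ?f x) = ?f"
   using bump_fun_support[OF bf e] by (intro ext) (auto simp: indicator_def)
  ultimately show ?thesis by (simp only:)
 qed
 \<comment> \<open>The kernel is positive on an open ball, which is not negligible, so the
   normalising integral cannot vanish.\<close>
 have "I \<noteq> 0"
 proof
  assume "I = 0"
  then have "AE x in lborel. ?f x = 0" using integral_nonneg_eq_0_iff_AE[OF fi] f0 by (simp add: I_def)
  then have "AE x in lborel. x \<notin> ball (0::'a) e"
  proof eventually_elim
   case (elim x)
   show ?case
   proof
    assume "x : ball 0 e"
    then have "(norm x)\<^sup>2 < e^2" by (intro power_strict_mono) auto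
    then show False using elim by (simp add: flat_def dot_square_norm)
   qed
  qed
  then have "ball (0::'a) e : null_sets lborel" by (subst AE_iff_null_sets) auto
  then have "negligible (ball (0::'a) e)" using null_sets_completionI negligible_iff_null_sets by blast
  moreover have "\<not> negligible (ball (0::'a) e)" using e open_not_negligible[of "ball (0::'a) e"] by auto
  ultimately show False by simp
 qed
 moreover have "I >= 0" unfolding I_def using f0 by simp
 ultimately have I: "I > 0" by simp
 have m: "mollifier e w = (1 / I) * ?f w" for w :: 'a by (simp add: mollifier_def I_def)
 show b: "bump_fun e (mollifier e :: 'a => real)"
  unfolding m[abs_def] by (rule bump_fun.scale[OF bf])
 have nn: "mollifier e w >= 0" for w :: 'a unfolding m using I f0[of w] by simp
 show "mollifier e w >= 0" by (rule nn)
 show "mollifier e (- w) = mollifier e w" unfolding m by simp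
 have [measurable]: "(mollifier e :: 'a => real) : borel_measurable borel" using bump_fun_measurable[OF b] .
 have "(\<integral>\<^sup>+x. ennreal (mollifier e (x - y)) \<partial>(lborel :: 'a measure)) = (\<integral>\<^sup>+x. ennreal (mollifier e x) \<partial>(lborel :: 'a measure))"
  by (rule nn_integral_translate) measurable
 also have "... = ennreal (LINT x|lborel. mollifier e (x::'a))"
  using fi nn by (intro nn_integral_eq_integral) (auto simp: m[abs_def])
 also have "(LINT x|lborel. mollifier e (x::'a)) = 1" unfolding m using I by (simp add: I_def)
 finally show "(\<integral>\<^sup>+x. ennreal (mollifier e (x - y)) \<partial>(lborel :: 'a measure)) = 1" by simp
qed

lemma mollifier_integrable:
 assumes e: "e > 0"
 shows "integrable lborel (%y. mollifier e (x - y :: 'a::euclidean_space))" and "(LINT y|lborel. mollifier e (x - y :: 'a)) = 1"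
proof -
 have [measurable]: "(mollifier e :: 'a => real) : borel_measurable borel" using bump_fun_measurable[OF mollifier_bump[OF e]] .
 have s: "mollifier e (x - y) = mollifier e (y - x)" for y :: 'a using mollifier_sym[OF e, of "x - y"] by simp
 have n: "(\<integral>\<^sup>+y. ennreal (mollifier e (x - y :: 'a)) \<partial>lborel) = ennreal 1"
  unfolding s using mollifier_nn_integral[OF e, of x] by simp
 show "integrable lborel (%y. mollifier e (x - y))" "(LINT y|lborel. mollifier e (x - y)) = 1"
  using nn_integral_eq_integrable[of "%y. mollifier e (x - y)" lborel 1] n mollifier_nonneg[OF e] by auto
qed

lemma integrable_bounded_compact_support:
 fixes F :: "'a::euclidean_space => complex"
 assumes F: "L2fun lborel F" and s: "!!x. norm x > R ==> F x = 0"
 shows "integrable lborel F"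
proof -
 have [measurable]: "F : borel_measurable borel" using F by (simp add: L2fun_def)
 have "integrable lborel (%x. indicator (cball 0 R) x + (cmod (F x))^2)"
  using F emeasure_bounded_finite[of "cball (0::'a) R"] by (intro Bochner_Integration.integrable_add integrable_real_indicator) (auto simp: L2fun_def)
 then show ?thesis
 proof (rule Bochner_Integration.integrable_bound)
  show "AE x in lborel. norm (F x) <= norm (indicator (cball 0 R) x + (cmod (F x))^2)"
  proof (rule AE_I2)
   fix x :: 'a
   have "cmod (F x) <= 1 + (cmod (F x))^2" using sum_squares_bound[of "cmod (F x)" 1] norm_ge_zero[of "F x"] by (simp only: power_one mult_1_right)
   then show "norm (F x) <= norm (indicator (cball 0 R) x + (cmod (F x))^2)" using s[of x] by (cases "norm x <= R") auto
  qed
 qed measurable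
qed

lemma convol_measurable:
 assumes "bump_fun e (g :: 'a::euclidean_space => real)" "e > 0" "integrable lborel F"
 shows "convol g F : borel_measurable borel"
 using convol_C_on[OF assms, of 0] by (intro borel_measurable_continuous_onI) simp

text \<open>Writing the kernel as the product of two square roots, Cauchy-Schwarz bounds the square
  of the convolution by the convolution of |F|^2, because the kernel has mass one. Tonelli then
  integrates this bound to the square norm of F.\<close>

lemma convol_L2_contraction:
 fixes F :: "'a::euclidean_space => complex"
 assumes e: "e > 0" and F: "L2fun lborel F" and i: "integrable lborel F"
 shows "L2fun lborel (convol (mollifier e) F)" and "L2norm lborel (convol (mollifier e) F) <= L2norm lborel F"
proof -
 let ?\<rho> = "mollifier e :: 'a => real"
 have [measurable]: "?\<rho> : borel_measurable borel" using bump_fun_measurable[OF mollifier_bump[OF e]] .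
 have [measurable]: "F : borel_measurable borel" using F by (simp add: L2fun_def)
 have [measurable]: "convol ?\<rho> F : borel_measurable borel" by (rule convol_measurable[OF mollifier_bump[OF e] e i])
 obtain B where B: "B >= 0" "!!w. \<bar>?\<rho> w\<bar> <= B" using bump_fun_bounded[OF mollifier_bump[OF e] e] by blast
 have pt: "ennreal ((cmod (convol ?\<rho> F x))^2) <= (\<integral>\<^sup>+y. ennreal (?\<rho> (x - y)) * ennreal ((cmod (F y))^2) \<partial>lborel)" for x
 proof -
  let ?f = "%y. complex_of_real (sqrt (?\<rho> (x - y)))" and ?g = "%y. complex_of_real (sqrt (?\<rho> (x - y))) * F y"
  have f: "L2fun lborel ?f"
   using mollifier_integrable(1)[where 'a='a, OF e] mollifier_nonneg[where 'a='a, OF e] by (simp add: L2fun_def norm_mult)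
  have g: "L2fun lborel ?g"
  proof (rule L2fun_mult_bounded[OF F, where k="sqrt B"])
   show "cmod (complex_of_real (sqrt (?\<rho> (x - y)))) <= sqrt B" for y
    using B(2)[of "x - y"] mollifier_nonneg[OF e, of "x - y"] by simp
  qed measurable
  have gi: "integrable lborel (%y. ?\<rho> (x - y) * (cmod (F y))^2)"
   using g mollifier_nonneg[where 'a='a, OF e] by (simp add: L2fun_def norm_mult power_mult_distrib)
  have "cmod (convol ?\<rho> F x) <= (LINT y|lborel. cmod (?\<rho> (x - y) *R F y))"
   unfolding convol_def by (rule integral_norm_bound)
  also have "... = (LINT y|lborel. cmod (?f y) * cmod (?g y))"
   using mollifier_nonneg[where 'a='a, OF e] by (intro Bochner_Integration.integral_cong) (auto simp: norm_mult simp flip: mult.assoc)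
  also have "... <= L2norm lborel ?f * L2norm lborel ?g" by (rule integral_norm_mult_le[OF f g])
  also have "L2norm lborel ?f = 1"
   using mollifier_integrable(2)[OF e, of x] mollifier_nonneg[where 'a='a, OF e] by (simp add: L2norm_def)
  finally have "(cmod (convol ?\<rho> F x))\<^sup>2 <= (L2norm lborel ?g)\<^sup>2" by (intro power_mono) auto
  also have "... = (LINT y|lborel. ?\<rho> (x - y) * (cmod (F y))^2)"
   using mollifier_nonneg[where 'a='a, OF e] by (simp add: L2norm_power2 norm_mult power_mult_distrib)
  finally have "ennreal ((cmod (convol ?\<rho> F x))^2) <= ennreal (LINT y|lborel. ?\<rho> (x - y) * (cmod (F y))^2)" by (rule ennreal_leI)
  also have "... = (\<integral>\<^sup>+y. ennreal (?\<rho> (x - y) * (cmod (F y))^2) \<partial>lborel)"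
   using gi mollifier_nonneg[where 'a='a, OF e] by (intro nn_integral_eq_integral[symmetric]) auto
  also have "... = (\<integral>\<^sup>+y. ennreal (?\<rho> (x - y)) * ennreal ((cmod (F y))^2) \<partial>lborel)"
   using mollifier_nonneg[where 'a='a, OF e] by (intro nn_integral_cong ennreal_mult) auto
  finally show ?thesis .
 qed
 have "(\<integral>\<^sup>+x. ennreal ((cmod (convol ?\<rho> F x))^2) \<partial>lborel) <= (\<integral>\<^sup>+x. (\<integral>\<^sup>+y. ennreal (?\<rho> (x - y)) * ennreal ((cmod (F y))^2) \<partial>lborel) \<partial>lborel)"
  by (intro nn_integral_mono pt)
 also have "... = (\<integral>\<^sup>+y. (\<integral>\<^sup>+x. ennreal (?\<rho> (x - y)) * ennreal ((cmod (F y))^2) \<partial>lborel) \<partial>lborel)"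
  by (rule lborel_pair.Fubini'[symmetric]) measurable
 also have "... = (\<integral>\<^sup>+y. ennreal ((cmod (F y))^2) \<partial>lborel)"
  by (intro nn_integral_cong) (simp add: nn_integral_multc mollifier_nn_integral[where 'a='a, OF e])
 also have "... = ennreal (LINT y|lborel. (cmod (F y))^2)"
  using F by (intro nn_integral_eq_integral) (auto simp: L2fun_def)
 finally have le: "(\<integral>\<^sup>+x. ennreal ((cmod (convol ?\<rho> F x))^2) \<partial>lborel) <= ennreal (LINT y|lborel. (cmod (F y))^2)" .
 have int: "integrable lborel (%x. (cmod (convol ?\<rho> F x))^2)"
 proof (rule integrableI_bounded)
  show "(\<integral>\<^sup>+x. ennreal (norm ((cmod (convol ?\<rho> F x))^2)) \<partial>lborel) < \<infinity>" using le_less_trans[OF le ennreal_less_top] by simp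
 qed measurable
 then show "L2fun lborel (convol ?\<rho> F)" by (simp add: L2fun_def)
 have "(LINT x|lborel. (cmod (convol ?\<rho> F x))^2) <= (LINT y|lborel. (cmod (F y))^2)"
  using le int by (simp add: nn_integral_eq_integral)
 then show "L2norm lborel (convol ?\<rho> F) <= L2norm lborel F" by (simp add: L2norm_def)
qed

text \<open>F is first truncated in size, and the truncation is an almost everywhere limit of
  continuous functions. These are clamped to a disc and cut off outside a ball, so that dominated
  convergence gives convergence in the mean square.\<close>

lemma continuous_dense_L2:
 fixes F :: "'a::euclidean_space => complex"
 assumes F: "L2fun lborel F" and s: "!!x. norm x > R ==> F x = 0" and e: "e > 0"
 obtains G where "continuous_on UNIV G" "!!x. norm x > R + 1 ==> G x = 0" "L2norm lborel (%x. F x - G x) < e"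
proof -
 have Fm[measurable]: "F : borel_measurable borel" using F by (simp add: L2fun_def)
 define T where "T k x = (if cmod (F x) <= real k then F x else 0)" for k x
 have Tm[measurable]: "T k : borel_measurable borel" for k unfolding T_def by measurable
 have "(%k. LINT x|lborel. (cmod (F x - T k x))^2) ----> (LINT x|(lborel :: 'a measure). 0)"
 proof (rule integral_dominated_convergence[where w="%x. (cmod (F x))^2"])
  show "integrable lborel (%x. (cmod (F x))^2)" using F by (simp add: L2fun_def)
  show "AE x in lborel. (%k. (cmod (F x - T k x))^2) ----> 0"
  proof (rule AE_I2)
   fix x
   obtain k0 :: nat where k0: "cmod (F x) <= k0" using real_arch_simple by blast
   have "\<forall>\<^sub>F k in sequentially. (cmod (F x - T k x))^2 = 0"
    using eventually_ge_at_top[of k0] by eventually_elim (use k0 in \<open>auto simp: T_def\<close>)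
   then show "(%k. (cmod (F x - T k x))^2) ----> 0" by (rule tendsto_eventually)
  qed
  show "AE x in lborel. norm ((cmod (F x - T k x))^2) <= (cmod (F x))\<^sup>2" for k by (rule AE_I2) (simp add: T_def)
 qed measurable
 then have "(%k. L2norm lborel (%x. F x - T k x)) ----> 0" by (simp add: L2_tendsto_iff)
 then have "\<forall>\<^sub>F k in sequentially. L2norm lborel (%x. F x - T k x) < e / 2" using order_tendstoD(2) e half_gt_zero by blast
 then obtain k where k: "L2norm lborel (%x. F x - T k x) < e / 2" using eventually_happens'[OF sequentially_bot] by blast
 have "T k : borel_measurable lebesgue" by (rule measurable_completion) (simp add: Tm)
 then have "T k measurable_on UNIV" by (rule lebesgue_measurable_imp_measurable_on) simp
 then obtain N g where N: "negligible N" and gc: "!!n. continuous_on UNIV (g n)" and gl: "!!x. x \<notin> N ==> (%n. g n x) ----> T k x"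
  unfolding measurable_on_def by auto
 define K where "K = real k + 1"
 \<comment> \<open>The radial retraction onto the disc of radius K: continuous, and the identity on
   all values of the truncation.\<close>
 define c where "c z = z /\<^sub>R max 1 (cmod z / K)" for z :: complex
 have K: "K > 0" by (simp add: K_def)
 have cc: "continuous_on UNIV c" unfolding c_def using K by (intro continuous_intros) auto
 have cb: "cmod (c z) <= K" for z
 proof (cases "cmod z <= K")
  case True
  then show ?thesis using K by (simp add: c_def max_def field_simps)
 next
  case False
  then show ?thesis using K by (simp add: c_def max_def field_simps)
 qed
 have ci: "c z = z" if "cmod z <= K" for z using that K by (simp add: c_def max_def field_simps)
 define cutf where "cutf x = max 0 (min 1 (R + 1 - norm x))" for x :: 'a
 have chc: "continuous_on UNIV cutf" unfolding cutf_def by (intro continuous_intros)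
 have ch: "0 <= cutf x" "cutf x <= 1" "norm x <= R ==> cutf x = 1" "norm x > R + 1 ==> cutf x = 0" for x by (auto simp: cutf_def)
 define G where "G n x = cutf x *R c (g n x)" for n x
 have Gc: "continuous_on UNIV (G n)" for n unfolding G_def
  by (intro continuous_intros chc continuous_on_compose2[OF cc gc]) auto
 have [measurable]: "G n : borel_measurable borel" for n using Gc by (rule borel_measurable_continuous_onI)
 have Gb: "cmod (G n x) <= K" for n x
  using mult_mono[OF ch(2)[of x] cb[of "g n x"]] ch(1)[of x] by (simp add: G_def)
 have Gs: "G n x = 0" if "norm x > R + 1" for n x using ch(4)[OF that] by (simp add: G_def)
 have Tb: "cmod (T k x) <= K" for x by (simp add: T_def K_def)
 have Ts: "T k x = 0" if "norm x > R" for x using s[OF that] by (simp add: T_def)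
 have NAE: "AE x in lborel. x \<notin> N" using AE_not_in[of N lebesgue] N by (simp add: negligible_iff_null_sets AE_completion_iff)
 have "(%n. LINT x|lborel. (cmod (T k x - G n x))^2) ----> (LINT x|(lborel :: 'a measure). 0)"
 proof (rule integral_dominated_convergence[where w="%x. (2 * K)^2 * indicator (cball 0 (R + 1)) x"])
  show "integrable lborel (%x::'a. (2 * K)^2 * indicator (cball 0 (R + 1)) x)"
   using emeasure_bounded_finite[of "cball (0::'a) (R + 1)"] by (intro integrable_mult_right integrable_real_indicator) auto
  show "AE x in lborel. (%n. (cmod (T k x - G n x))^2) ----> 0"
   using NAE
  proof eventually_elim
   case (elim x)
   have "(%n. G n x) ----> cutf x *R c (T k x)" unfolding G_def
    using cc gl[OF elim] by (intro tendsto_intros continuous_on_tendsto_compose[OF cc]) auto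
   also have "cutf x *R c (T k x) = T k x" using ch(3)[of x] Ts[of x] ci[OF Tb[of x]] by (cases "norm x <= R") auto
   finally have "(%n. (cmod (T k x - G n x))^2) ----> (cmod (T k x - T k x))\<^sup>2" by (intro tendsto_intros)
   then show ?case by simp
  qed
  show "AE x in lborel. norm ((cmod (T k x - G n x))^2) <= (2 * K)\<^sup>2 * indicator (cball 0 (R + 1)) x" for n
  proof (rule AE_I2)
   fix x
   have "cmod (T k x - G n x) <= 2 * K" using norm_triangle_ineq4[of "T k x" "G n x"] Tb[of x] Gb[of n x] by linarith
   then have "(cmod (T k x - G n x))\<^sup>2 <= (2 * K)\<^sup>2" by (intro power_mono) auto
   then show "norm ((cmod (T k x - G n x))^2) <= (2 * K)\<^sup>2 * indicator (cball 0 (R + 1)) x"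
    using Gs[of x n] Ts[of x] by (cases "norm x <= R + 1") auto
  qed
 qed measurable
 then have "(%n. L2norm lborel (%x. T k x - G n x)) ----> 0" by (simp add: L2_tendsto_iff)
 then have "\<forall>\<^sub>F n in sequentially. L2norm lborel (%x. T k x - G n x) < e / 2" using order_tendstoD(2) e half_gt_zero by blast
 then obtain n where n: "L2norm lborel (%x. T k x - G n x) < e / 2" using eventually_happens'[OF sequentially_bot] by blast
 have bs: "L2fun lborel f" if "f : borel_measurable borel" "!!x. cmod (f x) <= K" "!!x. norm x > R + 1 ==> f x = 0" for f :: "'a => complex"
 proof -
  have [measurable]: "f : borel_measurable borel" by fact
  have "integrable lborel (%x::'a. K^2 * indicator (cball 0 (R + 1)) x)"
   using emeasure_bounded_finite[of "cball (0::'a) (R + 1)"] by (intro integrable_mult_right integrable_real_indicator) auto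
  then have "integrable lborel (%x. (cmod (f x))^2)"
  proof (rule Bochner_Integration.integrable_bound)
   show "AE x in lborel. norm ((cmod (f x))^2) <= norm (K^2 * indicator (cball 0 (R + 1)) x)"
   proof (rule AE_I2)
    fix x
    have "(cmod (f x))\<^sup>2 <= K\<^sup>2" using that(2) by (intro power_mono) auto
    then show "norm ((cmod (f x))^2) <= norm (K^2 * indicator (cball 0 (R + 1)) x)" using that(3)[of x] by (cases "norm x <= R + 1") auto
   qed
  qed measurable
  then show ?thesis by (simp add: L2fun_def)
 qed
 have "L2fun lborel (T k)" "L2fun lborel (G n)"
  using Tb Ts Gb Gs by (auto intro!: bs)
 then have "L2norm lborel (%x. F x - G n x) <= L2norm lborel (%x. F x - T k x) + L2norm lborel (%x. T k x - G n x)"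
  by (intro L2norm_triangle_diff F)
 then have "L2norm lborel (%x. F x - G n x) < e" using k n by linarith
 then show ?thesis using Gs by (intro that[of "G n"] Gc) auto
qed

text \<open>Three errors: the contraction property bounds the cost of replacing F by a continuous G
  under the mollifier, density bounds G - F itself, and uniform continuity bounds the effect of
  mollifying G on a ball of fixed volume.\<close>

lemma convol_tendsto_L2:
 fixes F :: "'a::euclidean_space => complex"
 assumes F: "L2fun lborel F" and s: "!!x. norm x > R ==> F x = 0"
  and \<epsilon>: "!!n. \<epsilon> n > 0" "\<epsilon> ----> 0"
 shows "(%n. L2norm lborel (%x. convol (mollifier (\<epsilon> n)) F x - F x)) ----> 0"
proof (rule LIMSEQ_I)
 fix e :: real assume e: "e > 0"
 obtain G where Gc: "continuous_on UNIV G" and Gs: "!!x. norm x > R + 1 ==> G x = 0" and Gd: "L2norm lborel (%x. F x - G x) < e / 3"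
  using continuous_dense_L2[where e="e / 3", OF F s] e by (metis divide_pos_pos zero_less_numeral)
 have [measurable]: "G : borel_measurable borel" using Gc by (rule borel_measurable_continuous_onI)
 have c2: "integrable lborel (%x. (cmod (G x))^2)"
 proof -
  have "integrable lborel (%x. indicator (cball 0 (R + 1)) x *R (cmod (G x))\<^sup>2)"
   by (intro borel_integrable_compact continuous_intros continuous_on_subset[OF Gc]) auto
  moreover have "(%x. indicator (cball 0 (R + 1)) x *R (cmod (G x))\<^sup>2) = (%x. (cmod (G x))^2)"
   using Gs by (intro ext) (auto simp: indicator_def not_le)
  ultimately show ?thesis by (simp only:)
 qed
 then have Gq: "L2fun lborel G" by (simp add: L2fun_def)
 have Gi: "integrable lborel G" by (rule integrable_bounded_compact_support[OF Gq Gs])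
 have Fi: "integrable lborel F" by (rule integrable_bounded_compact_support[OF F s])
 define V where "V = sqrt (measure lborel (cball (0::'a) (R + 2))) + 1"
 have V: "V > 0" unfolding V_def by (simp add: add_nonneg_pos)
 define \<eta> where "\<eta> = e / (3 * V)"
 have \<eta>: "\<eta> > 0" using e V by (simp add: \<eta>_def)
 have "uniformly_continuous_on (cball 0 (R + 3)) G"
  using continuous_on_subset[OF Gc] by (intro compact_uniformly_continuous) auto
 then obtain d where d: "d > 0" "!!x y. x : cball 0 (R + 3) ==> y : cball 0 (R + 3) ==> dist y x < d ==> dist (G y) (G x) < \<eta>"
  unfolding uniformly_continuous_on_def using \<eta> by metis
 have "\<forall>\<^sub>F n in sequentially. \<epsilon> n < min d 1" by (rule order_tendstoD(2)[OF \<epsilon>(2)]) (use d(1) in simp)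
 \<comment> \<open>Mollification radii below 1 keep the support of the mollified G inside the ball
   of radius R + 2, and only values of G up to radius R + 3 enter.\<close>
 then obtain no where no: "!!n. n >= no ==> \<epsilon> n < min d 1" unfolding eventually_sequentially by blast
 have "L2norm lborel (%x. convol (mollifier (\<epsilon> n)) F x - F x) < e" if n: "n >= no" for n
 proof -
  let ?\<rho> = "mollifier (\<epsilon> n) :: 'a => real"
  note b = mollifier_bump[OF \<epsilon>(1), of n]
  have close: "cmod (G y - G x) <= \<eta>" if "norm (x - y) < \<epsilon> n" for x y
  proof (cases "norm x <= R + 2")
   case True
   have yx: "norm (y - x) < min d 1" using that no[OF n] by (simp add: norm_minus_commute)
   moreover have "norm y <= norm x + norm (y - x)" using norm_triangle_ineq[of x "y - x"] by simp
   ultimately have "norm y <= R + 3" using True by simp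
   then show ?thesis using d(2)[of x y] True yx by (simp add: dist_norm less_imp_le)
  next
   case False
   have "norm (y - x) < 1" using that no[OF n] by (simp add: norm_minus_commute)
   moreover have "norm x <= norm y + norm (y - x)" using norm_triangle_ineq[of y "x - y"] by (simp add: norm_minus_commute)
   ultimately have "norm y > R + 1" "norm x > R + 1" using False by auto
   then show ?thesis using Gs \<eta> by simp
  qed
  have z: "convol ?\<rho> G x = 0 & G x = 0" if x: "norm x > R + 2" for x
  proof -
   have "?\<rho> (x - y) *R G y = 0" for y
   proof (cases "norm (x - y) < \<epsilon> n")
    case True
    then have "norm (x - y) < 1" using no[OF n] by simp
    then have "norm y > R + 1" using x norm_triangle_ineq[of y "x - y"] by simp
    then show ?thesis using Gs by simp
   next
    case False
    then show ?thesis using bump_fun_support[OF b \<epsilon>(1), of "x - y"] by simp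
   qed
   then show ?thesis using Gs[of x] x by (simp only: convol_def) simp
  qed
  have "cmod (convol ?\<rho> G x - G x) <= \<eta>" for x
  proof -
   have i: "integrable lborel (%y. ?\<rho> (x - y) *R G y)" by (rule convol_integrable[OF b \<epsilon>(1) Gi])
   have i': "integrable lborel (%y. ?\<rho> (x - y) *R G x)" using mollifier_integrable(1)[where 'a='a, OF \<epsilon>(1)] by simp
   have "convol ?\<rho> G x - G x = (LINT y|lborel. ?\<rho> (x - y) *R G y) - (LINT y|lborel. ?\<rho> (x - y) *R G x)"
    using mollifier_integrable[where 'a='a, OF \<epsilon>(1)] by (simp add: convol_def)
   also have "... = (LINT y|lborel. ?\<rho> (x - y) *R (G y - G x))" unfolding scaleR_diff_right using i i' by simp
   also have "cmod ... <= (LINT y|lborel. ?\<rho> (x - y) * \<eta>)"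
   proof (rule order_trans[OF integral_norm_bound], rule Bochner_Integration.integral_mono)
    show "integrable lborel (%y. norm (?\<rho> (x - y) *R (G y - G x)))" unfolding scaleR_diff_right using i i' by simp
    show "integrable lborel (%y. ?\<rho> (x - y) * \<eta>)" using mollifier_integrable(1)[where 'a='a, OF \<epsilon>(1)] by simp
    show "norm (?\<rho> (x - y) *R (G y - G x)) <= ?\<rho> (x - y) * \<eta>" for y
     using close[of x y] bump_fun_support[OF b \<epsilon>(1), of "x - y"] mollifier_nonneg[OF \<epsilon>(1), of n "x - y"]
     by (cases "norm (x - y) < \<epsilon> n") (auto intro: mult_left_mono)
   qed
   finally show ?thesis using mollifier_integrable[where 'a='a, OF \<epsilon>(1)] by simp
  qed
  note cl = this
  have [measurable]: "convol ?\<rho> G : borel_measurable borel" by (rule convol_measurable[OF b \<epsilon>(1) Gi])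
  have "(LINT x|lborel. (cmod (convol ?\<rho> G x - G x))^2) <= (LINT x|lborel. \<eta>^2 * indicator (cball (0::'a) (R + 2)) x)"
  proof (rule Bochner_Integration.integral_mono)
   show "integrable lborel (%x. (cmod (convol ?\<rho> G x - G x))^2)"
    using L2fun_diff[OF convol_L2_contraction(1)[OF \<epsilon>(1) Gq Gi] Gq] by (simp add: L2fun_def)
   show "integrable lborel (%x. \<eta>^2 * indicator (cball (0::'a) (R + 2)) x)"
    using emeasure_bounded_finite[of "cball (0::'a) (R + 2)"] by (intro integrable_mult_right integrable_real_indicator) auto
   show "(cmod (convol ?\<rho> G x - G x))\<^sup>2 <= \<eta>\<^sup>2 * indicator (cball 0 (R + 2)) x" for x
    using z[of x] power_mono[OF cl[of x], of 2] by (cases "norm x <= R + 2") auto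
  qed
  also have "... = \<eta>^2 * measure lborel (cball (0::'a) (R + 2))" by simp
  finally have "L2norm lborel (%x. convol ?\<rho> G x - G x) <= sqrt (\<eta>^2 * measure lborel (cball (0::'a) (R + 2)))"
   unfolding L2norm_def by simp
  also have "... = \<eta> * (V - 1)" using \<eta> by (simp add: real_sqrt_mult V_def)
  also have "... < \<eta> * V" using \<eta> by simp
  also have "\<eta> * V = e / 3" using V by (simp add: \<eta>_def)
  finally have 1: "L2norm lborel (%x. convol ?\<rho> G x - G x) < e / 3" .
  have cd: "convol ?\<rho> (%y. F y - G y) x = convol ?\<rho> F x - convol ?\<rho> G x" for x
   unfolding convol_def scaleR_diff_right
   by (rule Bochner_Integration.integral_diff[OF convol_integrable[OF b \<epsilon>(1) Fi] convol_integrable[OF b \<epsilon>(1) Gi]])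
  have 2: "L2norm lborel (%x. convol ?\<rho> F x - convol ?\<rho> G x) < e / 3"
  proof -
   have e: "(%x. convol ?\<rho> F x - convol ?\<rho> G x) = convol ?\<rho> (%y. F y - G y)"
    by (intro ext cd[symmetric])
   show ?thesis unfolding e
    using convol_L2_contraction(2)[OF \<epsilon>(1)[of n] L2fun_diff[OF F Gq] Bochner_Integration.integrable_diff[OF Fi Gi]] Gd by linarith
  qed
  note sq = convol_L2_contraction(1)[OF \<epsilon>(1)[of n] F Fi] convol_L2_contraction(1)[OF \<epsilon>(1)[of n] Gq Gi]
  have "L2norm lborel (%x. convol ?\<rho> F x - F x) <= L2norm lborel (%x. convol ?\<rho> F x - convol ?\<rho> G x) + L2norm lborel (%x. convol ?\<rho> G x - F x)"
   by (rule L2norm_triangle_diff[OF sq F])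
  also have "L2norm lborel (%x. convol ?\<rho> G x - F x) <= L2norm lborel (%x. convol ?\<rho> G x - G x) + L2norm lborel (%x. G x - F x)"
   by (rule L2norm_triangle_diff[OF sq(2) Gq F])
  finally show ?thesis using 1 2 Gd L2norm_minus_commute[of lborel F G] by linarith
 qed
 then show "EX no. ALL n>=no. norm (L2norm lborel (%x. convol (mollifier (\<epsilon> n)) F x - F x) - 0) < e"
  by (intro exI[of _ no]) simp
qed

text \<open>Explicit formulas, because the symmetry of the second derivatives has to be visible;
  \<open>bump_fun_derivative\<close> only gives existence.\<close>

lemma mollifier_derivatives:
 fixes e :: real
 assumes e: "e > 0"
 obtains \<rho>' \<rho>'' where
  "!!w :: 'a::euclidean_space. (mollifier e has_derivative \<rho>' w) (at w)" "!!v. bump_fun e (%w. \<rho>' w v)"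
  "!!v w. ((%w. \<rho>' w v) has_derivative \<rho>'' v w) (at w)" "!!v x. bump_fun e (%w. \<rho>'' v w x)"
  "!!v x w. \<rho>'' v w x = \<rho>'' x w v"
proof -
 define c where "c = 1 / (LINT v|(lborel :: 'a measure). flat 0 (e^2 - v \<bullet> v))"
 let ?t = "%w::'a. e^2 - w \<bullet> w"
 define \<rho>' where "\<rho>' w v = c * ((- 2) * ((w \<bullet> v) * flat 2 (?t w)))" for w v :: 'a
 define \<rho>'' where "\<rho>'' v w x = c * ((- 2) * ((v \<bullet> x) * flat 2 (?t w) + (- 2) * ((w \<bullet> v) * ((w \<bullet> x) * (flat 4 (?t w) + (- 2) * flat 3 (?t w))))))" for v w x :: 'a
 have m: "mollifier e w = c * flat 0 (?t w)" for w :: 'a by (simp add: mollifier_def c_def)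
 have fd: "((%w. flat k (?t w)) has_derivative (%v. (flat (k + 2) (?t w) - real k * flat (k + 1) (?t w)) * (- (2 * (w \<bullet> v))))) (at w)" for k w
 proof -
  have "((%w. e^2 - w \<bullet> w) has_derivative (%v. - (2 * (w \<bullet> v)))) (at w)"
   by (auto intro!: derivative_eq_intros simp: inner_commute)
  from has_derivative_compose[OF this, of "flat k" "(*) (flat (k + 2) (?t w) - real k * flat (k + 1) (?t w))"]
  show ?thesis using flat_deriv by (simp add: has_field_derivative_def)
 qed
 show ?thesis
 proof (rule that[of \<rho>' \<rho>''])
  show "(mollifier e has_derivative \<rho>' w) (at w)" for w
  proof -
   have "((%w. c * flat 0 (?t w)) has_derivative (%v. c * ((flat (0 + 2) (?t w) - real 0 * flat (0 + 1) (?t w)) * (- (2 * (w \<bullet> v)))))) (at w)"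
    by (rule has_derivative_mult_right[OF fd])
   moreover have "(%v. c * ((flat (0 + 2) (?t w) - real 0 * flat (0 + 1) (?t w)) * (- (2 * (w \<bullet> v))))) = \<rho>' w"
    by (intro ext) (simp add: \<rho>'_def numeral_2_eq_2)
   moreover have "(%w. c * flat 0 (?t w)) = mollifier e" by (intro ext m[symmetric])
   ultimately show ?thesis by (simp only:)
  qed
  show "bump_fun e (%w. \<rho>' w v)" for v unfolding \<rho>'_def by (intro bump_fun.intros)
  show "((%w. \<rho>' w v) has_derivative \<rho>'' v w) (at w)" for v w
  proof -
   have "((%w. c * ((- 2) * ((w \<bullet> v) * flat 2 (?t w)))) has_derivative
     (%x. c * ((- 2) * ((w \<bullet> v) * ((flat (2 + 2) (?t w) - real 2 * flat (2 + 1) (?t w)) * (- (2 * (w \<bullet> x)))) + (x \<bullet> v) * flat 2 (?t w))))) (at w)"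
    by (intro has_derivative_mult_right has_derivative_mult fd has_derivative_inner_left has_derivative_ident)
   moreover have "(%x. c * ((- 2) * ((w \<bullet> v) * ((flat (2 + 2) (?t w) - real 2 * flat (2 + 1) (?t w)) * (- (2 * (w \<bullet> x)))) + (x \<bullet> v) * flat 2 (?t w)))) = \<rho>'' v w"
   proof
    fix x
    have e: "(2::nat) + 2 = 4" "(2::nat) + 1 = 3" by simp_all
    show "c * ((- 2) * ((w \<bullet> v) * ((flat (2 + 2) (?t w) - real 2 * flat (2 + 1) (?t w)) * (- (2 * (w \<bullet> x)))) + (x \<bullet> v) * flat 2 (?t w))) = \<rho>'' v w x"
     unfolding e
     by (simp add: \<rho>''_def inner_commute algebra_simps)
   qed
   ultimately show ?thesis by (simp add: \<rho>'_def)
  qed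
  show "bump_fun e (%w. \<rho>'' v w x)" for v x unfolding \<rho>''_def by (intro bump_fun.intros)
  show "\<rho>'' v w x = \<rho>'' x w v" for v x w by (simp add: \<rho>''_def inner_commute algebra_simps)
 qed
qed

text \<open>Functions in \<open>L2_loc\<close> are only Lebesgue measurable on the domain, whereas
  convolution over \<open>lborel\<close> asks for a Borel function on the whole space. On a compact
  K such a function is found by changing f on a null set and extending by zero.\<close>

lemma borel_version:
 fixes f :: "'a::euclidean_space => complex"
 assumes f: "L2_loc \<Omega> f" and \<Omega>: "open \<Omega>" and K: "compact K" "K \<subseteq> \<Omega>"
 obtains F where "L2fun lborel F" "!!x. x \<notin> K ==> F x = 0" "AE x in lborel. x : K --> F x = f x"
proof -
 have K': "K : sets borel" using K(1) by (intro borel_closed compact_imp_closed)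
 then have K'': "K : sets lebesgue" by simp
 have fm: "f : borel_measurable (lebesgue_on \<Omega>)" using f by (simp add: L2_loc_def)
 then have "f : borel_measurable (lebesgue_on K)"
  using measurable_restrict_mono[OF _ K(2)] by blast
 then have m: "(%x. if x : K then f x else 0) : borel_measurable lebesgue"
  using borel_measurable_if[OF K''] by blast
 have "(%x. Re (if x : K then f x else 0)) : borel_measurable lebesgue" "(%x. Im (if x : K then f x else 0)) : borel_measurable lebesgue"
  using m by measurable
 then obtain a b where ab[measurable]: "a : borel_measurable lborel" "b : borel_measurable lborel"
  and ab': "AE x in lborel. Re (if x : K then f x else 0) = a x" "AE x in lborel. Im (if x : K then f x else 0) = b x"
  using completion_ex_borel_measurable_real by blast
 define F where "F x = indicator K x *R Complex (a x) (b x)" for x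
 have [measurable]: "F : borel_measurable borel" unfolding F_def Complex_eq using K' ab by measurable
 have ae: "AE x in lborel. F x = (if x : K then f x else 0)"
  using ab' by eventually_elim (auto simp: F_def complex_eq_iff indicator_def split: if_splits)
 have "integrable (lebesgue_on K) (%x. (cmod (f x))^2)" using f K by (simp add: L2_loc_def)
 then have "integrable lebesgue (%x. indicator K x *R (cmod (f x))\<^sup>2)" using K'' by (simp add: integrable_restrict_space)
 moreover have "AE x in lebesgue. indicator K x *R (cmod (f x))\<^sup>2 = (cmod (F x))^2"
  using AE_completion[OF ae] by eventually_elim (auto simp: indicator_def)
 moreover have "(%x. (cmod (F x))^2) : borel_measurable lebesgue" by (rule measurable_completion) simp
 ultimately have "integrable lebesgue (%x. (cmod (F x))^2)" using integrable_cong_AE_imp by blast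
 then have "integrable lborel (%x. (cmod (F x))^2)" by (subst (asm) integrable_completion) auto
 then have "L2fun lborel F" by (simp add: L2fun_def)
 moreover have "F x = 0" if "x \<notin> K" for x using that by (simp add: F_def)
 moreover have "AE x in lborel. x : K --> F x = f x" using ae by eventually_elim auto
 ultimately show ?thesis using that by blast
qed

text \<open>y -> g(x - y) is a test function supported in the ball of radius e around x. Its
  derivative in y is minus that of g, which cancels the sign in the definition of the weak
  derivative.\<close>

lemma weak_partial_convol:
 fixes f f' :: "'a::euclidean_space => complex"
 assumes wp: "is_weak_partial \<Omega> v f f'" and fm: "f : borel_measurable (lebesgue_on \<Omega>)" and \<Omega>: "open \<Omega>"
  and K: "compact K" "K \<subseteq> \<Omega>"
  and F: "F : borel_measurable borel" "AE x in lborel. x : K --> F x = f x"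
  and F': "F' : borel_measurable borel" "AE x in lborel. x : K --> F' x = f' x"
  and g: "bump_fun e g" "e > 0" "!!w. (g has_derivative g' w) (at w)" "!!v. bump_fun e (%w. g' w v)"
  and x: "cball x e \<subseteq> K"
 shows "convol (%w. g' w v) F x = convol g F' x"
proof -
 define \<psi> where "\<psi> y = g (x - y)" for y
 have d: "(\<psi> has_derivative (%v. g' (x - y) (- v))) (at y)" for y unfolding \<psi>_def
  by (rule has_derivative_compose[OF _ g(3)]) (auto intro!: derivative_eq_intros)
 have fd: "frechet_derivative \<psi> (at y) v = - g' (x - y) v" for y
  using fun_cong[OF frechet_derivative_at[OF d[of y]], of v] linear_neg[OF has_derivative_linear[OF g(3)]] by simp
 have "smooth_on UNIV \<psi>" unfolding smooth_on_def \<psi>_def using bump_fun_reflect_C_on[OF g(1)] by blast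
 moreover have "\<psi> y = 0" if "y \<notin> cball x e" for y
  using bump_fun_support[OF g(1,2), of "x - y"] that by (simp add: \<psi>_def dist_norm)
 ultimately have "test_fun \<Omega> \<psi>" unfolding test_fun_def using x K by (intro conjI exI[of _ "cball x e"]) auto
 then have eq: "(LINT y|lebesgue_on \<Omega>. frechet_derivative \<psi> (at y) v *R f y) = - (LINT y|lebesgue_on \<Omega>. \<psi> y *R f' y)"
  using wp unfolding is_weak_partial_def by blast
 have \<Omega>': "\<Omega> : sets lebesgue" using \<Omega> by auto
 have conv: "(LINT y|lebesgue_on \<Omega>. k (x - y) *R p y) = convol k P x"
  if k: "bump_fun e k" and P: "P : borel_measurable borel" "AE x in lborel. x : K --> P x = p x" and p: "p : borel_measurable (lebesgue_on \<Omega>)" for k p P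
 proof -
  have [measurable]: "P : borel_measurable borel" "k : borel_measurable borel" using P bump_fun_measurable[OF k] by auto
  have km: "(%y. k (x - y) *R P y) : borel_measurable lborel" by simp
  have "AE y in lebesgue. indicator \<Omega> y *R (k (x - y) *R p y) = k (x - y) *R P y"
   using AE_completion[OF P(2)]
  proof eventually_elim
   case (elim y)
   show ?case
   proof (cases "y : cball x e")
    case True
    then have "y : K" "y : \<Omega>" using x K by auto
    then show ?thesis using elim by simp
   next
    case False
    then show ?thesis using bump_fun_support[OF k g(2), of "x - y"] by (simp add: dist_norm)
   qed
  qed
  moreover have "(%y. indicator \<Omega> y *R (k (x - y) *R p y)) : borel_measurable lebesgue"
  proof -
   have "(%y. k (x - y)) : borel_measurable lebesgue" by (rule measurable_completion) simp
   then have "(%y. k (x - y)) : borel_measurable (lebesgue_on \<Omega>)" by (rule measurable_restrict_space1)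
   then have "(%y. k (x - y) *R p y) : borel_measurable (lebesgue_on \<Omega>)" using p by measurable
   then show ?thesis using \<Omega>' by (simp add: borel_measurable_restrict_space_iff)
  qed
  ultimately have "(LINT y|lebesgue. indicator \<Omega> y *R (k (x - y) *R p y)) = (LINT y|lebesgue. k (x - y) *R P y)"
   using measurable_completion[OF km] by (intro integral_cong_AE)
  also have "... = convol k P x" unfolding convol_def by (rule integral_completion[OF km])
  finally show ?thesis using \<Omega>' by (simp add: integral_restrict_space)
 qed
 have fm': "f' : borel_measurable (lebesgue_on \<Omega>)" using wp by (simp add: is_weak_partial_def L2_loc_def)
 have "- (LINT y|lebesgue_on \<Omega>. g' (x - y) v *R f y) = - (LINT y|lebesgue_on \<Omega>. g (x - y) *R f' y)"
  using eq by (simp add: fd \<psi>_def)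
 then show ?thesis using conv[OF g(4)[of v] F fm] conv[OF g(1) F' fm'] by simp
qed

definition annulus :: "real => real => 'a::euclidean_space set"
 where "annulus r1 r2 = {x. r1 <= norm x & norm x <= r2}"

lemma compact_annulus [simp]: "compact (annulus r1 r2)"
proof -
 have "annulus r1 r2 = cball 0 r2 - ball (0::'a) r1" by (auto simp: annulus_def)
 then show ?thesis by (simp add: compact_diff)
qed

lemma annulus_sets [measurable, simp]: "annulus r1 r2 : sets borel"
 by (intro borel_closed compact_imp_closed) simp

lemma open_exterior [simp]: "open (exterior R :: 'a::euclidean_space set)"
 unfolding exterior_def by (intro open_Collect_less continuous_intros)

lemma L2norm_le_lborel:
 fixes f :: "'a::euclidean_space => complex"
 assumes A: "A : sets borel" "A \<subseteq> K" and C: "!!x. x : A ==> \<phi> x = C x"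
  and F: "AE x in lborel. x : K --> F x = f x"
  and sq: "L2fun lborel (%x. C x - F x)" and m: "\<phi> : borel_measurable borel" "f : borel_measurable (lebesgue_on A)"
 shows "L2norm (lebesgue_on A) (%x. \<phi> x - f x) <= L2norm lborel (%x. C x - F x)"
proof -
 have A': "A : sets lebesgue" using A by simp
 have CF: "(%x. (cmod (C x - F x))^2) : borel_measurable lborel"
  using L2fun_integrable[OF sq] by (rule borel_measurable_integrable)
 have "(LINT x|lebesgue_on A. (cmod (\<phi> x - f x))^2) = (LINT x|lebesgue. indicator A x *R (cmod (\<phi> x - f x))\<^sup>2)"
  using A' by (simp add: integral_restrict_space)
 also have "... = (LINT x|lebesgue. indicator A x *R (cmod (C x - F x))\<^sup>2)"
 proof (rule integral_cong_AE)
  have "\<phi> : borel_measurable lebesgue" using m by (intro measurable_completion) simp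
  then have "(%x. (cmod (\<phi> x - f x))^2) : borel_measurable (lebesgue_on A)"
   using m measurable_restrict_space1[of \<phi> lebesgue borel A] by measurable
  then show "(%x. indicator A x *R (cmod (\<phi> x - f x))\<^sup>2) : borel_measurable lebesgue"
   using A' by (simp add: borel_measurable_restrict_space_iff)
  show "(%x. indicator A x *R (cmod (C x - F x))\<^sup>2) : borel_measurable lebesgue"
   using CF A by (intro measurable_completion borel_measurable_scaleR borel_measurable_indicator) auto
  show "AE x in lebesgue. indicator A x *R (cmod (\<phi> x - f x))\<^sup>2 = indicator A x *R (cmod (C x - F x))\<^sup>2"
   using AE_completion[OF F] by eventually_elim (use A(2) C in \<open>auto simp: indicator_def\<close>)
 qed
 also have "... = (LINT x|lborel. indicator A x *R (cmod (C x - F x))\<^sup>2)"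
  using CF A by (intro integral_completion borel_measurable_scaleR borel_measurable_indicator) auto
 also have "... <= (LINT x|lborel. (cmod (C x - F x))^2)"
 proof (rule Bochner_Integration.integral_mono)
  show "integrable lborel (%x. (cmod (C x - F x))^2)" using sq by (simp add: L2fun_def)
  then show "integrable lborel (%x. indicator A x *R (cmod (C x - F x))\<^sup>2)"
   using A by (intro integrable_mult_indicator) auto
 qed (auto simp: indicator_def)
 finally show ?thesis by (simp add: L2norm_def)
qed

text \<open>\<open>weak_partial\<close> is a choice; membership in \<open>H2_loc\<close> guarantees
  that the chosen function really is a weak derivative, for first and second order.\<close>

lemma H2_loc_is_weak_partial:
 assumes "H2_loc \<Omega> u" "b : Basis"
 shows "is_weak_partial \<Omega> b u (weak_partial \<Omega> b u)" "L2_loc \<Omega> u" "L2_loc \<Omega> (weak_partial \<Omega> b u)"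
  and "c : Basis ==> is_weak_partial \<Omega> c (weak_partial \<Omega> b u) (weak_partial \<Omega> c (weak_partial \<Omega> b u))"
proof -
 have s: "is_weak_partial \<Omega> c f (weak_partial \<Omega> c f)" if "H1_loc \<Omega> f" "c : Basis" for c f
 proof -
  have "EX g. is_weak_partial \<Omega> c f g" using that unfolding H1_loc_def by blast
  then show ?thesis unfolding weak_partial_def by (rule someI_ex)
 qed
 have h: "H1_loc \<Omega> u" "H1_loc \<Omega> (weak_partial \<Omega> b u)" using assms unfolding H2_loc_def by blast+
 show "is_weak_partial \<Omega> b u (weak_partial \<Omega> b u)" by (rule s[OF h(1) assms(2)])
 show "L2_loc \<Omega> u" "L2_loc \<Omega> (weak_partial \<Omega> b u)" using h unfolding H1_loc_def by blast+
 show "c : Basis ==> is_weak_partial \<Omega> c (weak_partial \<Omega> b u) (weak_partial \<Omega> c (weak_partial \<Omega> b u))"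
  by (rule s[OF h(2)])
qed

text \<open>u is replaced by a Borel version on an annulus K wider by d and mollified with radii at
  most d. On the smaller annulus every derivative of the mollification is then the mollification of
  the weak derivative, and converges in the mean square.\<close>

theorem smooth_approximation:
 fixes u :: "'a::euclidean_space => complex" and R0 r1 r2 :: real
 defines "\<Omega> \<equiv> exterior R0"
 assumes u: "H2_loc \<Omega> u" and R0: "R0 > 0" and r: "R0 < r1"
 obtains \<phi> g hh where "!!n::nat. C2_complex (\<phi> n) (g n) (hh n)"
  "!!n. smooth_on UNIV (\<phi> n)" "!!n v. smooth_on UNIV (g n v)"
  "(%n. L2norm (lebesgue_on (annulus r1 r2)) (%x. \<phi> n x - u x)) ----> 0"
  "!!b. b : Basis ==> (%n. L2norm (lebesgue_on (annulus r1 r2)) (%x. g n b x - weak_partial \<Omega> b u x)) ----> 0"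
  "!!b c. b : Basis ==> c : Basis ==> (%n. L2norm (lebesgue_on (annulus r1 r2)) (%x. hh n b c x - weak_partial \<Omega> c (weak_partial \<Omega> b u) x)) ----> 0"
proof -
 define d where "d = (r1 - R0) / 2"
 have d: "d > 0" using r by (simp add: d_def)
 define K A where "K = (annulus (r1 - d) (r2 + d) :: 'a set)" and "A = (annulus r1 r2 :: 'a set)"
 have K: "compact K" unfolding K_def by (rule compact_annulus)
 have K2: "K \<subseteq> \<Omega>" using r by (auto simp: K_def \<Omega>_def annulus_def exterior_def d_def field_simps)
 note K = K K2
 have \<Omega>o: "open \<Omega>" by (simp add: \<Omega>_def)
 have AK: "A : sets borel" "A \<subseteq> K" "A \<subseteq> \<Omega>" using d K by (auto simp: A_def K_def annulus_def \<Omega>_def exterior_def r intro: less_le_trans[OF r])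
 define \<epsilon> where "\<epsilon> n = d / real (Suc n)" for n
 have \<epsilon>: "\<epsilon> n > 0" "\<epsilon> n <= d" for n using d by (auto simp: \<epsilon>_def field_simps)
 have \<epsilon>0: "\<epsilon> ----> 0"
  using tendsto_mult[OF tendsto_const[of d] LIMSEQ_inverse_real_of_nat] by (simp add: \<epsilon>_def[abs_def] divide_inverse)
 have cb: "cball x (\<epsilon> n) \<subseteq> K" if x: "x : A" for x n
 proof
  fix y assume "y : cball x (\<epsilon> n)"
  then have "norm (x - y) <= d" using \<epsilon>(2)[of n] by (simp add: dist_norm)
  then show "y : K" using x norm_triangle_ineq2[of x y] norm_triangle_ineq2[of y x]
   by (auto simp: A_def K_def annulus_def norm_minus_commute)
 qed
 let ?ub = "%b. weak_partial \<Omega> b u"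
 let ?ubc = "%b c. weak_partial \<Omega> c (weak_partial \<Omega> b u)"
 note wp = H2_loc_is_weak_partial[OF u]
 obtain b0 :: 'a where b0: "b0 : Basis" using nonempty_Basis by blast
 have L0: "L2_loc \<Omega> u" by (rule wp(2)[OF b0])
 have L1: "L2_loc \<Omega> (?ub b)" if "b : Basis" for b by (rule wp(3)[OF that])
 have L2: "L2_loc \<Omega> (?ubc b c)" if "b : Basis" "c : Basis" for b c
  using wp(4)[OF that] unfolding is_weak_partial_def by (rule conjunct1)
 note L = L0 L1 L2
 have Lm1: "f : borel_measurable (lebesgue_on \<Omega>)" if "L2_loc \<Omega> f" for f using that unfolding L2_loc_def by (rule conjunct1)
 have Lm2: "f : borel_measurable (lebesgue_on A)" if "L2_loc \<Omega> f" for f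
  by (rule measurable_restrict_mono[OF Lm1[OF that] AK(3)])
 note Lm = Lm1 Lm2
 define BV where "BV f F \<longleftrightarrow> L2fun lborel F & (ALL x. x \<notin> K --> F x = 0) & (AE x in lborel. x : K --> F x = f x)" for f F :: "'a => complex"
 have bv: "EX F. BV f F" if "L2_loc \<Omega> f" for f
  using borel_version[OF that \<Omega>o K] unfolding BV_def by metis
 obtain F0 where F0: "BV u F0" using bv[OF L(1)] by blast
 have "ALL b:Basis. EX F. BV (?ub b) F" using bv L by blast
 then obtain F1 where F1: "!!b. b : Basis ==> BV (?ub b) (F1 b)" by metis
 have "ALL b:Basis. ALL c:Basis. EX F. BV (?ubc b c) F" using bv L by blast
 then obtain F2 where F2: "!!b c. b : Basis ==> c : Basis ==> BV (?ubc b c) (F2 b c)" by metis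
 have supp: "F x = 0" if "BV f F" "norm x > r2 + d" for f F x using that by (auto simp: BV_def K_def annulus_def)
 have sqi: "L2fun lborel F" "F : borel_measurable borel" "AE x in lborel. x : K --> F x = f x" if "BV f F" for f F
  using that by (auto simp: BV_def L2fun_def)
 have int: "integrable lborel F" if "BV f F" for f F
  by (rule integrable_bounded_compact_support[OF sqi(1)[OF that] supp[OF that]])
 define \<rho> :: "nat => 'a => real" where "\<rho> n = mollifier (\<epsilon> n)" for n
 have "EX \<rho>1 \<rho>2. (ALL w. (\<rho> n has_derivative \<rho>1 w) (at w)) & (ALL v. bump_fun (\<epsilon> n) (%w. \<rho>1 w v)) &
   (ALL v w. ((%w. \<rho>1 w v) has_derivative \<rho>2 v w) (at w)) & (ALL v x. bump_fun (\<epsilon> n) (%w. \<rho>2 v w x)) & (ALL v x w. \<rho>2 v w x = \<rho>2 x w v)" for n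
  unfolding \<rho>_def using mollifier_derivatives[OF \<epsilon>(1)[of n]] by metis
 then obtain \<rho>1 \<rho>2 where \<rho>1: "!!n w. (\<rho> n has_derivative \<rho>1 n w) (at w)" "!!n v. bump_fun (\<epsilon> n) (%w. \<rho>1 n w v)"
  and \<rho>2: "!!n v w. ((%w. \<rho>1 n w v) has_derivative \<rho>2 n v w) (at w)" "!!n v x. bump_fun (\<epsilon> n) (%w. \<rho>2 n v w x)" "!!n v x w. \<rho>2 n v w x = \<rho>2 n x w v"
  by metis
 have \<rho>b: "bump_fun (\<epsilon> n) (\<rho> n)" for n unfolding \<rho>_def by (rule mollifier_bump[OF \<epsilon>(1)])
 define \<phi> where "\<phi> n = convol (\<rho> n) F0" for n
 define g where "g n v = convol (%w. \<rho>1 n w v) F0" for n v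
 define hh where "hh n v z = convol (%w. \<rho>2 n v w z) F0" for n v z
 have C2: "C2_complex (\<phi> n) (g n) (hh n)" for n
 proof
  show "(\<phi> n has_derivative (%v. g n v x)) (at x)" for x
   unfolding \<phi>_def g_def by (rule convol_has_derivative[OF \<rho>b \<epsilon>(1) int[OF F0] \<rho>1])
  show "(g n v has_derivative (%w. hh n v w x)) (at x)" for v x
   unfolding hh_def g_def by (rule convol_has_derivative[OF \<rho>1(2) \<epsilon>(1) int[OF F0] \<rho>2(1,2)])
  show "continuous_on UNIV (hh n v w)" for v w
   unfolding hh_def using convol_C_on[OF \<rho>2(2) \<epsilon>(1) int[OF F0], of 0] by simp
  show "hh n v w x = hh n w v x" for v w x unfolding hh_def by (subst \<rho>2(3)) simp
 qed
 have w1: "g n b x = convol (\<rho> n) (F1 b) x" if "b : Basis" "x : A" for n b x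
  unfolding g_def
  by (rule weak_partial_convol[OF wp(1)[OF that(1)] Lm(1)[OF L(1)] \<Omega>o K sqi(2,3)[OF F0] sqi(2,3)[OF F1[OF that(1)]] \<rho>b \<epsilon>(1) \<rho>1 cb[OF that(2)]])
 \<comment> \<open>One derivative is moved at a time: first the one along b onto u, with the
   c-derivative of the mollifier as kernel, then the one along c onto the weak derivative. The
   symmetry of \<rho>2 puts the directions into this order.\<close>
 have w2: "hh n b c x = convol (\<rho> n) (F2 b c) x" if "b : Basis" "c : Basis" "x : A" for n b c x
 proof -
  have "hh n b c x = convol (%w. \<rho>2 n c w b) F0 x" unfolding hh_def by (subst \<rho>2(3)) simp
  also have "... = convol (%w. \<rho>1 n w c) (F1 b) x"
   by (rule weak_partial_convol[OF wp(1)[OF that(1)] Lm(1)[OF L(1)] \<Omega>o K sqi(2,3)[OF F0] sqi(2,3)[OF F1[OF that(1)]] \<rho>1(2) \<epsilon>(1) \<rho>2(1,2) cb[OF that(3)]])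
  also have "... = convol (\<rho> n) (F2 b c) x"
   by (rule weak_partial_convol[OF wp(4)[OF that(1,2)] Lm(1)[OF L(2)[OF that(1)]] \<Omega>o K sqi(2,3)[OF F1[OF that(1)]] sqi(2,3)[OF F2[OF that(1,2)]] \<rho>b \<epsilon>(1) \<rho>1 cb[OF that(3)]])
  finally show ?thesis .
 qed
 have lim: "(%n. L2norm (lebesgue_on A) (%x. p n x - f x)) ----> 0"
  if F: "BV f F" and f: "L2_loc \<Omega> f" and p: "!!n x. x : A ==> p n x = convol (\<rho> n) F x" "!!n. continuous_on UNIV (p n)" for p f F
 proof (rule Lim_null_comparison[OF always_eventually])
  show "(%n. L2norm lborel (%x. convol (\<rho> n) F x - F x)) ----> 0"
   unfolding \<rho>_def by (rule convol_tendsto_L2[OF sqi(1)[OF F] supp[OF F] \<epsilon>(1) \<epsilon>0])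
  show "ALL n. norm (L2norm (lebesgue_on A) (%x. p n x - f x)) <= L2norm lborel (%x. convol (\<rho> n) F x - F x)"
  proof
   fix n
   have sq: "L2fun lborel (%x. convol (\<rho> n) F x - F x)"
    unfolding \<rho>_def by (rule L2fun_diff[OF convol_L2_contraction(1)[OF \<epsilon>(1) sqi(1)[OF F] int[OF F]] sqi(1)[OF F]])
   have "L2norm (lebesgue_on A) (%x. p n x - f x) <= L2norm lborel (%x. convol (\<rho> n) F x - F x)"
    by (rule L2norm_le_lborel[OF AK(1,2) p(1) sqi(3)[OF F] sq borel_measurable_continuous_onI[OF p(2)] Lm(2)[OF f]])
   then show "norm (L2norm (lebesgue_on A) (%x. p n x - f x)) <= L2norm lborel (%x. convol (\<rho> n) F x - F x)" by simp
  qed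
 qed
 show ?thesis
 proof (rule that[of \<phi> g hh])
  show "smooth_on UNIV (\<phi> n)" "smooth_on UNIV (g n v)" for n v
   unfolding smooth_on_def \<phi>_def g_def
   using convol_C_on[OF \<rho>b \<epsilon>(1) int[OF F0]] convol_C_on[OF \<rho>1(2) \<epsilon>(1) int[OF F0]] by blast+
  show "(%n. L2norm (lebesgue_on (annulus r1 r2)) (%x. \<phi> n x - u x)) ----> 0"
   unfolding A_def[symmetric] by (rule lim[OF F0 L(1)]) (simp_all add: \<phi>_def C1_complex.c0[OF C2_complex_imp_C1[OF C2], unfolded \<phi>_def])
  show "(%n. L2norm (lebesgue_on (annulus r1 r2)) (%x. g n b x - weak_partial \<Omega> b u x)) ----> 0" if "b : Basis" for b
   unfolding A_def[symmetric] by (rule lim[OF F1[OF that] L(2)[OF that] w1[OF that] C1_complex.c1[OF C2_complex_imp_C1[OF C2]]])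
  show "(%n. L2norm (lebesgue_on (annulus r1 r2)) (%x. hh n b c x - weak_partial \<Omega> c (weak_partial \<Omega> b u) x)) ----> 0" if "b : Basis" "c : Basis" for b c
   unfolding A_def[symmetric] by (rule lim[OF F2[OF that] L(3)[OF that] w2[OF that] C2_complex.c2[OF C2]])
 qed (rule C2)
qed

subsection \<open>Traces on spheres\<close>

lemma continuous_sphere_integral:
 fixes g :: "real => 'a::euclidean_space => real"
 assumes c: "continuous_on ({a..b} \<times> sphere 0 1) (%(t, om). g t om)"
 shows "continuous_on {a..b} (%t. LINT om|sphere0. g t om)"
 unfolding continuous_on_iff
proof (intro ballI allI impI)
 fix t and e :: real assume t: "t : {a..b}" and e: "e > 0"
 define s where "s = measure (sphere0 :: 'a measure) (sphere 0 1) + 1"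
 have s: "s > 0" by (simp add: s_def add_nonneg_pos)
 have gi: "integrable sphere0 (g t)" if "t : {a..b}" for t
 proof -
  have "continuous_on (sphere 0 1) (%om. case (t, om) of (t, om) => g t om)"
   by (rule continuous_on_compose2[OF c, of "sphere 0 1" "%om. (t, om)"]) (use that in \<open>auto intro!: continuous_intros\<close>)
  then show ?thesis by (intro integrable_sphere0_continuous) simp
 qed
 have "uniformly_continuous_on ({a..b} \<times> sphere 0 1) (%(t, om). g t om)"
  using c by (intro compact_uniformly_continuous compact_Times) auto
 then obtain d where d: "d > 0" and D: "!!x y. x : {a..b} \<times> sphere 0 1 ==> y : {a..b} \<times> sphere 0 1 ==> dist y x < d ==>
   dist (case y of (t, om) => g t om) (case x of (t, om) => g t om) < e / s"
  unfolding uniformly_continuous_on_def using e s by (metis divide_pos_pos)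
 show "EX d>0. ALL t':{a..b}. dist t' t < d --> dist (LINT om|sphere0. g t' om) (LINT om|sphere0. g t om) < e"
 proof (intro exI[of _ d] conjI d ballI impI)
  fix t' assume t': "t' : {a..b}" "dist t' t < d"
  have "\<bar>(LINT om|sphere0. g t' om) - (LINT om|sphere0. g t om)\<bar> = \<bar>LINT om|sphere0. g t' om - g t om\<bar>"
   using gi[OF t] gi[OF t'(1)] by simp
  also have "... <= (LINT om|sphere0. \<bar>g t' om - g t om\<bar>)" using integral_norm_bound[of sphere0 "%om. g t' om - g t om"] by simp
  also have "... <= (LINT om|(sphere0 :: 'a measure). e / s)"
  proof (rule Bochner_Integration.integral_mono)
   show "integrable sphere0 (%om. \<bar>g t' om - g t om\<bar>)" using gi[OF t] gi[OF t'(1)] by simp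
   show "\<bar>g t' om - g t om\<bar> <= e / s" if "om : space sphere0" for om
    using D[of "(t, om)" "(t', om)"] t t' that by (simp add: dist_Pair_Pair dist_real_def)
  qed simp
  also have "... = e * (measure (sphere0 :: 'a measure) (sphere 0 1) / s)" by simp
  also have "... < e * 1" using e s by (intro mult_strict_left_mono) (auto simp: s_def)
  finally show "dist (LINT om|sphere0. g t' om) (LINT om|sphere0. g t om) < e" by (simp add: dist_real_def)
 qed
qed

text \<open>Polar coordinates for Lebesgue measure on an annulus, with the radial integral as a
  gauge integral, so that it can be compared with the fundamental theorem of calculus in
  \<open>trace_inequality\<close>.\<close>

lemma polar_continuous:
 fixes f :: "'a::euclidean_space => real"
 assumes f: "continuous_on UNIV f" "!!x. f x >= 0" and r: "0 < r1"
 shows "continuous_on {r1..r2} (%t. LINT om|sphere0. f (t *R om))"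
  and "(LINT x|lebesgue_on (annulus r1 r2). f x) = integral {r1..r2} (%t. t ^ (DIM('a) - 1) * (LINT om|sphere0. f (t *R om)))"
proof -
 let ?A = "annulus r1 r2 :: 'a set" and ?I = "%t. LINT om|sphere0. f (t *R om)" and ?N = "DIM('a)"
 have fc: "continuous_on S (%x. f (k x))" if "continuous_on S k" for S :: "'b::topological_space set" and k
  by (rule continuous_on_compose2[OF f(1) that]) auto
 show Ic: "continuous_on {r1..r2} ?I"
  by (rule continuous_sphere_integral) (unfold split_beta, intro fc continuous_intros)
 have [measurable]: "f : borel_measurable borel" using f(1) by (rule borel_measurable_continuous_onI)
 have I0: "?I t >= 0" for t using f(2) by simp
 have fi: "integrable lborel (%x. indicator ?A x *R f x)"
  by (rule borel_integrable_compact) (auto intro: continuous_on_subset[OF f(1)])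
 have "(LINT x|lebesgue_on ?A. f x) = (LINT x|lebesgue. indicator ?A x *R f x)" by (simp add: integral_restrict_space)
 also have "... = (LINT x|lborel. indicator ?A x *R f x)" by (rule integral_completion) simp
 finally have e1: "(LINT x|lebesgue_on ?A. f x) = (LINT x|lborel. indicator ?A x *R f x)" .
 have "ennreal (LINT x|lborel. indicator ?A x *R f x) = (\<integral>\<^sup>+x. ennreal (indicator ?A x *R f x) \<partial>lborel)"
  using fi f(2) by (intro nn_integral_eq_integral[symmetric]) auto
 also have "... = (\<integral>\<^sup>+t. (\<integral>\<^sup>+om. ennreal (indicator ?A (t *R om) *R f (t *R om)) \<partial>sphere0) \<partial>radial_measure ?N)"
  by (rule polar_nn_integral) measurable
 also have "... = (\<integral>\<^sup>+t. ennreal (indicator {r1..r2} t * ?I t) \<partial>radial_measure ?N)"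
 proof (rule nn_integral_cong_AE)
  show "AE t in radial_measure ?N. (\<integral>\<^sup>+om. ennreal (indicator ?A (t *R om) *R f (t *R om)) \<partial>sphere0) = ennreal (indicator {r1..r2} t * ?I t)"
   using AE_radial_pos
  proof eventually_elim
   case (elim t)
   have fit: "integrable sphere0 (%om. f (t *R om))" by (intro integrable_sphere0_continuous fc continuous_intros)
   have "(\<integral>\<^sup>+om. ennreal (indicator ?A (t *R om) *R f (t *R om)) \<partial>(sphere0 :: 'a measure)) = (\<integral>\<^sup>+om. indicator {r1..r2} t * ennreal (f (t *R om)) \<partial>sphere0)"
    by (rule nn_integral_cong) (use elim in \<open>auto simp: annulus_def indicator_def\<close>)
   also have "... = indicator {r1..r2} t * (\<integral>\<^sup>+om. ennreal (f (t *R om)) \<partial>sphere0)"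
    using fit by (intro nn_integral_cmult) simp
   also have "(\<integral>\<^sup>+om. ennreal (f (t *R om)) \<partial>sphere0) = ennreal (?I t)"
    using fit f(2) by (intro nn_integral_eq_integral) auto
   finally show ?case by (auto simp: indicator_def)
  qed
 qed
 also have "... = (\<integral>\<^sup>+t. ennreal (t ^ (?N - 1)) * indicator {0<..} t * ennreal (indicator {r1..r2} t * ?I t) \<partial>lborel)"
  unfolding radial_measure_def
 proof (rule nn_integral_density)
  have "(%t. indicator {r1..r2} t *R ?I t) : borel_measurable borel"
   by (rule borel_measurable_continuous_on_indicator[OF _ Ic]) simp
  then show "(%t. ennreal (indicator {r1..r2} t * ?I t)) : borel_measurable lborel" by simp
 qed measurable
 also have "... = (\<integral>\<^sup>+t. ennreal (indicator {r1..r2} t *R (t ^ (?N - 1) * ?I t)) \<partial>lborel)"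
  by (rule nn_integral_cong) (use r I0 in \<open>auto simp: indicator_def ennreal_mult\<close>)
 also have "... = ennreal (LINT t|lborel. indicator {r1..r2} t *R (t ^ (?N - 1) * ?I t))"
  using I0 r by (intro nn_integral_eq_integral borel_integrable_compact continuous_intros Ic AE_I2) (auto simp: indicator_def)
 finally have "(LINT x|lborel. indicator ?A x *R f x) = (LINT t|lborel. indicator {r1..r2} t *R (t ^ (?N - 1) * ?I t))"
  using I0 r f(2) by (subst (asm) ennreal_inj) (auto intro!: integral_nonneg_AE AE_I2 simp: indicator_def)
 also have "... = integral {r1..r2} (%t. t ^ (?N - 1) * ?I t)"
 proof -
  have "set_integrable lborel {r1..r2} (%t. t ^ (?N - 1) * ?I t)"
   unfolding set_integrable_def by (intro borel_integrable_compact continuous_intros Ic) simp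
  from set_borel_integral_eq_integral(2)[OF this] show ?thesis by (simp only: set_lebesgue_integral_def)
 qed
 finally show "(LINT x|lebesgue_on ?A. f x) = integral {r1..r2} (%t. t ^ (?N - 1) * ?I t)" using e1 by simp
qed

lemma L2fun_continuous_annulus:
 fixes f :: "'a::euclidean_space => complex"
 assumes f: "continuous_on UNIV f"
 shows "L2fun (lebesgue_on (annulus r1 r2)) f"
proof -
 have fb[measurable]: "f : borel_measurable borel" using f by (rule borel_measurable_continuous_onI)
 have "integrable lborel (%x. indicator (annulus r1 r2) x *R (cmod (f x))\<^sup>2)"
  by (rule borel_integrable_compact) (auto intro!: continuous_intros continuous_on_subset[OF f])
 then have "integrable lebesgue (%x. indicator (annulus r1 r2) x *R (cmod (f x))\<^sup>2)" by (subst integrable_completion) auto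
 moreover have "f : borel_measurable lebesgue" by (rule measurable_completion) simp
 ultimately show ?thesis unfolding L2fun_def
  by (auto simp: integrable_restrict_space intro: measurable_restrict_space1)
qed

lemma L2_loc_annulus:
 assumes f: "L2_loc (exterior R0) f" and r: "R0 < r1"
 shows "L2fun (lebesgue_on (annulus r1 r2)) f"
proof -
 have A: "annulus r1 r2 \<subseteq> exterior R0" using r by (auto simp: annulus_def exterior_def)
 have "f : borel_measurable (lebesgue_on (exterior R0))" using f unfolding L2_loc_def by (rule conjunct1)
 then have "f : borel_measurable (lebesgue_on (annulus r1 r2))" by (rule measurable_restrict_mono[OF _ A])
 moreover have "integrable (lebesgue_on (annulus r1 r2)) (%x. (cmod (f x))^2)"
  using f A compact_annulus unfolding L2_loc_def by blast
 ultimately show ?thesis by (simp add: L2fun_def)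
qed

lemma L2norm_annulus_mono:
 assumes f: "L2fun (lebesgue_on (annulus r1 r2)) f" and s: "r1 <= s1" "s2 <= r2"
 shows "L2norm (lebesgue_on (annulus s1 s2)) f <= L2norm (lebesgue_on (annulus r1 r2)) f"
proof -
 have sub: "annulus s1 s2 \<subseteq> annulus r1 r2" using s by (auto simp: annulus_def)
 have i: "integrable lebesgue (%x. indicator (annulus r1 r2) x *R (cmod (f x))\<^sup>2)"
  using f by (simp add: L2fun_def integrable_restrict_space)
 have e: "indicator (annulus s1 s2) x *R (cmod (f x))\<^sup>2 = indicator (annulus s1 s2) x *R (indicator (annulus r1 r2) x *R (cmod (f x))\<^sup>2)" for x
  using sub by (auto simp: indicator_def)
 have i2: "integrable lebesgue (%x. indicator (annulus s1 s2) x *R (cmod (f x))\<^sup>2)"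
 proof -
  have "integrable lebesgue (%x. indicator (annulus s1 s2) x *R (indicator (annulus r1 r2) x *R (cmod (f x))\<^sup>2))"
   by (rule integrable_mult_indicator[OF _ i]) simp
  then show ?thesis by (simp only: e[symmetric])
 qed
 have "(LINT x|lebesgue. indicator (annulus s1 s2) x *R (cmod (f x))\<^sup>2) <= (LINT x|lebesgue. indicator (annulus r1 r2) x *R (cmod (f x))\<^sup>2)"
  using i i2 sub by (intro Bochner_Integration.integral_mono) (auto simp: indicator_def)
 then show ?thesis by (simp add: L2norm_def integral_restrict_space)
qed

lemma C1_complex_diff:
 assumes "C1_complex \<phi> g" "C1_complex \<psi> k"
 shows "C1_complex (%x. \<phi> x - \<psi> x) (%v x. g v x - k v x)"
proof -
 interpret f: C1_complex \<phi> g by fact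
 interpret s: C1_complex \<psi> k by fact
 show ?thesis by unfold_locales (intro has_derivative_diff f.d1 s.d1 continuous_intros f.c1 s.c1)+
qed

text \<open>A sum of norms, equivalent to the usual H1 norm; with it convergence is checked one
  derivative at a time.\<close>

definition H1norm :: "'a::euclidean_space set => ('a => complex) => ('a => 'a => complex) => real"
 where "H1norm A \<phi> g = L2norm (lebesgue_on A) \<phi> + (SUM b:Basis. L2norm (lebesgue_on A) (g b))"

lemma H1norm_nonneg [simp]: "H1norm A \<phi> g >= 0"
 by (auto simp: H1norm_def intro!: add_nonneg_nonneg sum_nonneg)

text \<open>The sphere integral a(t) of |\<phi>|^2 and its derivative are both bounded by E(t), the
  sphere integral of |\<phi>|^2 + |grad \<phi>|^2. With J the integral of E this gives a(r) <= E(t)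
  + J for every t, and averaging over t leaves J alone.\<close>

lemma trace_inequality:
 assumes r: "0 < r1" "r1 < r2"
 obtains C where "C >= 0" "!!(\<phi> :: 'a::euclidean_space => complex) g r. C1_complex \<phi> g ==> r1 <= r ==> r <= r2 ==>
  L2norm sphere0 (%om. \<phi> (r *R om)) <= C * H1norm (annulus r1 r2) \<phi> g"
proof -
 let ?N = "DIM('a)" and ?A = "annulus r1 r2 :: 'a set"
 \<comment> \<open>1/(r2 - r1) comes from averaging, the summand 1 from the oscillation of a, and
   r1^(N-1) from comparing dr with the volume element of the annulus.\<close>
 define c where "c = (1 / (r2 - r1) + 1) / r1 ^ (?N - 1)"
 have c0: "c >= 0" using r by (simp add: c_def)
 have main: "L2norm sphere0 (%om. \<phi> (r *R om)) <= sqrt c * H1norm ?A \<phi> g"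
  if C1: "C1_complex \<phi> g" and rr: "r1 <= r" "r <= r2" for \<phi> :: "'a => complex" and g r
 proof -
  interpret C1_complex \<phi> g by (rule C1)
  define f where "f x = (cmod (\<phi> x))^2 + grad2 x" for x
  define a where "a t = (LINT om|sphere0. (cmod (\<phi> (t *R om)))^2)" for t
  define a' where "a' t = (LINT om|sphere0. 2 * (\<phi> (t *R om) \<bullet> g om (t *R om)))" for t
  define E where "E t = (LINT om|sphere0. f (t *R om))" for t
  have fc: "continuous_on UNIV f" unfolding f_def by (intro continuous_intros continuous_phi continuous_grad2)
  have f0: "f x >= 0" for x by (auto simp: f_def grad2_def intro!: add_nonneg_nonneg sum_nonneg)
  have Ec: "continuous_on {r1..r2} E" unfolding E_def by (rule polar_continuous(1)[OF fc f0 r(1)])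
  have i: "integrable sphere0 (%om. k (t *R om))" if "continuous_on UNIV k" for t and k :: "'a => real"
   by (intro integrable_sphere0_continuous continuous_on_compose2[OF that] continuous_intros) auto
  have fE: "integrable sphere0 (%om. f (t *R om))" for t by (rule i[OF fc])
  have gb: "(cmod (g om x))\<^sup>2 <= grad2 x" if w: "norm om = 1" for om x
  proof -
   have "g om x = (SUM b:Basis. (om \<bullet> b) *R g b x)" by (rule has_derivative_basis_expansion[OF lin1])
   then have "cmod (g om x) <= (SUM b:Basis. \<bar>om \<bullet> b\<bar> * cmod (g b x))" by (simp add: norm_sum order_trans[OF norm_sum])
   then have "(cmod (g om x))\<^sup>2 <= (SUM b:Basis. \<bar>om \<bullet> b\<bar> * cmod (g b x))\<^sup>2" by (intro power_mono) auto
   also have "... <= (SUM b:Basis. \<bar>om \<bullet> b\<bar>\<^sup>2) * (SUM b:Basis. (cmod (g b x))^2)" by (rule Cauchy_Schwarz_ineq_sum)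
   also have "(SUM b:Basis. \<bar>om \<bullet> b\<bar>\<^sup>2) = 1"
    using euclidean_inner[of om om] w by (simp add: power2_eq_square dot_square_norm)
   finally show ?thesis by (simp add: grad2_def)
  qed
  have aE: "a t <= E t" for t unfolding a_def E_def
  proof (rule Bochner_Integration.integral_mono)
   show "integrable sphere0 (%om. (cmod (\<phi> (t *R om)))^2)"
    by (rule i[of "%x. (cmod (\<phi> x))^2"]) (intro continuous_intros c0)
  qed (use fE in \<open>auto simp: f_def grad2_def intro!: sum_nonneg\<close>)
  have a'E: "norm (a' t) <= E t" for t
  proof -
   have i2: "integrable sphere0 (%om. 2 * (\<phi> (t *R om) \<bullet> g om (t *R om)))"
    by (intro integrable_sphere0_continuous continuous_intros continuous_phi continuous_g)
   show ?thesis unfolding a'_def E_def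
   proof (rule order_trans[OF integral_norm_bound], rule Bochner_Integration.integral_mono)
    show "norm (2 * (\<phi> (t *R om) \<bullet> g om (t *R om))) <= f (t *R om)" if w: "om : space sphere0" for om
    proof -
     have "norm (2 * (\<phi> (t *R om) \<bullet> g om (t *R om))) <= 2 * (cmod (\<phi> (t *R om)) * cmod (g om (t *R om)))"
      using Cauchy_Schwarz_ineq2[of "\<phi> (t *R om)" "g om (t *R om)"] by simp
     also have "... <= (cmod (\<phi> (t *R om)))\<^sup>2 + (cmod (g om (t *R om)))^2"
      using sum_squares_bound[of "cmod (\<phi> (t *R om))" "cmod (g om (t *R om))"] by simp
     also have "... <= f (t *R om)" using gb[of om] w by (simp add: f_def)
     finally show ?thesis .
    qed
   qed (use i2 fE in auto)
  qed
  define J where "J = integral {r1..r2} E"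
  have Ei: "E integrable_on {x..y}" if "r1 <= x" "y <= r2" for x y
   using that by (intro integrable_continuous_interval continuous_on_subset[OF Ec]) auto
  have E0: "E t >= 0" for t unfolding E_def using f0 by simp
  have ad: "a y - a x <= J & a x - a y <= J" if "r1 <= x" "x <= y" "y <= r2" for x y
  proof -
   have "(a' has_integral (a y - a x)) {x..y}"
   proof (rule fundamental_theorem_of_calculus[OF that(2)])
    fix t assume t: "t : {x..y}"
    have "(a has_real_derivative a' t) (at t)" unfolding a_def[abs_def] a'_def
     by (rule sphere_norm_deriv) (use that t r in auto)
    then show "(a has_vector_derivative a' t) (at t within {x..y})"
     by (simp add: has_real_derivative_iff_has_vector_derivative has_vector_derivative_at_within)
   qed
   then have 1: "a y - a x = integral {x..y} a'" "a' integrable_on {x..y}" by (auto simp: integral_unique)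
   have "norm (integral {x..y} a') <= integral {x..y} E"
    using 1(2) Ei[OF that(1,3)] a'E by (intro integral_norm_bound_integral) auto
   also have "... <= J" unfolding J_def using that Ei E0 by (intro integral_subset_le) auto
   finally show ?thesis using 1 by auto
  qed
  have "integral {r1..r2} (%t. a r) <= integral {r1..r2} (%t. E t + J)"
  proof (rule integral_le)
   show "a r <= E t + J" if "t : {r1..r2}" for t
    using ad[of t r] ad[of r t] that rr aE[of t] by (cases "t <= r") auto
  qed (use Ei[of r1 r2] in \<open>auto intro!: integrable_add\<close>)
  also have "integral {r1..r2} (%t. E t + J) = J + (r2 - r1) * J"
   using r Ei[of r1 r2] by (subst Henstock_Kurzweil_Integration.integral_add) (auto simp: J_def)
  finally have "(r2 - r1) * a r <= J + (r2 - r1) * J" using r by simp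
  then have ar: "a r <= (1 / (r2 - r1) + 1) * J" using r by (simp add: field_simps)
  have "r1 ^ (?N - 1) * J <= integral {r1..r2} (%t. t ^ (?N - 1) * E t)"
  proof -
   have "r1 ^ (?N - 1) * J = integral {r1..r2} (%t. r1 ^ (?N - 1) * E t)" by (simp add: J_def)
   also have "... <= integral {r1..r2} (%t. t ^ (?N - 1) * E t)"
    using r E0 by (intro integral_le integrable_continuous_interval continuous_intros Ec mult_right_mono power_mono) auto
   finally show ?thesis .
  qed
  also have "... = (LINT x|lebesgue_on ?A. f x)" unfolding E_def by (rule polar_continuous(2)[OF fc f0 r(1), symmetric])
  also have "... = (L2norm (lebesgue_on ?A) \<phi>)^2 + (SUM b:Basis. (L2norm (lebesgue_on ?A) (g b))^2)"
   unfolding f_def grad2_def L2norm_power2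
   using L2fun_continuous_annulus[OF C1_complex.c0[OF C1]] L2fun_continuous_annulus[OF c1]
   by (subst Bochner_Integration.integral_add) (auto simp: L2fun_def Bochner_Integration.integral_sum)
  also have "... <= (H1norm ?A \<phi> g)\<^sup>2"
  proof -
   have "(SUM b:Basis. (L2norm (lebesgue_on ?A) (g b))^2) <= (SUM b:Basis. L2norm (lebesgue_on ?A) (g b))\<^sup>2"
   proof -
    have "(SUM b:Basis. (L2norm (lebesgue_on ?A) (g b))^2) <= (SUM b:Basis. L2norm (lebesgue_on ?A) (g b) * (SUM b:Basis. L2norm (lebesgue_on ?A) (g b)))"
     unfolding power2_eq_square by (intro sum_mono mult_left_mono member_le_sum) auto
    then show ?thesis by (simp add: sum_distrib_right[symmetric] power2_eq_square)
   qed
   moreover have "0 <= 2 * L2norm (lebesgue_on ?A) \<phi> * (SUM b:Basis. L2norm (lebesgue_on ?A) (g b))"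
    by (intro mult_nonneg_nonneg sum_nonneg) auto
   ultimately show ?thesis unfolding H1norm_def by (simp add: power2_sum)
  qed
  finally have "J <= (H1norm ?A \<phi> g)\<^sup>2 / r1 ^ (?N - 1)" using r by (simp add: field_simps)
  then have "(1 / (r2 - r1) + 1) * J <= (1 / (r2 - r1) + 1) * ((H1norm ?A \<phi> g)^2 / r1 ^ (?N - 1))"
   using r by (intro mult_left_mono) auto
  then have "a r <= c * (H1norm ?A \<phi> g)^2" using ar by (simp add: c_def)
  then have "sqrt (a r) <= sqrt (c * (H1norm ?A \<phi> g)^2)" by simp
  then show ?thesis by (simp add: L2norm_def a_def real_sqrt_mult)
 qed
 show ?thesis by (rule that[of "sqrt c"]) (use main c0 in auto)
qed

lemma L2norm_sphere_measure: "f : borel_measurable sphere0 ==> L2norm sphere_measure f = L2norm sphere0 f"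
 unfolding L2norm_def sphere_measure_eq by (subst integral_completion) auto

lemma L2fun_sphere_measure: "L2fun sphere0 f ==> L2fun sphere_measure f"
 unfolding L2fun_def sphere_measure_eq
 by (auto intro: measurable_completion simp: integrable_completion)

lemma L2fun_sphere_continuous:
 fixes f :: "'a::euclidean_space => complex"
 assumes "continuous_on (sphere 0 1) f" shows "L2fun sphere0 f"
proof -
 have "integrable sphere0 (%x. (cmod (f x))^2)"
  by (intro integrable_sphere0_continuous continuous_intros assms)
 moreover have "f : borel_measurable sphere0"
  using integrable_sphere0_continuous[OF assms] by (rule borel_measurable_integrable)
 ultimately show ?thesis by (simp add: L2fun_def)
qed

lemma C1_complex_restrict:
 fixes \<phi> :: "'a::euclidean_space => complex"
 assumes "C1_complex \<phi> g"
 shows "continuous_on (sphere 0 1) (%om. \<phi> (r *R om))" "L2fun sphere0 (%om. \<phi> (r *R om))"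
proof -
 interpret C1_complex \<phi> g by fact
 show "continuous_on (sphere 0 1) (%om. \<phi> (r *R om))" by (intro continuous_phi continuous_intros)
 then show "L2fun sphere0 (%om. \<phi> (r *R om))" by (rule L2fun_sphere_continuous)
qed

lemma smooth_on_C1_complex:
 fixes \<phi> :: "'a::euclidean_space => complex"
 assumes "smooth_on UNIV \<phi>"
 shows "C1_complex \<phi> (%v x. frechet_derivative \<phi> (at x) v)"
proof
 have c: "C_on (Suc 0) UNIV \<phi>" using assms unfolding smooth_on_def by blast
 show "(\<phi> has_derivative (%v. frechet_derivative \<phi> (at x) v)) (at x)" for x
  using c by (auto simp: frechet_derivative_works)
 show "continuous_on UNIV (%x. frechet_derivative \<phi> (at x) v)" for v using c by simp
qed

lemma C1_complex_frechet:
 assumes "C1_complex \<phi> g" shows "frechet_derivative \<phi> (at x) v = g v x"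
 using fun_cong[OF frechet_derivative_at[OF C1_complex.d1[OF assms, of x]], of v] by simp

text \<open>The filter is arbitrary so that the same statement serves for a single index and for
  pairs of indices in the Cauchy property.\<close>

lemma H1norm_diff_tendsto:
 fixes f :: "'a::euclidean_space => complex"
 assumes f: "L2fun (lebesgue_on A) f" "!!b. b : Basis ==> L2fun (lebesgue_on A) (f' b)" and A: "A = annulus s1 s2"
  and a: "!!n::'n. C1_complex (\<phi> n) (g n)" "((%n. L2norm (lebesgue_on A) (%x. \<phi> n x - f x)) ---> 0) F"
   "!!b. b : Basis ==> ((%n. L2norm (lebesgue_on A) (%x. g n b x - f' b x)) ---> 0) F"
  and b: "!!n::'n. C1_complex (\<psi> n) (k n)" "((%n. L2norm (lebesgue_on A) (%x. \<psi> n x - f x)) ---> 0) F"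
   "!!b. b : Basis ==> ((%n. L2norm (lebesgue_on A) (%x. k n b x - f' b x)) ---> 0) F"
 shows "((%n. H1norm A (%x. \<phi> n x - \<psi> n x) (%v x. g n v x - k n v x)) ---> 0) F"
proof -
 have t: "((%n. L2norm (lebesgue_on A) (%x. p n x - q n x)) ---> 0) F"
  if h: "L2fun (lebesgue_on A) h" and p: "!!n. continuous_on UNIV (p n)" "((%n. L2norm (lebesgue_on A) (%x. p n x - h x)) ---> 0) F"
   and q: "!!n. continuous_on UNIV (q n)" "((%n. L2norm (lebesgue_on A) (%x. q n x - h x)) ---> 0) F" for p q :: "'n => 'a => complex" and h
 proof (rule Lim_null_comparison[OF always_eventually])
  show "((%n. L2norm (lebesgue_on A) (%x. p n x - h x) + L2norm (lebesgue_on A) (%x. q n x - h x)) ---> 0) F"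
   using tendsto_add[OF p(2) q(2)] by simp
  show "ALL n. norm (L2norm (lebesgue_on A) (%x. p n x - q n x)) <= L2norm (lebesgue_on A) (%x. p n x - h x) + L2norm (lebesgue_on A) (%x. q n x - h x)"
  proof
   fix n
   have "L2fun (lebesgue_on A) (p n)" "L2fun (lebesgue_on A) (q n)"
    unfolding A using p q by (intro L2fun_continuous_annulus; simp)+
   from L2norm_triangle_diff[OF this(1) h this(2)]
   show "norm (L2norm (lebesgue_on A) (%x. p n x - q n x)) <= L2norm (lebesgue_on A) (%x. p n x - h x) + L2norm (lebesgue_on A) (%x. q n x - h x)"
    by (simp add: L2norm_minus_commute[of _ h])
  qed
 qed
 have "((%n. L2norm (lebesgue_on A) (%x. \<phi> n x - \<psi> n x) + (SUM b:Basis. L2norm (lebesgue_on A) (%x. g n b x - k n b x))) ---> 0 + (SUM b:(Basis::'a set). 0)) F"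
 proof (rule tendsto_add)
  show "((%n. L2norm (lebesgue_on A) (%x. \<phi> n x - \<psi> n x)) ---> 0) F"
   by (rule t[OF f(1) C1_complex.c0[OF a(1)] a(2) C1_complex.c0[OF b(1)] b(2)])
  show "((%n. SUM b:Basis. L2norm (lebesgue_on A) (%x. g n b x - k n b x)) ---> (SUM b:(Basis::'a set). 0)) F"
  proof (rule tendsto_sum)
   fix b :: 'a assume "b : Basis"
   then show "((%n. L2norm (lebesgue_on A) (%x. g n b x - k n b x)) ---> 0) F"
    by (intro t[OF f(2) C1_complex.c1[OF a(1)] a(3) C1_complex.c1[OF b(1)] b(3)])
  qed
 qed
 then show ?thesis by (simp add: H1norm_def)
qed

text \<open>\<open>sphere_trace\<close> picks some function satisfying
  \<open>is_sphere_trace\<close>, and the given sequence has to converge to this very choice.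
  Completeness and the trace inequality show that a trace exists; on the overlap of two annuli the
  trace inequality forces the given sequence and the one behind the chosen trace to have the same
  limit on the sphere.\<close>

theorem sphere_trace_tendsto:
 fixes f :: "'a::euclidean_space => complex" and R0 r1 r2 r :: real
 defines "\<Omega> \<equiv> exterior R0"
 assumes R0: "R0 > 0" and f: "L2_loc \<Omega> f" "!!b. b : Basis ==> L2_loc \<Omega> (weak_partial \<Omega> b f)"
  and r: "R0 < r1" "r1 < r" "r < r2"
  and sm: "!!n::nat. smooth_on UNIV (\<psi> n)" and C1: "!!n. C1_complex (\<psi> n) (k n)"
  and lim: "(%n. L2norm (lebesgue_on (annulus r1 r2)) (%x. \<psi> n x - f x)) ----> 0"
   "!!b. b : Basis ==> (%n. L2norm (lebesgue_on (annulus r1 r2)) (%x. k n b x - weak_partial \<Omega> b f x)) ----> 0"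
 shows "L2fun sphere_measure (sphere_trace \<Omega> r f)"
  and "(%n. L2norm sphere_measure (%om. \<psi> n (r *R om) - sphere_trace \<Omega> r f om)) ----> 0"
proof -
 let ?A = "annulus r1 r2 :: 'a set"
 have sqf: "L2fun (lebesgue_on (annulus s1 s2)) f" "!!b. b : Basis ==> L2fun (lebesgue_on (annulus s1 s2)) (weak_partial \<Omega> b f)"
  if "R0 < s1" for s1 s2 using L2_loc_annulus[OF _ that] f unfolding \<Omega>_def by blast+
 have sqd: "L2fun (lebesgue_on (annulus s1 s2)) (%x. p x - h x)" if "continuous_on UNIV p" "L2fun (lebesgue_on (annulus s1 s2)) h" for p h s1 s2
  by (rule L2fun_diff[OF L2fun_continuous_annulus[OF that(1)] that(2)])
 have sm_eq: "L2norm sphere_measure (%om. p (r *R om) - q (r *R om)) = L2norm sphere0 (%om. p (r *R om) - q (r *R om))"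
  if "C1_complex p g" "C1_complex q g'" for p q :: "'a => complex" and g g'
  by (rule L2norm_sphere_measure) (rule L2fun_measurable[OF L2fun_diff[OF C1_complex_restrict(2)[OF that(1)] C1_complex_restrict(2)[OF that(2)]]])
 have sq: "L2fun sphere_measure (%om. p (r *R om))" if "C1_complex p g" for p :: "'a => complex" and g
  by (rule L2fun_sphere_measure[OF C1_complex_restrict(2)[OF that]])
 have r12: "0 < r1" "r1 < r2" using r R0 by auto
 obtain C where C: "C >= 0" "!!(\<phi> :: 'a => complex) g r. C1_complex \<phi> g ==> r1 <= r ==> r <= r2 ==>
  L2norm sphere0 (%om. \<phi> (r *R om)) <= C * H1norm ?A \<phi> g"
  using trace_inequality[OF r12, where 'a='a] by blast
 have cauchy: "EX N. ALL m>=N. ALL n>=N. L2norm sphere_measure (%om. \<psi> m (r *R om) - \<psi> n (r *R om)) < e" if e: "e > 0" for e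
 proof -
  have "((%(m, n). H1norm ?A (%x. \<psi> m x - \<psi> n x) (%v x. k m v x - k n v x)) ---> 0) (sequentially \<times>\<^sub>F sequentially)"
   unfolding split_beta
   by (rule H1norm_diff_tendsto[where \<phi>="%p. \<psi> (fst p)" and g="%p. k (fst p)" and \<psi>="%p. \<psi> (snd p)" and k="%p. k (snd p)",
     OF sqf(1)[OF r(1)] sqf(2)[OF r(1)] refl C1 filterlim_compose[OF lim(1) filterlim_fst] filterlim_compose[OF lim(2) filterlim_fst]
     C1 filterlim_compose[OF lim(1) filterlim_snd] filterlim_compose[OF lim(2) filterlim_snd]])
  then have "((%p. C * (case p of (m, n) => H1norm ?A (%x. \<psi> m x - \<psi> n x) (%v x. k m v x - k n v x))) ---> C * 0) (sequentially \<times>\<^sub>F sequentially)"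
   by (intro tendsto_intros)
  then have "\<forall>\<^sub>F p in sequentially \<times>\<^sub>F sequentially. C * (case p of (m, n) => H1norm ?A (%x. \<psi> m x - \<psi> n x) (%v x. k m v x - k n v x)) < e"
   using e order_tendstoD(2) by force
  then obtain N where N: "!!m n. m >= N ==> n >= N ==> C * H1norm ?A (%x. \<psi> m x - \<psi> n x) (%v x. k m v x - k n v x) < e"
   unfolding eventually_prod_sequentially by auto
  show ?thesis
  proof (intro exI[of _ N] allI impI)
   fix m n assume "m >= N" "n >= N"
   from N[OF this] C(2)[OF C1_complex_diff[OF C1 C1], of r m n] r
   show "L2norm sphere_measure (%om. \<psi> m (r *R om) - \<psi> n (r *R om)) < e" unfolding sm_eq[OF C1 C1] by simp
  qed
 qed
 obtain T0 where T0: "L2fun sphere_measure T0" "(%n. L2norm sphere_measure (%om. \<psi> n (r *R om) - T0 om)) ----> 0"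
  using L2_complete[OF sq[OF C1] cauchy] by blast
 have "is_sphere_trace \<Omega> r f T0"
  unfolding is_sphere_trace_def L2_sphere_L2fun
 proof (intro conjI exI)
  show "0 < r1" "r1 < r" "r < r2" using r R0 by auto
  show "?A = {x. r1 <= norm x & norm x <= r2}" by (simp add: annulus_def)
  show "?A \<subseteq> \<Omega>" using r by (auto simp: annulus_def \<Omega>_def exterior_def)
  show "ALL n. smooth_on UNIV (\<psi> n)" using sm by blast
  show "ALL b:Basis. (%n. LINT x|lebesgue_on ?A. (cmod (frechet_derivative (\<psi> n) (at x) b - weak_partial \<Omega> b f x))^2) ----> 0"
   using lim(2) by (simp add: C1_complex_frechet[OF C1] L2_tendsto_iff)
 qed (use T0 lim in \<open>simp_all add: L2_tendsto_iff\<close>)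
 then have tr: "is_sphere_trace \<Omega> r f (sphere_trace \<Omega> r f)"
  unfolding sphere_trace_def by (rule someI[where P="is_sphere_trace \<Omega> r f"])
 then have T0': "L2_sphere (sphere_trace \<Omega> r f)" unfolding is_sphere_trace_def by (rule conjunct1)
 have "EX q1 q2 A \<phi>. 0 < q1 & q1 < r & r < q2 & A = {x. q1 <= norm x & norm x <= q2} & A \<subseteq> \<Omega> &
   (ALL n::nat. smooth_on UNIV (\<phi> n)) &
   (%n. LINT x|lebesgue_on A. (cmod (\<phi> n x - f x))^2) ----> 0 &
   (ALL b:Basis. (%n. LINT x|lebesgue_on A. (cmod (frechet_derivative (\<phi> n) (at x) b - weak_partial \<Omega> b f x))^2) ----> 0) &
   (%n. LINT om|sphere_measure. (cmod (\<phi> n (r *R om) - sphere_trace \<Omega> r f om))^2) ----> 0"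
  using tr unfolding is_sphere_trace_def by (rule conjunct2)
 then obtain q1 q2 A \<phi> where h: "0 < q1 & q1 < r & r < q2 & A = {x. q1 <= norm x & norm x <= q2} & A \<subseteq> \<Omega> &
   (ALL n::nat. smooth_on UNIV (\<phi> n)) &
   (%n. LINT x|lebesgue_on A. (cmod (\<phi> n x - f x))^2) ----> 0 &
   (ALL b:Basis. (%n. LINT x|lebesgue_on A. (cmod (frechet_derivative (\<phi> n) (at x) b - weak_partial \<Omega> b f x))^2) ----> 0) &
   (%n. LINT om|sphere_measure. (cmod (\<phi> n (r *R om) - sphere_trace \<Omega> r f om))^2) ----> 0" by (elim exE)
 have q0: "0 < q1" and q12: "q1 < r" "r < q2"
  and A: "A = {x. q1 <= norm x & norm x <= q2}" "A \<subseteq> \<Omega>" and \<phi>s: "ALL n. smooth_on UNIV (\<phi> n)"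
  and \<phi>0: "(%n. LINT x|lebesgue_on A. (cmod (\<phi> n x - f x))^2) ----> 0"
  and \<phi>1: "ALL b:Basis. (%n. LINT x|lebesgue_on A. (cmod (frechet_derivative (\<phi> n) (at x) b - weak_partial \<Omega> b f x))^2) ----> 0"
  and \<phi>2: "(%n. LINT om|sphere_measure. (cmod (\<phi> n (r *R om) - sphere_trace \<Omega> r f om))^2) ----> 0"
  using h by - ((elim conjE, assumption)+)
 have A': "A = annulus q1 q2" using A(1) by (simp add: annulus_def)
 have T: "L2fun sphere_measure (sphere_trace \<Omega> r f)" using T0' by (simp add: L2_sphere_L2fun)
 have q: "q1 < r" "r < q2" "annulus q1 q2 \<subseteq> \<Omega>" using q12 A(2) A' by auto
 have \<phi>a: "smooth_on UNIV (\<phi> n)" for n using \<phi>s by blast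
 have \<phi>b: "(%n. L2norm (lebesgue_on (annulus q1 q2)) (%x. \<phi> n x - f x)) ----> 0"
  using \<phi>0 unfolding A' L2_tendsto_iff .
 have \<phi>c: "(%n. L2norm (lebesgue_on (annulus q1 q2)) (%x. frechet_derivative (\<phi> n) (at x) b - weak_partial \<Omega> b f x)) ----> 0" if "b : Basis" for b
  using bspec[OF \<phi>1 that] unfolding A' L2_tendsto_iff .
 have \<phi>d: "(%n. L2norm sphere_measure (%om. \<phi> n (r *R om) - sphere_trace \<Omega> r f om)) ----> 0"
  using \<phi>2 unfolding L2_tendsto_iff .
 note \<phi> = \<phi>a \<phi>b \<phi>c \<phi>d
 show "L2fun sphere_measure (sphere_trace \<Omega> r f)" by (rule T)
 \<comment> \<open>The closed annulus behind the chosen trace contains a point of norm q1 and lies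
   in the exterior domain.\<close>
 have q1: "q1 > R0"
 proof -
  obtain b :: 'a where "b : Basis" using nonempty_Basis by blast
  then have "q1 *R b : annulus q1 q2" using q q0 by (simp add: annulus_def)
  then show ?thesis using q(3) q0 \<open>b : Basis\<close> by (auto simp: \<Omega>_def exterior_def)
 qed
 \<comment> \<open>The sequence behind the chosen trace lives on its own annulus, so the comparison
   takes place on the intersection.\<close>
 define s1 s2 where "s1 = max r1 q1" and "s2 = min r2 q2"
 have s: "R0 < s1" "0 < s1" "s1 < r" "r < s2" using r q R0 q1 by (auto simp: s1_def s2_def)
 note \<phi>C = smooth_on_C1_complex[OF \<phi>(1)]
 have restr: "(%n. L2norm (lebesgue_on (annulus s1 s2)) (%x. p n x - h x)) ----> 0"
  if l: "(%n. L2norm (lebesgue_on (annulus t1 t2)) (%x. p n x - h x)) ----> 0" and t: "t1 <= s1" "s2 <= t2"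
   and p: "!!n. continuous_on UNIV (p n)" and h: "L2fun (lebesgue_on (annulus t1 t2)) h" for p :: "nat => 'a => complex" and h t1 t2
  by (rule Lim_null_comparison[OF always_eventually l]) (use L2norm_annulus_mono[OF sqd[OF p h] t] in simp)
 have m: "r1 <= s1" "s2 <= r2" "q1 <= s1" "s2 <= q2" by (auto simp: s1_def s2_def)
 have H: "(%n. H1norm (annulus s1 s2) (%x. \<psi> n x - \<phi> n x) (%v x. k n v x - frechet_derivative (\<phi> n) (at x) v)) ----> 0"
  by (rule H1norm_diff_tendsto[OF sqf(1)[OF s(1)] sqf(2)[OF s(1)] refl C1
    restr[OF lim(1) m(1,2) C1_complex.c0[OF C1] sqf(1)[OF r(1)]] restr[OF lim(2) m(1,2) C1_complex.c1[OF C1] sqf(2)[OF r(1)]]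
    \<phi>C restr[OF \<phi>(2) m(3,4) C1_complex.c0[OF \<phi>C] sqf(1)[OF q1]] restr[OF \<phi>(3) m(3,4) C1_complex.c1[OF \<phi>C] sqf(2)[OF q1]]])
 have s12: "0 < s1" "s1 < s2" using s by auto
 obtain C' where C': "C' >= 0" "!!(\<phi> :: 'a => complex) g r. C1_complex \<phi> g ==> s1 <= r ==> r <= s2 ==>
  L2norm sphere0 (%om. \<phi> (r *R om)) <= C' * H1norm (annulus s1 s2) \<phi> g"
  using trace_inequality[OF s12, where 'a='a] by blast
 show "(%n. L2norm sphere_measure (%om. \<psi> n (r *R om) - sphere_trace \<Omega> r f om)) ----> 0"
 proof (rule Lim_null_comparison[OF always_eventually])
  show "(%n. C' * H1norm (annulus s1 s2) (%x. \<psi> n x - \<phi> n x) (%v x. k n v x - frechet_derivative (\<phi> n) (at x) v)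
    + L2norm sphere_measure (%om. \<phi> n (r *R om) - sphere_trace \<Omega> r f om)) ----> 0"
   using tendsto_add[OF tendsto_mult_left[OF H, of C'] \<phi>(4)] by simp
  show "ALL n. norm (L2norm sphere_measure (%om. \<psi> n (r *R om) - sphere_trace \<Omega> r f om)) <=
    C' * H1norm (annulus s1 s2) (%x. \<psi> n x - \<phi> n x) (%v x. k n v x - frechet_derivative (\<phi> n) (at x) v)
    + L2norm sphere_measure (%om. \<phi> n (r *R om) - sphere_trace \<Omega> r f om)"
  proof
   fix n
   have "L2norm sphere_measure (%om. \<psi> n (r *R om) - sphere_trace \<Omega> r f om) <=
     L2norm sphere_measure (%om. \<psi> n (r *R om) - \<phi> n (r *R om)) + L2norm sphere_measure (%om. \<phi> n (r *R om) - sphere_trace \<Omega> r f om)"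
    by (rule L2norm_triangle_diff[OF sq[OF C1] sq[OF \<phi>C] T])
   moreover have "L2norm sphere_measure (%om. \<psi> n (r *R om) - \<phi> n (r *R om)) <= C' * H1norm (annulus s1 s2) (%x. \<psi> n x - \<phi> n x) (%v x. k n v x - frechet_derivative (\<phi> n) (at x) v)"
    unfolding sm_eq[OF C1 \<phi>C] using C'(2)[OF C1_complex_diff[OF C1 \<phi>C], of r n n] s by simp
   ultimately show "norm (L2norm sphere_measure (%om. \<psi> n (r *R om) - sphere_trace \<Omega> r f om)) <=
    C' * H1norm (annulus s1 s2) (%x. \<psi> n x - \<phi> n x) (%v x. k n v x - frechet_derivative (\<phi> n) (at x) v)
    + L2norm sphere_measure (%om. \<phi> n (r *R om) - sphere_trace \<Omega> r f om)" by simp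
  qed
 qed
qed

text \<open>The trace constant is the same for all radii of the annulus, so the Cauchy estimate is
  uniform in r; letting the other index tend to infinity at fixed r keeps the bound.\<close>

lemma sphere_trace_uniform:
 fixes f :: "'a::euclidean_space => complex" and R0 r1 r2 :: real
 defines "\<Omega> \<equiv> exterior R0"
 assumes R0: "R0 > 0" and f: "L2_loc \<Omega> f" "!!b. b : Basis ==> L2_loc \<Omega> (weak_partial \<Omega> b f)"
  and r: "R0 < r1" "r1 < r2"
  and sm: "!!n::nat. smooth_on UNIV (\<psi> n)" and C1: "!!n. C1_complex (\<psi> n) (k n)"
  and lim: "(%n. L2norm (lebesgue_on (annulus r1 r2)) (%x. \<psi> n x - f x)) ----> 0"
   "!!b. b : Basis ==> (%n. L2norm (lebesgue_on (annulus r1 r2)) (%x. k n b x - weak_partial \<Omega> b f x)) ----> 0"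
  and e: "e > 0"
 shows "\<forall>\<^sub>F n in sequentially. ALL r. r1 < r --> r < r2 --> L2norm sphere_measure (%om. \<psi> n (r *R om) - sphere_trace \<Omega> r f om) < e"
proof -
 let ?A = "annulus r1 r2 :: 'a set"
 have sqf: "L2fun (lebesgue_on ?A) f" "!!b. b : Basis ==> L2fun (lebesgue_on ?A) (weak_partial \<Omega> b f)"
  using L2_loc_annulus[OF _ r(1)] f unfolding \<Omega>_def by blast+
 have r12: "0 < r1" "r1 < r2" using r R0 by auto
 obtain C where C: "C >= 0" "!!(\<phi> :: 'a => complex) g r. C1_complex \<phi> g ==> r1 <= r ==> r <= r2 ==>
  L2norm sphere0 (%om. \<phi> (r *R om)) <= C * H1norm ?A \<phi> g"
  using trace_inequality[OF r12, where 'a='a] by blast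
 have "((%(m, n). H1norm ?A (%x. \<psi> m x - \<psi> n x) (%v x. k m v x - k n v x)) ---> 0) (sequentially \<times>\<^sub>F sequentially)"
  unfolding split_beta
  by (rule H1norm_diff_tendsto[where \<phi>="%p. \<psi> (fst p)" and g="%p. k (fst p)" and \<psi>="%p. \<psi> (snd p)" and k="%p. k (snd p)",
    OF sqf refl C1 filterlim_compose[OF lim(1) filterlim_fst] filterlim_compose[OF lim(2) filterlim_fst]
    C1 filterlim_compose[OF lim(1) filterlim_snd] filterlim_compose[OF lim(2) filterlim_snd]])
 then have "((%p. C * (case p of (m, n) => H1norm ?A (%x. \<psi> m x - \<psi> n x) (%v x. k m v x - k n v x))) ---> C * 0) (sequentially \<times>\<^sub>F sequentially)"
  by (intro tendsto_intros)
 then have "\<forall>\<^sub>F p in sequentially \<times>\<^sub>F sequentially. C * (case p of (m, n) => H1norm ?A (%x. \<psi> m x - \<psi> n x) (%v x. k m v x - k n v x)) < e / 2"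
  by (rule order_tendstoD(2)) (use e in simp)
 then obtain N where N: "!!m n. m >= N ==> n >= N ==> C * H1norm ?A (%x. \<psi> m x - \<psi> n x) (%v x. k m v x - k n v x) < e / 2"
  unfolding eventually_prod_sequentially by auto
 have "L2norm sphere_measure (%om. \<psi> n (r *R om) - sphere_trace \<Omega> r f om) < e" if n: "n >= N" and rr: "r1 < r" "r < r2" for n r
 proof -
  note T = sphere_trace_tendsto[OF R0 f[unfolded \<Omega>_def] r(1) rr sm C1 lim[unfolded \<Omega>_def], folded \<Omega>_def]
  have "\<forall>\<^sub>F m in sequentially. L2norm sphere_measure (%om. \<psi> m (r *R om) - sphere_trace \<Omega> r f om) < e / 2"
   using order_tendstoD(2)[OF T(2), of "e / 2"] e by simp
  then have "\<forall>\<^sub>F m in sequentially. m >= N & L2norm sphere_measure (%om. \<psi> m (r *R om) - sphere_trace \<Omega> r f om) < e / 2"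
   using eventually_ge_at_top[of N] by eventually_elim simp
  then obtain m where m: "m >= N" "L2norm sphere_measure (%om. \<psi> m (r *R om) - sphere_trace \<Omega> r f om) < e / 2"
   using eventually_happens'[OF sequentially_bot] by blast
  note sq = C1_complex_restrict(2)[OF C1, of _ r]
  have "L2norm sphere_measure (%om. \<psi> n (r *R om) - \<psi> m (r *R om)) = L2norm sphere0 (%om. \<psi> n (r *R om) - \<psi> m (r *R om))"
   by (rule L2norm_sphere_measure[OF L2fun_measurable[OF L2fun_diff[OF sq sq]]])
  also have "... < e / 2" using C(2)[OF C1_complex_diff[OF C1 C1], of r n m] N[OF n m(1)] rr by simp
  finally have "L2norm sphere_measure (%om. \<psi> n (r *R om) - \<psi> m (r *R om)) < e / 2" .
  then show ?thesis
   using L2norm_triangle_diff[OF L2fun_sphere_measure[OF sq] L2fun_sphere_measure[OF sq] T(1), of n m] m(2) by linarith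
 qed
 then show ?thesis unfolding eventually_sequentially by blast
qed

section \<open>Traces of u and of its derivatives on all spheres\<close>

locale H2_exterior =
 fixes R0 :: real and u :: "'a::euclidean_space => complex"
 assumes R0: "R0 > 0" and dim: "DIM('a) >= 2" and u: "H2_loc (exterior R0) u"
begin

abbreviation "\<Omega> \<equiv> exterior R0 :: 'a set"
abbreviation "S \<equiv> sphere_measure :: 'a measure"
abbreviation "Tu r \<equiv> sphere_trace \<Omega> r u"
abbreviation "Tb r b \<equiv> sphere_trace \<Omega> r (weak_partial \<Omega> b u)"
abbreviation "Tr r \<equiv> radial_deriv_trace \<Omega> r u"

lemma L2_locs: "L2_loc \<Omega> u" "b : Basis ==> L2_loc \<Omega> (weak_partial \<Omega> b u)"
 "b : Basis ==> c : Basis ==> L2_loc \<Omega> (weak_partial \<Omega> c (weak_partial \<Omega> b u))"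
proof -
 obtain b0 :: 'a where b0: "b0 : Basis" using nonempty_Basis by blast
 show "L2_loc \<Omega> u" by (rule H2_loc_is_weak_partial(2)[OF u b0])
 show "b : Basis ==> L2_loc \<Omega> (weak_partial \<Omega> b u)" by (rule H2_loc_is_weak_partial(3)[OF u])
 show "b : Basis ==> c : Basis ==> L2_loc \<Omega> (weak_partial \<Omega> c (weak_partial \<Omega> b u))"
  using H2_loc_is_weak_partial(4)[OF u] unfolding is_weak_partial_def by (rule conjunct1)
qed

lemma approximation:
 assumes x: "R0 < x" "x <= y"
 obtains \<phi> g hh where "!!n::nat. C2_complex (\<phi> n) (g n) (hh n)"
  "!!e. e > 0 ==> \<forall>\<^sub>F n in sequentially. ALL r. x <= r --> r <= y --> L2norm S (%om. \<phi> n (r *R om) - Tu r om) < e"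
  "!!b e. b : Basis ==> e > 0 ==> \<forall>\<^sub>F n in sequentially. ALL r. x <= r --> r <= y --> L2norm S (%om. g n b (r *R om) - Tb r b om) < e"
  "(%n. L2norm (lebesgue_on (annulus x y)) (%x. \<phi> n x - u x)) ----> 0"
  "!!b. b : Basis ==> (%n. L2norm (lebesgue_on (annulus x y)) (%x. hh n b b x - weak_partial \<Omega> b (weak_partial \<Omega> b u) x)) ----> 0"
  "!!r. x <= r ==> r <= y ==> L2fun S (Tu r)"
  "!!r b. x <= r ==> r <= y ==> b : Basis ==> L2fun S (Tb r b)"
proof -
 \<comment> \<open>The trace statements concern radii strictly inside an annulus, so [x, y] is
   enlarged on both sides, staying above R0.\<close>
 define r1 r2 where "r1 = (R0 + x) / 2" and "r2 = y + 1"
 have r: "R0 < r1" "r1 < x" "y < r2" "r1 < r2" using x by (auto simp: r1_def r2_def)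
 obtain \<phi> g hh where C2: "!!n::nat. C2_complex (\<phi> n) (g n) (hh n)"
  and sm: "!!n. smooth_on UNIV (\<phi> n)" "!!n v. smooth_on UNIV (g n v)"
  and l0: "(%n. L2norm (lebesgue_on (annulus r1 r2)) (%x. \<phi> n x - u x)) ----> 0"
  and l1: "!!b. b : Basis ==> (%n. L2norm (lebesgue_on (annulus r1 r2)) (%x. g n b x - weak_partial \<Omega> b u x)) ----> 0"
  and l2: "!!b c. b : Basis ==> c : Basis ==> (%n. L2norm (lebesgue_on (annulus r1 r2)) (%x. hh n b c x - weak_partial \<Omega> c (weak_partial \<Omega> b u) x)) ----> 0"
  by (rule smooth_approximation[OF u R0 r(1)]) (rule that)
 note C1 = C2_complex_imp_C1[OF C2]
 have C1g: "C1_complex (g n b) (hh n b)" for n b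
  by unfold_locales (rule C2_complex.d2[OF C2], rule C2_complex.c2[OF C2])
 have rr: "r1 < r" "r < r2" if "x <= r" "r <= y" for r using that r by auto
 have restr: "(%n. L2norm (lebesgue_on (annulus x y)) (%x. p n x - h x)) ----> 0"
  if l: "(%n. L2norm (lebesgue_on (annulus r1 r2)) (%x. p n x - h x)) ----> 0"
   and p: "!!n. continuous_on UNIV (p n)" and h: "L2_loc \<Omega> h" for p :: "nat => 'a => complex" and h
 proof (rule Lim_null_comparison[OF always_eventually l], rule allI)
  fix n
  have "L2fun (lebesgue_on (annulus r1 r2)) (%x. p n x - h x)"
   by (rule L2fun_diff[OF L2fun_continuous_annulus[OF p] L2_loc_annulus[OF h r(1)]])
  from L2norm_annulus_mono[OF this, of x y] r
  show "norm (L2norm (lebesgue_on (annulus x y)) (%x. p n x - h x)) <= L2norm (lebesgue_on (annulus r1 r2)) (%x. p n x - h x)" by simp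
 qed
 show ?thesis
 proof (rule that[of \<phi> g hh, OF C2])
  show "\<forall>\<^sub>F n in sequentially. ALL r. x <= r --> r <= y --> L2norm S (%om. \<phi> n (r *R om) - Tu r om) < e" if "e > 0" for e
   by (rule eventually_mono[OF sphere_trace_uniform[OF R0 L2_locs(1,2) r(1,4) sm(1) C1 l0 l1 that]]) (use rr in auto)
  show "\<forall>\<^sub>F n in sequentially. ALL r. x <= r --> r <= y --> L2norm S (%om. g n b (r *R om) - Tb r b om) < e" if "b : Basis" "e > 0" for b e
   by (rule eventually_mono[OF sphere_trace_uniform[OF R0 L2_locs(2)[OF that(1)] L2_locs(3)[OF that(1)] r(1,4) sm(2) C1g l1[OF that(1)] l2[OF that(1)] that(2)]]) (use rr in auto)
  show "(%n. L2norm (lebesgue_on (annulus x y)) (%x. \<phi> n x - u x)) ----> 0"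
   by (rule restr[OF l0 C1_complex.c0[OF C1] L2_locs(1)])
  show "(%n. L2norm (lebesgue_on (annulus x y)) (%x. hh n b b x - weak_partial \<Omega> b (weak_partial \<Omega> b u) x)) ----> 0" if "b : Basis" for b
   by (rule restr[OF l2[OF that that] C2_complex.c2[OF C2] L2_locs(3)[OF that that]])
  show "L2fun S (Tu r)" if "x <= r" "r <= y" for r
   by (rule sphere_trace_tendsto(1)[OF R0 L2_locs(1,2) r(1) rr[OF that] sm(1) C1 l0 l1])
  show "L2fun S (Tb r b)" if "x <= r" "r <= y" "b : Basis" for r b
   by (rule sphere_trace_tendsto(1)[OF R0 L2_locs(2)[OF that(3)] L2_locs(3)[OF that(3)] r(1) rr[OF that(1,2)] sm(2) C1g l1[OF that(3)] l2[OF that(3)]])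
 qed
qed

lemma sqi_Tu: "r > R0 ==> L2fun S (Tu r)"
 and sqi_Tb: "r > R0 ==> b : Basis ==> L2fun S (Tb r b)"
 using approximation[of r r] by (metis order_refl)+

lemma coordinate_measurable: "(%om. complex_of_real (om \<bullet> b)) : borel_measurable S"
 unfolding sphere_measure_eq by (intro measurable_completion borel_measurable_sphere0) measurable

lemma coordinate_bound: "om : space S ==> b : Basis ==> cmod (complex_of_real (om \<bullet> b)) <= 1"
 using Basis_le_norm[of b om] by simp

lemma sqi_Tr: assumes "r > R0" shows "L2fun S (Tr r)"
 unfolding radial_deriv_trace_def[abs_def] scaleR_conv_of_real
 by (intro L2fun_sum L2fun_mult_bounded[where k=1] sqi_Tb[OF assms] coordinate_measurable coordinate_bound finite_Basis)

lemma radial_approx: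
 assumes C1: "C1_complex \<phi> g" and r: "r > R0"
 shows "L2norm S (%om. g om (r *R om) - Tr r om) <= (SUM b:Basis. L2norm S (%om. g b (r *R om) - Tb r b om))"
proof -
 interpret C1_complex \<phi> g by (rule C1)
 have sg: "L2fun S (%om. g b (r *R om))" for b
  by (intro L2fun_sphere_measure L2fun_sphere_continuous continuous_g continuous_intros)
 have e: "(%om. g om (r *R om) - Tr r om) = (%om. SUM b:Basis. complex_of_real (om \<bullet> b) * (g b (r *R om) - Tb r b om))"
 proof
  fix om
  have "g om (r *R om) = (SUM b:Basis. (om \<bullet> b) *R g b (r *R om))" by (rule has_derivative_basis_expansion[OF lin1])
  then show "g om (r *R om) - Tr r om = (SUM b:Basis. complex_of_real (om \<bullet> b) * (g b (r *R om) - Tb r b om))"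
   by (simp add: radial_deriv_trace_def sum_subtractf right_diff_distrib scaleR_conv_of_real)
 qed
 have sd: "L2fun S (%om. g b (r *R om) - Tb r b om)" if "b : Basis" for b
  by (rule L2fun_diff[OF sg sqi_Tb[OF r that]])
 show ?thesis unfolding e
 proof (rule order_trans[OF L2norm_sum_le], goal_cases)
  case (2 b)
  then show ?case by (intro L2fun_mult_bounded[where k=1] sd coordinate_measurable coordinate_bound)
 next
  case 3
  show ?case
  proof (rule sum_mono)
   fix b :: 'a assume b: "b : Basis"
   show "L2norm S (%om. complex_of_real (om \<bullet> b) * (g b (r *R om) - Tb r b om)) <= L2norm S (%om. g b (r *R om) - Tb r b om)"
    using L2norm_mult_bounded[where W="%om. complex_of_real (om \<bullet> b)" and k=1, OF sd[OF b] coordinate_measurable coordinate_bound] b by simp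
  qed
 qed simp
qed

lemma radial_uniform:
 assumes C1: "!!n::nat. C1_complex (\<phi> n) (g n)" and x: "R0 < x"
  and l: "!!b e. b : Basis ==> e > 0 ==> \<forall>\<^sub>F n in sequentially. ALL r. x <= r --> r <= y --> L2norm S (%om. g n b (r *R om) - Tb r b om) < e"
  and e: "e > 0"
 shows "\<forall>\<^sub>F n in sequentially. ALL r. x <= r --> r <= y --> L2norm S (%om. g n om (r *R om) - Tr r om) < e"
proof -
 define e' where "e' = e / real DIM('a)"
 have e': "e' > 0" using e by (simp add: e'_def)
 have "\<forall>\<^sub>F n in sequentially. ALL b:Basis. ALL r. x <= r --> r <= y --> L2norm S (%om. g n b (r *R om) - Tb r b om) < e'"
  using l[OF _ e'] by (intro eventually_ball_finite) auto
 then show ?thesis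
 proof eventually_elim
  case (elim n)
  show ?case
  proof (intro allI impI)
   fix r assume r: "x <= r" "r <= y"
   have "L2norm S (%om. g n om (r *R om) - Tr r om) <= (SUM b:Basis. L2norm S (%om. g n b (r *R om) - Tb r b om))"
    by (rule radial_approx[OF C1]) (use r x in simp)
   also have "... < (SUM b:(Basis :: 'a set). e')" using elim r by (intro sum_strict_mono) auto
   finally show "L2norm S (%om. g n om (r *R om) - Tr r om) < e" by (simp add: e'_def)
  qed
 qed
qed

text \<open>The mean value theorem is applied to the scalar function of \<tau> obtained by pairing
  the remainder at \<tau> with the remainder at t. Cauchy-Schwarz then allows one factor of the norm
  to be cancelled.\<close>

lemma smooth_path_estimate:
 assumes C1: "C1_complex \<phi> g" and rt: "0 < r" "r < t"
  and M: "!!\<tau>. r <= \<tau> ==> \<tau> <= t ==> L2norm sphere0 (%om. g om (\<tau> *R om) - g om (r *R om)) <= M"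
 shows "L2norm sphere0 (%om. \<phi> (t *R om) - \<phi> (r *R om) - (t - r) *R g om (r *R om)) <= (t - r) * M"
proof -
 interpret C1_complex \<phi> g by (rule C1)
 define \<psi> where "\<psi> \<tau> om = \<phi> (\<tau> *R om) - \<phi> (r *R om) - (\<tau> - r) *R g om (r *R om)" for \<tau> om
 have pc: "continuous_on A (%z. \<psi> (f z) (h z))" if "continuous_on A f" "continuous_on A h" for A :: "'z::topological_space set" and f h
  unfolding \<psi>_def by (intro continuous_intros continuous_phi continuous_g that)
 have gc: "continuous_on A (%z. g (h z) (f z *R h z) - g (h z) (r *R h z))" if "continuous_on A f" "continuous_on A h" for A :: "'z::real_normed_vector set" and f h
  by (intro continuous_intros continuous_g that)
 have sq: "L2fun sphere0 (\<psi> \<tau>)" "L2fun sphere0 (%om. g om (\<tau> *R om) - g om (r *R om))" for \<tau>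
  by (intro L2fun_sphere_continuous pc gc continuous_intros)+
 have d: "((%\<tau>. LINT om|sphere0. \<psi> \<tau> om \<bullet> \<psi> t om) has_real_derivative (LINT om|sphere0. (g om (\<tau> *R om) - g om (r *R om)) \<bullet> \<psi> t om)) (at \<tau>)" for \<tau>
 proof (rule sphere_integral_has_derivative[where a="\<tau> - 1" and b="\<tau> + 1"])
  show "((%\<tau>. \<psi> \<tau> om \<bullet> \<psi> t om) has_real_derivative (g om (\<tau> *R om) - g om (r *R om)) \<bullet> \<psi> t om) (at \<tau>)" for \<tau> om
  proof -
   have "((%\<tau>. \<phi> (\<tau> *R om)) has_derivative (%h. g (h *R om) (\<tau> *R om))) (at \<tau>)"
    by (rule has_derivative_compose[OF _ d1]) (auto intro!: derivative_eq_intros)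
   then have "((%\<tau>. \<psi> \<tau> om \<bullet> \<psi> t om) has_derivative (%h. (g (h *R om) (\<tau> *R om) - h *R g om (r *R om)) \<bullet> \<psi> t om)) (at \<tau>)"
    unfolding \<psi>_def by (auto intro!: derivative_eq_intros)
   then show ?thesis using linear_scale[OF lin1]
    by (simp add: has_field_derivative_def mult_commute_abs flip: scaleR_diff_right)
  qed
  show "continuous_on (sphere 0 1) (%om. \<psi> \<tau> om \<bullet> \<psi> t om)" for \<tau> by (intro continuous_intros pc)
  show "continuous_on ({\<tau> - 1..\<tau> + 1} \<times> sphere 0 1) (%(\<tau>, om). (g om (\<tau> *R om) - g om (r *R om)) \<bullet> \<psi> t om)"
   unfolding split_beta by (intro continuous_intros pc gc)
 qed auto
 obtain z where z: "r < z" "z < t" "(LINT om|sphere0. \<psi> t om \<bullet> \<psi> t om) - (LINT om|sphere0. \<psi> r om \<bullet> \<psi> t om) = (t - r) * (LINT om|sphere0. (g om (z *R om) - g om (r *R om)) \<bullet> \<psi> t om)"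
  using MVT2[OF rt(2) d] by blast
 have "(L2norm sphere0 (\<psi> t))\<^sup>2 = (t - r) * (LINT om|sphere0. (g om (z *R om) - g om (r *R om)) \<bullet> \<psi> t om)"
  using z(3) by (simp add: L2norm_power2 dot_square_norm \<psi>_def[of r])
 also have "... <= (t - r) * (M * L2norm sphere0 (\<psi> t))"
 proof (rule mult_left_mono)
  have "(LINT om|sphere0. (g om (z *R om) - g om (r *R om)) \<bullet> \<psi> t om) <= L2norm sphere0 (%om. g om (z *R om) - g om (r *R om)) * L2norm sphere0 (\<psi> t)"
   using inner_bound[OF sq(2) sq(1)] by (simp add: abs_le_iff)
  also have "... <= M * L2norm sphere0 (\<psi> t)" using M[of z] z by (intro mult_right_mono) auto
  finally show "(LINT om|sphere0. (g om (z *R om) - g om (r *R om)) \<bullet> \<psi> t om) <= M * L2norm sphere0 (\<psi> t)" .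
 qed (use rt in simp)
 finally have "L2norm sphere0 (\<psi> t) * L2norm sphere0 (\<psi> t) <= ((t - r) * M) * L2norm sphere0 (\<psi> t)" by (simp add: power2_eq_square mult_ac)
 moreover have "(t - r) * M >= 0" using M[of r] rt by (simp add: L2norm_def)
 ultimately have "L2norm sphere0 (\<psi> t) <= (t - r) * M"
  by (cases "L2norm sphere0 (\<psi> t) = 0") (auto simp: less_le L2norm_nonneg)
 then show ?thesis by (simp add: \<psi>_def[abs_def])
qed

end

subsection \<open>Evolution of the sphere integrals of a solution\<close>

text \<open>Each derivative d n is a bounded part m n that converges almost everywhere, plus an
  error controlled only in the mean square over r. The limit is therefore taken in the increments:
  f0(t) - f0(s) is the integral of lim m n, which makes f0 Lipschitz and right differentiable almost
  everywhere.\<close>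

lemma limit_lipschitz_derivative:
 fixes f d m z :: "nat => real => real" and f0 p :: "real => real"
 assumes f: "!!n r. x <= r ==> r <= y ==> (f n has_real_derivative d n r) (at r)"
  and d: "!!n. continuous_on {x..y} (d n)"
  and f0: "!!r. x <= r ==> r <= y ==> (%n. f n r) ----> f0 r"
  and m[measurable]: "!!n. m n : borel_measurable borel" and mM: "!!n r. x <= r ==> r <= y ==> \<bar>m n r\<bar> <= M"
  and mp: "AE r in lborel. x <= r --> r <= y --> (%n. m n r) ----> p r"
  and dm: "!!n r. x <= r ==> r <= y ==> \<bar>d n r - m n r\<bar> <= C * z n r" and C: "C >= 0"
  and z: "!!n. integrable lborel (%r. indicator {x..y} r * (z n r)^2)"
   "(%n. LINT r|lborel. indicator {x..y} r * (z n r)^2) ----> 0"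
 shows "!!s t. x <= s ==> s <= t ==> t <= y ==> \<bar>f0 t - f0 s\<bar> <= M * (t - s)"
  and "AE r in lborel. x < r --> r < y --> ((%s. (f0 (r + s) - f0 r) / s) ---> p r) (at_right 0)"
proof -
 define m' where "m' n r = indicator {x..y} r * m n r" for n r
 have [measurable]: "m' n : borel_measurable borel" for n unfolding m'_def by measurable
 \<comment> \<open>A Borel function on the whole line that agrees with p almost everywhere on
   [x, y].\<close>
 define P where "P r = lim (%n. m' n r)" for r
 have [measurable]: "P : borel_measurable borel" unfolding P_def by (rule borel_measurable_lim_metric) measurable
 have P: "AE r in lborel. (%n. m' n r) ----> P r & (x <= r --> r <= y --> P r = p r)"
  using mp
 proof eventually_elim
  case (elim r)
  show ?case
  proof (cases "x <= r & r <= y")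
   case True
   then have "(%n. m' n r) ----> p r" using elim by (simp add: m'_def)
   then show ?thesis using limI[of "%n. m' n r"] by (simp add: P_def)
  next
   case False
   then have "m' n r = 0" for n by (auto simp: m'_def)
   then have "(%n. m' n r) ----> 0" by simp
   then show ?thesis using limI[of "%n. m' n r"] False by (simp add: P_def)
  qed
 qed
 have m'b: "\<bar>m' n r\<bar> <= indicator {x..y} r * \<bar>M\<bar>" for n r
  using mM[of r n] by (auto simp: m'_def indicator_def)
 have PM: "AE r in lborel. \<bar>P r\<bar> <= indicator {x..y} r * \<bar>M\<bar>"
  using P
 proof eventually_elim
  case (elim r)
  then have "(%n. \<bar>m' n r\<bar>) ----> \<bar>P r\<bar>" by (intro tendsto_rabs) simp
  then show ?case by (rule LIMSEQ_le_const2) (use m'b in blast)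
 qed
 have iI: "integrable lborel (indicat_real {s..t})" for s t :: real by (intro integrable_real_indicator) (auto simp: emeasure_lborel_Icc_eq)
 have iM: "integrable lborel (%r. indicator {x..y} r * \<bar>M\<bar>)" using iI by simp
 have im: "integrable lborel (m' n)" for n
  by (rule Bochner_Integration.integrable_bound[OF iM]) (use m'b in \<open>auto intro!: AE_I2\<close>)
 have iP: "integrable lborel P"
  by (rule Bochner_Integration.integrable_bound[OF iM]) (use PM in auto)
 have incr: "f0 t - f0 s = (LINT r|lborel. indicator {s..t} r * P r)" if st: "x <= s" "s <= t" "t <= y" for s t
 proof -
  have ft: "has_bochner_integral lborel (%r. indicator {s..t} r *R d n r) (f n t - f n s)" for n
   by (rule has_bochner_integral_FTC_Icc[OF st(2)])
    (use st f in \<open>auto intro!: continuous_on_subset[OF d] intro: has_field_derivative_at_within simp flip: has_real_derivative_iff_has_vector_derivative\<close>)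
  have id: "integrable lborel (%r. indicator {s..t} r * d n r)" "(LINT r|lborel. indicator {s..t} r * d n r) = f n t - f n s" for n
   using ft[of n] by (simp_all add: has_bochner_integral_iff)
  have im2: "integrable lborel (%r. indicator {s..t} r * m' n r)" for n
   using integrable_real_mult_indicator[OF _ im, of "{s..t}"] by (simp add: mult.commute)
  have "(%n. LINT r|lborel. indicator {s..t} r * m' n r) ----> (LINT r|lborel. indicator {s..t} r * P r)"
  proof (rule integral_dominated_convergence[OF _ _ iM])
   show "AE r in lborel. (%n. indicator {s..t} r * m' n r) ----> indicator {s..t} r * P r"
    using P by eventually_elim (intro tendsto_intros, simp)
   show "AE r in lborel. norm (indicator {s..t} r * m' n r) <= indicator {x..y} r * \<bar>M\<bar>" for n
   proof (rule AE_I2)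
    fix r show "norm (indicator {s..t} r * m' n r) <= indicator {x..y} r * \<bar>M\<bar>"
     using m'b[of n r] by (cases "r : {s..t}") auto
   qed
  qed measurable
  moreover have "(%n. (f n t - f n s) - (LINT r|lborel. indicator {s..t} r * m' n r)) ----> 0"
  proof (rule LIMSEQ_I)
   fix e :: real assume e: "e > 0"
   \<comment> \<open>Weights for z <= \<delta> + z^2/\<delta>, which trades the first power of z for
     its square. The added 1 keeps k positive when C (y - x) is zero.\<close>
   define k where "k = C * (y - x) + 1"
   define \<delta> where "\<delta> = e / (2 * k)"
   have den: "k > 0" using C st by (simp add: k_def add_nonneg_pos)
   then have \<delta>: "\<delta> > 0" using e by (simp add: \<delta>_def)
   have "C * (y - x) * \<delta> <= k * \<delta>" using \<delta> by (simp add: k_def mult_right_mono)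
   also have "... = e / 2" using den by (simp add: \<delta>_def)
   finally have \<delta>e: "C * (y - x) * \<delta> <= e / 2" .
   have "(%n. C / \<delta> * (LINT r|lborel. indicator {x..y} r * (z n r)^2)) ----> C / \<delta> * 0" by (intro tendsto_intros z)
   then have "\<forall>\<^sub>F n in sequentially. C / \<delta> * (LINT r|lborel. indicator {x..y} r * (z n r)^2) < e / 2"
    by (rule order_tendstoD(2)) (use e in simp)
   then obtain N where N: "!!n. n >= N ==> C / \<delta> * (LINT r|lborel. indicator {x..y} r * (z n r)^2) < e / 2"
    unfolding eventually_sequentially by blast
   show "EX N. ALL n>=N. norm ((f n t - f n s) - (LINT r|lborel. indicator {s..t} r * m' n r) - 0) < e"
   proof (intro exI[of _ N] allI impI)
    fix n assume n: "n >= N"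
    let ?R = "%r. C * \<delta> * indicator {x..y} r + C / \<delta> * (indicator {x..y} r * (z n r)^2)"
    have iR: "integrable lborel ?R"
     by (intro Bochner_Integration.integrable_add integrable_mult_right z(1) iI)
    have "\<bar>(f n t - f n s) - (LINT r|lborel. indicator {s..t} r * m' n r)\<bar>
     = \<bar>LINT r|lborel. indicator {s..t} r * d n r - indicator {s..t} r * m' n r\<bar>"
     using id im2 by simp
    also have "... <= (LINT r|lborel. \<bar>indicator {s..t} r * d n r - indicator {s..t} r * m' n r\<bar>)"
     using integral_norm_bound[of lborel "%r. indicator {s..t} r * d n r - indicator {s..t} r * m' n r"] by simp
    also have "... <= (LINT r|lborel. ?R r)"
    proof (rule Bochner_Integration.integral_mono[OF _ iR])
     show "integrable lborel (%r. \<bar>indicator {s..t} r * d n r - indicator {s..t} r * m' n r\<bar>)"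
      by (rule integrable_abs, rule Bochner_Integration.integrable_diff[OF id(1) im2])
     fix r
     show "\<bar>indicator {s..t} r * d n r - indicator {s..t} r * m' n r\<bar> <= ?R r"
     proof (cases "r : {s..t}")
      case True
      then have r: "x <= r" "r <= y" using st by auto
      have "0 <= (\<delta> - z n r)\<^sup>2 + \<delta>^2 + (z n r)^2" by simp
      then have "2 * (\<delta> * z n r) <= 2 * (\<delta>^2 + (z n r)^2)" by (simp add: power2_diff)
      then have "z n r <= \<delta> + (z n r)^2 / \<delta>" using \<delta> by (simp add: field_simps power2_eq_square)
      then have "C * z n r <= C * (\<delta> + (z n r)^2 / \<delta>)" using C by (rule mult_left_mono)
      then show ?thesis using dm[OF r, of n] True r by (simp add: m'_def distrib_left)
     next
      case False
      moreover have "?R r >= 0" using C \<delta> by (simp add: indicator_def)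
      ultimately show ?thesis by simp
     qed
    qed
    also have "... = C * \<delta> * (y - x) + C / \<delta> * (LINT r|lborel. indicator {x..y} r * (z n r)^2)"
     using z(1)[of n] iI st by simp
    also have "C * \<delta> * (y - x) = C * (y - x) * \<delta>" by simp
    also have "C * (y - x) * \<delta> + C / \<delta> * (LINT r|lborel. indicator {x..y} r * (z n r)^2) < e" using N[OF n] \<delta>e by linarith
    finally show "norm ((f n t - f n s) - (LINT r|lborel. indicator {s..t} r * m' n r) - 0) < e" by simp
   qed
  qed
  ultimately have "(%n. (LINT r|lborel. indicator {s..t} r * m' n r) + ((f n t - f n s) - (LINT r|lborel. indicator {s..t} r * m' n r)))
    ----> (LINT r|lborel. indicator {s..t} r * P r) + 0" by (rule tendsto_add)
  moreover have "(%n. f n t - f n s) ----> f0 t - f0 s" using st by (intro tendsto_intros f0) auto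
  ultimately show ?thesis using LIMSEQ_unique by fastforce
 qed
 show "\<bar>f0 t - f0 s\<bar> <= M * (t - s)" if st: "x <= s" "s <= t" "t <= y" for s t
 proof -
  have "M >= 0" using mM[of s 0] st by simp
  have "\<bar>LINT r|lborel. indicator {s..t} r * P r\<bar> <= (LINT r|lborel. \<bar>indicator {s..t} r * P r\<bar>)"
   using integral_norm_bound[of lborel "%r. indicator {s..t} r * P r"] by simp
  also have "... <= (LINT r|lborel. indicator {s..t} r * M)"
  proof (rule integral_mono_AE)
   show "integrable lborel (%r. \<bar>indicator {s..t} r * P r\<bar>)"
    using integrable_real_mult_indicator[OF _ iP, of "{s..t}"] by (simp add: mult.commute)
   show "AE r in lborel. \<bar>indicator {s..t} r * P r\<bar> <= indicator {s..t} r * M"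
    using PM by eventually_elim (use \<open>M >= 0\<close> st in \<open>auto simp: indicator_def split: if_splits\<close>)
  qed (use iI in simp)
  also have "... = M * (t - s)" using st iI by simp
  finally show ?thesis using incr[OF st] by simp
 qed
 have sP: "P integrable_on {s..t}" "(LINT r|lborel. indicator {s..t} r * P r) = integral {s..t} P" for s t
 proof -
  have "set_integrable lborel {s..t} P"
   unfolding set_integrable_def using integrable_real_mult_indicator[OF _ iP, of "{s..t}"] by (simp add: mult.commute)
  from set_borel_integral_eq_integral[OF this] show "P integrable_on {s..t}" "(LINT r|lborel. indicator {s..t} r * P r) = integral {s..t} P"
   by (simp_all add: set_lebesgue_integral_def)
 qed
 have sP': "P integrable_on cbox s t" for s t using sP(1) by simp
 obtain N where N: "negligible N" and N': "!!x e. x \<notin> N ==> 0 < e ==>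
   EX d>0. ALL h. 0 < h & h < d --> norm (integral (cbox x (x + h *R One)) P /\<^sub>R h ^ DIM(real) - P x) < e"
  by (rule integrable_ccontinuous_explicit[OF sP']) (rule that)
 have NAE: "AE t in lborel. t \<notin> N"
  using AE_not_in[of N lebesgue] N by (simp add: negligible_iff_null_sets AE_completion_iff)
 show "AE r in lborel. x < r --> r < y --> ((%s. (f0 (r + s) - f0 r) / s) ---> p r) (at_right 0)"
  using NAE P
 proof eventually_elim
  case (elim r)
  note elimr = elim
  show ?case unfolding tendsto_iff
  proof (intro impI allI)
   fix e :: real assume r: "x < r" "r < y" and "e > 0"
   then obtain d where d: "d > 0" "!!h. 0 < h ==> h < d ==> norm (integral {r..r+h} P / h - P r) < e"
    using N'[OF elimr(1), of e] by (auto simp: divide_inverse mult.commute)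
   have "\<forall>\<^sub>F s in at_right 0. s : {0<..<min d (y - r)}" using d(1) r by (intro eventually_at_right_real) simp
   then show "\<forall>\<^sub>F s in at_right 0. dist ((f0 (r + s) - f0 r) / s) (p r) < e"
   proof eventually_elim
    case (elim s)
    then show ?case using d(2)[of s] r incr[of r "r + s"] sP(2)[of r "r + s"] elimr(2) by (simp add: dist_real_def)
   qed
  qed
 qed
qed

text \<open>The mode of convergence shared by the approximations of u, of its radial derivative and
  of its partial derivatives, packaged so that bounds, continuity and limits of inner products are
  proved once for all of them.\<close>

definition utrace :: "real => real => (nat => real => 'a::euclidean_space => complex) => (real => 'a => complex) => bool"
 where "utrace x y p P \<longleftrightarrow> (ALL n. continuous_on UNIV (%(r, om). p n r om)) &
  (ALL r. x <= r --> r <= y --> L2fun sphere_measure (P r)) &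
  (ALL e>0. \<forall>\<^sub>F n in sequentially. ALL r. x <= r --> r <= y --> L2norm sphere_measure (%om. p n r om - P r om) < e)"

lemma utraceD:
 assumes "utrace x y p P"
 shows "continuous_on X F ==> continuous_on X G ==> continuous_on X (%z. p n (F z) (G z))"
  and "L2fun sphere0 (p n r)" "L2fun sphere_measure (p n r)"
  and "x <= r ==> r <= y ==> L2fun sphere_measure (P r)"
  and "e > 0 ==> \<forall>\<^sub>F n in sequentially. ALL r. x <= r --> r <= y --> L2norm sphere_measure (%om. p n r om - P r om) < e"
  and "x <= r ==> r <= y ==> (%n. L2norm sphere_measure (%om. p n r om - P r om)) ----> 0"
proof -
 have c0: "continuous_on UNIV (%(r, om). p n r om)" for n using assms unfolding utrace_def by blast
 show c: "continuous_on X (%z. p n (F z) (G z))" if "continuous_on X F" "continuous_on X G" for X :: "'z::topological_space set" and F G n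
  using continuous_on_compose2[OF c0[of n] continuous_on_Pair[OF that]] by simp
 show sq: "L2fun sphere0 (p n r)" by (intro L2fun_sphere_continuous c continuous_intros)
 then show "L2fun sphere_measure (p n r)" by (rule L2fun_sphere_measure)
 show "x <= r ==> r <= y ==> L2fun sphere_measure (P r)" using assms unfolding utrace_def by blast
 show u: "\<forall>\<^sub>F n in sequentially. ALL r. x <= r --> r <= y --> L2norm sphere_measure (%om. p n r om - P r om) < e" if "e > 0" for e
  using assms that unfolding utrace_def by blast
 show "(%n. L2norm sphere_measure (%om. p n r om - P r om)) ----> 0" if "x <= r" "r <= y"
 proof (rule order_tendstoI)
  show "\<forall>\<^sub>F n in sequentially. a < L2norm sphere_measure (%om. p n r om - P r om)" if "a < 0" for a
   using that by (intro always_eventually allI less_le_trans[OF _ L2norm_nonneg])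
  show "\<forall>\<^sub>F n in sequentially. L2norm sphere_measure (%om. p n r om - P r om) < a" if "0 < a" for a
   using u[OF that] by eventually_elim (use \<open>x <= r\<close> \<open>r <= y\<close> in blast)
 qed
qed

text \<open>Beyond some index N the approximations lie within 1 of P; the finitely many earlier ones
  have norms continuous in r on a compact interval.\<close>

lemma utrace_bounded:
 fixes P :: "real => 'a::euclidean_space => complex"
 assumes u: "utrace x y p P"
 obtains M where "M >= 0" "!!n r. x <= r ==> r <= y ==> L2norm sphere_measure (p n r) <= M"
  "!!r. x <= r ==> r <= y ==> L2norm sphere_measure (P r) <= M"
proof -
 note U = utraceD[OF u]
 have ex: "EX b. ALL r. x <= r --> r <= y --> L2norm sphere_measure (p n r) <= b" for n
 proof -
  have "continuous_on {x..y} (%r. LINT om|sphere0. (cmod (p n r om))^2)"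
   by (rule continuous_sphere_integral) (unfold split_beta, intro continuous_intros U(1))
  then have "continuous_on {x..y} (%r. L2norm sphere0 (p n r))" unfolding L2norm_def by (intro continuous_intros)
  then have "bounded ((%r. L2norm sphere0 (p n r)) ` {x..y})" by (intro compact_imp_bounded compact_continuous_image) auto
  then obtain b where b: "ALL r:{x..y}. L2norm sphere0 (p n r) <= b" unfolding bounded_iff by auto
  have "L2norm sphere_measure (p n r) <= b" if "x <= r" "r <= y" for r
   using b that L2norm_sphere_measure[OF L2fun_measurable[OF U(2)], of n r] by simp
  then show ?thesis by blast
 qed
 obtain b where b: "!!n r. x <= r ==> r <= y ==> L2norm sphere_measure (p n r) <= b n"
  using choice[of "%n b. ALL r. x <= r --> r <= y --> L2norm sphere_measure (p n r) <= b"] ex by blast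
 obtain N where N: "!!n r. n >= N ==> x <= r ==> r <= y ==> L2norm sphere_measure (%om. p n r om - P r om) < 1"
  using U(5)[of 1] unfolding eventually_sequentially by auto
 have PM: "L2norm sphere_measure (P r) <= \<bar>b N\<bar> + 1" if "x <= r" "r <= y" for r
  using L2norm_triangle_diff[OF U(4)[OF that] U(3)[of N r] L2fun_zero] N[OF order_refl that] b[OF that, of N]
  by (simp add: L2norm_minus_commute[of _ "P r"])
 define M where "M = \<bar>b N\<bar> + 2 + (\<Sum>n<N. \<bar>b n\<bar>)"
 have s0: "(\<Sum>n<N. \<bar>b n\<bar>) >= 0" by (intro sum_nonneg) auto
 show ?thesis
 proof (rule that[of M])
  show "M >= 0" using s0 by (simp add: M_def)
  show "L2norm sphere_measure (P r) <= M" if "x <= r" "r <= y" for r using PM[OF that] s0 unfolding M_def by linarith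
  show "L2norm sphere_measure (p n r) <= M" if r: "x <= r" "r <= y" for n r
  proof (cases "n < N")
   case True
   then have "\<bar>b n\<bar> <= (\<Sum>n<N. \<bar>b n\<bar>)" by (intro member_le_sum) auto
   then show ?thesis using b[OF r, of n] by (simp add: M_def)
  next
   case False
   then have "L2norm sphere_measure (%om. p n r om - P r om) < 1" using N r by simp
   then show ?thesis
    using L2norm_triangle_diff[OF U(3)[of n r] U(4)[OF r] L2fun_zero] PM[OF r] s0 unfolding M_def diff_zero by linarith
  qed
 qed
qed

lemma utrace_continuous:
 fixes P :: "real => 'a::euclidean_space => complex"
 assumes u: "utrace x y p P" and r: "x <= r" "r <= y" and e: "e > 0"
 shows "EX d>0. ALL t. x <= t --> t <= y --> \<bar>t - r\<bar> < d --> L2norm sphere_measure (%om. P t om - P r om) < e"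
proof -
 note U = utraceD[OF u]
 obtain n where n: "!!t. x <= t ==> t <= y ==> L2norm sphere_measure (%om. p n t om - P t om) < e / 3"
  using eventually_happens'[OF sequentially_bot U(5)[of "e / 3"]] e by auto
 have sd: "L2fun sphere0 (%om. p n t om - p n r om)" for t by (rule L2fun_diff[OF U(2) U(2)])
 have "continuous_on {x..y} (%t. LINT om|sphere0. (cmod (p n t om - p n r om))^2)"
  by (rule continuous_sphere_integral) (unfold split_beta, intro continuous_intros U(1))
 then have "continuous_on {x..y} (%t. L2norm sphere0 (%om. p n t om - p n r om))" unfolding L2norm_def by (intro continuous_intros)
 from this[unfolded continuous_on_iff, rule_format, of r "e / 3"] r e
 obtain d where d: "d > 0" "!!t. x <= t ==> t <= y ==> \<bar>t - r\<bar> < d ==> L2norm sphere0 (%om. p n t om - p n r om) < e / 3"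
  by (auto simp: dist_real_def L2norm_def)
 show ?thesis
 proof (intro exI[of _ d] conjI d(1) allI impI)
  fix t assume t: "x <= t" "t <= y" "\<bar>t - r\<bar> < d"
  have "L2norm sphere_measure (%om. P t om - P r om) <= L2norm sphere_measure (%om. P t om - p n t om) + L2norm sphere_measure (%om. p n t om - P r om)"
   by (rule L2norm_triangle_diff[OF U(4)[OF t(1,2)] U(3) U(4)[OF r]])
  also have "L2norm sphere_measure (%om. p n t om - P r om) <= L2norm sphere_measure (%om. p n t om - p n r om) + L2norm sphere_measure (%om. p n r om - P r om)"
   by (rule L2norm_triangle_diff[OF U(3) U(3) U(4)[OF r]])
  finally show "L2norm sphere_measure (%om. P t om - P r om) < e"
   using n[OF t(1,2)] n[OF r] d(2)[OF t] L2norm_sphere_measure[OF L2fun_measurable[OF sd], of t]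
   by (simp add: L2norm_minus_commute[of _ "P t"])
 qed
qed

lemma inner_difference_bound:
 assumes "L2fun M f" "L2fun M f0" "L2fun M g" "L2fun M g0"
 shows "\<bar>(LINT x|M. f x \<bullet> g x) - (LINT x|M. f0 x \<bullet> g0 x)\<bar>
  <= L2norm M (%x. f x - f0 x) * L2norm M g + L2norm M f0 * L2norm M (%x. g x - g0 x)"
proof -
 have d: "L2fun M (%x. f x - f0 x)" "L2fun M (%x. g x - g0 x)" using assms by (auto intro: L2fun_diff)
 have "(LINT x|M. f x \<bullet> g x) - (LINT x|M. f0 x \<bullet> g0 x) = (LINT x|M. (f x - f0 x) \<bullet> g x) + (LINT x|M. f0 x \<bullet> (g x - g0 x))"
  using integrable_inner[OF assms(1,3)] integrable_inner[OF assms(2,3)] integrable_inner[OF assms(2,4)]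
  by (simp add: inner_diff_left inner_diff_right)
 then show ?thesis using inner_bound[OF d(1) assms(3)] inner_bound[OF assms(2) d(2)] by linarith
qed

lemma utrace_inner:
 fixes P Q :: "real => 'a::euclidean_space => complex"
 assumes u: "utrace x y p P" and v: "utrace x y q Q" and e: "e > 0"
 shows "\<forall>\<^sub>F n in sequentially. ALL r. x <= r --> r <= y -->
  \<bar>(LINT om|sphere0. p n r om \<bullet> q n r om) - (LINT om|sphere_measure. P r om \<bullet> Q r om)\<bar> < e"
proof -
 note U = utraceD[OF u] and V = utraceD[OF v]
 obtain M where M: "M >= 0" "!!n r. x <= r ==> r <= y ==> L2norm sphere_measure (p n r) <= M" "!!r. x <= r ==> r <= y ==> L2norm sphere_measure (P r) <= M"
  by (rule utrace_bounded[OF u]) (rule that)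
 obtain K where K: "K >= 0" "!!n r. x <= r ==> r <= y ==> L2norm sphere_measure (q n r) <= K" "!!r. x <= r ==> r <= y ==> L2norm sphere_measure (Q r) <= K"
  by (rule utrace_bounded[OF v]) (rule that)
 define e' where "e' = e / (K + M + 1)"
 have e': "e' > 0" "(K + M) * e' < e" using e M K by (auto simp: e'_def field_simps)
 show ?thesis using U(5)[OF e'(1)] V(5)[OF e'(1)]
 proof eventually_elim
  case (elim n)
  show ?case
  proof (intro allI impI)
   fix r assume r: "x <= r" "r <= y"
   have i: "integrable sphere0 (%om. p n r om \<bullet> q n r om)" by (rule integrable_inner[OF U(2) V(2)])
   have "(LINT om|sphere0. p n r om \<bullet> q n r om) = (LINT om|sphere_measure. p n r om \<bullet> q n r om)"
    unfolding sphere_measure_eq using i by (subst integral_completion) auto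
   then have "\<bar>(LINT om|sphere0. p n r om \<bullet> q n r om) - (LINT om|sphere_measure. P r om \<bullet> Q r om)\<bar>
    <= L2norm sphere_measure (%om. p n r om - P r om) * L2norm sphere_measure (q n r) + L2norm sphere_measure (P r) * L2norm sphere_measure (%om. q n r om - Q r om)"
    using inner_difference_bound[OF U(3) U(4)[OF r] V(3) V(4)[OF r]] by simp
   also have "... <= e' * K + M * e'"
   proof (intro add_mono mult_mono K(2)[OF r] M(3)[OF r])
    show "L2norm sphere_measure (%om. p n r om - P r om) <= e'" "L2norm sphere_measure (%om. q n r om - Q r om) <= e'"
     using elim r by (auto intro: less_imp_le)
   qed (use M(1) e'(1) in auto)
   also have "... < e" using e'(2) by (simp add: algebra_simps)
   finally show "\<bar>(LINT om|sphere0. p n r om \<bullet> q n r om) - (LINT om|sphere_measure. P r om \<bullet> Q r om)\<bar> < e" .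
  qed
 qed
qed

lemma utrace_inner_tendsto:
 fixes P Q :: "real => 'a::euclidean_space => complex"
 assumes "utrace x y p P" "utrace x y q Q" "x <= r" "r <= y"
 shows "(%n. LINT om|sphere0. p n r om \<bullet> q n r om) ----> (LINT om|sphere_measure. P r om \<bullet> Q r om)"
 unfolding tendsto_iff
proof (intro allI impI)
 fix e :: real assume "e > 0"
 from utrace_inner[OF assms(1,2) this]
 show "\<forall>\<^sub>F n in sequentially. dist (LINT om|sphere0. p n r om \<bullet> q n r om) (LINT om|sphere_measure. P r om \<bullet> Q r om) < e"
  by eventually_elim (use assms(3,4) in \<open>auto simp: dist_real_def\<close>)
qed

text \<open>Smallness on an annulus gives smallness of the sphere norms only after integration in r,
  with the weight r^(N-1) bounded below by x0^(N-1). This produces the functions z of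
  \<open>limit_lipschitz_derivative\<close>.\<close>

lemma polar_square_integrals:
 fixes f :: "'a::euclidean_space => complex"
 assumes f: "f : borel_measurable borel" and k: "!!x. x : annulus x0 y0 ==> cmod (f x) <= k" and x0: "0 < x0"
 defines "z \<equiv> %r. L2norm sphere0 (%om. f (r *R om))"
 shows "integrable lborel (%r. indicator {x0..y0} r * (z r)^2)"
  and "(LINT r|lborel. indicator {x0..y0} r * (z r)^2) <= (1 / x0 ^ (DIM('a) - 1)) * (L2norm (lebesgue_on (annulus x0 y0)) f)^2"
  and "!!r. x0 <= r ==> r <= y0 ==> L2fun sphere0 (%om. f (r *R om))"
proof -
 let ?A = "annulus x0 y0 :: 'a set" and ?N = "DIM('a)"
 note [measurable] = f
 define F where "F x = indicator ?A x * (cmod (f x))^2" for x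
 have [measurable]: "F : borel_measurable borel" unfolding F_def by measurable
 have Fk: "F x <= indicator ?A x * k^2" "F x >= 0" for x
  using power_mono[OF k norm_ge_zero, of x] by (auto simp: F_def indicator_def)
 have "integrable lborel (%x. indicator ?A x * k^2)"
  using emeasure_compact_finite[OF compact_annulus] by (intro integrable_mult_left integrable_real_indicator) auto
 then have Fi: "integrable lborel F"
  by (rule Bochner_Integration.integrable_bound) (use Fk in \<open>auto intro!: AE_I2\<close>)
 have L: "(L2norm (lebesgue_on ?A) f)\<^sup>2 = (LINT x|lborel. F x)"
 proof -
  have "(L2norm (lebesgue_on ?A) f)\<^sup>2 = (LINT x|lebesgue. F x)"
   unfolding L2norm_power2 F_def by (subst integral_restrict_space) auto
  then show ?thesis by (subst (asm) integral_completion) auto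
 qed
 have sq: "L2fun sphere0 (%om. f (r *R om))" if r: "x0 <= r" "r <= y0" for r
 proof -
  have fm: "(%om. f (r *R om)) : borel_measurable sphere0" by (rule borel_measurable_sphere0) measurable
  have "integrable (sphere0 :: 'a measure) (%om. k^2)" by (intro integrable_sphere0_continuous continuous_intros)
  then have "integrable sphere0 (%om. (cmod (f (r *R om)))^2)"
  proof (rule Bochner_Integration.integrable_bound)
   show "AE om in sphere0. norm ((cmod (f (r *R om)))^2) <= norm (k^2)"
   proof (rule AE_I2)
    fix om :: 'a assume "om : space sphere0"
    then have "cmod (f (r *R om)) <= k" using r x0 by (intro k) (simp add: annulus_def)
    then have "(cmod (f (r *R om)))\<^sup>2 <= k\<^sup>2" by (rule power_mono) simp
    then show "norm ((cmod (f (r *R om)))^2) <= norm (k^2)" by simp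
   qed
  qed (use fm in measurable)
  then show ?thesis using fm by (simp add: L2fun_def)
 qed
 then show "!!r. x0 <= r ==> r <= y0 ==> L2fun sphere0 (%om. f (r *R om))" .
 define G where "G r = (\<integral>\<^sup>+om. ennreal (F (r *R om)) \<partial>(sphere0 :: 'a measure))" for r
 have pm: "(%(r, om). ennreal (F (r *R om))) : borel_measurable (radial_measure ?N \<Otimes>\<^sub>M (sphere0 :: 'a measure))"
  using measurable_compose[OF measurable_scale_sphere, of "%x. ennreal (F x)" borel ?N] by (simp add: split_beta)
 have "G : borel_measurable (radial_measure ?N)"
  unfolding G_def using sphere0.borel_measurable_nn_integral[OF pm] by simp
 then have Gm[measurable]: "G : borel_measurable borel"
  by (subst (asm) measurable_cong_sets[where M'=borel and N'=borel]) (auto simp: radial_measure_def)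
 have Gz: "G r = indicator {x0..y0} r * ennreal ((z r)^2)" if r: "r > 0" for r
 proof (cases "x0 <= r & r <= y0")
  case True
  have "G r = (\<integral>\<^sup>+om. ennreal ((cmod (f (r *R om)))^2) \<partial>(sphere0 :: 'a measure))"
   unfolding G_def by (rule nn_integral_cong) (use True r in \<open>auto simp: F_def annulus_def\<close>)
  also have "... = ennreal (LINT om|sphere0. (cmod (f (r *R om)))^2)"
   using L2fun_integrable[OF sq] True by (intro nn_integral_eq_integral) auto
  finally show ?thesis using True by (simp add: z_def L2norm_power2)
 next
  case False
  have "G r = (\<integral>\<^sup>+om. 0 \<partial>(sphere0 :: 'a measure))"
   unfolding G_def by (rule nn_integral_cong) (use False r in \<open>auto simp: F_def annulus_def\<close>)
  then show ?thesis using False by (auto simp: indicator_def)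
 qed
 \<comment> \<open>Measurability of z^2 in r is read off from the Tonelli function G, since z is
   defined by a separate integral for each r.\<close>
 have zG: "ennreal (indicator {x0..y0} r * (z r)^2) = indicator {x0..y0} r * G r" for r
  using Gz[of r] x0 by (cases "r : {x0..y0}") auto
 have "(%r. enn2real (indicator {x0..y0} r * G r)) : borel_measurable borel" by measurable
 moreover have "(%r. enn2real (indicator {x0..y0} r * G r)) = (%r. indicator {x0..y0} r * (z r)^2)"
  by (simp flip: zG)
 ultimately have zm: "(%r. indicator {x0..y0} r * (z r)^2) : borel_measurable lborel" by simp
 have p0: "x0 ^ (?N - 1) > 0" using x0 by simp
 have "ennreal (x0 ^ (?N - 1)) * (\<integral>\<^sup>+r. ennreal (indicator {x0..y0} r * (z r)^2) \<partial>lborel) = (\<integral>\<^sup>+r. ennreal (x0 ^ (?N - 1)) * (indicator {x0..y0} r * G r) \<partial>lborel)"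
  unfolding zG by (rule nn_integral_cmult[symmetric]) measurable
 also have "... <= (\<integral>\<^sup>+r. (ennreal (r ^ (?N - 1)) * indicator {0<..} r) * G r \<partial>lborel)"
 proof (rule nn_integral_mono)
  fix r
  have "ennreal (x0 ^ (?N - 1)) * G r <= ennreal (r ^ (?N - 1)) * G r" if "x0 <= r"
   using that x0 by (intro mult_right_mono ennreal_leI power_mono) auto
  then show "ennreal (x0 ^ (?N - 1)) * (indicator {x0..y0} r * G r) <= (ennreal (r ^ (?N - 1)) * indicator {0<..} r) * G r"
   using x0 by (auto simp: indicator_def)
 qed
 also have "... = (\<integral>\<^sup>+r. G r \<partial>radial_measure ?N)"
  unfolding radial_measure_def by (rule nn_integral_density[symmetric]) measurable
 also have "... = (\<integral>\<^sup>+x. ennreal (F x) \<partial>lborel)" unfolding G_def by (rule polar_nn_integral[symmetric]) measurable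
 also have "... = ennreal ((L2norm (lebesgue_on ?A) f)^2)"
  unfolding L using Fi Fk by (intro nn_integral_eq_integral) auto
 finally have le: "ennreal (x0 ^ (?N - 1)) * (\<integral>\<^sup>+r. ennreal (indicator {x0..y0} r * (z r)^2) \<partial>lborel) <= ennreal ((L2norm (lebesgue_on ?A) f)^2)" .
 have fin: "(\<integral>\<^sup>+r. ennreal (indicator {x0..y0} r * (z r)^2) \<partial>lborel) < \<infinity>"
 proof (rule ccontr)
  assume "\<not> ?thesis"
  then have "(\<integral>\<^sup>+r. ennreal (indicator {x0..y0} r * (z r)^2) \<partial>lborel) = top" by (simp add: less_top[symmetric])
  then show False using le p0 x0 by (simp add: ennreal_mult_top top_unique)
 qed
 show i: "integrable lborel (%r. indicator {x0..y0} r * (z r)^2)"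
  using zm fin by (intro integrableI_nonneg) auto
 have I0: "(LINT r|lborel. indicator {x0..y0} r * (z r)^2) >= 0" by (intro integral_nonneg_AE AE_I2) simp
 have "ennreal (x0 ^ (?N - 1) * (LINT r|lborel. indicator {x0..y0} r * (z r)^2)) <= ennreal ((L2norm (lebesgue_on ?A) f)^2)"
  using le i I0 p0 by (subst (asm) nn_integral_eq_integral) (auto simp: ennreal_mult)
 then have "x0 ^ (?N - 1) * (LINT r|lborel. indicator {x0..y0} r * (z r)^2) <= (L2norm (lebesgue_on ?A) f)\<^sup>2"
  by (subst (asm) ennreal_le_iff) auto
 then show "(LINT r|lborel. indicator {x0..y0} r * (z r)^2) <= (1 / x0 ^ (?N - 1)) * (L2norm (lebesgue_on ?A) f)^2"
  using p0 by (simp add: field_simps)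
qed

section \<open>The trace of u as a path in L2 of the sphere\<close>

context H2_exterior
begin

lemma path_approximation:
 assumes x: "R0 < x" "x <= y"
 obtains \<phi> g hh where "!!n::nat. C2_complex (\<phi> n) (g n) (hh n)"
  "utrace x y (%n r om. \<phi> n (r *R om)) Tu"
  "utrace x y (%n r om. g n om (r *R om)) Tr"
  "!!b. b : Basis ==> utrace x y (%n r om. g n b (r *R om)) (%r. Tb r b)"
  "(%n. L2norm (lebesgue_on (annulus x y)) (%x. \<phi> n x - u x)) ----> 0"
  "!!b. b : Basis ==> (%n. L2norm (lebesgue_on (annulus x y)) (%x. hh n b b x - weak_partial \<Omega> b (weak_partial \<Omega> b u) x)) ----> 0"
proof (rule approximation[OF x])
 fix \<phi> g hh
 assume C2: "!!n::nat. C2_complex (\<phi> n) (g n) (hh n)"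
  and l0: "!!e. e > 0 ==> \<forall>\<^sub>F n in sequentially. ALL r. x <= r --> r <= y --> L2norm S (%om. \<phi> n (r *R om) - Tu r om) < e"
  and l1: "!!b e. b : Basis ==> e > 0 ==> \<forall>\<^sub>F n in sequentially. ALL r. x <= r --> r <= y --> L2norm S (%om. g n b (r *R om) - Tb r b om) < e"
  and a: "(%n. L2norm (lebesgue_on (annulus x y)) (%x. \<phi> n x - u x)) ----> 0"
   "!!b. b : Basis ==> (%n. L2norm (lebesgue_on (annulus x y)) (%x. hh n b b x - weak_partial \<Omega> b (weak_partial \<Omega> b u) x)) ----> 0"
 note C1 = C2_complex_imp_C1[OF C2]
 note l2 = radial_uniform[OF C1 x(1) l1]
 show ?thesis
 proof (rule that[OF C2 _ _ _ a])
  show "utrace x y (%n r om. \<phi> n (r *R om)) Tu"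
   unfolding utrace_def split_beta using l0 x sqi_Tu
   by (auto intro!: C1_complex.continuous_phi[OF C1] continuous_intros)
  show "utrace x y (%n r om. g n om (r *R om)) Tr"
   unfolding utrace_def split_beta using l2 x sqi_Tr
   by (auto intro!: C1_complex.continuous_g[OF C1] continuous_intros)
  show "utrace x y (%n r om. g n b (r *R om)) (%r. Tb r b)" if "b : Basis" for b
   unfolding utrace_def split_beta using l1[OF that] x sqi_Tb[OF _ that]
   by (auto intro!: C1_complex.continuous_g[OF C1] continuous_intros)
 qed
qed

lemma path_estimate:
 assumes r: "R0 < r" "r < t" and M: "!!\<tau>. r <= \<tau> ==> \<tau> <= t ==> L2norm S (%om. Tr \<tau> om - Tr r om) <= M"
 shows "L2norm S (%om. Tu t om - Tu r om - (t - r) *R Tr r om) <= (t - r) * M"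
proof (rule field_le_epsilon)
 fix e :: real assume e: "e > 0"
 obtain \<phi> g hh where C2: "!!n::nat. C2_complex (\<phi> n) (g n) (hh n)"
  and u1: "utrace r t (%n r om. \<phi> n (r *R om)) Tu" and u2: "utrace r t (%n r om. g n om (r *R om)) Tr"
  by (rule path_approximation[OF r(1) less_imp_le[OF r(2)]]) (rule that)
 note C1 = C2_complex_imp_C1[OF C2]
 note U = utraceD[OF u1] and V = utraceD[OF u2]
 \<comment> \<open>2 + 3 (t - r) counts the errors: one \<delta> for u at each end, (t - r) \<delta>
   in the linear term and 2 (t - r) \<delta> in the oscillation of the radial derivative.\<close>
 define \<delta> where "\<delta> = e / (2 + 3 * (t - r))"
 have k: "2 + 3 * (t - r) > 0" using r by simp
 then have \<delta>: "\<delta> > 0" "\<delta> * (2 + 3 * (t - r)) = e" using e by (simp_all add: \<delta>_def)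
 have "\<forall>\<^sub>F n in sequentially. (ALL s. r <= s --> s <= t --> L2norm S (%om. \<phi> n (s *R om) - Tu s om) < \<delta>) &
   (ALL s. r <= s --> s <= t --> L2norm S (%om. g n om (s *R om) - Tr s om) < \<delta>)"
  by (rule eventually_conj[OF U(5)[OF \<delta>(1)] V(5)[OF \<delta>(1)]])
 then obtain n where n: "!!s. r <= s ==> s <= t ==> L2norm S (%om. \<phi> n (s *R om) - Tu s om) < \<delta>"
   "!!s. r <= s ==> s <= t ==> L2norm S (%om. g n om (s *R om) - Tr s om) < \<delta>"
  using eventually_happens'[OF sequentially_bot] by blast
 note sqs = L2fun_diff L2fun_scaleR U(3) V(3)
 have S0: "L2norm sphere0 f = L2norm S f" if "L2fun sphere0 f" for f :: "'a => complex"
  by (rule L2norm_sphere_measure[OF L2fun_measurable[OF that], symmetric])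
 have rt: "r <= r" "r <= t" "t <= t" using r by auto
 have gM: "L2norm sphere0 (%om. g n om (\<tau> *R om) - g n om (r *R om)) <= M + 2 * \<delta>" if \<tau>: "r <= \<tau>" "\<tau> <= t" for \<tau>
 proof -
  have "L2norm S (%om. g n om (\<tau> *R om) - g n om (r *R om)) <= L2norm S (%om. g n om (\<tau> *R om) - Tr \<tau> om) + L2norm S (%om. Tr \<tau> om - g n om (r *R om))"
   by (rule L2norm_triangle_diff[OF V(3) V(4)[OF \<tau>] V(3)])
  also have "L2norm S (%om. Tr \<tau> om - g n om (r *R om)) <= L2norm S (%om. Tr \<tau> om - Tr r om) + L2norm S (%om. Tr r om - g n om (r *R om))"
   by (rule L2norm_triangle_diff[OF V(4)[OF \<tau>] V(4)[OF rt(1,2)] V(3)])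
  finally have "L2norm S (%om. g n om (\<tau> *R om) - g n om (r *R om)) <= M + 2 * \<delta>"
   using n(2)[OF \<tau>] n(2)[OF rt(1,2)] M[OF \<tau>] by (simp add: L2norm_minus_commute[of _ "Tr r"])
  then show ?thesis using S0[OF L2fun_diff[OF V(2) V(2)], of n \<tau> n r] by simp
 qed
 let ?a = "%om. Tu t om - \<phi> n (t *R om)" and ?b = "%om. \<phi> n (r *R om) - Tu r om" and ?c = "%om. (t - r) *R (g n om (r *R om) - Tr r om)"
  and ?d = "%om. \<phi> n (t *R om) - \<phi> n (r *R om) - (t - r) *R g n om (r *R om)"
 have sq: "L2fun S ?a" "L2fun S ?b" "L2fun S ?c" "L2fun sphere0 ?d" "L2fun S ?d"
  using rt r U(2,3,4) V(2,3,4) by (auto intro!: L2fun_diff L2fun_scaleR)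
 have e1: "(%om. Tu t om - Tu r om - (t - r) *R Tr r om) = (%om. ?a om + (?b om + (?c om + ?d om)))"
  by (auto simp: scaleR_diff_right)
 have "L2norm S (%om. ?a om + (?b om + (?c om + ?d om))) <= L2norm S ?a + (L2norm S ?b + (L2norm S ?c + L2norm S ?d))"
  by (intro order_trans[OF L2norm_triangle] add_left_mono order_refl L2fun_add sq)
 moreover have "L2norm S ?d <= (t - r) * (M + 2 * \<delta>)"
  using smooth_path_estimate[OF C1 _ r(2) gM] r R0 S0[OF sq(4)] by simp
 moreover have "L2norm S ?a <= \<delta>" using n(1)[OF rt(2,3)] by (simp add: L2norm_minus_commute[of _ "Tu t"])
 moreover have "L2norm S ?b <= \<delta>" using n(1)[OF rt(1,2)] by simp
 moreover have "L2norm S ?c <= (t - r) * \<delta>" using n(2)[OF rt(1,2)] r by (simp add: L2norm_scaleR)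
 ultimately have "L2norm S (%om. Tu t om - Tu r om - (t - r) *R Tr r om) <= (t - r) * M + \<delta> * (2 + 3 * (t - r))"
  unfolding e1 by (simp add: algebra_simps)
 then show "L2norm S (%om. Tu t om - Tu r om - (t - r) *R Tr r om) <= (t - r) * M + e" by (simp only: \<delta>(2))
qed

end

text \<open>For the Pohozaev identity, where the Laplacian is paired with 2r times the radial
  derivative.\<close>

lemma utrace_scale:
 fixes P :: "real => 'a::euclidean_space => complex"
 assumes u: "utrace x y p P" and c: "continuous_on UNIV c" and b: "!!r. x <= r ==> r <= y ==> \<bar>c r\<bar> <= k"
 shows "utrace x y (%n r om. c r *R p n r om) (%r om. c r *R P r om)"
 unfolding utrace_def
proof (intro conjI allI impI)
 note U = utraceD[OF u]
 show "continuous_on UNIV (%(r, om). c r *R p n r om)" for n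
  unfolding split_beta by (intro continuous_intros U(1) continuous_on_compose2[OF c]) auto
 show "L2fun sphere_measure (%om. c r *R P r om)" if "x <= r" "r <= y" for r
  by (intro L2fun_scaleR U(4) that)
 fix e :: real assume e: "e > 0"
 have e': "e / (\<bar>k\<bar> + 1) > 0" using e by simp
 show "\<forall>\<^sub>F n in sequentially. ALL r. x <= r --> r <= y --> L2norm sphere_measure (%om. c r *R p n r om - c r *R P r om) < e"
  using U(5)[OF e']
 proof eventually_elim
  case (elim n)
  show ?case
  proof (intro allI impI)
   fix r assume r: "x <= r" "r <= y"
   have "L2norm sphere_measure (%om. c r *R p n r om - c r *R P r om) = \<bar>c r\<bar> * L2norm sphere_measure (%om. p n r om - P r om)"
    by (simp flip: scaleR_diff_right add: L2norm_scaleR)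
   also have "... <= (\<bar>k\<bar> + 1) * L2norm sphere_measure (%om. p n r om - P r om)"
    using b[OF r] by (intro mult_right_mono) auto
   also have "... < (\<bar>k\<bar> + 1) * (e / (\<bar>k\<bar> + 1))" using elim r by (intro mult_strict_left_mono) auto
   also have "... = e" by simp
   finally show "L2norm sphere_measure (%om. c r *R p n r om - c r *R P r om) < e" .
  qed
 qed
qed

lemma borel_bounded_version:
 fixes f :: "'a::euclidean_space => complex"
 assumes f: "f : borel_measurable (lebesgue_on \<Omega>)" and lb: "locally_bounded_on \<Omega> f" and \<Omega>: "open \<Omega>" and K: "compact K" "K \<subseteq> \<Omega>"
 obtains F k where "F : borel_measurable borel" "!!x. cmod (F x) <= k" "k >= 0" "AE x in lborel. x : K --> F x = f x"
proof -
 have "L2_loc \<Omega> f" unfolding L2_loc_def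
 proof (intro conjI f allI impI)
  fix G assume G: "compact G & G \<subseteq> \<Omega>"
  then have "bounded (f ` G)" using lb unfolding locally_bounded_on_def by simp
  then obtain b where "ALL v:f ` G. norm v <= b" unfolding bounded_iff by (rule exE)
  then have b: "cmod (f x) <= b" if "x : G" for x using that by simp
  have Gs: "G : sets lebesgue" using G by (simp add: lmeasurable_compact fmeasurableD)
  have [measurable]: "f : borel_measurable (lebesgue_on G)" using measurable_restrict_mono[OF f] G by blast
  have "integrable lebesgue (indicat_real G)"
   by (rule integrable_real_indicator) (use lmeasurable_compact G in \<open>auto simp: fmeasurable_def\<close>)
  then have "integrable (lebesgue_on G) (%x. b^2)" using Gs by (simp add: integrable_restrict_space)
  then show "integrable (lebesgue_on G) (%x. (cmod (f x))^2)"
   by (rule Bochner_Integration.integrable_bound) (use b Gs in \<open>auto intro!: AE_I2 power_mono\<close>)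
 qed
 then obtain F where F: "L2fun lborel F" "AE x in lborel. x : K --> F x = f x"
  by (rule borel_version[OF _ \<Omega> K]) (rule that)
 have "bounded (f ` K)" using lb K unfolding locally_bounded_on_def by simp
 then obtain b where "ALL v:f ` K. norm v <= b" unfolding bounded_iff by (rule exE)
 then have b: "cmod (f x) <= b" if "x : K" for x using that by simp
 have [measurable]: "F : borel_measurable borel" using L2fun_measurable[OF F(1)] by simp
 show ?thesis
 proof (rule that[of "%x. if cmod (F x) <= \<bar>b\<bar> then F x else 0" "\<bar>b\<bar>"])
  show "AE x in lborel. x : K --> (if cmod (F x) <= \<bar>b\<bar> then F x else 0) = f x"
   using F(2) by eventually_elim (use order_trans[OF b abs_ge_self] in auto)
 qed auto
qed

locale schroedinger_solution = H2_exterior +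
 fixes q :: "'a => complex"
 assumes q_meas: "measurable_coeff R0 q" and q_bdd: "locally_bounded_on (exterior R0) q"
  and u_eq: "AE x in lebesgue_on (exterior R0). - weak_laplacian (exterior R0) u x + q x * u x = 0"
begin

lemma second_order_limit:
 assumes x: "R0 < x" and xy: "x <= y" and C2: "!!n::nat. C2_complex (\<phi> n) (g n) (hh n)"
  and u1: "utrace x y (%n r om. \<phi> n (r *R om)) Tu"
  and l0: "(%n. L2norm (lebesgue_on (annulus x y)) (%x. \<phi> n x - u x)) ----> 0"
  and l2: "!!b. b : Basis ==> (%n. L2norm (lebesgue_on (annulus x y)) (%x. hh n b b x - weak_partial \<Omega> b (weak_partial \<Omega> b u) x)) ----> 0"
  and uK: "utrace x y \<kappa> K"
  and fd: "!!n r. x <= r ==> r <= y ==> (f n has_real_derivative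
    r ^ (DIM('a) - 1) * (en n r + (LINT om|sphere0. \<kappa> n r om \<bullet> C2_complex.lap (hh n) (r *R om)))) (at r)"
  and en: "!!n. continuous_on {x..y} (en n)" "!!n r. x <= r ==> r <= y ==> \<bar>en n r\<bar> <= E"
   "!!r. x <= r ==> r <= y ==> (%n. en n r) ----> e r"
  and f0: "!!r. x <= r ==> r <= y ==> (%n. f n r) ----> f0 r"
 shows "EX L. ALL s t. x <= s --> s <= t --> t <= y --> \<bar>f0 t - f0 s\<bar> <= L * (t - s)"
  and "AE r in lborel. x < r --> r < y --> ((%s. (f0 (r + s) - f0 r) / s) --->
    r ^ (DIM('a) - 1) * (e r + (LINT om|S. K r om \<bullet> (q (r *R om) * Tu r om)))) (at_right 0)"
proof -
 let ?A = "annulus x y :: 'a set" and ?N = "DIM('a)"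
 have x0: "0 < x" using x R0 by simp
 have AO: "?A \<subseteq> \<Omega>" using x by (auto simp: annulus_def exterior_def)
 have qm: "q : borel_measurable (lebesgue_on \<Omega>)" using q_meas by (simp add: measurable_coeff_def)
 \<comment> \<open>A bounded Borel version of q on the annulus. By \<open>AE_polar\<close> it agrees
   with q almost everywhere on almost every sphere, so the final formula can be stated with q
   itself.\<close>
 obtain q' k where q': "q' : borel_measurable borel" "!!x. cmod (q' x) <= k" "k >= 0" "AE x in lborel. x : ?A --> q' x = q x"
  by (rule borel_bounded_version[OF qm q_bdd open_exterior compact_annulus AO]) (rule that)
 note [measurable] = q'(1)
 note C1 = C2_complex_imp_C1[OF C2]
 note U = utraceD[OF u1] and W = utraceD[OF uK]
 define lp where "lp n = C2_complex.lap (hh n)" for n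
 have lpc: "continuous_on X (%z. lp n (k z))" if "continuous_on X k" for X :: "'z::topological_space set" and k n
  unfolding lp_def by (rule C2_complex.continuous_lap[OF C2 that])
 have \<phi>c: "continuous_on X (%z. \<phi> n (k z))" if "continuous_on X k" for X :: "'z::topological_space set" and k n
  by (rule C1_complex.continuous_phi[OF C1 that])
 have [measurable]: "lp n : borel_measurable borel" "\<phi> n : borel_measurable borel" for n
  using lpc[OF continuous_on_id] \<phi>c[OF continuous_on_id] by (auto intro: borel_measurable_continuous_onI)
 define rest where "rest n z = lp n z - q' z * \<phi> n z" for n z
 have rm: "rest n : borel_measurable borel" for n unfolding rest_def by measurable
 have rb: "EX c. ALL z:?A. cmod (rest n z) <= c" for n
 proof -
  have "bounded (lp n ` ?A)" "bounded (\<phi> n ` ?A)"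
   using lpc[OF continuous_on_id] \<phi>c[OF continuous_on_id] by (auto intro!: compact_imp_bounded compact_continuous_image)
  then have "(EX c. ALL z:?A. cmod (lp n z) <= c)" "(EX c. ALL z:?A. cmod (\<phi> n z) <= c)" by (simp_all add: bounded_iff)
  then obtain c1 c2 where c: "!!z. z : ?A ==> cmod (lp n z) <= c1" "!!z. z : ?A ==> cmod (\<phi> n z) <= c2"
   by (elim exE) auto
  have "cmod (rest n z) <= c1 + k * c2" if z: "z : ?A" for z
  proof -
   have "cmod (q' z * \<phi> n z) <= k * c2" unfolding norm_mult using q' c(2)[OF z] by (intro mult_mono) auto
   then show ?thesis unfolding rest_def using norm_triangle_ineq4[of "lp n z" "q' z * \<phi> n z"] c(1)[OF z] by linarith
  qed
  then show ?thesis by blast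
 qed
 define z where "z n r = L2norm sphere0 (%om. rest n (r *R om))" for n r
 have zi: "integrable lborel (%r. indicator {x..y} r * (z n r)^2)"
  "(LINT r|lborel. indicator {x..y} r * (z n r)^2) <= (1 / x ^ (?N - 1)) * (L2norm (lebesgue_on ?A) (rest n))^2"
  "!!r. x <= r ==> r <= y ==> L2fun sphere0 (%om. rest n (r *R om))" for n
 proof -
  obtain c where c: "!!z. z : ?A ==> cmod (rest n z) <= c" using rb[of n] by blast
  show "integrable lborel (%r. indicator {x..y} r * (z n r)^2)"
   "(LINT r|lborel. indicator {x..y} r * (z n r)^2) <= (1 / x ^ (?N - 1)) * (L2norm (lebesgue_on ?A) (rest n))^2"
   "!!r. x <= r ==> r <= y ==> L2fun sphere0 (%om. rest n (r *R om))"
   unfolding z_def by (rule polar_square_integrals[OF rm c x0]; assumption)+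
 qed
 have rest0: "(%n. L2norm (lebesgue_on ?A) (rest n)) ----> 0"
 proof (rule Lim_null_comparison[OF always_eventually])
  let ?w = "%b. weak_partial \<Omega> b (weak_partial \<Omega> b u)"
  show "(%n. (SUM b:Basis. L2norm (lebesgue_on ?A) (%x. hh n b b x - ?w b x)) + k * L2norm (lebesgue_on ?A) (%x. \<phi> n x - u x)) ----> 0"
   using tendsto_add[OF tendsto_sum[OF l2] tendsto_mult[OF tendsto_const[of k] l0]] by simp
  show "ALL n. norm (L2norm (lebesgue_on ?A) (rest n)) <= (SUM b:Basis. L2norm (lebesgue_on ?A) (%x. hh n b b x - ?w b x)) + k * L2norm (lebesgue_on ?A) (%x. \<phi> n x - u x)"
  proof
   fix n
   have As: "?A : sets lebesgue" "\<Omega> : sets lebesgue" by auto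
   have sw: "L2fun (lebesgue_on ?A) (%x. hh n b b x - ?w b x)" if "b : Basis" for b
    by (rule L2fun_diff[OF L2fun_continuous_annulus[OF C2_complex.c2[OF C2]] L2_loc_annulus[OF L2_locs(3)[OF that that] x]])
   have su: "L2fun (lebesgue_on ?A) (%x. \<phi> n x - u x)"
    by (rule L2fun_diff[OF L2fun_continuous_annulus[OF C1_complex.c0[OF C1]] L2_loc_annulus[OF L2_locs(1) x]])
   have q'A: "(%x. - q' x) : borel_measurable (lebesgue_on ?A)" using q'(1) by (intro measurable_restrict_space1 measurable_completion) simp
   have sq2: "L2fun (lebesgue_on ?A) (%x. - q' x * (\<phi> n x - u x))"
    by (rule L2fun_mult_bounded[OF su q'A, of k]) (use q' in auto)
   let ?D = "%x. (SUM b:Basis. hh n b b x - ?w b x) + (- q' x) * (\<phi> n x - u x)"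
   have sD: "L2fun (lebesgue_on ?A) ?D" by (intro L2fun_add L2fun_sum sw sq2 finite_Basis)
   have "AE x in lebesgue. x : \<Omega> --> - weak_laplacian \<Omega> u x + q x * u x = 0"
    using u_eq by (subst (asm) AE_restrict_space_iff) (use As in auto)
   moreover have "AE x in lebesgue. x : ?A --> q' x = q x" using q'(4) by (rule AE_completion)
   ultimately have "AE x in lebesgue. x : ?A --> rest n x = ?D x"
   proof eventually_elim
    case (elim z)
    show ?case
    proof
     assume z: "z : ?A"
     \<comment> \<open>The equation for u enters here: the weak Laplacian equals q u almost
       everywhere.\<close>
     have "(SUM b:Basis. ?w b z) = q' z * u z" using elim z AO by (auto simp: weak_laplacian_def)
     then show "rest n z = ?D z" by (simp add: rest_def lp_def C2_complex.lap_def[OF C2] sum_subtractf algebra_simps)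
    qed
   qed
   then have "AE x in lebesgue_on ?A. rest n x = ?D x" by (subst AE_restrict_space_iff) (use As in auto)
   moreover have "rest n : borel_measurable (lebesgue_on ?A)" using rm[of n] by (intro measurable_restrict_space1 measurable_completion) simp
   ultimately have "(LINT x|lebesgue_on ?A. (cmod (rest n x))^2) = (LINT x|lebesgue_on ?A. (cmod (?D x))^2)"
    using L2fun_measurable[OF sD]
    by (intro integral_cong_AE borel_measurable_power borel_measurable_norm) (auto elim: eventually_mono)
   then have "L2norm (lebesgue_on ?A) (rest n) = L2norm (lebesgue_on ?A) ?D" by (simp only: L2norm_def)
   also have "... <= L2norm (lebesgue_on ?A) (%x. SUM b:Basis. hh n b b x - ?w b x) + L2norm (lebesgue_on ?A) (%x. - q' x * (\<phi> n x - u x))"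
    by (rule L2norm_triangle[OF L2fun_sum sq2]) (auto intro: sw)
   also have "... <= (SUM b:Basis. L2norm (lebesgue_on ?A) (%x. hh n b b x - ?w b x)) + k * L2norm (lebesgue_on ?A) (%x. \<phi> n x - u x)"
   proof (rule add_mono)
    show "L2norm (lebesgue_on ?A) (%x. SUM b:Basis. hh n b b x - ?w b x) <= (SUM b:Basis. L2norm (lebesgue_on ?A) (%x. hh n b b x - ?w b x))"
     by (rule L2norm_sum_le) (auto intro: sw)
    show "L2norm (lebesgue_on ?A) (%x. - q' x * (\<phi> n x - u x)) <= k * L2norm (lebesgue_on ?A) (%x. \<phi> n x - u x)"
     by (rule L2norm_mult_bounded[OF su q'A]) (use q' in auto)
   qed
   finally show "norm (L2norm (lebesgue_on ?A) (rest n)) <= (SUM b:Basis. L2norm (lebesgue_on ?A) (%x. hh n b b x - ?w b x)) + k * L2norm (lebesgue_on ?A) (%x. \<phi> n x - u x)" by simp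
  qed
 qed
 have z0: "(%n. LINT r|lborel. indicator {x..y} r * (z n r)^2) ----> 0"
 proof (rule Lim_null_comparison[OF always_eventually])
  show "(%n. (1 / x ^ (?N - 1)) * (L2norm (lebesgue_on ?A) (rest n))^2) ----> 0"
   using tendsto_mult[OF tendsto_const[of "1 / x ^ (?N - 1)"] tendsto_power[OF rest0, of 2]] by simp
  have "(LINT r|lborel. indicator {x..y} r * (z n r)^2) >= 0" for n by (intro integral_nonneg_AE AE_I2) simp
  then show "ALL n. norm (LINT r|lborel. indicator {x..y} r * (z n r)^2) <= (1 / x ^ (?N - 1)) * (L2norm (lebesgue_on ?A) (rest n))^2"
   using zi(2) by simp
 qed
 obtain M where M: "M >= 0" "!!n r. x <= r ==> r <= y ==> L2norm S (%om. \<phi> n (r *R om)) <= M"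
  by (rule utrace_bounded[OF u1]) (rule that)
 obtain Mk where Mk: "Mk >= 0" "!!n r. x <= r ==> r <= y ==> L2norm S (\<kappa> n r) <= Mk"
  by (rule utrace_bounded[OF uK]) (rule that)
 have S0: "L2norm S f = L2norm sphere0 f" if "L2fun sphere0 f" for f :: "'a => complex"
  by (rule L2norm_sphere_measure[OF L2fun_measurable[OF that]])
 have q's: "(%om. q' (r *R om)) : borel_measurable sphere0" for r by (rule borel_measurable_sphere0) measurable
 then have q'S: "(%om. q' (r *R om)) : borel_measurable S" for r
  unfolding sphere_measure_eq by (rule measurable_completion)
 have sqq: "L2fun sphere0 (%om. q' (r *R om) * \<phi> n (r *R om))" for n r
  by (rule L2fun_mult_bounded[OF U(2) q's q'(2)])
 define c where "c n r = (LINT om|sphere0. \<kappa> n r om \<bullet> (q' (r *R om) * \<phi> n (r *R om)))" for n r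
 have cb: "\<bar>c n r\<bar> <= Mk * (k * M)" if r: "x <= r" "r <= y" for n r
 proof -
  have "\<bar>c n r\<bar> <= L2norm sphere0 (\<kappa> n r) * L2norm sphere0 (%om. q' (r *R om) * \<phi> n (r *R om))"
   unfolding c_def by (rule inner_bound[OF W(2) sqq])
  also have "... <= Mk * (k * M)"
  proof (intro mult_mono)
   show "L2norm sphere0 (\<kappa> n r) <= Mk" using Mk(2)[OF r, of n] S0[OF W(2)] by simp
   have "L2norm sphere0 (%om. q' (r *R om) * \<phi> n (r *R om)) <= k * L2norm sphere0 (%om. \<phi> n (r *R om))"
    by (rule L2norm_mult_bounded[OF U(2) q's q'(2,3)])
   also have "... <= k * M" using M(2)[OF r, of n] S0[OF U(2)[of n r]] q'(3) by (intro mult_left_mono) auto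
   finally show "L2norm sphere0 (%om. q' (r *R om) * \<phi> n (r *R om)) <= k * M" .
  qed (use Mk in auto)
  finally show ?thesis .
 qed
 have cm: "c n : borel_measurable borel" for n
 proof -
  have pr: "(%z. (fst z, snd z)) : (borel :: real measure) \<Otimes>\<^sub>M (sphere0 :: 'a measure) \<rightarrow>\<^sub>M borel"
  proof -
   have "(%om. om) : sphere0 \<rightarrow>\<^sub>M (borel :: 'a measure)" by (rule borel_measurable_sphere0) simp
   then have "(%z. snd z) : (borel :: real measure) \<Otimes>\<^sub>M sphere0 \<rightarrow>\<^sub>M (borel :: 'a measure)"
    using measurable_compose[OF measurable_snd] by blast
   then show ?thesis unfolding borel_prod[symmetric] by (intro measurable_Pair) auto
  qed
  have k1: "(%z. \<kappa> n (fst z) (snd z)) : borel_measurable borel"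
   by (intro borel_measurable_continuous_onI W(1) continuous_intros)
  have sc: "(%z::real \<times> 'a. fst z *R snd z) : borel_measurable borel"
   by (intro borel_measurable_continuous_onI continuous_intros)
  have "(%z::real \<times> 'a. \<kappa> n (fst z) (snd z) \<bullet> (q' (fst z *R snd z) * \<phi> n (fst z *R snd z))) : borel_measurable borel"
   by (intro borel_measurable_inner k1 borel_measurable_times measurable_compose[OF sc]) measurable
  from measurable_compose[OF pr this]
  have "(%(r, om). \<kappa> n r om \<bullet> (q' (r *R om) * \<phi> n (r *R om))) : borel_measurable (borel \<Otimes>\<^sub>M sphere0)" by (simp add: split_beta)
  then show ?thesis unfolding c_def by (rule sphere0.borel_measurable_lebesgue_integral)
 qed
 \<comment> \<open>The indicator makes en n Borel on the whole line without changing it on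
   [x, y].\<close>
 define m where "m n r = r ^ (?N - 1) * (indicator {x..y} r *R en n r + c n r)" for n r
 have mm: "m n : borel_measurable borel" for n
  unfolding m_def using cm[of n] borel_measurable_continuous_on_indicator[OF _ en(1)[of n]] by measurable
 have wy: "r ^ (?N - 1) <= y ^ (?N - 1)" "0 <= r ^ (?N - 1)" if "x <= r" "r <= y" for r
  using that x0 by (auto intro: power_mono)
 have mM: "\<bar>m n r\<bar> <= y ^ (?N - 1) * (E + Mk * (k * M))" if r: "x <= r" "r <= y" for n r
 proof -
  have "\<bar>m n r\<bar> = r ^ (?N - 1) * \<bar>en n r + c n r\<bar>" using wy(2)[OF r] r by (simp add: m_def abs_mult)
  also have "... <= y ^ (?N - 1) * (E + Mk * (k * M))"
   using wy[OF r] en(2)[OF r, of n] cb[OF r, of n] by (intro mult_mono) auto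
  finally show ?thesis .
 qed
 have kl: "L2fun sphere0 (%om. lp n (r *R om))" for n r
  by (intro L2fun_sphere_continuous lpc continuous_intros)
 define d where "d n r = r ^ (?N - 1) * (en n r + (LINT om|sphere0. \<kappa> n r om \<bullet> lp n (r *R om)))" for n r
 have dc: "continuous_on {x..y} (d n)" for n
  unfolding d_def by (intro continuous_intros en(1) continuous_sphere_integral) (unfold split_beta, intro continuous_intros W(1) lpc)
 have dm: "\<bar>d n r - m n r\<bar> <= y ^ (?N - 1) * Mk * z n r" if r: "x <= r" "r <= y" for n r
 proof -
  have "d n r - m n r = r ^ (?N - 1) * ((LINT om|sphere0. \<kappa> n r om \<bullet> lp n (r *R om)) - c n r)"
   using r by (simp add: d_def m_def algebra_simps)
  also have "(LINT om|sphere0. \<kappa> n r om \<bullet> lp n (r *R om)) - c n r = (LINT om|sphere0. \<kappa> n r om \<bullet> rest n (r *R om))"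
   unfolding c_def rest_def inner_diff_right
   by (rule Bochner_Integration.integral_diff[symmetric, OF integrable_inner[OF W(2) kl] integrable_inner[OF W(2) sqq]])
  finally have "\<bar>d n r - m n r\<bar> = r ^ (?N - 1) * \<bar>LINT om|sphere0. \<kappa> n r om \<bullet> rest n (r *R om)\<bar>" using wy(2)[OF r] by (simp add: abs_mult)
  also have "... <= y ^ (?N - 1) * (Mk * z n r)"
  proof (rule mult_mono[OF wy(1)[OF r]])
   have "\<bar>LINT om|sphere0. \<kappa> n r om \<bullet> rest n (r *R om)\<bar> <= L2norm sphere0 (\<kappa> n r) * z n r"
    unfolding z_def by (rule inner_bound[OF W(2) zi(3)[OF r]])
   also have "... <= Mk * z n r"
    using Mk(2)[OF r, of n] S0[OF W(2)[of n r]] by (intro mult_right_mono) (auto simp: z_def)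
   finally show "\<bar>LINT om|sphere0. \<kappa> n r om \<bullet> rest n (r *R om)\<bar> <= Mk * z n r" .
  qed (use wy[OF r] in auto)
  finally show ?thesis by (simp add: mult_ac)
 qed
 define p where "p r = r ^ (?N - 1) * (e r + (LINT om|S. K r om \<bullet> (q (r *R om) * Tu r om)))" for r
 have mp: "AE r in lborel. x <= r --> r <= y --> (%n. m n r) ----> p r"
  using AE_polar[OF q'(4)]
 proof eventually_elim
  case (elim r)
  show ?case
  proof (intro impI)
   assume r: "x <= r" "r <= y"
   have rp: "r > 0" "r > R0" using r x0 x by auto
   have sT: "L2fun S (%om. q' (r *R om) * Tu r om)"
    by (rule L2fun_mult_bounded[OF sqi_Tu[OF rp(2)] q'S q'(2)])
   have "(%n. LINT om|S. \<kappa> n r om \<bullet> (q' (r *R om) * \<phi> n (r *R om))) ----> (LINT om|S. K r om \<bullet> (q' (r *R om) * Tu r om))"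
   proof (rule inner_tendsto[OF W(3) W(4)[OF r] W(6)[OF r] L2fun_sphere_measure[OF sqq] sT])
    show "(%n. L2norm S (%om. q' (r *R om) * \<phi> n (r *R om) - q' (r *R om) * Tu r om)) ----> 0"
    proof (rule Lim_null_comparison[OF always_eventually])
     show "(%n. k * L2norm S (%om. \<phi> n (r *R om) - Tu r om)) ----> 0"
      using tendsto_mult[OF tendsto_const[of k] U(6)[OF r]] by simp
     show "ALL n. norm (L2norm S (%om. q' (r *R om) * \<phi> n (r *R om) - q' (r *R om) * Tu r om)) <= k * L2norm S (%om. \<phi> n (r *R om) - Tu r om)"
      using L2norm_mult_bounded[OF L2fun_diff[OF U(3)[where r=r] U(4)[OF r]] q'S[of r] q'(2,3)]
      by (simp add: right_diff_distrib)
    qed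
   qed
   moreover have "(LINT om|S. \<kappa> n r om \<bullet> (q' (r *R om) * \<phi> n (r *R om))) = c n r" for n
    unfolding c_def sphere_measure_eq using integrable_inner[OF W(2) sqq]
    by (intro integral_completion) auto
   moreover have "(LINT om|S. K r om \<bullet> (q' (r *R om) * Tu r om)) = (LINT om|S. K r om \<bullet> (q (r *R om) * Tu r om))"
   proof (rule integral_cong_AE)
    have Km: "K r : borel_measurable S" by (rule L2fun_measurable[OF W(4)[OF r]])
    show "(%om. K r om \<bullet> (q' (r *R om) * Tu r om)) : borel_measurable S"
     by (rule borel_measurable_inner[OF Km L2fun_measurable[OF sT]])
    show "(%om. K r om \<bullet> (q (r *R om) * Tu r om)) : borel_measurable S"
     using q_meas rp by (intro borel_measurable_inner Km borel_measurable_times L2fun_measurable[OF sqi_Tu]) (auto simp: measurable_coeff_def)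
    have "AE om in sphere0. r *R om : ?A --> q' (r *R om) = q (r *R om)" using elim rp by simp
    then have "AE om in S. r *R om : ?A --> q' (r *R om) = q (r *R om)"
     unfolding sphere_measure_eq by (rule AE_completion)
    moreover have "AE om in S. r *R om : ?A"
     by (rule AE_I2) (use r rp in \<open>auto simp: annulus_def sphere_measure_eq\<close>)
    ultimately show "AE om in S. K r om \<bullet> (q' (r *R om) * Tu r om) = K r om \<bullet> (q (r *R om) * Tu r om)"
     by eventually_elim simp
   qed
   ultimately have "(%n. c n r) ----> (LINT om|S. K r om \<bullet> (q (r *R om) * Tu r om))" by simp
   then have "(%n. r ^ (?N - 1) * (en n r + c n r)) ----> p r" unfolding p_def by (intro tendsto_intros en(3) r)
   then show "(%n. m n r) ----> p r" using r by (simp add: m_def)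
  qed
 qed
 have fd': "(f n has_real_derivative d n r) (at r)" if "x <= r" "r <= y" for n r
  using fd[OF that] by (simp add: d_def lp_def)
 have C0: "y ^ (?N - 1) * Mk >= 0" using Mk x0 xy by simp
 note lim = limit_lipschitz_derivative[OF fd' dc f0 mm mM mp dm C0 zi(1) z0]
 show "EX L. ALL s t. x <= s --> s <= t --> t <= y --> \<bar>f0 t - f0 s\<bar> <= L * (t - s)" using lim(1) by blast
 show "AE r in lborel. x < r --> r < y --> ((%s. (f0 (r + s) - f0 r) / s) --->
    r ^ (?N - 1) * (e r + (LINT om|S. K r om \<bullet> (q (r *R om) * Tu r om)))) (at_right 0)"
  using lim(2) unfolding p_def .
qed

end

context schroedinger_solution
begin

definition ip :: "('a => complex) => ('a => complex) => real" where "ip f g = (LINT om|S. f om \<bullet> g om)"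


text \<open>Integrals over |x| = r, with the weight r^(N-1) of surface measure, of u rather than of
  v = r^((N-1)/2) u. The functions A, C, D and B of v are combinations of these with powers of 1/r
  as coefficients.\<close>

definition a0 where "a0 r = r ^ (DIM('a) - 1) * ip (Tu r) (Tu r)"
definition i0 where "i0 r = r ^ (DIM('a) - 1) * ip (Tu r) (Tr r)"
definition t0 where "t0 r = r ^ (DIM('a) - 1) * ip (Tr r) (Tr r)"
definition g0 where "g0 r = r ^ (DIM('a) - 1) * (SUM b:Basis. ip (Tb r b) (Tb r b))"
definition l1 where "l1 r = r ^ (DIM('a) - 1) * ip (Tu r) (%om. q (r *R om) * Tu r om)"
definition l2 where "l2 r = r ^ (DIM('a) - 1) * ip (Tr r) (%om. q (r *R om) * Tu r om)"

lemma ip_self: "ip f f = (L2norm S f)^2"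
 by (simp add: ip_def L2norm_power2 dot_square_norm)

lemma scalar_approximation:
 assumes x: "R0 < x" "x <= y"
 obtains \<phi> g hh E where "!!n::nat. C2_complex (\<phi> n) (g n) (hh n)"
  "utrace x y (%n r om. \<phi> n (r *R om)) Tu"
  "utrace x y (%n r om. g n om (r *R om)) Tr"
  "(%n. L2norm (lebesgue_on (annulus x y)) (%x. \<phi> n x - u x)) ----> 0"
  "!!b. b : Basis ==> (%n. L2norm (lebesgue_on (annulus x y)) (%x. hh n b b x - weak_partial \<Omega> b (weak_partial \<Omega> b u) x)) ----> 0"
  "!!r. x <= r ==> r <= y ==> (%n. LINT om|sphere0. C1_complex.grad2 (g n) (r *R om)) ----> (SUM b:Basis. ip (Tb r b) (Tb r b))"
  "!!n r. x <= r ==> r <= y ==> \<bar>LINT om|sphere0. C1_complex.grad2 (g n) (r *R om)\<bar> <= E"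
proof (rule path_approximation[OF x])
 fix \<phi> g hh
 assume C2: "!!n::nat. C2_complex (\<phi> n) (g n) (hh n)"
  and u1: "utrace x y (%n r om. \<phi> n (r *R om)) Tu"
  and u2: "utrace x y (%n r om. g n om (r *R om)) Tr"
  and ub: "!!b. b : Basis ==> utrace x y (%n r om. g n b (r *R om)) (%r. Tb r b)"
  and l: "(%n. L2norm (lebesgue_on (annulus x y)) (%x. \<phi> n x - u x)) ----> 0"
   "!!b. b : Basis ==> (%n. L2norm (lebesgue_on (annulus x y)) (%x. hh n b b x - weak_partial \<Omega> b (weak_partial \<Omega> b u) x)) ----> 0"
 note C1 = C2_complex_imp_C1[OF C2]
 have G: "(LINT om|sphere0. C1_complex.grad2 (g n) (r *R om)) = (SUM b:Basis. LINT om|sphere0. g n b (r *R om) \<bullet> g n b (r *R om))" for n r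
  unfolding C1_complex.grad2_def[OF C1] dot_square_norm
  by (intro Bochner_Integration.integral_sum integrable_sphere0_continuous continuous_intros C1_complex.continuous_g[OF C1])
 have "EX k. ALL n r. x <= r --> r <= y --> \<bar>LINT om|sphere0. g n b (r *R om) \<bullet> g n b (r *R om)\<bar> <= k" if b: "b : Basis" for b
 proof -
  note U = utraceD[OF ub[OF b]]
  obtain M where M: "M >= 0" "!!n r. x <= r ==> r <= y ==> L2norm S (%om. g n b (r *R om)) <= M"
   by (rule utrace_bounded[OF ub[OF b]]) (rule that)
  have "\<bar>LINT om|sphere0. g n b (r *R om) \<bullet> g n b (r *R om)\<bar> <= M * M" if r: "x <= r" "r <= y" for n r
  proof -
   have "L2norm sphere0 (%om. g n b (r *R om)) <= M"
    using M(2)[OF r, of n] L2norm_sphere_measure[OF L2fun_measurable[OF U(2)], of n r] by simp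
   then show ?thesis
    using order_trans[OF inner_bound[OF U(2) U(2)] mult_mono] M(1) by (meson L2norm_nonneg)
  qed
  then show ?thesis by blast
 qed
 then have "ALL b:Basis. EX k. ALL n r. x <= r --> r <= y --> \<bar>LINT om|sphere0. g n b (r *R om) \<bullet> g n b (r *R om)\<bar> <= k" by blast
 from bchoice[OF this] obtain k where k: "!!b n r. b : Basis ==> x <= r ==> r <= y ==> \<bar>LINT om|sphere0. g n b (r *R om) \<bullet> g n b (r *R om)\<bar> <= k b"
  by blast
 show ?thesis
 proof (rule that[OF C2 u1 u2 l])
  show "(%n. LINT om|sphere0. C1_complex.grad2 (g n) (r *R om)) ----> (SUM b:Basis. ip (Tb r b) (Tb r b))" if "x <= r" "r <= y" for r
   unfolding G ip_def by (intro tendsto_sum utrace_inner_tendsto[OF ub ub that])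
  show "\<bar>LINT om|sphere0. C1_complex.grad2 (g n) (r *R om)\<bar> <= (SUM b:Basis. k b)" if "x <= r" "r <= y" for n r
   unfolding G using k[OF _ that] by (intro order_trans[OF sum_abs] sum_mono) auto
 qed
qed

text \<open>The limit of \<open>flux_phi_grad\<close>; the Laplacian is paired with \<phi> itself,
  so \<kappa> tends to the trace of u.\<close>

lemma i0_evolution:
 assumes x: "R0 < x" "x <= y"
 shows "EX L. ALL s t. x <= s --> s <= t --> t <= y --> \<bar>i0 t - i0 s\<bar> <= L * (t - s)"
  and "AE r in lborel. x < r --> r < y --> ((%s. (i0 (r + s) - i0 r) / s) ---> g0 r + l1 r) (at_right 0)"
proof -
 obtain \<phi> g hh E where C2: "!!n::nat. C2_complex (\<phi> n) (g n) (hh n)"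
  and u1: "utrace x y (%n r om. \<phi> n (r *R om)) Tu" and u2: "utrace x y (%n r om. g n om (r *R om)) Tr"
  and l: "(%n. L2norm (lebesgue_on (annulus x y)) (%x. \<phi> n x - u x)) ----> 0"
   "!!b. b : Basis ==> (%n. L2norm (lebesgue_on (annulus x y)) (%x. hh n b b x - weak_partial \<Omega> b (weak_partial \<Omega> b u) x)) ----> 0"
  and G: "!!r. x <= r ==> r <= y ==> (%n. LINT om|sphere0. C1_complex.grad2 (g n) (r *R om)) ----> (SUM b:Basis. ip (Tb r b) (Tb r b))"
   "!!n r. x <= r ==> r <= y ==> \<bar>LINT om|sphere0. C1_complex.grad2 (g n) (r *R om)\<bar> <= E"
  by (rule scalar_approximation[OF x]) (rule that)
 note C1 = C2_complex_imp_C1[OF C2]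
 note cs = continuous_intros C1_complex.continuous_phi[OF C1] C1_complex.continuous_g[OF C1] C2_complex.continuous_lap[OF C2] C1_complex.continuous_grad2[OF C1]
 have d: "((%r. r ^ (DIM('a) - 1) * (LINT om|sphere0. \<phi> n (r *R om) \<bullet> g n om (r *R om))) has_real_derivative
   r ^ (DIM('a) - 1) * ((LINT om|sphere0. C1_complex.grad2 (g n) (r *R om)) + (LINT om|sphere0. \<phi> n (r *R om) \<bullet> C2_complex.lap (hh n) (r *R om)))) (at r)" if "x <= r" "r <= y" for n r
 proof -
  have "(LINT om|sphere0. \<phi> n (r *R om) \<bullet> C2_complex.lap (hh n) (r *R om) + C1_complex.grad2 (g n) (r *R om))
   = (LINT om|sphere0. \<phi> n (r *R om) \<bullet> C2_complex.lap (hh n) (r *R om)) + (LINT om|sphere0. C1_complex.grad2 (g n) (r *R om))"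
   by (intro Bochner_Integration.integral_add integrable_sphere0_continuous cs)
  then show ?thesis using C2_complex.flux_phi_grad[OF C2 dim, of r n] that x R0 by (simp add: add.commute)
 qed
 have f0: "(%n. r ^ (DIM('a) - 1) * (LINT om|sphere0. \<phi> n (r *R om) \<bullet> g n om (r *R om))) ----> i0 r" if "x <= r" "r <= y" for r
  unfolding i0_def ip_def by (intro tendsto_intros utrace_inner_tendsto[OF u1 u2 that])
 have ec: "continuous_on {x..y} (%r. LINT om|sphere0. C1_complex.grad2 (g n) (r *R om))" for n
  by (rule continuous_sphere_integral) (unfold split_beta, intro cs)
 note L = second_order_limit[OF x C2 u1 l u1 d ec G(2) G(1) f0]
 show "EX L. ALL s t. x <= s --> s <= t --> t <= y --> \<bar>i0 t - i0 s\<bar> <= L * (t - s)" by (rule L(1))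
 show "AE r in lborel. x < r --> r < y --> ((%s. (i0 (r + s) - i0 r) / s) ---> g0 r + l1 r) (at_right 0)"
  using L(2) by (simp add: g0_def l1_def ip_def distrib_left)
qed

text \<open>The limit of \<open>flux_pohozaev\<close>. The combination 2 t0 - g0 is treated as a
  whole: the derivative of either term alone would involve second derivatives other than the
  Laplacian.\<close>

lemma J0_evolution:
 assumes x: "R0 < x" "x <= y"
 defines "J \<equiv> %r. r * (2 * t0 r - g0 r)"
 shows "EX L. ALL s t. x <= s --> s <= t --> t <= y --> \<bar>J t - J s\<bar> <= L * (t - s)"
  and "AE r in lborel. x < r --> r < y --> ((%s. (J (r + s) - J r) / s) ---> (2 - real DIM('a)) * g0 r + 2 * r * l2 r) (at_right 0)"
proof -
 obtain \<phi> g hh E where C2: "!!n::nat. C2_complex (\<phi> n) (g n) (hh n)"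
  and u1: "utrace x y (%n r om. \<phi> n (r *R om)) Tu" and u2: "utrace x y (%n r om. g n om (r *R om)) Tr"
  and l: "(%n. L2norm (lebesgue_on (annulus x y)) (%x. \<phi> n x - u x)) ----> 0"
   "!!b. b : Basis ==> (%n. L2norm (lebesgue_on (annulus x y)) (%x. hh n b b x - weak_partial \<Omega> b (weak_partial \<Omega> b u) x)) ----> 0"
  and G: "!!r. x <= r ==> r <= y ==> (%n. LINT om|sphere0. C1_complex.grad2 (g n) (r *R om)) ----> (SUM b:Basis. ip (Tb r b) (Tb r b))"
   "!!n r. x <= r ==> r <= y ==> \<bar>LINT om|sphere0. C1_complex.grad2 (g n) (r *R om)\<bar> <= E"
  by (rule scalar_approximation[OF x]) (rule that)
 note C1 = C2_complex_imp_C1[OF C2]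
 note cs = continuous_intros C1_complex.continuous_phi[OF C1] C1_complex.continuous_g[OF C1] C2_complex.continuous_lap[OF C2] C1_complex.continuous_grad2[OF C1]
 note U = utraceD[OF u2]
 let ?G = "%n r. LINT om|sphere0. C1_complex.grad2 (g n) (r *R om)"
 define f where "f n r = r ^ (DIM('a) - 1) * (r * (2 * (LINT om|sphere0. g n om (r *R om) \<bullet> g n om (r *R om)) - ?G n r))" for n r
 have u3: "utrace x y (%n r om. (2 * r) *R g n om (r *R om)) (%r om. (2 * r) *R Tr r om)"
  by (rule utrace_scale[OF u2, where k="2 * y"]) (use x R0 in \<open>auto intro!: continuous_intros\<close>)
 have ig: "integrable sphere0 (%om. g n om (r *R om) \<bullet> g n om (r *R om))" "integrable sphere0 (%om. C1_complex.grad2 (g n) (r *R om))"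
  "integrable sphere0 (%om. g n om (r *R om) \<bullet> C2_complex.lap (hh n) (r *R om))" for n r
  by (intro integrable_sphere0_continuous cs)+
 have d: "(f n has_real_derivative
   r ^ (DIM('a) - 1) * ((2 - real DIM('a)) * ?G n r + (LINT om|sphere0. (2 * r) *R g n om (r *R om) \<bullet> C2_complex.lap (hh n) (r *R om)))) (at r)" if r: "x <= r" "r <= y" for n r
 proof -
  have "f n = (%r. r ^ (DIM('a) - 1) * (LINT om|sphere0. r * (2 * (cmod (g n om (r *R om)))^2 - C1_complex.grad2 (g n) (r *R om))))"
   unfolding f_def using ig by (simp add: dot_square_norm)
  moreover have "(LINT om|sphere0. (2 - real DIM('a)) * C1_complex.grad2 (g n) (r *R om) + 2 * r * (g n om (r *R om) \<bullet> C2_complex.lap (hh n) (r *R om)))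
    = (2 - real DIM('a)) * ?G n r + (LINT om|sphere0. (2 * r) *R g n om (r *R om) \<bullet> C2_complex.lap (hh n) (r *R om))"
   using ig by simp
  ultimately show ?thesis using C2_complex.flux_pohozaev[OF C2 dim, of r n] r x R0 by simp
 qed
 have f0: "(%n. f n r) ----> J r" if "x <= r" "r <= y" for r
 proof -
  have "(%n. f n r) ----> r ^ (DIM('a) - 1) * (r * (2 * ip (Tr r) (Tr r) - (SUM b:Basis. ip (Tb r b) (Tb r b))))"
   unfolding f_def ip_def[of "Tr r"] by (intro tendsto_intros utrace_inner_tendsto[OF u2 u2 that] G(1) that)
  also have "r ^ (DIM('a) - 1) * (r * (2 * ip (Tr r) (Tr r) - (SUM b:Basis. ip (Tb r b) (Tb r b)))) = J r"
   by (simp add: J_def t0_def g0_def algebra_simps)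
  finally show ?thesis .
 qed
 have ec: "continuous_on {x..y} (%r. (2 - real DIM('a)) * ?G n r)" for n
  by (intro continuous_on_mult_left continuous_sphere_integral) (unfold split_beta, intro cs)
 have eb: "\<bar>(2 - real DIM('a)) * ?G n r\<bar> <= \<bar>2 - real DIM('a)\<bar> * E" if "x <= r" "r <= y" for n r
  unfolding abs_mult using G(2)[OF that] by (intro mult_left_mono) auto
 note L = second_order_limit[OF x C2 u1 l u3 d ec eb tendsto_mult[OF tendsto_const G(1)] f0]
 show "EX L. ALL s t. x <= s --> s <= t --> t <= y --> \<bar>J t - J s\<bar> <= L * (t - s)" by (rule L(1))
 have e: "r ^ (DIM('a) - 1) * ((2 - real DIM('a)) * (SUM b:Basis. ip (Tb r b) (Tb r b)) + (LINT om|S. (2 * r) *R Tr r om \<bullet> (q (r *R om) * Tu r om)))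
   = (2 - real DIM('a)) * g0 r + 2 * r * l2 r" for r
  by (simp add: g0_def l2_def ip_def algebra_simps)
 show "AE r in lborel. x < r --> r < y --> ((%s. (J (r + s) - J r) / s) ---> (2 - real DIM('a)) * g0 r + 2 * r * l2 r) (at_right 0)"
  using L(2) unfolding e .
qed

text \<open>The exceptional null set depends on the interval, so the half line is exhausted by
  countably many intervals.\<close>

lemma AE_exterior_radius:
 assumes "!!x y. R0 < x ==> x <= y ==> AE r in lborel. x < r --> r < y --> P r"
 shows "AE r in lborel. R0 < r --> P r"
proof -
 define xs ys where "xs n = R0 + 1 / real (Suc n)" and "ys n = R0 + 1 + real n" for n
 have "1 / real (Suc n) <= 1" for n by simp
 then have xy: "R0 < xs n" "xs n <= ys n" for n
  unfolding xs_def ys_def using of_nat_0_le_iff[of n, where 'a=real] by (simp, smt (verit))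
 have "AE r in lborel. ALL n. xs n < r --> r < ys n --> P r"
  using assms[OF xy] by (simp add: AE_all_countable)
 then show ?thesis
 proof eventually_elim
  case (elim r)
  show ?case
  proof
   assume r: "R0 < r"
   obtain n where n: "1 / real (Suc n) < r - R0" using reals_Archimedean[of "r - R0"] r by (auto simp: inverse_eq_divide)
   obtain m where m: "r < R0 + 1 + real m" using reals_Archimedean2[of "r - R0 - 1"] by (auto simp: algebra_simps)
   define k where "k = max n m"
   have "1 / real (Suc k) <= 1 / real (Suc n)" by (rule divide_left_mono) (auto simp: k_def)
   then have "xs k < r" "r < ys k" using n m by (auto simp: xs_def ys_def k_def)
   then show "P r" using elim by blast
  qed
 qed
qed

text \<open>Only first derivatives of u occur here. The functions f n and their derivatives converge
  uniformly in r, and the limit is differentiable at every r.\<close>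

lemma ip_Tu_deriv:
 assumes r: "R0 < r"
 shows "((%r. ip (Tu r) (Tu r)) has_real_derivative 2 * ip (Tu r) (Tr r)) (at r)"
proof -
 define x y where "x = (R0 + r) / 2" and "y = r + 1"
 have x: "R0 < x" "x <= y" "x < r" "r < y" using r by (auto simp: x_def y_def)
 obtain \<phi> g hh E where C2: "!!n::nat. C2_complex (\<phi> n) (g n) (hh n)"
  and u1: "utrace x y (%n r om. \<phi> n (r *R om)) Tu" and u2: "utrace x y (%n r om. g n om (r *R om)) Tr"
  by (rule scalar_approximation[OF x(1,2)]) (rule that)
 note C1 = C2_complex_imp_C1[OF C2]
 define f where "f n r = (LINT om|sphere0. \<phi> n (r *R om) \<bullet> \<phi> n (r *R om))" for n r
 define d where "d n r = (LINT om|sphere0. \<phi> n (r *R om) \<bullet> g n om (r *R om))" for n r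
 have fd: "(f n has_real_derivative 2 * d n r) (at r)" if "r : {x..y}" for n r
  unfolding f_def[abs_def] d_def using C1_complex.sphere_norm_deriv[OF C1, of r n] that x R0
  by (simp add: dot_square_norm)
 have lim: "(%n. f n r) ----> ip (Tu r) (Tu r)" if "r : {x..y}" for r
  unfolding f_def ip_def using utrace_inner_tendsto[OF u1 u1] that by simp
 have "EX h. ALL r:{x..y}. (%n. f n r) ----> h r & (h has_derivative (%t. t * (2 * ip (Tu r) (Tr r)))) (at r within {x..y})"
 proof (rule has_derivative_sequence[where f'="%n r t. t * (2 * d n r)"])
  show "(f n has_derivative (%t. t * (2 * d n r))) (at r within {x..y})" if "r : {x..y}" for n r
   using fd[OF that, of n] by (simp add: has_field_derivative_def mult_commute_abs has_derivative_at_withinI)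
  show "\<forall>\<^sub>F n in sequentially. ALL r:{x..y}. ALL t. norm (t * (2 * d n r) - t * (2 * ip (Tu r) (Tr r))) <= e * norm t" if e: "e > 0" for e :: real
  proof -
   have "e / 2 > 0" using e by simp
   from utrace_inner[OF u1 u2 this] show ?thesis
   proof eventually_elim
    case (elim n)
    show ?case
    proof (intro ballI allI)
     fix r t :: real assume r: "r : {x..y}"
     then have "\<bar>d n r - ip (Tu r) (Tr r)\<bar> < e / 2" using elim by (auto simp: d_def ip_def)
     then have "2 * \<bar>d n r - ip (Tu r) (Tr r)\<bar> * \<bar>t\<bar> <= e * \<bar>t\<bar>" by (intro mult_right_mono) auto
     moreover have "t * (2 * d n r) - t * (2 * ip (Tu r) (Tr r)) = 2 * (d n r - ip (Tu r) (Tr r)) * t" by (simp add: algebra_simps)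
     ultimately show "norm (t * (2 * d n r) - t * (2 * ip (Tu r) (Tr r))) <= e * norm t" by (simp only: real_norm_def abs_mult)
    qed
   qed
  qed
  show "r : {x..y}" "(%n. f n r) ----> ip (Tu r) (Tu r)" using lim[of r] x by auto
 qed simp
 then obtain h where hh: "ALL r:{x..y}. (%n. f n r) ----> h r & (h has_derivative (%t. t * (2 * ip (Tu r) (Tr r)))) (at r within {x..y})"
  by (rule exE)
 have h: "(%n. f n r) ----> h r" "(h has_derivative (%t. t * (2 * ip (Tu r) (Tr r)))) (at r within {x..y})" if "r : {x..y}" for r
  using bspec[OF hh that] by auto
 have he: "h r = ip (Tu r) (Tu r)" if "r : {x..y}" for r using LIMSEQ_unique[OF h(1)[OF that] lim[OF that]] .
 have "(h has_real_derivative 2 * ip (Tu r) (Tr r)) (at r)"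
  using h(2)[of r] x by (simp add: at_within_Icc_at has_field_derivative_def mult_commute_abs)
 then show ?thesis
  by (rule has_field_derivative_transform_within_open[where S="{x<..<y}"]) (use he x in auto)
qed

lemma a0_deriv:
 assumes r: "R0 < r"
 shows "(a0 has_real_derivative (real DIM('a) - 1) / r * a0 r + 2 * i0 r) (at r)"
proof -
 have r0: "r > 0" using r R0 by simp
 have d: "((%r. r ^ (DIM('a) - 1) * ip (Tu r) (Tu r)) has_real_derivative
   (real (DIM('a) - 1) * r ^ (DIM('a) - 1 - Suc 0)) * ip (Tu r) (Tu r) + (2 * ip (Tu r) (Tr r)) * r ^ (DIM('a) - 1)) (at r)"
  by (rule DERIV_mult[OF DERIV_pow ip_Tu_deriv[OF r]])
 have e: "real (DIM('a) - 1) * r ^ (DIM('a) - 1 - Suc 0) = (real DIM('a) - 1) / r * r ^ (DIM('a) - 1)"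
 proof -
  have "r ^ (DIM('a) - 1) = r * r ^ (DIM('a) - 1 - Suc 0)"
   using dim by (metis One_nat_def Suc_1 Suc_diff_le diff_Suc_Suc power_Suc diff_Suc_1 Suc_le_D)
  then show ?thesis using r0 dim by (simp add: of_nat_diff)
 qed
 have eq: "(real (DIM('a) - 1) * r ^ (DIM('a) - 1 - Suc 0)) * ip (Tu r) (Tu r) + (2 * ip (Tu r) (Tr r)) * r ^ (DIM('a) - 1)
   = (real DIM('a) - 1) / r * a0 r + 2 * i0 r" unfolding e a0_def i0_def by (simp add: mult_ac)
 have "a0 = (%r. r ^ (DIM('a) - 1) * ip (Tu r) (Tu r))" by (simp add: a0_def[abs_def])
 then show ?thesis using d unfolding eq by simp
qed

text \<open>Cauchy-Schwarz with the unit normal; it makes the tangential part g0 - t0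
  nonnegative.\<close>

lemma t0_le_g0:
 assumes r: "R0 < r" shows "t0 r <= g0 r"
proof -
 have "ip (Tr r) (Tr r) <= (LINT om|S. (SUM b:Basis. (cmod (Tb r b om))^2))"
  unfolding ip_def
 proof (rule Bochner_Integration.integral_mono)
  show "integrable S (%om. Tr r om \<bullet> Tr r om)" by (rule integrable_inner[OF sqi_Tr[OF r] sqi_Tr[OF r]])
  show "integrable S (%om. SUM b:Basis. (cmod (Tb r b om))^2)"
   using sqi_Tb[OF r] by (intro Bochner_Integration.integrable_sum) (auto simp: L2fun_def)
  fix om :: 'a assume "om : space S"
  then have w: "(SUM b:Basis. (om \<bullet> b)^2) = 1"
   by (simp add: sphere_measure_eq power2_eq_square euclidean_inner[symmetric] dot_square_norm)
  have "cmod (Tr r om) <= (SUM b:Basis. \<bar>om \<bullet> b\<bar> * cmod (Tb r b om))"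
   unfolding radial_deriv_trace_def by (rule order_trans[OF norm_sum]) simp
  then have "(cmod (Tr r om))\<^sup>2 <= (SUM b:Basis. \<bar>om \<bullet> b\<bar> * cmod (Tb r b om))\<^sup>2" by (rule power_mono) simp
  also have "... <= (SUM b:Basis. \<bar>om \<bullet> b\<bar>\<^sup>2) * (SUM b:Basis. (cmod (Tb r b om))^2)" by (rule Cauchy_Schwarz_ineq_sum)
  finally show "Tr r om \<bullet> Tr r om <= (SUM b:Basis. (cmod (Tb r b om))^2)" using w by (simp add: dot_square_norm)
 qed
 also have "... = (SUM b:Basis. ip (Tb r b) (Tb r b))"
  unfolding ip_def dot_square_norm using sqi_Tb[OF r] by (intro Bochner_Integration.integral_sum) (auto simp: L2fun_def)
 finally show ?thesis using r R0 unfolding t0_def g0_def by (intro mult_left_mono) auto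
qed

end

subsection \<open>The quadratic form of the potential\<close>

lemma mult_form_eq: "mult_form V \<phi> = (LINT om|sphere_measure. V om * (\<phi> om \<bullet> \<phi> om))"
proof -
 have e: "of_real (V om) * \<phi> om * cnj (\<phi> om) = of_real (V om * (\<phi> om \<bullet> \<phi> om))" for om
  by (simp only: mult.assoc complex_norm_square[symmetric] dot_square_norm of_real_mult of_real_power)
 show ?thesis by (simp only: mult_form_def X_inner_def e integral_complex_of_real Re_complex_of_real)
qed

lemma mult_form_difference:
 assumes a: "L2fun sphere_measure \<phi>" and b: "L2fun sphere_measure \<psi>"
  and V: "V : borel_measurable sphere_measure" "!!om. om : space sphere_measure ==> \<bar>V om\<bar> <= k"
 shows "mult_form V \<phi> - mult_form V \<psi> = (LINT om|sphere_measure. V om * ((\<phi> om - \<psi> om) \<bullet> (\<phi> om + \<psi> om)))"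
proof -
 have "V om * ((\<phi> om - \<psi> om) \<bullet> (\<phi> om + \<psi> om)) = V om * (\<phi> om \<bullet> \<phi> om) - V om * (\<psi> om \<bullet> \<psi> om)" for om
  by (simp add: inner_diff_left inner_add_right inner_commute algebra_simps)
 then show ?thesis
  unfolding mult_form_eq using integrable_weighted_inner[OF a a V] integrable_weighted_inner[OF b b V] by simp
qed

lemma mult_form_difference_bound:
 assumes a: "L2fun sphere_measure \<phi>" and b: "L2fun sphere_measure \<psi>"
  and V: "V : borel_measurable sphere_measure" "!!om. om : space sphere_measure ==> \<bar>V om\<bar> <= k" and k: "k >= 0"
 shows "\<bar>mult_form V \<phi> - mult_form V \<psi>\<bar> <= k * (L2norm sphere_measure (%om. \<phi> om - \<psi> om) * (L2norm sphere_measure \<phi> + L2norm sphere_measure \<psi>))"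
proof -
 have d: "mult_form V \<phi> - mult_form V \<psi> = (LINT om|sphere_measure. V om * ((\<phi> om - \<psi> om) \<bullet> (\<phi> om + \<psi> om)))"
  by (rule mult_form_difference[OF a b V])
 have "\<bar>mult_form V \<phi> - mult_form V \<psi>\<bar> <= k * (L2norm sphere_measure (%om. \<phi> om - \<psi> om) * L2norm sphere_measure (%om. \<phi> om + \<psi> om))"
  by (subst d) (rule weighted_inner_bound[OF L2fun_diff[OF a b] L2fun_add[OF a b] V])
 also have "... <= k * (L2norm sphere_measure (%om. \<phi> om - \<psi> om) * (L2norm sphere_measure \<phi> + L2norm sphere_measure \<psi>))"
  by (intro mult_left_mono L2norm_triangle[OF a b] k) auto
 finally show ?thesis .
qed

text \<open>Hypothesis (c) separated from the equation. The form is studied along an arbitrary path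
  in L2 of the sphere, because it is wanted along the solution and also along constant paths, where
  it leads to coercivity.\<close>

locale one_sided_potential =
 fixes R0 s0 :: real and Q0 Q0r :: "'a::euclidean_space => real" and Q0rs :: "'a => real => real"
 assumes R0: "R0 > 0"
  and Q0_meas: "measurable_coeff R0 Q0" and Q0_bdd: "locally_bounded_on (exterior R0) Q0"
  and s0: "s0 > 0"
  and Q0rs_meas: "!!s. 0 < s ==> s < s0 ==> measurable_coeff R0 (%x. Q0rs x s)"
  and Q0rs_bdd: "!!G. compact G ==> G \<subseteq> exterior R0 ==>
     bdd_above {\<bar>Q0rs x s\<bar> | x s. x : G & 0 < s & s < s0}"
  and Q0rs_ineq: "!!\<phi> r s. L2_sphere \<phi> ==> r > R0 ==> 0 < s ==> s < s0 ==>
     (1 / s) * mult_form (%om. Q0 ((r + s) *R om) - Q0 (r *R om)) \<phi>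
      <= mult_form (%om. Q0rs (r *R om) s) \<phi>"
  and Q0rs_lim: "!!\<phi> r. L2_sphere \<phi> ==> r > R0 ==>
     ((%s. mult_form (%om. Q0rs (r *R om) s) \<phi>)
       ---> mult_form (%om. Q0r (r *R om)) \<phi>) (at_right 0)"
begin

abbreviation "S \<equiv> sphere_measure :: 'a measure"
abbreviation "qf t \<phi> \<equiv> mult_form (%om. Q0 (t *R om)) \<phi>"

lemma sphere_in_annulus: "R0 < x ==> x <= r ==> r <= y ==> om : space S ==> r *R om : annulus x y"
 using R0 by (auto simp: annulus_def sphere_measure_eq)

lemma annulus_exterior: "R0 < x ==> (annulus x y :: 'a set) \<subseteq> exterior R0"
 by (auto simp: annulus_def exterior_def)

lemma Q0_bound:
 assumes x: "R0 < x"
 obtains k where "k >= 0" "!!r om. x <= r ==> r <= y ==> om : space S ==> \<bar>Q0 (r *R om)\<bar> <= k"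
proof -
 have "bounded (Q0 ` annulus x y)" using Q0_bdd[unfolded locally_bounded_on_def, rule_format, of "annulus x y"] annulus_exterior[OF x] by simp
 then obtain k where "ALL v:Q0 ` annulus x y. norm v <= k" unfolding bounded_iff by (rule exE)
 then have "\<bar>Q0 (r *R om)\<bar> <= \<bar>k\<bar>" if "x <= r" "r <= y" "om : space S" for r om
  using sphere_in_annulus[OF x that] by force
 then show ?thesis by (intro that[of "\<bar>k\<bar>"]) auto
qed

lemma Q0rs_bound:
 assumes x: "R0 < x"
 obtains k where "k >= 0" "!!r om s. x <= r ==> r <= y ==> om : space S ==> 0 < s ==> s < s0 ==> \<bar>Q0rs (r *R om) s\<bar> <= k"
proof -
 obtain k where k: "ALL v:{\<bar>Q0rs z s\<bar> | z s. z : annulus x y & 0 < s & s < s0}. v <= k"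
  using Q0rs_bdd[OF compact_annulus annulus_exterior[OF x, of y]] unfolding bdd_above_def by (rule exE)
 have "\<bar>Q0rs (r *R om) s\<bar> <= \<bar>k\<bar>" if "x <= r" "r <= y" "om : space S" "0 < s" "s < s0" for r om s
 proof -
  have "\<bar>Q0rs (r *R om) s\<bar> : {\<bar>Q0rs z s\<bar> | z s. z : annulus x y & 0 < s & s < s0}"
   using sphere_in_annulus[OF x that(1-3)] that(4,5) by blast
  then show ?thesis using k abs_ge_self[of k] by (meson order_trans)
 qed
 then show ?thesis by (intro that[of "\<bar>k\<bar>"]) auto
qed

lemma Q0_measurable: "R0 < r ==> (%om. Q0 (r *R om)) : borel_measurable S"
 and Q0rs_measurable: "R0 < r ==> 0 < s ==> s < s0 ==> (%om. Q0rs (r *R om) s) : borel_measurable S"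
 using Q0_meas Q0rs_meas by (auto simp: measurable_coeff_def)

text \<open>The increment is split at \<open>qf r \<phi>\<close>: (c) bounds the change of radius at
  the fixed element \<phi>, and the change from \<phi> to \<psi> takes place at a fixed
  radius.\<close>

lemma qf_increment:
 assumes r: "R0 < r" and s: "0 < s" "s < s0" and p: "L2fun S \<phi>" and p': "L2fun S \<psi>"
 shows "- qf (r + s) \<phi> - - qf r \<psi> >= - s * mult_form (%om. Q0rs (r *R om) s) \<phi> - (qf r \<phi> - qf r \<psi>)"
proof -
 obtain k where k: "!!t om. r <= t ==> t <= r + s ==> om : space S ==> \<bar>Q0 (t *R om)\<bar> <= k"
  by (rule Q0_bound[OF r]) (rule that)
 have i: "integrable S (%om. Q0 ((r + s) *R om) * (\<phi> om \<bullet> \<phi> om))" "integrable S (%om. Q0 (r *R om) * (\<phi> om \<bullet> \<phi> om))"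
  using r s by (auto intro!: integrable_weighted_inner[OF p p Q0_measurable, of _ k] k)
 have "mult_form (%om. Q0 ((r + s) *R om) - Q0 (r *R om)) \<phi> = qf (r + s) \<phi> - qf r \<phi>"
  unfolding mult_form_eq left_diff_distrib using i by simp
 moreover have "L2_sphere \<phi>" using p by (simp add: L2_sphere_L2fun)
 ultimately have "(1 / s) * (qf (r + s) \<phi> - qf r \<phi>) <= mult_form (%om. Q0rs (r *R om) s) \<phi>"
  using Q0rs_ineq[of \<phi> r s] r s by simp
 then have "qf (r + s) \<phi> - qf r \<phi> <= s * mult_form (%om. Q0rs (r *R om) s) \<phi>" using s by (simp add: field_simps)
 then show ?thesis by simp
qed

text \<open>After division of \<open>qf_increment\<close> by s, the first part converges:
  \<open>Q0rs\<close> is bounded uniformly in s and P(r+s) tends to P(r), so the limit in (c) at the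
  single element P(r) suffices. The second part is the form at fixed radius, bilinear in the
  difference quotient of P and in P(r+s) + P(r), and converges as well.\<close>

lemma form_rd_ge:
 assumes r: "R0 < r" and P: "!!t. R0 < t ==> L2fun S (P t)" and Pd: "L2fun S Pd"
  and lim: "((%s. L2norm S (%om. (1 / s) *R (P (r + s) om - P r om) - Pd om)) ---> 0) (at_right 0)"
 shows "rd_ge (%t. - qf t (P t)) r (- mult_form (%om. Q0r (r *R om)) (P r) - 2 * (LINT om|S. Q0 (r *R om) * (P r om \<bullet> Pd om)))"
proof -
 \<comment> \<open>The modulus keeps the argument above R0, so Ps is square integrable for every s
   and the limit lemmas apply without restricting s.\<close>
 define Ps where "Ps s = P (r + \<bar>s\<bar>)" for s
 define D where "D s om = (1 / s) *R (Ps s om - P r om)" for s om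
 have sP: "L2fun S (Ps s)" for s unfolding Ps_def using r by (intro P) simp
 have sD: "L2fun S (D s)" for s
  unfolding D_def[abs_def] by (rule L2fun_scaleR[OF L2fun_diff[OF sP P[OF r]]])
 have pos: "\<forall>\<^sub>F s in at_right 0. (s::real) > 0" by (simp add: eventually_at_right_less)
 have small: "\<forall>\<^sub>F s in at_right 0. 0 < s & s < s0" using eventually_at_right_real[OF s0] by eventually_elim simp
 have D0: "((%s. L2norm S (%om. D s om - Pd om)) ---> 0) (at_right 0)"
 proof (rule Lim_transform_eventually[OF lim])
  show "\<forall>\<^sub>F s in at_right 0. L2norm S (%om. (1 / s) *R (P (r + s) om - P r om) - Pd om) = L2norm S (%om. D s om - Pd om)"
   using pos by eventually_elim (simp add: D_def Ps_def)
 qed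
 have P0: "((%s. L2norm S (%om. Ps s om - P r om)) ---> 0) (at_right 0)"
 proof (rule Lim_null_comparison)
  have "((%s. s) ---> 0) (at_right (0::real))" by (rule tendsto_ident_at)
  from tendsto_mult[OF this tendsto_add[OF D0 tendsto_const[of "L2norm S Pd"]]]
  show "((%s. s * (L2norm S (%om. D s om - Pd om) + L2norm S Pd)) ---> 0) (at_right 0)" by simp
  show "\<forall>\<^sub>F s in at_right 0. norm (L2norm S (%om. Ps s om - P r om)) <= s * (L2norm S (%om. D s om - Pd om) + L2norm S Pd)"
   using pos
  proof eventually_elim
   case (elim s)
   have "(%om. Ps s om - P r om) = (%om. s *R D s om)" using elim by (simp add: D_def)
   then have "L2norm S (%om. Ps s om - P r om) = s * L2norm S (D s)" using elim by (simp add: L2norm_scaleR)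
   also have "L2norm S (D s) <= L2norm S (%om. D s om - Pd om) + L2norm S Pd"
    using L2norm_triangle_diff[OF sD[of s] Pd L2fun_zero] by simp
   finally show ?case using elim by (simp add: mult_left_mono)
  qed
 qed
 obtain k where k: "k >= 0" "!!om. om : space S ==> \<bar>Q0 (r *R om)\<bar> <= k"
  using Q0_bound[OF r, of r] by (metis order_refl)
 obtain k' where k': "k' >= 0" "!!om s. om : space S ==> 0 < s ==> s < s0 ==> \<bar>Q0rs (r *R om) s\<bar> <= k'"
  using Q0rs_bound[OF r, of r] by (metis order_refl)
 have second: "((%s. LINT om|S. Q0 (r *R om) * (D s om \<bullet> (Ps s om + P r om))) ---> (LINT om|S. Q0 (r *R om) * (Pd om \<bullet> (P r om + P r om)))) (at_right 0)"
  by (rule weighted_inner_tendsto[OF sD Pd D0 L2fun_add[OF sP P[OF r]] L2fun_add[OF P[OF r] P[OF r]] _ Q0_measurable[OF r] k(2)])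
   (use P0 in simp)
 have second': "(LINT om|S. Q0 (r *R om) * (Pd om \<bullet> (P r om + P r om))) = 2 * (LINT om|S. Q0 (r *R om) * (P r om \<bullet> Pd om))"
 proof -
  have "Q0 (r *R om) * (Pd om \<bullet> (P r om + P r om)) = 2 * (Q0 (r *R om) * (P r om \<bullet> Pd om))" for om
   by (simp only: inner_add_right inner_commute) simp
  then show ?thesis by (simp only: Bochner_Integration.integral_mult_right_zero)
 qed
 define V where "V s = mult_form (%om. Q0rs (r *R om) s)" for s
 have "((%s. V s (Ps s) - V s (P r)) ---> 0) (at_right 0)"
 proof (rule Lim_null_comparison)
  show "((%s. k' * (L2norm S (%om. Ps s om - P r om) * (L2norm S (%om. Ps s om - P r om) + 2 * L2norm S (P r)))) ---> 0) (at_right 0)"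
   using tendsto_mult[OF tendsto_const[of k'] tendsto_mult[OF P0 tendsto_add[OF P0 tendsto_const[of "2 * L2norm S (P r)"]]]] by simp
  show "\<forall>\<^sub>F s in at_right 0. norm (V s (Ps s) - V s (P r)) <= k' * (L2norm S (%om. Ps s om - P r om) * (L2norm S (%om. Ps s om - P r om) + 2 * L2norm S (P r)))"
   using small
  proof eventually_elim
   case (elim s)
   have "\<bar>V s (Ps s) - V s (P r)\<bar> <= k' * (L2norm S (%om. Ps s om - P r om) * (L2norm S (Ps s) + L2norm S (P r)))"
    unfolding V_def by (rule mult_form_difference_bound[OF sP P[OF r] Q0rs_measurable[OF r]]) (use elim k' in auto)
   also have "... <= k' * (L2norm S (%om. Ps s om - P r om) * (L2norm S (%om. Ps s om - P r om) + 2 * L2norm S (P r)))"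
    using L2norm_triangle_diff[OF sP[of s] P[OF r] L2fun_zero] k' by (intro mult_left_mono) auto
   finally show ?case by simp
  qed
 qed
 moreover have "((%s. V s (P r)) ---> mult_form (%om. Q0r (r *R om)) (P r)) (at_right 0)"
  unfolding V_def using Q0rs_lim[OF _ r, of "P r"] P[OF r] by (simp add: L2_sphere_L2fun)
 ultimately have "((%s. (V s (Ps s) - V s (P r)) + V s (P r)) ---> 0 + mult_form (%om. Q0r (r *R om)) (P r)) (at_right 0)"
  by (rule tendsto_add)
 then have first: "((%s. V s (Ps s)) ---> mult_form (%om. Q0r (r *R om)) (P r)) (at_right 0)" by simp
 have tot: "((%s. - V s (Ps s) - (LINT om|S. Q0 (r *R om) * (D s om \<bullet> (Ps s om + P r om))))
   ---> - mult_form (%om. Q0r (r *R om)) (P r) - 2 * (LINT om|S. Q0 (r *R om) * (P r om \<bullet> Pd om))) (at_right 0)" (is "(?f ---> ?L) _")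
  unfolding second'[symmetric] by (intro tendsto_intros first second)
 show ?thesis unfolding rd_ge_def
 proof (intro allI impI)
  fix e :: real assume "e > 0"
  then have "\<forall>\<^sub>F s in at_right 0. ?L - e < ?f s" by (intro order_tendstoD(1)[OF tot]) simp
  then show "\<forall>\<^sub>F s in at_right 0. (?L - e) * s <= - qf (r + s) (P (r + s)) - - qf r (P r)"
   using small
  proof eventually_elim
   case (elim s)
   have Pe: "P (r + s) = Ps s" using elim by (simp add: Ps_def)
   have "qf r (Ps s) - qf r (P r) = (LINT om|S. Q0 (r *R om) * ((Ps s om - P r om) \<bullet> (Ps s om + P r om)))"
    by (rule mult_form_difference[OF sP P[OF r] Q0_measurable[OF r] k(2)])
   also have "... = (LINT om|S. s * (Q0 (r *R om) * (D s om \<bullet> (Ps s om + P r om))))"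
    using elim by (intro Bochner_Integration.integral_cong refl) (simp add: D_def)
   finally have "qf r (Ps s) - qf r (P r) = s * (LINT om|S. Q0 (r *R om) * (D s om \<bullet> (Ps s om + P r om)))" by simp
   moreover have "- s * V s (Ps s) - (qf r (Ps s) - qf r (P r)) <= - qf (r + s) (P (r + s)) - - qf r (P r)"
    unfolding Pe V_def using elim by (intro qf_increment r sP P) auto
   moreover have "(?L - e) * s <= ?f s * s" using elim by (intro mult_right_mono) auto
   ultimately show ?case by (simp add: algebra_simps)
  qed
 qed
qed

lemma form_lower_lip:
 assumes x: "R0 < x" and P: "!!t. R0 < t ==> L2fun S (P t)"
  and L: "!!s t. x <= s ==> s <= t ==> t <= y ==> L2norm S (%om. P t om - P s om) <= L * (t - s)"
  and M: "!!t. x <= t ==> t <= y ==> L2norm S (P t) <= M"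
 shows "lower_lip x y (%t. - qf t (P t))"
proof (cases "x <= y")
 case True
 have M0: "M >= 0" using M[of x] True order_trans[OF L2norm_nonneg] by blast
 obtain k where k: "k >= 0" "!!r om. x <= r ==> r <= y ==> om : space S ==> \<bar>Q0 (r *R om)\<bar> <= k"
  by (rule Q0_bound[OF x]) (rule that)
 obtain k' where k': "k' >= 0" "!!r om s. x <= r ==> r <= y ==> om : space S ==> 0 < s ==> s < s0 ==> \<bar>Q0rs (r *R om) s\<bar> <= k'"
  by (rule Q0rs_bound[OF x]) (rule that)
 have fb: "\<bar>mult_form V (P t)\<bar> <= c * M^2" if t: "x <= t" "t <= y" and V: "V : borel_measurable S" "!!om. om : space S ==> \<bar>V om\<bar> <= c" and c: "c >= 0" for V t c
 proof -
  have "\<bar>mult_form V (P t)\<bar> <= c * (L2norm S (P t) * L2norm S (P t))"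
   unfolding mult_form_eq using t x by (intro weighted_inner_bound P V) auto
  also have "... <= c * M^2" unfolding power2_eq_square using M[OF t] M0 c by (intro mult_left_mono mult_mono) auto
  finally show ?thesis .
 qed
 \<comment> \<open>The first entry covers steps shorter than s0, where (c) applies. For longer steps
   the form is bounded by k M^2, and its change, at most 2 k M^2, is at most 2 k M^2/s0 times the
   step.\<close>
 define C where "C = max (k' * M^2 + k * (\<bar>L\<bar> * (2 * M))) (2 * (k * M^2) / s0)"
 show ?thesis unfolding lower_lip_def
 proof (intro exI[of _ C] allI impI)
  fix s t assume st: "x <= s" "s <= t" "t <= y"
  have Rs: "R0 < s" "R0 < t" using st x by auto
  show "- qf t (P t) - - qf s (P s) >= - C * (t - s)"
  proof (cases "t - s < s0")
   case False
   have "2 * (k * M^2) = 2 * (k * M^2) / s0 * s0" using s0 by simp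
   also have "... <= C * (t - s)" using False s0 k by (intro mult_mono) (auto simp: C_def le_max_iff_disj)
   finally show ?thesis
    using fb[OF _ st(3) Q0_measurable[OF Rs(2)] k(2) k(1)] fb[OF st(1) _ Q0_measurable[OF Rs(1)] k(2) k(1)] st by auto
  next
   case True
   show ?thesis
   proof (cases "t = s")
    case False
    then have \<sigma>: "0 < t - s" "t - s < s0" using st True by auto
    have "- (t - s) * mult_form (%om. Q0rs (s *R om) (t - s)) (P t) - (qf s (P t) - qf s (P s)) <= - qf (s + (t - s)) (P t) - - qf s (P s)"
     by (rule qf_increment[OF Rs(1) \<sigma> P[OF Rs(2)] P[OF Rs(1)]])
    moreover have "(t - s) * mult_form (%om. Q0rs (s *R om) (t - s)) (P t) <= (t - s) * (k' * M^2)"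
     using fb[of t "%om. Q0rs (s *R om) (t - s)" k', OF _ st(3) Q0rs_measurable[OF Rs(1) \<sigma>]] k' st \<sigma> by (intro mult_left_mono) (auto simp: abs_le_iff)
    moreover have "qf s (P t) - qf s (P s) <= (t - s) * (k * (\<bar>L\<bar> * (2 * M)))"
    proof -
     have "\<bar>qf s (P t) - qf s (P s)\<bar> <= k * (L2norm S (%om. P t om - P s om) * (L2norm S (P t) + L2norm S (P s)))"
      using st by (intro mult_form_difference_bound P Rs Q0_measurable k) auto
     also have "... <= k * ((\<bar>L\<bar> * (t - s)) * (2 * M))"
     proof (intro mult_left_mono[OF mult_mono] k)
      have "L * (t - s) <= \<bar>L\<bar> * (t - s)" using st by (intro mult_right_mono) auto
      then show "L2norm S (%om. P t om - P s om) <= \<bar>L\<bar> * (t - s)" using L[OF st] by linarith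
      show "L2norm S (P t) + L2norm S (P s) <= 2 * M" using M[of t] M[of s] st by simp
     qed (use st in auto)
     finally show ?thesis by (simp add: mult_ac)
    qed
    ultimately have "- qf t (P t) - - qf s (P s) >= - ((k' * M^2 + k * (\<bar>L\<bar> * (2 * M))) * (t - s))" by (simp add: algebra_simps)
    moreover have "(k' * M^2 + k * (\<bar>L\<bar> * (2 * M))) * (t - s) <= C * (t - s)" using st by (intro mult_right_mono) (auto simp: C_def)
    ultimately show ?thesis by linarith
   qed simp
  qed
 qed
qed (auto simp: lower_lip_def)

end

section \<open>Regularity in r of the traces, and solutions with vanishing traces\<close>

lemma lower_lip_imp_lipschitz:
 assumes "lower_lip x y f" "lower_lip x y (%t. - f t)"
 shows "EX L. ALL s t. x <= s --> s <= t --> t <= y --> \<bar>f t - f s\<bar> <= L * (t - s)"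
proof -
 obtain L where L: "!!s t. x <= s ==> s <= t ==> t <= y ==> f t - f s >= - L * (t - s)"
  using assms(1) unfolding lower_lip_def by blast
 obtain M where M: "!!s t. x <= s ==> s <= t ==> t <= y ==> - f t - - f s >= - M * (t - s)"
  using assms(2) unfolding lower_lip_def by blast
 show ?thesis
 proof (intro exI[of _ "max L M"] allI impI)
  fix s t assume st: "x <= s" "s <= t" "t <= y"
  have "L * (t - s) <= max L M * (t - s)" "M * (t - s) <= max L M * (t - s)" using st by (auto intro: mult_right_mono)
  then show "\<bar>f t - f s\<bar> <= max L M * (t - s)" using L[OF st] M[OF st] by auto
 qed
qed

lemma lower_lip_lipschitz_both:
 assumes "EX L. ALL s t. x <= s --> s <= t --> t <= y --> \<bar>f t - f s\<bar> <= L * (t - s)"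
 shows "lower_lip x y f" "lower_lip x y (%t. - f t)"
proof -
 obtain L where L: "!!s t. x <= s ==> s <= t ==> t <= y ==> \<bar>f t - f s\<bar> <= L * (t - s)" using assms by blast
 show "lower_lip x y f" by (rule lower_lip_lipschitz[OF L])
 show "lower_lip x y (%t. - f t)" by (rule lower_lip_lipschitz[where L=L]) (use L in \<open>auto simp: abs_minus_commute\<close>)
qed

lemma lower_lip_C1_mult:
 assumes f: "lower_lip x y f" and W: "!!t. x <= t ==> t <= y ==> (W has_real_derivative W' t) (at t)" "continuous_on {x..y} W'"
  and pos: "!!t. x <= t ==> t <= y ==> W t >= 0"
 shows "lower_lip x y (%t. W t * f t)"
proof -
 obtain N where "!!s t. x <= s ==> s <= t ==> t <= y ==> \<bar>W t - W s\<bar> <= N * (t - s)"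
  by (rule C1_lipschitz[OF W]; (assumption | rule that))
 then show ?thesis by (rule lower_lip_mult[OF f _ pos])
qed

lemma lower_lip_divide:
 assumes f: "lower_lip x y f" and x: "0 < x" and c: "c >= 0"
 shows "lower_lip x y (%t. c / t ^ n * f t)"
proof (rule lower_lip_C1_mult[OF f])
 show "((%t. c / t ^ n) has_real_derivative (- (c * (real n * t ^ (n - Suc 0)))) / (t ^ n * t ^ n)) (at t)" if "x <= t" for t
  using x that by (auto intro!: derivative_eq_intros)
 show "continuous_on {x..y} (%t. (- (c * (real n * t ^ (n - Suc 0)))) / (t ^ n * t ^ n))"
  using x by (intro continuous_intros) auto
 show "c / t ^ n >= 0" if "x <= t" for t using x that c by simp
qed

context H2_exterior
begin

lemma path_lipschitz:
 assumes x: "R0 < x" "x <= y"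
 obtains L M where "!!s t. x <= s ==> s <= t ==> t <= y ==> L2norm S (%om. Tu t om - Tu s om) <= L * (t - s)"
  "!!t. x <= t ==> t <= y ==> L2norm S (Tu t) <= M"
proof -
 obtain \<phi> g hh where u1: "utrace x y (%n r om. (\<phi> n :: 'a => complex) (r *R om)) Tu"
  and u2: "utrace x y (%n r om. (g n :: 'a => 'a => complex) om (r *R om)) Tr"
  by (rule path_approximation[OF x]) (rule that)
 obtain M where M: "!!t. x <= t ==> t <= y ==> L2norm S (Tu t) <= M" by (rule utrace_bounded[OF u1]) (rule that)
 obtain K where K: "K >= 0" "!!t. x <= t ==> t <= y ==> L2norm S (Tr t) <= K" by (rule utrace_bounded[OF u2]) (rule that)
 \<comment> \<open>2 K bounds the oscillation of the radial derivative on [s, t] and a further K its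
   value at s.\<close>
 have "L2norm S (%om. Tu t om - Tu s om) <= (3 * K) * (t - s)" if st: "x <= s" "s <= t" "t <= y" for s t
 proof (cases "s = t")
  case False
  have R: "R0 < s" "R0 < t" "s < t" using st x False by auto
  have "L2norm S (%om. Tr \<tau> om - Tr s om) <= 2 * K" if \<tau>: "s <= \<tau>" "\<tau> <= t" for \<tau>
   using L2norm_triangle_diff[OF sqi_Tr[of \<tau>] L2fun_zero sqi_Tr[OF R(1)]] R \<tau> st K(2)[of \<tau>] K(2)[of s]
    L2norm_minus_commute[of S "%_. 0" "Tr s"] by simp
  from path_estimate[OF R(1,3) this]
  have "L2norm S (%om. Tu t om - Tu s om - (t - s) *R Tr s om) <= (t - s) * (2 * K)" .
  moreover have "L2norm S (%om. (Tu t om - Tu s om - (t - s) *R Tr s om) + (t - s) *R Tr s om)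
    <= L2norm S (%om. Tu t om - Tu s om - (t - s) *R Tr s om) + L2norm S (%om. (t - s) *R Tr s om)"
   by (intro L2norm_triangle L2fun_diff L2fun_scaleR sqi_Tu sqi_Tr R)
  moreover have "L2norm S (%om. (t - s) *R Tr s om) <= (t - s) * K"
   unfolding L2norm_scaleR using K(2)[of s] st by (simp add: mult_left_mono)
  ultimately show ?thesis by (simp add: algebra_simps)
 qed (simp add: L2norm_def)
 then show ?thesis using M by (rule that)
qed

text \<open>\<open>path_estimate\<close> with M = e/2: the radial trace is continuous in r, so its
  oscillation on [r, r+s] is small.\<close>

lemma path_derivative:
 assumes r: "R0 < r"
 shows "((%s. L2norm S (%om. (1 / s) *R (Tu (r + s) om - Tu r om) - Tr r om)) ---> 0) (at_right 0)"
 unfolding tendsto_iff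
proof (intro allI impI)
 fix e :: real assume e: "e > 0"
 obtain \<phi> g hh where u2: "utrace r (r + 1) (%n r om. (g n :: 'a => 'a => complex) om (r *R om)) Tr"
  by (rule path_approximation[OF r, of "r + 1"]) (simp, rule that)
 obtain d where d: "d > 0" "!!t. r <= t ==> t <= r + 1 ==> \<bar>t - r\<bar> < d ==> L2norm S (%om. Tr t om - Tr r om) < e / 2"
  using utrace_continuous[OF u2, of r "e / 2"] e by auto
 have "\<forall>\<^sub>F s in at_right 0. s : {0<..<min d 1}" using d(1) by (intro eventually_at_right_real) simp
 then show "\<forall>\<^sub>F s in at_right 0. dist (L2norm S (%om. (1 / s) *R (Tu (r + s) om - Tu r om) - Tr r om)) 0 < e"
 proof eventually_elim
  case (elim s)
  then have s: "0 < s" "s < d" "s < 1" by auto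
  have "L2norm S (%om. Tu (r + s) om - Tu r om - (r + s - r) *R Tr r om) <= (r + s - r) * (e / 2)"
  proof (rule path_estimate[OF r])
   show "L2norm S (%om. Tr \<tau> om - Tr r om) <= e / 2" if "r <= \<tau>" "\<tau> <= r + s" for \<tau>
    using d(2)[of \<tau>] that s by (intro less_imp_le) auto
  qed (use s in simp)
  then have "L2norm S (%om. Tu (r + s) om - Tu r om - s *R Tr r om) <= s * (e / 2)" by simp
  moreover have "(%om. (1 / s) *R (Tu (r + s) om - Tu r om) - Tr r om) = (%om. (1 / s) *R (Tu (r + s) om - Tu r om - s *R Tr r om))"
   using s by (simp add: scaleR_diff_right)
  ultimately have "L2norm S (%om. (1 / s) *R (Tu (r + s) om - Tu r om) - Tr r om) <= (1 / s) * (s * (e / 2))"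
   using s by (simp only: L2norm_scaleR) (intro mult_mono, auto)
  then show ?case using s e by simp
 qed
qed

text \<open>Zero traces make the mollifications small on all spheres of an annulus at once, hence
  small in L2 of the annulus, where they also converge to u. Countably many annuli cover the
  exterior.\<close>

lemma vanishing_trace:
 assumes T: "T > R0" and z: "!!r. r > T ==> L2norm S (Tu r) = 0"
 shows "AE x in lebesgue. norm x > T --> u x = 0"
proof -
 have ann: "AE z in lebesgue. z : annulus x y --> u z = 0" if x: "T < x" "x <= y" for x y
 proof -
  let ?A = "annulus x y :: 'a set"
  have x': "R0 < x" "0 < x" using x T R0 by auto
  obtain \<phi> g hh where C2: "!!n::nat. C2_complex (\<phi> n) (g n) (hh n)"
   and u1: "utrace x y (%n r om. \<phi> n (r *R om)) Tu"
   and l: "(%n. L2norm (lebesgue_on ?A) (%x. \<phi> n x - u x)) ----> 0"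
   by (rule path_approximation[OF x'(1) x(2)]) (rule that)
  note C1 = C2_complex_imp_C1[OF C2]
  note U = utraceD[OF u1]
  have su: "L2fun (lebesgue_on ?A) u" by (rule L2_loc_annulus[OF L2_locs(1) x'(1)])
  have s\<phi>: "L2fun (lebesgue_on ?A) (\<phi> n)" for n
   by (rule L2fun_continuous_annulus[OF C1_complex.c0[OF C1]])
  have pc: "continuous_on UNIV (%x. (cmod (\<phi> n x))^2)" for n by (intro continuous_intros C1_complex.c0[OF C1])
  define k where "k = y ^ (DIM('a) - 1) * (y - x) + 1"
  have k: "k > 0" using x x' by (simp add: k_def add_nonneg_pos)
  have "L2norm (lebesgue_on ?A) u <= e" if e: "e > 0" for e
  proof -
   define \<delta> where "\<delta> = e / 2 / sqrt k"
   have \<delta>: "\<delta> > 0" using e k by (simp add: \<delta>_def)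
   have "\<forall>\<^sub>F n in sequentially. L2norm (lebesgue_on ?A) (%x. \<phi> n x - u x) < e / 2" by (rule order_tendstoD(2)[OF l]) (use e in simp)
   from eventually_conj[OF this U(5)[OF \<delta>]]
   obtain n where n: "L2norm (lebesgue_on ?A) (%x. \<phi> n x - u x) < e / 2"
    "ALL r. x <= r --> r <= y --> L2norm S (%om. \<phi> n (r *R om) - Tu r om) < \<delta>"
    using eventually_happens'[OF sequentially_bot] by blast
   have b: "(LINT om|sphere0. (cmod (\<phi> n (r *R om)))^2) <= \<delta>\<^sup>2" if r: "x <= r" "r <= y" for r
   proof -
    have "L2norm S (%om. \<phi> n (r *R om)) <= \<delta>"
    proof -
     have "L2norm S (%om. \<phi> n (r *R om)) <= L2norm S (%om. \<phi> n (r *R om) - Tu r om) + L2norm S (Tu r)"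
      using L2norm_triangle_diff[OF U(3)[of n r] U(4)[OF r] L2fun_zero] by simp
     moreover have "L2norm S (%om. \<phi> n (r *R om) - Tu r om) < \<delta>" using n(2) r by blast
     moreover have "L2norm S (Tu r) = 0" using z r x by simp
     ultimately show ?thesis by linarith
    qed
    then have "L2norm sphere0 (%om. \<phi> n (r *R om)) <= \<delta>"
     using L2norm_sphere_measure[OF L2fun_measurable[OF U(2)], of n r] by simp
    then show ?thesis unfolding L2norm_power2[symmetric] by (intro power_mono) auto
   qed
   have "(L2norm (lebesgue_on ?A) (\<phi> n))\<^sup>2 = integral {x..y} (%t. t ^ (DIM('a) - 1) * (LINT om|sphere0. (cmod (\<phi> n (t *R om)))^2))"
    unfolding L2norm_power2 by (rule polar_continuous(2)[OF pc _ x'(2)]) simp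
   also have "... <= integral {x..y} (%t. y ^ (DIM('a) - 1) * \<delta>^2)"
   proof (rule integral_le)
    show "(%t. t ^ (DIM('a) - 1) * (LINT om|sphere0. (cmod (\<phi> n (t *R om)))^2)) integrable_on {x..y}"
     by (intro integrable_continuous_real continuous_intros polar_continuous(1)[OF pc _ x'(2)]) simp
    show "t ^ (DIM('a) - 1) * (LINT om|sphere0. (cmod (\<phi> n (t *R om)))^2) <= y ^ (DIM('a) - 1) * \<delta>^2" if "t : {x..y}" for t
     using that x' b[of t] by (intro mult_mono power_mono) auto
   qed auto
   also have "... = (y ^ (DIM('a) - 1) * (y - x)) * \<delta>^2" using x by simp
   also have "... <= k * \<delta>^2" by (intro mult_right_mono) (auto simp: k_def)
   also have "... = (e / 2)^2" using k by (simp add: \<delta>_def power_divide)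
   finally have "L2norm (lebesgue_on ?A) (\<phi> n) <= e / 2" by (rule power2_le_imp_le) (use e in simp)
   then show ?thesis
    using L2norm_triangle_diff[OF su s\<phi>[of n] L2fun_zero] n(1) by (simp add: L2norm_minus_commute[of _ u])
  qed
  then have "L2norm (lebesgue_on ?A) u <= 0" by (rule field_le_epsilon) simp
  then have "L2norm (lebesgue_on ?A) u = 0" by (intro order_antisym) auto
  then have "(LINT z|lebesgue_on ?A. (cmod (u z))^2) = 0" using L2norm_power2[of "lebesgue_on ?A" u] by simp
  then have "AE z in lebesgue_on ?A. (cmod (u z))^2 = 0"
   using su by (subst (asm) integral_nonneg_eq_0_iff_AE) (auto simp: L2fun_def)
  then show ?thesis by (subst (asm) AE_restrict_space_iff) auto
 qed
 define xs ys where "xs n = T + 1 / real (Suc n)" and "ys n = T + 1 + real n" for n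
 have "1 / real (Suc n) <= 1" for n by simp
 then have xy: "T < xs n" "xs n <= ys n" for n
  unfolding xs_def ys_def using of_nat_0_le_iff[of n, where 'a=real] by (simp, smt (verit))
 have "AE z in lebesgue. ALL n. z : annulus (xs n) (ys n) --> u z = 0"
  by (subst AE_all_countable) (rule allI, rule ann[OF xy])
 then show ?thesis
 proof eventually_elim
  case (elim z)
  show ?case
  proof
   assume r: "T < norm z"
   obtain n where n: "1 / real (Suc n) < norm z - T" using reals_Archimedean[of "norm z - T"] r by (auto simp: inverse_eq_divide)
   obtain m where m: "norm z < T + 1 + real m" using reals_Archimedean2[of "norm z - T - 1"] by (auto simp: algebra_simps)
   define k where "k = max n m"
   have "1 / real (Suc k) <= 1 / real (Suc n)" by (rule divide_left_mono) (auto simp: k_def)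
   then have "z : annulus (xs k) (ys k)" using n m by (auto simp: annulus_def xs_def ys_def k_def)
   then show "u z = 0" using elim by blast
  qed
 qed
qed

end

subsection \<open>Compact support of the solution\<close>

context schroedinger_solution
begin

lemma ip_commute: "ip f g = ip g f" by (simp add: ip_def inner_commute)

lemma ip_add_right:
 "L2fun S f ==> L2fun S g ==> L2fun S k ==> ip f (%om. g om + k om) = ip f g + ip f k"
 unfolding ip_def inner_add_right by (intro Bochner_Integration.integral_add integrable_inner)

lemma ip_scaleR_right: "ip f (%om. c *R g om) = c * ip f g"
 by (simp add: ip_def)

lemma ip_bound: "L2fun S f ==> L2fun S g ==> \<bar>ip f g\<bar> <= L2norm S f * L2norm S g"
 unfolding ip_def by (rule inner_bound)

end

lemma weight_deriv:
 assumes dim: "n >= (2::nat)" and r: "r > (0::real)"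
 shows "((%r. r ^ (n - 1)) has_real_derivative (real n - 1) / r * r ^ (n - 1)) (at r)"
proof -
 have "r ^ (n - 1) = r * r ^ (n - 1 - Suc 0)"
  using dim by (metis One_nat_def Suc_1 Suc_diff_le diff_Suc_Suc power_Suc diff_Suc_1 Suc_le_D)
 then have "(real n - 1) / r * r ^ (n - 1) = real (n - 1) * r ^ (n - 1 - Suc 0)" using r dim by (simp add: of_nat_diff)
 then show ?thesis using DERIV_pow[of "n - 1" r UNIV] by simp
qed

theorem theorem5p10:
  fixes R0 \<beta> s0 c0 c1 :: real
    and q Q Q1 u :: "'a::euclidean_space \<Rightarrow> complex"
    and Q0 Q0r :: "'a \<Rightarrow> real"
    and Q0rs :: "'a \<Rightarrow> real \<Rightarrow> real"
    and h a b F F' :: "real \<Rightarrow> real"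
  assumes dim: "DIM('a) \<ge> 2"
    and R0: "R0 > 0"
    and q_meas: "measurable_coeff R0 q"
    and q_bdd: "locally_bounded_on (exterior R0) q"
    and q_lim: "filterlim (\<lambda>r. r\<^sup>2 * (INF x\<in>sphere (0::'a) r. Re (- q x))) at_top at_top"
    and u_H2: "H2_loc (exterior R0) u"
    and u_eq: "AE x in lebesgue_on (exterior R0).
                 - weak_laplacian (exterior R0) u x + q x * u x = 0"
    and Q_def: "\<And>x. x \<in> exterior R0 \<Longrightarrow>
                 Q x = q x + of_real ((real DIM('a) - 1) * (real DIM('a) - 3) / (4 * (norm x)\<^sup>2))"
    \<comment> \<open>(a)\<close>
    and Q_split: "\<And>x. x \<in> exterior R0 \<Longrightarrow> Q x = of_real (Q0 x) + Q1 x"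
    and Q0_nonpos: "\<And>x. x \<in> exterior R0 \<Longrightarrow> Q0 x \<le> 0"
    and Q0_meas: "measurable_coeff R0 Q0"
    and Q0_bdd: "locally_bounded_on (exterior R0) Q0"
    and Q1_meas: "measurable_coeff R0 Q1"
    and Q1_bdd: "locally_bounded_on (exterior R0) Q1"
    and beta: "0 < \<beta>" "\<beta> < 1"
    and Q0_Q: "\<And>x. x \<in> exterior R0 \<Longrightarrow> 0 \<ge> \<beta> * Q0 x \<and> \<beta> * Q0 x \<ge> Re (Q x)"
    \<comment> \<open>(b)\<close>
    and Q0_right_lim: "\<And>\<phi> r. L2_sphere \<phi> \<Longrightarrow> r > R0 \<Longrightarrow>
          \<exists>l. ((\<lambda>t. mult_form (\<lambda>\<omega>. Q0 (t *\<^sub>R \<omega>)) \<phi>) \<longlongrightarrow> l) (at_right r)"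
    \<comment> \<open>(c)\<close>
    and s0: "s0 > 0"
    and Q0rs_meas: "\<And>s. 0 < s \<Longrightarrow> s < s0 \<Longrightarrow> measurable_coeff R0 (\<lambda>x. Q0rs x s)"
    and Q0rs_bdd: "\<And>G. compact G \<Longrightarrow> G \<subseteq> exterior R0 \<Longrightarrow>
          bdd_above {\<bar>Q0rs x s\<bar> | x s. x \<in> G \<and> 0 < s \<and> s < s0}"
    and Q0rs_ineq: "\<And>\<phi> r s. L2_sphere \<phi> \<Longrightarrow> r > R0 \<Longrightarrow> 0 < s \<Longrightarrow> s < s0 \<Longrightarrow>
          (1 / s) * mult_form (\<lambda>\<omega>. Q0 ((r + s) *\<^sub>R \<omega>) - Q0 (r *\<^sub>R \<omega>)) \<phi>
            \<le> mult_form (\<lambda>\<omega>. Q0rs (r *\<^sub>R \<omega>) s) \<phi>"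
    and Q0r_meas: "measurable_coeff R0 Q0r"
    and Q0r_bdd: "locally_bounded_on (exterior R0) Q0r"
    and Q0rs_lim: "\<And>\<phi> r. L2_sphere \<phi> \<Longrightarrow> r > R0 \<Longrightarrow>
          ((\<lambda>s. mult_form (\<lambda>\<omega>. Q0rs (r *\<^sub>R \<omega>) s) \<phi>)
             \<longlongrightarrow> mult_form (\<lambda>\<omega>. Q0r (r *\<^sub>R \<omega>)) \<phi>) (at_right 0)"
    \<comment> \<open>(d)\<close>
    and h_L1: "integrable (lebesgue_on {R0<..}) h"
    and h_bounds: "\<And>r. r > R0 \<Longrightarrow> 0 < h r \<and> h r \<le> 2 / r"
    and a_def: "\<And>r. r > R0 \<Longrightarrow> a r = 1 / h r * (SUP x\<in>sphere 0 r. cmod (Q1 x))"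
    and b_def: "\<And>r. r > R0 \<Longrightarrow> b r = (INF x\<in>sphere 0 r. - (Q0 x + 1 / h r * Q0r x))"
    and a_b: "\<And>r. r > R0 \<Longrightarrow> (a r)\<^sup>2 \<le> b r"
    \<comment> \<open>(e)\<close>
    and F_pos: "\<And>r. r > R0 \<Longrightarrow> F r > 0"
    and F_deriv: "\<And>r. r > R0 \<Longrightarrow> (F has_real_derivative F' r) (at r)"
    and F_C1: "continuous_on {R0<..} F'"
    and c_pos: "c0 > 0" "c1 > 0"
    and F_bound: "\<And>r. r > R0 \<Longrightarrow> (F r)\<^sup>2 \<le> c0 * r ^ 4 * (h r)\<^sup>2 * b r"
    and F_lim: "filterlim F at_top at_top"
    and F'_bound: "\<And>r. r > R0 \<Longrightarrow> F' r \<le> c1 * inverse r"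
    and energy: "Liminf at_top (\<lambda>r. ereal (sphere_integral r (\<lambda>\<omega>::'a.
          (cmod (radial_deriv_trace (exterior R0) r u \<omega>))\<^sup>2
            - Re (q (r *\<^sub>R \<omega>)) * (cmod (sphere_trace (exterior R0) r u \<omega>))\<^sup>2))) = 0"
  shows "\<exists>R>R0. AE x in lebesgue. norm x > R \<longrightarrow> u x = 0"
proof -

 \<comment> \<open>Bounds for the potentials and their forms on spheres\<close>
 interpret schroedinger_solution R0 u q
  using dim R0 u_H2 q_meas q_bdd u_eq by unfold_locales
 interpret P: one_sided_potential R0 s0 Q0 Q0r Q0rs
  by (unfold_locales; fact)
 \<comment> \<open>\<kappa> is the exponent in v = r^\<kappa> u: the weight r^(N-1) is
   r^(2\<kappa>), and \<kappa> (\<kappa> - 1)/r^2 is the term that turns q into Q.\<close>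
 define \<kappa> where "\<kappa> = (real DIM('a) - 1) / 2"
 have \<kappa>: "\<kappa> >= 1 / 2" using dim by (simp add: \<kappa>_def)
 define w where "w r = r ^ (DIM('a) - 1)" for r :: real
 have rp: "r > 0" "w r > 0" if "r > R0" for r using that R0 by (auto simp: w_def)
 have wd: "(w has_real_derivative 2 * \<kappa> / r * w r) (at r)" if "r > R0" for r
 proof -
  have "2 * \<kappa> = real DIM('a) - 1" by (simp add: \<kappa>_def)
  then show ?thesis unfolding w_def[abs_def] using weight_deriv[OF dim rp(1)[OF that]] by (simp only:)
 qed
 note sT = sqi_Tu and sR = sqi_Tr
 have sphere_norm: "norm om = 1" if "om : space S" for om :: 'a using that by (simp add: sphere_measure_eq)
 have in_ext: "r *R om : exterior R0" "r *R om : sphere 0 r" if "r > R0" "om : space S" for r and om :: 'a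
  using that rp[OF that(1)] sphere_norm[OF that(2)] by (auto simp: exterior_def)
 obtain z0 :: 'a where z0: "norm z0 = 1" using vector_choose_size[of 1] by auto
 have bdd: "bounded (V ` sphere 0 r)" if "locally_bounded_on (exterior R0) V" "r > R0" for V :: "'a => 'c::real_normed_vector" and r
 proof -
  have "(sphere 0 r :: 'a set) \<subseteq> exterior R0" using that(2) by (auto simp: exterior_def)
  then show ?thesis using that(1) unfolding locally_bounded_on_def by simp
 qed
 \<comment> \<open>\<open>SUP\<close> and \<open>INF\<close> carry information only on bounded sets.
   Local boundedness of Q1, and of Q0 and Q0r in \<open>b_bound\<close>, makes the definitions of a
   and b usable pointwise.\<close>
 have Q1b: "cmod (Q1 x) <= h r * a r" if r: "r > R0" and x: "x : sphere 0 r" for r x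
 proof -
  have "bdd_above ((%x. cmod (Q1 x)) ` sphere 0 r)"
   using bdd[OF Q1_bdd r] unfolding bounded_iff bdd_above_def by auto
  then have "cmod (Q1 x) <= (SUP x\<in>sphere 0 r. cmod (Q1 x))" using x by (rule cSUP_upper2) simp
  then show ?thesis using a_def[OF r] h_bounds[OF r] by simp
 qed
 have a0: "a r >= 0" if r: "r > R0" for r
 proof -
  have "0 <= h r * a r" using order_trans[OF norm_ge_zero Q1b[OF r, of "r *R z0"]] z0 rp[OF r] by simp
  then show ?thesis using h_bounds[OF r] by (simp add: zero_le_mult_iff)
 qed
 have b_bound: "h r * b r <= - (h r * Q0 x) - Q0r x" if r: "r > R0" and x: "x : sphere 0 r" for r x
 proof -
  obtain k1 k2 where k: "ALL x:sphere 0 r. \<bar>Q0 x\<bar> <= k1" "ALL x:sphere 0 r. \<bar>Q0r x\<bar> <= k2"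
   using bdd[OF Q0_bdd r] bdd[OF Q0r_bdd r] unfolding bounded_iff by auto
  have "bdd_below ((%x. - (Q0 x + 1 / h r * Q0r x)) ` sphere 0 r)"
  proof (rule bdd_belowI2[where m="- k1 - 1 / h r * k2"])
   fix x :: 'a assume x: "x : sphere 0 r"
   have "1 / h r * Q0r x <= 1 / h r * k2" using bspec[OF k(2) x] h_bounds[OF r] by (intro mult_left_mono) auto
   then show "- k1 - 1 / h r * k2 <= - (Q0 x + 1 / h r * Q0r x)" using bspec[OF k(1) x] by linarith
  qed
  then have "b r <= - (Q0 x + 1 / h r * Q0r x)" unfolding b_def[OF r] using x by (rule cINF_lower)
  then have "h r * b r <= h r * (- (Q0 x + 1 / h r * Q0r x))" using h_bounds[OF r] by (intro mult_left_mono) auto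
  also have "... = - (h r * Q0 x) - Q0r x" using h_bounds[OF r] by (simp add: field_simps)
  finally show ?thesis .
 qed
 have bounded_on_sphere: "EX k. ALL om:space S. norm (V (r *R om)) <= k"
  if "locally_bounded_on (exterior R0) V" "r > R0" for V :: "'a => 'c::real_normed_vector" and r
  using bdd[OF that] in_ext(2)[OF that(2)] unfolding bounded_iff by blast
 have meas: "(%om. Q0 (r *R om)) : borel_measurable S" "(%om. Q0r (r *R om)) : borel_measurable S"
  "(%om. Q1 (r *R om)) : borel_measurable S" "(%om. q (r *R om)) : borel_measurable S" if "r > R0" for r
  using Q0_meas Q0r_meas Q1_meas q_meas that by (auto simp: measurable_coeff_def)
 have form_int: "integrable S (%om. V (r *R om) * (f om \<bullet> g om))"
  if V: "locally_bounded_on (exterior R0) V" "(%om. V (r *R om)) : borel_measurable S" "r > R0" and fg: "L2fun S f" "L2fun S g"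
  for V :: "'a => real" and r f g
 proof -
  obtain k where "ALL om:space S. norm (V (r *R om)) <= k" using bounded_on_sphere[OF V(1,3)] by (rule exE)
  then show ?thesis by (intro integrable_weighted_inner[OF fg V(2), of k]) auto
 qed
 \<comment> \<open>The definition of b integrated against |\<phi>|^2. With k = -(Q_0 \<phi>, \<phi>)
   it says that -(Q_0r \<phi>, \<phi>) >= -h k + h b |\<phi>|^2; the weight W integrates this
   inequality.\<close>
 have form_damping: "h r * P.qf r \<phi> + h r * b r * (L2norm S \<phi>)^2 <= - mult_form (%om. Q0r (r *R om)) \<phi>"
  if r: "r > R0" and \<phi>: "L2fun S \<phi>" for r \<phi>
 proof -
  note i = form_int[OF Q0_bdd meas(1)[OF r] r \<phi> \<phi>] form_int[OF Q0r_bdd meas(2)[OF r] r \<phi> \<phi>] integrable_inner[OF \<phi> \<phi>]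
  have "(LINT om|S. h r * b r * (\<phi> om \<bullet> \<phi> om)) <= (LINT om|S. - (h r * (Q0 (r *R om) * (\<phi> om \<bullet> \<phi> om))) - Q0r (r *R om) * (\<phi> om \<bullet> \<phi> om))"
  proof (rule Bochner_Integration.integral_mono)
   fix om assume "om : space S"
   from mult_right_mono[OF b_bound[OF r in_ext(2)[OF r this]] inner_ge_zero[of "\<phi> om"]]
   show "h r * b r * (\<phi> om \<bullet> \<phi> om) <= - (h r * (Q0 (r *R om) * (\<phi> om \<bullet> \<phi> om))) - Q0r (r *R om) * (\<phi> om \<bullet> \<phi> om)"
    by (simp add: algebra_simps)
  qed (use i in auto)
  then show ?thesis using i by (simp add: mult_form_eq L2norm_power2 dot_square_norm)
 qed
 have qf_neg: "P.qf r \<phi> <= 0" if r: "r > R0" for r \<phi>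
 proof -
  have "0 <= (LINT om|S. - (Q0 (r *R om) * (\<phi> om \<bullet> \<phi> om)))"
   using Q0_nonpos[OF in_ext(1)[OF r]] by (intro integral_nonneg_AE AE_I2) (simp add: mult_nonpos_nonneg)
  then show ?thesis by (simp add: mult_form_eq)
 qed

 \<comment> \<open>Coercivity of the form of Q_0 at large radii\<close>
 obtain W M where W: "!!r. r >= R0 ==> 1 <= W r" "!!r. r >= R0 ==> W r <= M"
  and Wl: "!!x y. R0 < x ==> EX N. ALL s t. x <= s --> s <= t --> t <= y --> \<bar>W t - W s\<bar> <= N * (t - s)"
  and Wd: "AE t in lborel. R0 < t --> ((%s. (W (t + s) - W t) / s) ---> W t * h t) (at_right 0)"
  by (rule integrating_weight[OF R0 h_L1 h_bounds]) auto
 have M: "M > 0" using W(1)[of R0] W(2)[of R0] by simp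
 obtain r1 where r1: "r1 > R0" "!!r. r >= r1 ==> F r >= 1"
 proof -
  have "\<forall>\<^sub>F r in at_top. 1 <= F r" using F_lim unfolding filterlim_at_top by blast
  then obtain m where m: "!!r. r >= m ==> F r >= 1" unfolding eventually_at_top_linorder by blast
  show ?thesis by (rule that[of "max m (R0 + 1)"]) (auto intro: m)
 qed
 define c where "c = 3 / (16 * c0 * r1^2 * M)"
 have c: "c > 0" using c_pos M r1 R0 by (simp add: c_def)
 \<comment> \<open>The form is followed along the constant path \<phi>, whose derivative is zero.
   The constant c does not depend on \<phi>.\<close>
 have coercive: "- P.qf r \<phi> >= c * (L2norm S \<phi>)^2" if r: "r >= 2 * r1" and \<phi>: "L2fun S \<phi>" for r \<phi>
  unfolding c_def
 proof (rule form_lower_bound[OF R0 W Wl Wd h_bounds F_bound c_pos(1) r1 _ _ _ _ r])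
  show "0 <= - P.qf t \<phi>" if "t > R0" for t using qf_neg[OF that, of \<phi>] by simp
  show "lower_lip x y (%t. - P.qf t \<phi>)" if "R0 < x" for x y
   by (rule P.form_lower_lip[OF that \<phi>, where L=0 and M="L2norm S \<phi>"]) (auto simp: L2norm_def)
  show "rd_ge (%t. - P.qf t \<phi>) t (- h t * (- P.qf t \<phi>) + h t * b t * (L2norm S \<phi>)^2)" if t: "t > R0" for t
  proof (rule rd_ge_mono[OF P.form_rd_ge[where P="%_. \<phi>" and Pd="%_. 0", OF t \<phi>]])
   show "- h t * (- P.qf t \<phi>) + h t * b t * (L2norm S \<phi>)^2 <= - mult_form (%om. Q0r (t *R om)) \<phi> - 2 * (LINT om|S. Q0 (t *R om) * (\<phi> om \<bullet> 0))"
    using form_damping[OF t \<phi>] by simp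
  qed (simp_all add: L2norm_def)
 qed auto

 \<comment> \<open>The scalar functions of r and their pairings with the equation\<close>
 define C where "C r = i0 r + \<kappa> / r ^ 1 * a0 r" for r
 \<comment> \<open>As v' = r^\<kappa> (u_r + (\<kappa>/r) u), C is (v, v') and D is |v'|^2 expressed
   through u; B is the squared gradient minus its radial part. The pairings with Q_1 are
   \<open>s1\<close> and \<open>R\<close>, and \<open>p1\<close> pairs Q_0 u with u_r. Powers such
   as \<open>r ^ 1\<close> have the shape that \<open>lower_lip_divide\<close> expects.\<close>
 define D where "D r = t0 r + 2 * \<kappa> / r * i0 r + \<kappa>^2 / r^2 * a0 r" for r
 define B where "B r = g0 r - t0 r" for r
 define K where "K r = w r * (- P.qf r (Tu r))" for r
 define s1 where "s1 r = w r * ip (Tr r) (%om. Q1 (r *R om) * Tu r om)" for r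
 define R where "R r = w r * ip (Tu r) (%om. Q1 (r *R om) * Tu r om)" for r
 define p1 where "p1 r = w r * (LINT om|S. Q0 (r *R om) * (Tu r om \<bullet> Tr r om))" for r
 define E1 where "E1 r = 2 * s1 r + 2 * \<kappa> / r * R r" for r
 \<comment> \<open>r^\<kappa> Z is v' + k v, so its square norm generates D, C and A at once. k = 0
   gives Cauchy-Schwarz for C, and general k the bound on the Q_1 terms.\<close>
 define Z where "Z k r om = Tr r om + (\<kappa> / r + k) *R Tu r om" for k r om
 have sZ: "L2fun S (Z k r)" if "r > R0" for k r
  unfolding Z_def[abs_def] by (intro L2fun_add L2fun_scaleR sT sR that)
 have Znorm: "D r + 2 * k * C r + k^2 * a0 r = w r * (L2norm S (Z k r))^2" if r: "r > R0" for k r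
 proof -
  have "(L2norm S (Z k r))\<^sup>2 = ip (Tr r) (Tr r) + 2 * ((\<kappa> / r + k) * ip (Tr r) (Tu r)) + (\<kappa> / r + k)^2 * ip (Tu r) (Tu r)"
   unfolding Z_def[abs_def] using L2norm_add_square[OF sR[OF r] L2fun_scaleR[OF sT[OF r]]]
   by (simp add: ip_self L2norm_scaleR power_mult_distrib ip_def)
  then show ?thesis
   by (simp add: D_def C_def t0_def i0_def a0_def w_def ip_commute[of "Tr r" "Tu r"] power2_sum power_divide algebra_simps)
 qed
 have A_norm: "a0 r = w r * (L2norm S (Tu r))^2" for r by (simp add: a0_def ip_self w_def)
 have sQ1: "L2fun S (%om. Q1 (r *R om) * Tu r om)" "L2norm S (%om. Q1 (r *R om) * Tu r om) <= h r * a r * L2norm S (Tu r)" if r: "r > R0" for r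
 proof -
  have k: "cmod (Q1 (r *R om)) <= h r * a r" if "om : space S" for om by (rule Q1b[OF r in_ext(2)[OF r that]])
  show "L2fun S (%om. Q1 (r *R om) * Tu r om)" by (rule L2fun_mult_bounded[OF sT[OF r] meas(3)[OF r] k])
  show "L2norm S (%om. Q1 (r *R om) * Tu r om) <= h r * a r * L2norm S (Tu r)"
   by (rule L2norm_mult_bounded[OF sT[OF r] meas(3)[OF r] k]) (use a0[OF r] h_bounds[OF r] in auto)
 qed
 have sQ0: "L2fun S (%om. Q0 (r *R om) *R Tu r om)" if r: "r > R0" for r
 proof -
  obtain k where k: "ALL om:space S. norm (Q0 (r *R om)) <= k" using bounded_on_sphere[OF Q0_bdd r] by (rule exE)
  show ?thesis unfolding scaleR_conv_of_real
   by (rule L2fun_mult_bounded[OF sT[OF r], where k=k]) (use meas(1)[OF r] k in auto)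
 qed
 \<comment> \<open>On the sphere q = Q_0 + Q_1 - \<kappa> (\<kappa> - 1)/r^2. The pairing is needed
   with f = u for \<open>l1\<close> and with f = u_r for \<open>l2\<close>.\<close>
 have q_ip: "ip f (%om. q (r *R om) * Tu r om) = (LINT om|S. Q0 (r *R om) * (f om \<bullet> Tu r om)) + ip f (%om. Q1 (r *R om) * Tu r om) - \<kappa> * (\<kappa> - 1) / r^2 * ip f (Tu r)"
  if r: "r > R0" and f: "L2fun S f" for r f
 proof -
  let ?d = "- (\<kappa> * (\<kappa> - 1) / r^2)"
  have "ip f (%om. q (r *R om) * Tu r om) = ip f (%om. Q0 (r *R om) *R Tu r om + (Q1 (r *R om) * Tu r om + ?d *R Tu r om))"
   unfolding ip_def
  proof (rule Bochner_Integration.integral_cong[OF refl])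
   fix om assume w: "om : space S"
   have k: "(real DIM('a) - 1) * (real DIM('a) - 3) / (4 * r^2) = - ?d" by (simp add: \<kappa>_def field_simps)
   have n: "norm (r *R om) = r" using in_ext(2)[OF r w] by simp
   have "q (r *R om) = of_real (Q0 (r *R om)) + Q1 (r *R om) + of_real ?d"
    using Q_def[OF in_ext(1)[OF r w], unfolded n k] Q_split[OF in_ext(1)[OF r w]] by (simp add: algebra_simps)
   then show "f om \<bullet> (q (r *R om) * Tu r om) = f om \<bullet> (Q0 (r *R om) *R Tu r om + (Q1 (r *R om) * Tu r om + ?d *R Tu r om))"
    by (simp only: scaleR_conv_of_real distrib_right add.assoc)
  qed
  also have "... = ip f (%om. Q0 (r *R om) *R Tu r om) + (ip f (%om. Q1 (r *R om) * Tu r om) + ?d * ip f (Tu r))"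
   using sQ0[OF r] sQ1(1)[OF r] sT[OF r] f
   by (simp only: ip_add_right L2fun_add L2fun_scaleR ip_scaleR_right)
  also have "ip f (%om. Q0 (r *R om) *R Tu r om) = (LINT om|S. Q0 (r *R om) * (f om \<bullet> Tu r om))" by (simp add: ip_def)
  finally show ?thesis by simp
 qed
 have l1_eq: "l1 r = - K r + R r - \<kappa> * (\<kappa> - 1) / r^2 * a0 r" if r: "r > R0" for r
  unfolding l1_def q_ip[OF r sT[OF r]] K_def R_def a0_def w_def mult_form_eq by (simp add: algebra_simps)
 have l2_eq: "l2 r = p1 r + s1 r - \<kappa> * (\<kappa> - 1) / r^2 * i0 r" if r: "r > R0" for r
  unfolding l2_def q_ip[OF r sR[OF r]] p1_def s1_def i0_def w_def ip_commute[of "Tr r" "Tu r"]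
  by (simp add: inner_commute[of "Tr r _" "Tu r _"] algebra_simps)

 \<comment> \<open>Lipschitz and lower Lipschitz bounds\<close>
 have A_d: "(a0 has_real_derivative 2 * C r) (at r)" if r: "r > R0" for r
 proof -
  have "2 * C r = (real DIM('a) - 1) / r * a0 r + 2 * i0 r" using rp(1)[OF r] by (simp add: C_def \<kappa>_def field_simps)
  then show ?thesis using a0_deriv[OF r] by (simp only:)
 qed
 have a0_lip: "lower_lip x y a0" "lower_lip x y (%t. - a0 t)"
  and i0_lip: "lower_lip x y i0" "lower_lip x y (%t. - i0 t)" if x: "R0 < x" for x y
 proof -
  have yy: "R0 < x" "x <= max x y" using x by auto
  note il = lower_lip_lipschitz_both[OF i0_evolution(1)[OF yy]]
  then show "lower_lip x y i0" "lower_lip x y (%t. - i0 t)" by (auto elim: lower_lip_subinterval)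
  obtain L where L: "!!s t. x <= s ==> s <= t ==> t <= y ==> \<bar>i0 t - i0 s\<bar> <= L * (t - s)"
   using i0_evolution(1)[OF yy] by (auto simp: le_max_iff_disj)
  have ic: "continuous_on {x..y} i0"
  proof (rule lipschitz_on_continuous_on[where L="\<bar>L\<bar>"], rule lipschitz_onI)
   fix s t assume st: "s : {x..y}" "t : {x..y}"
   have *: "\<bar>i0 t - i0 s\<bar> <= \<bar>L\<bar> * \<bar>t - s\<bar>" if "s <= t" "s : {x..y}" "t : {x..y}" for s t
   proof -
    have "L * (t - s) <= \<bar>L\<bar> * (t - s)" using that by (intro mult_right_mono) auto
    then show ?thesis using L[of s t] that by simp
   qed
   show "dist (i0 s) (i0 t) <= \<bar>L\<bar> * dist s t"
    using *[of s t] *[of t s] st by (cases "s <= t") (auto simp: dist_real_def abs_minus_commute)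
  qed simp
  have ac: "continuous_on {x..y} a0"
   by (intro continuous_at_imp_continuous_on ballI DERIV_isCont[OF A_d]) (use x in auto)
  have Ad: "(a0 has_real_derivative 2 * C t) (at t)" if "x <= t" for t using that x by (intro A_d) simp
  have Cc: "continuous_on {x..y} (%t. 2 * C t)"
   unfolding C_def using x R0 by (intro continuous_intros ic ac) auto
  obtain N where N: "!!s t. x <= s ==> s <= t ==> t <= y ==> \<bar>a0 t - a0 s\<bar> <= N * (t - s)"
   by (rule C1_lipschitz[of x y a0, OF Ad Cc]; (assumption | rule that))
  then show "lower_lip x y a0" "lower_lip x y (%t. - a0 t)" using lower_lip_lipschitz_both[of x y a0] by blast+
 qed
 have k0: "\<kappa> >= 0" "2 * \<kappa> >= 0" "\<kappa>\<^sup>2 >= 0" using \<kappa> by auto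
 have C_lip: "EX L. ALL s t. x <= s --> s <= t --> t <= y --> \<bar>C t - C s\<bar> <= L * (t - s)" if x: "R0 < x" for x y
 proof (rule lower_lip_imp_lipschitz)
  show "lower_lip x y C"
   unfolding C_def[abs_def] by (intro lower_lip_add lower_lip_divide k0 i0_lip a0_lip x rp(1)[OF x])
  have "(%t. - C t) = (%t. - i0 t + \<kappa> / t ^ 1 * (- a0 t))" by (simp add: C_def)
  then show "lower_lip x y (%t. - C t)"
   by (simp only:) (intro lower_lip_add lower_lip_divide k0 i0_lip a0_lip x rp(1)[OF x])
 qed
 \<comment> \<open>The Pohozaev combination. D - B is J/r plus terms in i0 and a0, so it inherits
   their regularity, which has not been established for D and B separately.\<close>
 define J where "J r = r * (2 * t0 r - g0 r)" for r
 have DB: "D r - B r = (1 / r ^ 1 * J r + 2 * \<kappa> / r ^ 1 * i0 r) + \<kappa>^2 / r ^ 2 * a0 r" if "r > R0" for r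
  using rp[OF that] by (simp add: D_def B_def J_def)
 have DB_ll: "lower_lip x y (%r. D r - B r)" if x: "R0 < x" for x y
 proof -
  have yy: "R0 < x" "x <= max x y" using x by auto
  have "lower_lip x y J"
   using lower_lip_lipschitz_both(1)[OF J0_evolution(1)[OF yy]] unfolding J_def[abs_def] by (rule lower_lip_subinterval) auto
  then have "lower_lip x y (%r. (1 / r ^ 1 * J r + 2 * \<kappa> / r ^ 1 * i0 r) + \<kappa>^2 / r ^ 2 * a0 r)"
   by (intro lower_lip_add lower_lip_divide k0 i0_lip a0_lip x rp(1)[OF x] zero_le_one)
  then show ?thesis unfolding lower_lip_def using DB x by (auto elim!: allE ex_forward)
 qed
 define v where "v t = (if R0 < t then Tu t else (%_. 0))" for t
 have sv: "L2fun S (v t)" for t using sT by (simp add: v_def)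
 have K_ll: "lower_lip x y K" if x: "R0 < x" for x y
 proof (cases "x <= y")
  case True
  obtain L M where L: "!!s t. x <= s ==> s <= t ==> t <= y ==> L2norm S (%om. Tu t om - Tu s om) <= L * (t - s)"
   and M: "!!t. x <= t ==> t <= y ==> L2norm S (Tu t) <= M"
   by (rule path_lipschitz[OF x True]) (rule that)
  have "lower_lip x y (%t. - P.qf t (v t))"
   by (rule P.form_lower_lip[OF x sv, where L=L and M=M]) (use L M x in \<open>auto simp: v_def\<close>)
  then have "lower_lip x y (%t. w t * (- P.qf t (v t)))"
   by (rule lower_lip_C1_mult[OF _ wd]) (use x R0 in \<open>auto simp: w_def intro!: continuous_intros\<close>)
  then show ?thesis unfolding lower_lip_def K_def using x by (auto simp: v_def elim!: ex_forward)
 qed (auto simp: lower_lip_def)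
 have E_ll: "lower_lip x y (%r. D r - B r + K r)" if "R0 < x" for x y by (intro lower_lip_add DB_ll K_ll that)

 \<comment> \<open>Right derivatives of K, C and E\<close>
 have K_rd: "rd_ge K r (h r * b r * a0 r - h r * K r - 2 * p1 r + 2 * \<kappa> / r * K r)" if r: "r > R0" for r
 proof -
  have "rd_ge (%t. - P.qf t (v t)) r (- mult_form (%om. Q0r (r *R om)) (v r) - 2 * (LINT om|S. Q0 (r *R om) * (v r om \<bullet> Tr r om)))"
  proof (rule P.form_rd_ge[OF r sv sR[OF r]])
   show "((%s. L2norm S (%om. (1 / s) *R (v (r + s) om - v r om) - Tr r om)) ---> 0) (at_right 0)"
   proof (rule Lim_transform_eventually[OF path_derivative[OF r]])
    have "\<forall>\<^sub>F s in at_right 0. (s::real) > 0" by (simp add: eventually_at_right_less)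
    then show "\<forall>\<^sub>F s in at_right 0. L2norm S (%om. (1 / s) *R (Tu (r + s) om - Tu r om) - Tr r om) = L2norm S (%om. (1 / s) *R (v (r + s) om - v r om) - Tr r om)"
     by eventually_elim (use r in \<open>simp add: v_def\<close>)
   qed
  qed
  then have "rd_ge (%t. w t * (- P.qf t (v t))) r (w r * (- mult_form (%om. Q0r (r *R om)) (v r) - 2 * (LINT om|S. Q0 (r *R om) * (v r om \<bullet> Tr r om))) + 2 * \<kappa> / r * w r * (- P.qf r (v r)))"
   by (rule rd_ge_mult[OF _ tendsto_right_quotient[OF wd[OF r]] rp(2)[OF r]])
  \<comment> \<open>\<open>form_damping\<close> trades the form of \<open>Q0r\<close> for -h K + h b
    A, and the derivative of the weight w contributes (2\<kappa>/r) K.\<close>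
  then have "rd_ge (%t. w t * (- P.qf t (v t))) r (h r * b r * a0 r - h r * K r - 2 * p1 r + 2 * \<kappa> / r * K r)"
  proof (rule rd_ge_mono)
   have vr: "v r = Tu r" using r by (simp add: v_def)
   have "w r * (h r * P.qf r (Tu r) + h r * b r * (L2norm S (Tu r))^2) <= w r * (- mult_form (%om. Q0r (r *R om)) (Tu r))"
    using form_damping[OF r sT[OF r]] rp(2)[OF r] by (intro mult_left_mono) auto
   then show "h r * b r * a0 r - h r * K r - 2 * p1 r + 2 * \<kappa> / r * K r
    <= w r * (- mult_form (%om. Q0r (r *R om)) (v r) - 2 * (LINT om|S. Q0 (r *R om) * (v r om \<bullet> Tr r om))) + 2 * \<kappa> / r * w r * (- P.qf r (v r))"
    unfolding vr A_norm K_def p1_def by (simp add: algebra_simps)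
  qed
  note main = this
  show ?thesis unfolding rd_ge_def
  proof (intro allI impI)
   fix e :: real assume "e > 0"
   have pos: "\<forall>\<^sub>F s in at_right 0. (s::real) > 0" by (simp add: eventually_at_right_less)
   show "\<forall>\<^sub>F s in at_right 0. (h r * b r * a0 r - h r * K r - 2 * p1 r + 2 * \<kappa> / r * K r - e) * s <= K (r + s) - K r"
    using main[unfolded rd_ge_def, rule_format, OF \<open>e > 0\<close>] pos
   proof eventually_elim
    case (elim s)
    then have "K (r + s) = w (r + s) * (- P.qf (r + s) (v (r + s)))" "K r = w r * (- P.qf r (v r))" using r by (simp_all add: K_def v_def)
    then show ?case using elim(1) by (simp only:)
   qed
  qed
 qed
 have i0_AE: "AE r in lborel. R0 < r --> ((%s. (i0 (r + s) - i0 r) / s) ---> g0 r + l1 r) (at_right 0)"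
  by (rule AE_exterior_radius) (rule i0_evolution(2))
 have J_AE: "AE r in lborel. R0 < r --> ((%s. (J (r + s) - J r) / s) ---> (2 - real DIM('a)) * g0 r + 2 * r * l2 r) (at_right 0)"
  unfolding J_def by (rule AE_exterior_radius) (rule J0_evolution(2))
 have C_rd: "AE r in lborel. r > R0 --> rd_ge C r (D r + B r - K r + R r)"
  using i0_AE
 proof eventually_elim
  case (elim r)
  show ?case
  proof
   assume r: "R0 < r"
   have "(i0 has_real_derivative g0 r + l1 r) (at r within {r<..})" using elim r by (simp add: tendsto_right_quotient_iff)
   moreover have "(a0 has_real_derivative 2 * C r) (at r within {r<..})" using A_d[OF r] by (rule has_field_derivative_at_within)
   ultimately have "(C has_real_derivative (g0 r + l1 r) + (\<kappa> / r * (2 * C r) - \<kappa> / r^2 * a0 r)) (at r within {r<..})"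
    unfolding C_def[abs_def] using rp(1)[OF r] by (auto intro!: derivative_eq_intros simp: power2_eq_square field_simps)
   moreover have "(g0 r + l1 r) + (\<kappa> / r * (2 * C r) - \<kappa> / r^2 * a0 r) = D r + B r - K r + R r"
    unfolding l1_eq[OF r] C_def D_def B_def using rp(1)[OF r] by (simp add: field_simps power2_eq_square)
   ultimately show "rd_ge C r (D r + B r - K r + R r)" by (intro rd_ge_of_tendsto) (simp add: tendsto_right_quotient_iff)
  qed
 qed
 have E_rd: "AE r in lborel. r > R0 --> rd_ge (%r. D r - B r + K r) r (E1 r + 2 / r * B r - h r * K r + h r * b r * a0 r)"
  using i0_AE J_AE
 proof eventually_elim
  case (elim r)
  show ?case
  proof
   assume r: "R0 < r"
   have "(i0 has_real_derivative g0 r + l1 r) (at r within {r<..})"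
    "(J has_real_derivative (2 - real DIM('a)) * g0 r + 2 * r * l2 r) (at r within {r<..})"
    using elim r by (simp_all add: tendsto_right_quotient_iff)
   moreover have "(a0 has_real_derivative 2 * C r) (at r within {r<..})" using A_d[OF r] by (rule has_field_derivative_at_within)
   ultimately have "((%r. (1 / r ^ 1 * J r + 2 * \<kappa> / r ^ 1 * i0 r) + \<kappa>^2 / r ^ 2 * a0 r) has_real_derivative
     ((((2 - real DIM('a)) * g0 r + 2 * r * l2 r) / r - J r / r^2) + (2 * \<kappa> / r * (g0 r + l1 r) - 2 * \<kappa> / r^2 * i0 r))
      + (\<kappa>^2 / r^2 * (2 * C r) - 2 * \<kappa>^2 / r ^ 3 * a0 r)) (at r within {r<..})"
    using rp(1)[OF r] by (auto intro!: derivative_eq_intros simp: field_simps eval_nat_numeral)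
   \<comment> \<open>Once the equation is inserted through \<open>l1_eq\<close> and
     \<open>l2_eq\<close>, the leftovers 2 p1 and -(2\<kappa>/r) K are the exact negatives of those
     in \<open>K_rd\<close>, so they disappear in the sum D - B + K.\<close>
   moreover have "((((2 - real DIM('a)) * g0 r + 2 * r * l2 r) / r - J r / r^2) + (2 * \<kappa> / r * (g0 r + l1 r) - 2 * \<kappa> / r^2 * i0 r))
      + (\<kappa>^2 / r^2 * (2 * C r) - 2 * \<kappa>^2 / r ^ 3 * a0 r) = E1 r + 2 / r * B r + 2 * p1 r - 2 * \<kappa> / r * K r"
   proof -
    have N: "real DIM('a) = 2 * \<kappa> + 1" unfolding \<kappa>_def by (simp add: field_simps)
    show ?thesis unfolding N l1_eq[OF r] l2_eq[OF r] C_def B_def J_def E1_def using rp(1)[OF r]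
     by (simp add: field_simps eval_nat_numeral)
   qed
   ultimately have "((%r. (1 / r ^ 1 * J r + 2 * \<kappa> / r ^ 1 * i0 r) + \<kappa>^2 / r ^ 2 * a0 r) has_real_derivative
     E1 r + 2 / r * B r + 2 * p1 r - 2 * \<kappa> / r * K r) (at r within {r<..})" by (simp only:)
   then have "((%s. (((1 / (r + s) ^ 1 * J (r + s) + 2 * \<kappa> / (r + s) ^ 1 * i0 (r + s)) + \<kappa>^2 / (r + s) ^ 2 * a0 (r + s))
     - ((1 / r ^ 1 * J r + 2 * \<kappa> / r ^ 1 * i0 r) + \<kappa>^2 / r ^ 2 * a0 r)) / s) ---> E1 r + 2 / r * B r + 2 * p1 r - 2 * \<kappa> / r * K r) (at_right 0)"
    by (rule tendsto_right_quotient_iff[THEN iffD2])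
   then have "((%s. ((D (r + s) - B (r + s)) - (D r - B r)) / s) ---> E1 r + 2 / r * B r + 2 * p1 r - 2 * \<kappa> / r * K r) (at_right 0)"
   proof (rule Lim_transform_eventually)
    have "\<forall>\<^sub>F s in at_right 0. (s::real) > 0" by (simp add: eventually_at_right_less)
    then show "\<forall>\<^sub>F s in at_right 0. (((1 / (r + s) ^ 1 * J (r + s) + 2 * \<kappa> / (r + s) ^ 1 * i0 (r + s)) + \<kappa>^2 / (r + s) ^ 2 * a0 (r + s))
     - ((1 / r ^ 1 * J r + 2 * \<kappa> / r ^ 1 * i0 r) + \<kappa>^2 / r ^ 2 * a0 r)) / s = ((D (r + s) - B (r + s)) - (D r - B r)) / s"
     by eventually_elim (use DB r in simp)
   qed
   then have "rd_ge (%r. D r - B r) r (E1 r + 2 / r * B r + 2 * p1 r - 2 * \<kappa> / r * K r)" by (rule rd_ge_of_tendsto)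
   from rd_ge_add[OF this K_rd[OF r]]
   show "rd_ge (%r. D r - B r + K r) r (E1 r + 2 / r * B r - h r * K r + h r * b r * a0 r)"
    by (rule rd_ge_mono) simp
  qed
 qed

 \<comment> \<open>Signs and Cauchy-Schwarz bounds\<close>
 have A0: "a0 r >= 0" if "r > R0" for r unfolding A_norm using rp(2)[OF that] by simp
 have D0: "D r >= 0" if r: "r > R0" for r using Znorm[OF r, of 0] rp(2)[OF r] by simp
 have K0: "K r >= 0" if r: "r > R0" for r unfolding K_def using mult_nonneg_nonpos[OF less_imp_le[OF rp(2)[OF r]] qf_neg[OF r, of "Tu r"]] by simp
 have CS: "(C r)\<^sup>2 <= a0 r * D r" if r: "r > R0" for r
 proof -
  have "C r = w r * ip (Tu r) (Z 0 r)"
   unfolding Z_def[abs_def] using sT[OF r] sR[OF r]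
   by (simp add: ip_add_right L2fun_scaleR ip_scaleR_right C_def i0_def a0_def w_def algebra_simps)
  moreover have "(ip (Tu r) (Z 0 r))\<^sup>2 <= (L2norm S (Tu r) * L2norm S (Z 0 r))\<^sup>2"
   using ip_bound[OF sT[OF r] sZ[OF r]] by (intro power2_le_iff_abs_le[THEN iffD2]) auto
  then have "(w r)\<^sup>2 * (ip (Tu r) (Z 0 r))^2 <= (w r)\<^sup>2 * (L2norm S (Tu r) * L2norm S (Z 0 r))^2" by (rule mult_left_mono) simp
  ultimately show ?thesis using Znorm[OF r, of 0] unfolding A_norm by (simp add: power_mult_distrib power2_eq_square mult_ac)
 qed
 have SR: "\<bar>E1 r + 2 * k * R r\<bar> <= 2 * h r * a r * sqrt (a0 r * (D r + 2 * k * C r + k^2 * a0 r))" if r: "r > R0" for r k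
 proof -
  let ?q = "%om. Q1 (r *R om) * Tu r om"
  have "ip ?q (Z k r) = ip ?q (Tr r) + (\<kappa> / r + k) * ip ?q (Tu r)"
   unfolding Z_def[abs_def] using sT[OF r] sR[OF r] sQ1(1)[OF r]
   by (simp only: ip_add_right L2fun_scaleR ip_scaleR_right)
  \<comment> \<open>The combination is a single pairing of Q_1 u with Z k, so one Cauchy-Schwarz
    step gives the bound in terms of |v' + k v|.\<close>
  then have "E1 r + 2 * k * R r = 2 * w r * ip ?q (Z k r)"
   by (simp add: E1_def s1_def R_def ip_commute[of _ ?q] algebra_simps)
  then have "\<bar>E1 r + 2 * k * R r\<bar> = 2 * w r * \<bar>ip ?q (Z k r)\<bar>" using rp(2)[OF r] by (simp add: abs_mult)
  also have "... <= 2 * w r * ((h r * a r * L2norm S (Tu r)) * L2norm S (Z k r))"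
  proof (rule mult_left_mono)
   show "\<bar>ip ?q (Z k r)\<bar> <= (h r * a r * L2norm S (Tu r)) * L2norm S (Z k r)"
    by (rule order_trans[OF ip_bound[OF sQ1(1)[OF r] sZ[OF r]] mult_right_mono[OF sQ1(2)[OF r]]]) simp
  qed (use rp(2)[OF r] in simp)
  also have "... = 2 * h r * a r * sqrt (a0 r * (D r + 2 * k * C r + k^2 * a0 r))"
  proof -
   have "a0 r * (D r + 2 * k * C r + k^2 * a0 r) = (w r * (L2norm S (Tu r) * L2norm S (Z k r)))^2"
    by (simp only: Znorm[OF r]) (simp add: A_norm[of r] power_mult_distrib power2_eq_square)
   then have "sqrt (a0 r * (D r + 2 * k * C r + k^2 * a0 r)) = w r * (L2norm S (Tu r) * L2norm S (Z k r))"
    using rp(2)[OF r] by (simp add: real_sqrt_abs2)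
   then show ?thesis by simp
  qed
  finally show ?thesis .
 qed

 \<comment> \<open>Smallness along a sequence of radii from the energy condition\<close>
 define En where "En r = sphere_integral r (%om::'a. (cmod (Tr r om))^2 - Re (q (r *R om)) * (cmod (Tu r om))^2)" for r
 have En_low: "t0 r + \<beta> * K r - a0 r / (4 * r^2) <= En r" if r: "r > R0" for r
 proof -
  have iT: "integrable S (%om. (cmod (Tu r om))^2)" "integrable S (%om. (cmod (Tr r om))^2)"
   using sT[OF r] sR[OF r] by (auto simp: L2fun_def)
  have iQ: "integrable S (%om. Q0 (r *R om) * (cmod (Tu r om))^2)"
   using form_int[OF Q0_bdd meas(1)[OF r] r sT[OF r] sT[OF r]] by (simp add: dot_square_norm)
  have "bounded ((%x. Re (q x)) ` G)" if "bounded (q ` G)" for G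
   using that unfolding bounded_iff by (auto intro: order_trans[OF abs_Re_le_cmod])
  then have "locally_bounded_on (exterior R0) (%x. Re (q x))" using q_bdd unfolding locally_bounded_on_def by blast
  then have iq: "integrable S (%om. Re (q (r *R om)) * (cmod (Tu r om))^2)"
   using form_int[OF _ _ r sT[OF r] sT[OF r], of "%x. Re (q x)"] meas(4)[OF r] by (simp add: dot_square_norm)
  have "(LINT om|S. (cmod (Tr r om))^2 - \<beta> * (Q0 (r *R om) * (cmod (Tu r om))^2) - (cmod (Tu r om))\<^sup>2 / (4 * r^2))
   <= (LINT om|S. (cmod (Tr r om))^2 - Re (q (r *R om)) * (cmod (Tu r om))^2)"
  proof (rule Bochner_Integration.integral_mono)
   fix om assume w: "om : space S"
   have n: "norm (r *R om) = r" using in_ext(2)[OF r w] by simp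
   have "0 <= (real DIM('a) - 2)\<^sup>2" by simp
   \<comment> \<open>(N-1)(N-3) = (N-2)^2 - 1 >= -1, which costs at most 1/(4 r^2) in passing from q
     to Q.\<close>
   then have k: "(real DIM('a) - 1) * (real DIM('a) - 3) / (4 * r^2) >= - 1 / (4 * r^2)"
    using rp(1)[OF r] by (intro divide_right_mono) (auto simp: power2_eq_square algebra_simps)
   have "Re (Q (r *R om)) = Re (q (r *R om)) + (real DIM('a) - 1) * (real DIM('a) - 3) / (4 * r^2)"
    using Q_def[OF in_ext(1)[OF r w], unfolded n] by simp
   then have "Re (q (r *R om)) <= \<beta> * Q0 (r *R om) + 1 / (4 * r^2)"
    using Q0_Q[OF in_ext(1)[OF r w]] k by simp
   from mult_right_mono[OF this, of "(cmod (Tu r om))\<^sup>2"]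
   show "(cmod (Tr r om))\<^sup>2 - \<beta> * (Q0 (r *R om) * (cmod (Tu r om))^2) - (cmod (Tu r om))\<^sup>2 / (4 * r^2) <= (cmod (Tr r om))\<^sup>2 - Re (q (r *R om)) * (cmod (Tu r om))^2"
    by (simp add: distrib_right)
  qed (use iT iQ iq in auto)
  from mult_left_mono[OF this less_imp_le[OF rp(2)[OF r]]]
  have "w r * ((LINT om|S. (cmod (Tr r om))^2) - \<beta> * (LINT om|S. Q0 (r *R om) * (cmod (Tu r om))^2) - (LINT om|S. (cmod (Tu r om))^2) / (4 * r^2)) <= En r"
   using iT iQ by (simp add: En_def sphere_integral_def w_def)
  then show ?thesis
   by (simp add: t0_def K_def a0_def ip_def mult_form_eq dot_square_norm w_def algebra_simps)
 qed
 have small: "EX r>T. r > R0 & D r + K r + a0 r < e" if e: "e > 0" for e T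
 proof -
  \<comment> \<open>The bounds r >= 1 and r >= 1/(\<beta> c) give 1/(4 r^2) <= \<beta> c/4. Half of
    \<beta> K is at least (\<beta> c/2) A by coercivity, so it absorbs the loss in
    \<open>En_low\<close> and still leaves (\<beta> c/4) A.\<close>
  define T' where "T' = Max {T, R0, 2 * r1, 1, 1 / (\<beta> * c)}"
  \<comment> \<open>The three summands pay for 2 t0, K and (2\<kappa>^2 + 1) A respectively when D +
    K + A is compared with the energy.\<close>
  define G where "G = 2 + 2 / \<beta> + (2 * \<kappa>^2 + 1) * (4 / (\<beta> * c))"
  have bc: "\<beta> * c > 0" using beta c by simp
  have G: "G > 0" "2 <= G" "1 <= G * (\<beta> / 2)" "2 * \<kappa>^2 + 1 <= G * (\<beta> * c / 4)"
  proof -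
   have p: "2 / \<beta> > 0" "(2 * \<kappa>^2 + 1) * (4 / (\<beta> * c)) > 0" 
    using beta by simp (intro mult_pos_pos divide_pos_pos bc add_nonneg_pos, simp_all)
   then show "G > 0" "2 <= G" unfolding G_def by linarith+
   have "2 / \<beta> * (\<beta> / 2) <= G * (\<beta> / 2)" using p beta by (intro mult_right_mono) (auto simp: G_def)
   then show "1 <= G * (\<beta> / 2)" using beta by simp
   have "(2 * \<kappa>^2 + 1) * (4 / (\<beta> * c)) * (\<beta> * c / 4) <= G * (\<beta> * c / 4)" using p bc by (intro mult_right_mono) (auto simp: G_def)
   then show "2 * \<kappa>^2 + 1 <= G * (\<beta> * c / 4)" using beta c by simp
  qed
  have "\<not> (\<forall>\<^sub>F r in at_top. ereal (e / G) <= ereal (En r))"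
  proof
   assume "\<forall>\<^sub>F r in at_top. ereal (e / G) <= ereal (En r)"
   then have "ereal (e / G) <= Liminf at_top (%r. ereal (En r))" by (rule Liminf_bounded)
   then have "ereal (e / G) <= 0" using energy by (simp add: En_def)
   moreover have "e / G > 0" using e G(1) by simp
   ultimately show False by simp
  qed
  moreover have "\<forall>\<^sub>F r in at_top. ereal (e / G) <= ereal (En r)" if all: "ALL r>T'. e / G <= En r"
   using eventually_gt_at_top[of T'] by eventually_elim (use all in simp)
  ultimately have "\<not> (ALL r>T'. e / G <= En r)" by blast
  then obtain r where r: "r > T'" "En r < e / G" by (auto simp: not_le)
  have rr: "r > T" "r > R0" "r >= 2 * r1" "r >= 1" "r >= 1 / (\<beta> * c)" using r(1) by (auto simp: T'_def)
  have "K r >= c * a0 r"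
  proof -
   have "w r * (c * (L2norm S (Tu r))^2) <= w r * (- P.qf r (Tu r))"
    by (rule mult_left_mono[OF coercive[OF rr(3) sT[OF rr(2)]] less_imp_le[OF rp(2)[OF rr(2)]]])
   then show ?thesis unfolding K_def A_norm by (simp add: mult_ac)
  qed
  then have Kc: "\<beta> / 2 * (c * a0 r) <= \<beta> / 2 * K r" using beta by (intro mult_left_mono) auto
  have "1 <= \<beta> * c * r" using rr(5) bc by (simp add: field_simps)
  also have "... <= \<beta> * c * (r * r)" using rr(4) bc by (intro mult_left_mono) auto
  finally have "1 / (4 * r^2) <= \<beta> * c / 4" using rr(4) by (simp add: field_simps power2_eq_square)
  from mult_right_mono[OF this A0[OF rr(2)]] have "a0 r / (4 * r^2) <= \<beta> * c / 4 * a0 r" by simp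
  then have low: "t0 r + \<beta> / 2 * K r + \<beta> * c / 4 * a0 r <= En r" using En_low[OF rr(2)] Kc by (simp add: field_simps)
  have D_le: "D r <= 2 * t0 r + 2 * \<kappa>^2 * a0 r"
  proof -
   have n2: "(L2norm S (Z 0 r))\<^sup>2 <= 2 * (L2norm S (Tr r))^2 + 2 * (\<kappa> / r)^2 * (L2norm S (Tu r))^2"
   proof -
    have "L2norm S (Z 0 r) <= L2norm S (Tr r) + \<kappa> / r * L2norm S (Tu r)"
     unfolding Z_def[abs_def] using L2norm_triangle[OF sR[OF rr(2)] L2fun_scaleR[OF sT[OF rr(2)], of "\<kappa> / r"]] \<kappa> rp(1)[OF rr(2)]
     by (simp add: L2norm_scaleR)
    then have "(L2norm S (Z 0 r))\<^sup>2 <= (L2norm S (Tr r) + \<kappa> / r * L2norm S (Tu r))\<^sup>2" by (rule power_mono) simp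
    moreover have "0 <= (L2norm S (Tr r) - \<kappa> / r * L2norm S (Tu r))\<^sup>2" by simp
    ultimately show ?thesis by (simp add: power2_sum power2_diff power_mult_distrib power_divide)
   qed
   have "(\<kappa> / r)\<^sup>2 <= \<kappa>\<^sup>2" unfolding power_divide using rr(4) by (simp add: divide_le_eq mult_right_le_one_le mult_le_cancel_left1)
   then have "2 * (\<kappa> / r)^2 * (L2norm S (Tu r))^2 <= 2 * \<kappa>^2 * (L2norm S (Tu r))^2" by (intro mult_right_mono) auto
   then have "(L2norm S (Z 0 r))\<^sup>2 <= 2 * (L2norm S (Tr r))^2 + 2 * \<kappa>^2 * (L2norm S (Tu r))^2" using n2 by linarith
   from mult_left_mono[OF this less_imp_le[OF rp(2)[OF rr(2)]]]
   show ?thesis using Znorm[OF rr(2), of 0] unfolding A_norm t0_def ip_self w_def[symmetric] by (simp add: algebra_simps)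
  qed
  have t0p: "t0 r >= 0" unfolding t0_def ip_self using rp(1)[OF rr(2)] by simp
  have "D r + K r + a0 r <= 2 * t0 r + 1 * K r + (2 * \<kappa>^2 + 1) * a0 r" using D_le by (simp add: algebra_simps)
  also have "... <= G * t0 r + G * (\<beta> / 2) * K r + G * (\<beta> * c / 4) * a0 r"
   using G(2-4) t0p K0[OF rr(2)] A0[OF rr(2)] by (intro add_mono mult_right_mono) auto
  also have "... = G * (t0 r + \<beta> / 2 * K r + \<beta> * c / 4 * a0 r)" by (simp add: algebra_simps)
  also have "... <= G * En r" using low G(1) by (intro mult_left_mono) auto
  also have "... < e" using r(2) G(1) by (simp add: field_simps)
  finally show ?thesis using rr by blast
 qed
 have B0: "B r >= 0" if "r > R0" for r using t0_le_g0[OF that] by (simp add: B_def)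
 obtain T where T: "T > R0" "!!r. r > T ==> a0 r = 0"
  using growth_alternative[OF R0 A0 B0 D0 K0 CS A_d C_lip E_ll C_rd E_rd SR h_L1 h_bounds a0 a_b F_pos F_deriv F_C1 c_pos F_bound F_lim F'_bound small]
  by blast
 have "L2norm S (Tu r) = 0" if "r > T" for r
  using T(2)[OF that] rp(2)[of r] T(1) that unfolding A_norm by simp
 from vanishing_trace[OF T(1) this] T(1) show ?thesis by blast
qed

end
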